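(* Let $d,n,m\geq1$ and let $\boldsymbol{v}=(v_1,\dots,v_m)$ be an $m$-tuple of non-zero elements of $K=\mathbb{C}[u^{\pm1},v]$. The cyclotomic Yokonuma--Hecke algebra $Y_{d,n}(\boldsymbol{v})$ is isomorphic, as a $K$-algebra, to the direct sum $\bigoplus_{\mu}\operatorname{Mat}_{m_{\mu}}\bigl(H(\boldsymbol{v})^{\mu}\bigr)$ over all $d$-compositions $\mu$ of $n$.
   Context: Let $u,v$ be indeterminates, $K=\mathbb{C}[u^{\pm1},v]$, $s_i=(i,i+1)\in\mathfrak{S}_n$. The affine Yokonuma--Hecke algebra $\widehat{Y}_{d,n}$ is the unital associative $K$-algebra generated by $g_1,\dots,g_{n-1},X_1^{\pm1},t_1,\dots,t_n$ with relations: $g_ig_j=g_jg_i$ for $|i-j|>1$; $g_ig_{i+1}g_i=g_{i+1}g_ig_{i+1}$; $X_1g_1X_1g_1=g_1X_1g_1X_1$; $X_1g_i=g_iX_1$ for $i\geq2$; $t_it_j=t_jt_i$; $g_it_j=t_{s_i(j)}g_i$; $t_j^d=1$; $X_1t_j=t_jX_1$; $g_i^2=u^2+v\,e_ig_i$, where $e_i=\frac1d\sum_{s=1}^{d}t_i^st_{i+1}^{-s}$. The affine Hecke algebra is $\widehat{H}_n=\widehat{Y}_{1,n}$ (so $t_j=1$, $e_i=1$), with generators written $\overline{g}_i$, $\overline{X}_1^{\pm1}$. The cyclotomic Yokonuma--Hecke algebra $Y_{d,n}(\boldsymbol{v})$ is the quotient of $\widehat{Y}_{d,n}$ by the relation $(X_1-v_1)\cdots(X_1-v_m)=0$.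 The cyclotomic Hecke (Ariki--Koike) algebra $H_n(\boldsymbol{v})$ is the quotient of $\widehat{H}_n$ by $(\overline{X}_1-v_1)\cdots(\overline{X}_1-v_m)=0$; by convention $H_0(\boldsymbol{v})=K$. A $d$-composition of $n$ is $\mu=(\mu_1,\dots,\mu_d)\in\mathbb{Z}_{\geq0}^d$ with $\sum_a\mu_a=n$; $m_{\mu}=\frac{n!}{\mu_1!\cdots\mu_d!}$, and $H(\boldsymbol{v})^{\mu}=H_{\mu_1}(\boldsymbol{v})\otimes\dots\otimes H_{\mu_d}(\boldsymbol{v})$ (tensor products over $K$). $\operatorname{Mat}_m(A)$ is the algebra of $m\times m$ matrices with entries in $A$. *)

theory Defs
  imports
    Complex_Main
    "HOL-Library.Poly_Mapping"
    "HOL-Library.Product_Plus"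
    "HOL-Combinatorics.Transposition"
    "HOL-Algebra.Module"
    "HOL-Algebra.QuotRing"
    "HOL-Algebra.Product_Groups"
    "Jordan_Normal_Form.Matrix"
begin

text \<open>
  Algebras over a commutative coefficient ring are records of type \<open>('k, 'a) module\<close>;
  the coefficient ring is a type \<open>'k\<close> of class \<open>comm_ring_1\<close>, acting through \<open>smult\<close>.
\<close>

section \<open>Constructions with algebras\<close>

definition alg_isomorphic :: "('k, 'a) module \<Rightarrow> ('k, 'b) module \<Rightarrow> bool"
  where "alg_isomorphic A B \<longleftrightarrow>
    (\<exists>h \<in> ring_iso A B. \<forall>c. \<forall>x \<in> carrier A. h (c \<odot>\<^bsub>A\<^esub> x) = c \<odot>\<^bsub>B\<^esub> h x)"

definition scalar_algebra :: "('k::comm_ring_1, 'k) module"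
  where "scalar_algebra =
    \<lparr>carrier = UNIV, monoid.mult = (*), one = 1, zero = 0, add = (+), module.smult = (*)\<rparr>"

text \<open>The quotient of an algebra by the two-sided ideal generated by a set of elements.\<close>

definition alg_quot :: "('k, 'a) module \<Rightarrow> 'a set \<Rightarrow> ('k, 'a set) module"
  where "alg_quot A S = (let I = Idl\<^bsub>A\<^esub> S in
    \<lparr>carrier = carrier (A Quot I), monoid.mult = monoid.mult (A Quot I), one = one (A Quot I),
     zero = zero (A Quot I), add = add (A Quot I),
     module.smult = (\<lambda>c C. \<Union>x\<in>C. I +>\<^bsub>A\<^esub> (c \<odot>\<^bsub>A\<^esub> x))\<rparr>)"

definition alg_quot_proj :: "('k, 'a) module \<Rightarrow> 'a set \<Rightarrow> 'a \<Rightarrow> 'a set"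
  where "alg_quot_proj A S x = Idl\<^bsub>A\<^esub> S +>\<^bsub>A\<^esub> x"

definition monoid_algebra :: "('m, 'c) monoid_scheme \<Rightarrow> ('k::comm_ring_1, 'm \<Rightarrow>\<^sub>0 'k) module"
  where "monoid_algebra M =
    \<lparr>carrier = {p. Poly_Mapping.keys p \<subseteq> carrier M},
     monoid.mult = (\<lambda>p q. \<Sum>x\<in>Poly_Mapping.keys p. \<Sum>y\<in>Poly_Mapping.keys q.
       Poly_Mapping.single (x \<otimes>\<^bsub>M\<^esub> y) (Poly_Mapping.lookup p x * Poly_Mapping.lookup q y)),
     one = Poly_Mapping.single \<one>\<^bsub>M\<^esub> 1,
     zero = 0,
     add = (+),
     module.smult = (\<lambda>c. Poly_Mapping.map ((*) c))\<rparr>"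

definition free_monoid :: "'g set \<Rightarrow> 'g list monoid"
  where "free_monoid G = \<lparr>carrier = lists G, monoid.mult = (@), one = []\<rparr>"

abbreviation free_algebra :: "'g set \<Rightarrow> ('k::comm_ring_1, 'g list \<Rightarrow>\<^sub>0 'k) module"
  where "free_algebra G \<equiv> monoid_algebra (free_monoid G)"

definition presented_algebra ::
    "'g set \<Rightarrow> (('g list \<Rightarrow>\<^sub>0 'k) \<times> ('g list \<Rightarrow>\<^sub>0 'k)) set \<Rightarrow> ('k::comm_ring_1, ('g list \<Rightarrow>\<^sub>0 'k) set) module"
  where "presented_algebra G R = alg_quot (free_algebra G) {l - r | l r. (l, r) \<in> R}"

text \<open>
  The tensor product of a family of algebras. The free module on the cartesian product of the
  factors, with the multiplication \<open>(x\<^sub>i)\<^sub>i (y\<^sub>i)\<^sub>i = (x\<^sub>i y\<^sub>i)\<^sub>i\<close> of basis elements, is the monoid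
  algebra of the product of the multiplicative monoids. The product of a multilinearity relator
  with a basis element is again such a relator, so the ideal they generate is their span, and the
  quotient is the usual tensor product of the underlying modules.
\<close>

definition multilinear_relators ::
    "'i set \<Rightarrow> ('i \<Rightarrow> ('k::comm_ring_1, 'a) module) \<Rightarrow> (('i \<Rightarrow> 'a) \<Rightarrow>\<^sub>0 'k) set"
  where "multilinear_relators I A =
    {Poly_Mapping.single (x(i := a \<oplus>\<^bsub>A i\<^esub> b)) 1
       - (Poly_Mapping.single (x(i := a)) 1 + Poly_Mapping.single (x(i := b)) 1) | x i a b.
       x \<in> (\<Pi>\<^sub>E i\<in>I. carrier (A i)) \<and> i \<in> I \<and> a \<in> carrier (A i) \<and> b \<in> carrier (A i)} \<union>
    {Poly_Mapping.single (x(i := c \<odot>\<^bsub>A i\<^esub> a)) 1 - Poly_Mapping.single (x(i := a)) c | x i a c.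
       x \<in> (\<Pi>\<^sub>E i\<in>I. carrier (A i)) \<and> i \<in> I \<and> a \<in> carrier (A i)}"

definition tensor_algebra ::
    "'i set \<Rightarrow> ('i \<Rightarrow> ('k::comm_ring_1, 'a) module) \<Rightarrow> ('k, (('i \<Rightarrow> 'a) \<Rightarrow>\<^sub>0 'k) set) module"
  where "tensor_algebra I A =
    alg_quot (monoid_algebra (product_group I A)) (multilinear_relators I A)"

definition matrix_algebra :: "nat \<Rightarrow> ('k, 'a) module \<Rightarrow> ('k, 'a mat) module"
  where "matrix_algebra r A =
    \<lparr>carrier = {M \<in> carrier_mat r r. elements_mat M \<subseteq> carrier A},
     monoid.mult = (\<lambda>M N. mat r r (\<lambda>(i, j). \<Oplus>\<^bsub>A\<^esub>l\<in>{..<r}. M $$ (i, l) \<otimes>\<^bsub>A\<^esub> N $$ (l, j))),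
     one = mat r r (\<lambda>(i, j). if i = j then \<one>\<^bsub>A\<^esub> else \<zero>\<^bsub>A\<^esub>),
     zero = mat r r (\<lambda>_. \<zero>\<^bsub>A\<^esub>),
     add = (\<lambda>M N. mat r r (\<lambda>(i, j). M $$ (i, j) \<oplus>\<^bsub>A\<^esub> N $$ (i, j))),
     module.smult = (\<lambda>c M. mat r r (\<lambda>(i, j). c \<odot>\<^bsub>A\<^esub> M $$ (i, j)))\<rparr>"

text \<open>For a finite index set this is the direct sum; only finite index sets occur below.\<close>

definition direct_sum_algebra :: "'i set \<Rightarrow> ('i \<Rightarrow> ('k, 'a) module) \<Rightarrow> ('k, 'i \<Rightarrow> 'a) module"
  where "direct_sum_algebra I A =
    \<lparr>carrier = (\<Pi>\<^sub>E i\<in>I. carrier (A i)),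
     monoid.mult = (\<lambda>x y. \<lambda>i\<in>I. x i \<otimes>\<^bsub>A i\<^esub> y i),
     one = (\<lambda>i\<in>I. \<one>\<^bsub>A i\<^esub>),
     zero = (\<lambda>i\<in>I. \<zero>\<^bsub>A i\<^esub>),
     add = (\<lambda>x y. \<lambda>i\<in>I. x i \<oplus>\<^bsub>A i\<^esub> y i),
     module.smult = (\<lambda>c x. \<lambda>i\<in>I. c \<odot>\<^bsub>A i\<^esub> x i)\<rparr>"


section \<open>The ground ring\<close>

text \<open>
  The ring \<open>\<complex>[u\<^sup>\<plusminus>\<^sup>1, v]\<close> as the monoid ring of \<open>\<int> \<times> \<nat>\<close>: the exponent pair \<open>(a, b)\<close> stands
  for the monomial \<open>u\<^sup>a v\<^sup>b\<close>.
\<close>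

type_synonym ground = "(int \<times> nat) \<Rightarrow>\<^sub>0 complex"

definition u_var :: ground where "u_var = Poly_Mapping.single (1, 0) 1"

definition v_var :: ground where "v_var = Poly_Mapping.single (0, 1) 1"

definition const_ground :: "complex \<Rightarrow> ground" where "const_ground = Poly_Mapping.single 0"


section \<open>Affine and cyclotomic Yokonuma--Hecke algebras\<close>

datatype gen = gen_g nat | gen_X | gen_Xinv | gen_t nat

definition yh_gens :: "nat \<Rightarrow> gen set"
  where "yh_gens n = gen_g ` {1..<n} \<union> {gen_X, gen_Xinv} \<union> gen_t ` {1..n}"

type_synonym free_elem = "gen list \<Rightarrow>\<^sub>0 ground"

definition word :: "gen list \<Rightarrow> free_elem" where "word w = Poly_Mapping.single w 1"

text \<open>
  The element \<open>e\<^sub>i = (1/d) \<Sum>\<^sub>s t\<^sub>i\<^sup>s t\<^sub>i\<^sub>+\<^sub>1\<^sup>-\<^sup>s\<close>, lifted to the free algebra. The inverse of \<open>t\<^sub>i\<^sub>+\<^sub>1\<close> is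
  not among the generators: by \<open>t\<^sub>i\<^sub>+\<^sub>1\<^sup>d = 1\<close>, its power with exponent \<open>-s\<close> is \<open>t\<^sub>i\<^sub>+\<^sub>1\<^sup>d\<^sup>-\<^sup>s\<close>.
\<close>

definition yh_e :: "nat \<Rightarrow> nat \<Rightarrow> nat \<Rightarrow> free_elem"
  where "yh_e d n i = const_ground (1 / of_nat d) \<odot>\<^bsub>free_algebra (yh_gens n)\<^esub>
    (\<Sum>s = 1..d. word (replicate s (gen_t i) @ replicate (d - s) (gen_t (i + 1))))"

inductive_set yh_relations :: "nat \<Rightarrow> nat \<Rightarrow> (free_elem \<times> free_elem) set"
  for d n :: nat
  where
    g_commute: "\<lbrakk>i \<in> {1..<n}; j \<in> {1..<n}; i + 1 < j \<or> j + 1 < i\<rbrakk> \<Longrightarrow>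
      (word [gen_g i, gen_g j], word [gen_g j, gen_g i]) \<in> yh_relations d n"
  | g_braid: "\<lbrakk>i \<in> {1..<n}; i + 1 \<in> {1..<n}\<rbrakk> \<Longrightarrow>
      (word [gen_g i, gen_g (i + 1), gen_g i], word [gen_g (i + 1), gen_g i, gen_g (i + 1)])
        \<in> yh_relations d n"
  | X_Xinv: "(word [gen_X, gen_Xinv], word []) \<in> yh_relations d n"
  | Xinv_X: "(word [gen_Xinv, gen_X], word []) \<in> yh_relations d n"
  | X_g_braid: "1 \<in> {1..<n} \<Longrightarrow>
      (word [gen_X, gen_g 1, gen_X, gen_g 1], word [gen_g 1, gen_X, gen_g 1, gen_X])
        \<in> yh_relations d n"
  | X_g_commute: "\<lbrakk>i \<in> {1..<n}; 2 \<le> i\<rbrakk> \<Longrightarrow>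
      (word [gen_X, gen_g i], word [gen_g i, gen_X]) \<in> yh_relations d n"
  | t_commute: "\<lbrakk>i \<in> {1..n}; j \<in> {1..n}\<rbrakk> \<Longrightarrow>
      (word [gen_t i, gen_t j], word [gen_t j, gen_t i]) \<in> yh_relations d n"
  | g_t: "\<lbrakk>i \<in> {1..<n}; j \<in> {1..n}\<rbrakk> \<Longrightarrow>
      (word [gen_g i, gen_t j], word [gen_t (transpose i (i + 1) j), gen_g i]) \<in> yh_relations d n"
  | t_power: "j \<in> {1..n} \<Longrightarrow> (word (replicate d (gen_t j)), word []) \<in> yh_relations d n"
  | X_t: "j \<in> {1..n} \<Longrightarrow>
      (word [gen_X, gen_t j], word [gen_t j, gen_X]) \<in> yh_relations d n"
  | g_square: "i \<in> {1..<n} \<Longrightarrow>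
      (word [gen_g i, gen_g i],
       u_var\<^sup>2 \<odot>\<^bsub>free_algebra (yh_gens n)\<^esub> word []
         + v_var \<odot>\<^bsub>free_algebra (yh_gens n)\<^esub> (yh_e d n i \<otimes>\<^bsub>free_algebra (yh_gens n)\<^esub> word [gen_g i]))
        \<in> yh_relations d n"

definition affine_YH :: "nat \<Rightarrow> nat \<Rightarrow> (ground, free_elem set) module"
  where "affine_YH d n = presented_algebra (yh_gens n) (yh_relations d n)"

definition affine_X :: "nat \<Rightarrow> nat \<Rightarrow> free_elem set"
  where "affine_X d n =
    alg_quot_proj (free_algebra (yh_gens n)) {l - r | l r. (l, r) \<in> yh_relations d n} (word [gen_X])"

definition cyclotomic_relator :: "nat \<Rightarrow> nat \<Rightarrow> ground list \<Rightarrow> free_elem set"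
  where "cyclotomic_relator d n vs =
    foldr (\<lambda>c y. (affine_X d n \<ominus>\<^bsub>affine_YH d n\<^esub> (c \<odot>\<^bsub>affine_YH d n\<^esub> \<one>\<^bsub>affine_YH d n\<^esub>)) \<otimes>\<^bsub>affine_YH d n\<^esub> y)
      vs \<one>\<^bsub>affine_YH d n\<^esub>"

definition cyclotomic_YH :: "nat \<Rightarrow> nat \<Rightarrow> ground list \<Rightarrow> (ground, free_elem set set) module"
  where "cyclotomic_YH d n vs = alg_quot (affine_YH d n) {cyclotomic_relator d n vs}"

abbreviation affine_hecke :: "nat \<Rightarrow> (ground, free_elem set) module"
  where "affine_hecke n \<equiv> affine_YH 1 n"

text \<open>
  The convention that the cyclotomic Hecke algebra for \<open>n = 0\<close> is the ground ring. All members of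
  the family need the same carrier type, so the ground ring appears here as the algebra with
  neither generators nor relations (see \<open>cyclotomic_hecke_0\<close> below); note that the presentation
  of \<open>affine_YH\<close> taken at \<open>n = 0\<close> would still contain \<open>X\<^sub>1\<close>.
\<close>

definition cyclotomic_hecke :: "nat \<Rightarrow> ground list \<Rightarrow> (ground, free_elem set set) module"
  where "cyclotomic_hecke n vs =
    (if n = 0 then alg_quot (presented_algebra {} {}) {}
     else alg_quot (affine_hecke n) {cyclotomic_relator 1 n vs})"

lemma monoid_algebra_simps:
  "carrier (monoid_algebra M) = {p. Poly_Mapping.keys p \<subseteq> carrier M}"
  "\<one>\<^bsub>monoid_algebra M\<^esub> = Poly_Mapping.single \<one>\<^bsub>M\<^esub> 1"
  "\<zero>\<^bsub>monoid_algebra M\<^esub> = 0"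
  "p \<oplus>\<^bsub>monoid_algebra M\<^esub> q = p + q"
  "c \<odot>\<^bsub>monoid_algebra M\<^esub> p = Poly_Mapping.map ((*) c) p"
  by (simp_all add: monoid_algebra_def)

lemma monoid_algebra_mult_superset:
  assumes "finite S" "finite T" "Poly_Mapping.keys p \<subseteq> S" "Poly_Mapping.keys q \<subseteq> T"
  shows "p \<otimes>\<^bsub>monoid_algebra M\<^esub> q = (\<Sum>x\<in>S. \<Sum>y\<in>T.
    Poly_Mapping.single (x \<otimes>\<^bsub>M\<^esub> y) (Poly_Mapping.lookup p x * Poly_Mapping.lookup q y))"
proof -
  have 1: "(\<Sum>y\<in>Poly_Mapping.keys q. Poly_Mapping.single (x \<otimes>\<^bsub>M\<^esub> y) (Poly_Mapping.lookup p x * Poly_Mapping.lookup q y))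
    = (\<Sum>y\<in>T. Poly_Mapping.single (x \<otimes>\<^bsub>M\<^esub> y) (Poly_Mapping.lookup p x * Poly_Mapping.lookup q y))" for x
    by (rule sum.mono_neutral_left) (use assms in \<open>auto simp: in_keys_iff\<close>)
  show ?thesis
    unfolding monoid_algebra_def
    by (simp add: 1, rule sum.mono_neutral_left) (use assms in \<open>auto simp: in_keys_iff\<close>)
qed

lemma monoid_algebra_mult_add_left:
  "(p + p') \<otimes>\<^bsub>monoid_algebra M\<^esub> q = p \<otimes>\<^bsub>monoid_algebra M\<^esub> q + p' \<otimes>\<^bsub>monoid_algebra M\<^esub> q"
proof -
  let ?S = "Poly_Mapping.keys p \<union> Poly_Mapping.keys p'" and ?T = "Poly_Mapping.keys q"
  have "Poly_Mapping.keys (p + p') \<subseteq> ?S" by (rule Poly_Mapping.keys_add)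
  then show ?thesis
    by (subst (1 2 3) monoid_algebra_mult_superset[of ?S ?T])
      (auto simp: lookup_add algebra_simps single_add sum.distrib)
qed

lemma monoid_algebra_mult_add_right:
  "p \<otimes>\<^bsub>monoid_algebra M\<^esub> (q + q') = p \<otimes>\<^bsub>monoid_algebra M\<^esub> q + p \<otimes>\<^bsub>monoid_algebra M\<^esub> q'"
proof -
  let ?S = "Poly_Mapping.keys p" and ?T = "Poly_Mapping.keys q \<union> Poly_Mapping.keys q'"
  have "Poly_Mapping.keys (q + q') \<subseteq> ?T" by (rule Poly_Mapping.keys_add)
  then show ?thesis
    by (subst (1 2 3) monoid_algebra_mult_superset[of ?S ?T])
      (auto simp: lookup_add algebra_simps single_add sum.distrib)
qed

lemma monoid_algebra_mult_single:
  "Poly_Mapping.single x a \<otimes>\<^bsub>monoid_algebra M\<^esub> Poly_Mapping.single y b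
    = Poly_Mapping.single (x \<otimes>\<^bsub>M\<^esub> y) (a * b)"
  by (subst monoid_algebra_mult_superset[of "{x}" "{y}"]) auto

lemma monoid_algebra_mult_zero:
  "0 \<otimes>\<^bsub>monoid_algebra M\<^esub> q = 0" "p \<otimes>\<^bsub>monoid_algebra M\<^esub> 0 = 0"
  by (simp_all add: monoid_algebra_def)

lemma keys_induct_in [consumes 1, case_names zero add]:
  fixes p :: "'a \<Rightarrow>\<^sub>0 'b::comm_monoid_add"
  assumes "Poly_Mapping.keys p \<subseteq> C" and "P 0"
    and "\<And>x c q. x \<in> C \<Longrightarrow> P q \<Longrightarrow> P (Poly_Mapping.single x c + q)"
  shows "P p"
proof -
  have sum_monomials: "(\<Sum>x\<in>Poly_Mapping.keys p. Poly_Mapping.single x (Poly_Mapping.lookup p x)) = p"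
    by (rule poly_mapping_eqI)
      (simp add: lookup_sum lookup_single when_def in_keys_iff sum.delta)
  have "P (\<Sum>x\<in>S. Poly_Mapping.single x (Poly_Mapping.lookup p x))"
    if "finite S" "S \<subseteq> C" for S
    using that by (induction S rule: finite_induct) (auto intro: assms)
  from this[of "Poly_Mapping.keys p"] show ?thesis
    using assms(1) by (simp add: sum_monomials)
qed

lemma ring_monoid_algebra:
  assumes "Group.monoid M"
  shows "ring (monoid_algebra M :: ('k::comm_ring_1, _) module)"
proof -
  interpret M: Group.monoid M by fact
  let ?A = "monoid_algebra M :: ('k, _) module"
  have closed: "x \<otimes>\<^bsub>?A\<^esub> y \<in> carrier ?A" if "x \<in> carrier ?A" "y \<in> carrier ?A" for x y
  proof -
    have "Poly_Mapping.keys (\<Sum>a\<in>Poly_Mapping.keys x. \<Sum>b\<in>Poly_Mapping.keys y.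
        Poly_Mapping.single (a \<otimes>\<^bsub>M\<^esub> b) (Poly_Mapping.lookup x a * Poly_Mapping.lookup y b)) \<subseteq> carrier M"
      by (rule order_trans[OF Poly_Mapping.keys_sum] UN_least)+
        (use that in \<open>auto simp: monoid_algebra_simps split: if_splits\<close>)
    then show ?thesis by (simp add: monoid_algebra_def)
  qed
  have one_l: "\<one>\<^bsub>?A\<^esub> \<otimes>\<^bsub>?A\<^esub> x = x" if "x \<in> carrier ?A" for x
  proof -
    have "Poly_Mapping.keys x \<subseteq> carrier M" using that by (simp add: monoid_algebra_simps)
    then show ?thesis
      by (induction x rule: keys_induct_in)
        (simp_all add: monoid_algebra_simps monoid_algebra_mult_zero monoid_algebra_mult_add_right
          monoid_algebra_mult_single)
  qed
  have one_r: "x \<otimes>\<^bsub>?A\<^esub> \<one>\<^bsub>?A\<^esub> = x" if "x \<in> carrier ?A" for x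
  proof -
    have "Poly_Mapping.keys x \<subseteq> carrier M" using that by (simp add: monoid_algebra_simps)
    then show ?thesis
      by (induction x rule: keys_induct_in)
        (simp_all add: monoid_algebra_simps monoid_algebra_mult_zero monoid_algebra_mult_add_left
          monoid_algebra_mult_single)
  qed
  have assoc: "x \<otimes>\<^bsub>?A\<^esub> y \<otimes>\<^bsub>?A\<^esub> z = x \<otimes>\<^bsub>?A\<^esub> (y \<otimes>\<^bsub>?A\<^esub> z)"
    if xyz: "x \<in> carrier ?A" "y \<in> carrier ?A" "z \<in> carrier ?A" for x y z
  proof -
    have x: "Poly_Mapping.keys x \<subseteq> carrier M" and y: "Poly_Mapping.keys y \<subseteq> carrier M"
      and z: "Poly_Mapping.keys z \<subseteq> carrier M"
      using xyz by (simp_all add: monoid_algebra_simps)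
    have 1: "Poly_Mapping.single a b \<otimes>\<^bsub>?A\<^esub> Poly_Mapping.single a' b' \<otimes>\<^bsub>?A\<^esub> z
        = Poly_Mapping.single a b \<otimes>\<^bsub>?A\<^esub> (Poly_Mapping.single a' b' \<otimes>\<^bsub>?A\<^esub> z)"
      if "a \<in> carrier M" "a' \<in> carrier M" for a b a' b'
      using z that by (induction z rule: keys_induct_in)
        (simp_all add: monoid_algebra_mult_zero monoid_algebra_mult_add_right
          monoid_algebra_mult_single M.m_assoc mult.assoc)
    have 2: "Poly_Mapping.single a b \<otimes>\<^bsub>?A\<^esub> y \<otimes>\<^bsub>?A\<^esub> z
        = Poly_Mapping.single a b \<otimes>\<^bsub>?A\<^esub> (y \<otimes>\<^bsub>?A\<^esub> z)" if "a \<in> carrier M" for a b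
      using y that by (induction y rule: keys_induct_in)
        (simp_all add: monoid_algebra_mult_zero monoid_algebra_mult_add_right
          monoid_algebra_mult_add_left 1)
    show ?thesis
      using x by (induction x rule: keys_induct_in)
        (simp_all add: monoid_algebra_mult_zero monoid_algebra_mult_add_left 2)
  qed
  show ?thesis
  proof (rule ringI)
    show "abelian_group ?A"
    proof (rule abelian_groupI)
      fix x assume "x \<in> carrier ?A"
      then show "\<exists>y\<in>carrier ?A. y \<oplus>\<^bsub>?A\<^esub> x = \<zero>\<^bsub>?A\<^esub>"
        by (intro bexI[of _ "- x"]) (auto simp: monoid_algebra_simps in_keys_iff)
    qed (use Poly_Mapping.keys_add in \<open>fastforce simp: monoid_algebra_simps algebra_simps\<close>)+
    show "Group.monoid ?A"
      by (rule monoidI) (use closed one_l one_r assoc in \<open>auto simp: monoid_algebra_simps\<close>)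
  qed (simp_all add: monoid_algebra_simps monoid_algebra_mult_add_left monoid_algebra_mult_add_right)
qed

lemma monoid_free_monoid: "Group.monoid (free_monoid G)"
  by (rule monoidI) (auto simp: free_monoid_def)

lemma alg_isomorphic_trans:
  assumes "alg_isomorphic A B" and "alg_isomorphic B C"
  shows "alg_isomorphic A C"
proof -
  from assms obtain f g where f: "f \<in> ring_iso A B" and g: "g \<in> ring_iso B C"
    and *: "\<And>c x. x \<in> carrier A \<Longrightarrow> f (c \<odot>\<^bsub>A\<^esub> x) = c \<odot>\<^bsub>B\<^esub> f x"
      "\<And>c x. x \<in> carrier B \<Longrightarrow> g (c \<odot>\<^bsub>B\<^esub> x) = c \<odot>\<^bsub>C\<^esub> g x"
    by (auto simp: alg_isomorphic_def)
  have "f x \<in> carrier B" if "x \<in> carrier A" for x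
    using f that by (auto simp: ring_iso_def Ring.ring_hom_def)
  then show ?thesis
    unfolding alg_isomorphic_def
    by (intro bexI[of _ "g \<circ> f"]) (auto simp: * intro: ring_iso_set_trans[OF f g])
qed

lemma alg_quot_empty_isomorphic:
  assumes "ring A" and smult_closed: "\<And>c x. x \<in> carrier A \<Longrightarrow> c \<odot>\<^bsub>A\<^esub> x \<in> carrier A"
  shows "alg_isomorphic A (alg_quot A {})" and "ring (alg_quot A {})"
    and "\<And>c x. x \<in> carrier (alg_quot A {}) \<Longrightarrow> c \<odot>\<^bsub>alg_quot A {}\<^esub> x \<in> carrier (alg_quot A {})"
proof -
  interpret ring A by fact
  have Idl: "Idl\<^bsub>A\<^esub> {} = {\<zero>\<^bsub>A\<^esub>}"
    using genideal_minimal[OF zeroideal, of "{}"] additive_subgroup.zero_closed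
      genideal_ideal[of "{}"] ideal.axioms(1) by fastforce
  have coset: "{\<zero>\<^bsub>A\<^esub>} +>\<^bsub>A\<^esub> x = {x}" if "x \<in> carrier A" for x
    using that by (simp add: a_r_coset_def' )
  have carr: "carrier (alg_quot A {}) = (\<lambda>x. {x}) ` carrier A"
    by (auto simp: alg_quot_def Let_def Idl FactRing_def A_RCOSETS_def' coset)
  have smult: "c \<odot>\<^bsub>alg_quot A {}\<^esub> {x} = {c \<odot>\<^bsub>A\<^esub> x}" if "x \<in> carrier A" for c x
    using that smult_closed by (simp add: alg_quot_def Let_def Idl coset)
  have iso: "(\<lambda>x. {x}) \<in> ring_iso A (alg_quot A {})"
    unfolding ring_iso_def Ring.ring_hom_def
    by (auto simp: carr bij_betw_def inj_on_def)
      (auto simp: alg_quot_def Let_def Idl FactRing_def rcoset_mult_def coset set_add_def')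
  show "alg_isomorphic A (alg_quot A {})"
    unfolding alg_isomorphic_def by (intro bexI[OF _ iso]) (simp add: smult)
  show "c \<odot>\<^bsub>alg_quot A {}\<^esub> x \<in> carrier (alg_quot A {})" if "x \<in> carrier (alg_quot A {})" for c x
    using that smult_closed by (auto simp: carr smult)
  have "ring ((alg_quot A {})\<lparr>zero := {\<zero>\<^bsub>A\<^esub>}\<rparr>)"
    by (rule ring_iso_imp_img_ring[OF iso])
  then show "ring (alg_quot A {})"
    by (simp add: alg_quot_def Let_def Idl FactRing_def)
qed

lemma cyclotomic_hecke_0: "alg_isomorphic scalar_algebra (cyclotomic_hecke 0 vs)"
proof -
  let ?F = "free_algebra {} :: (ground, free_elem) module"
  have ring: "ring ?F" by (intro ring_monoid_algebra monoid_free_monoid)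
  have smult: "c \<odot>\<^bsub>?F\<^esub> x \<in> carrier ?F" if "x \<in> carrier ?F" for c x
    using that by (auto simp: monoid_algebra_simps in_keys_iff map.rep_eq)
  have single: "\<exists>c. x = Poly_Mapping.single [] c" if "x \<in> carrier ?F" for x
    by (rule exI[of _ "Poly_Mapping.lookup x []"], rule poly_mapping_eqI)
      (use that in \<open>auto simp: monoid_algebra_simps free_monoid_def lookup_single when_def in_keys_iff\<close>)
  have "Poly_Mapping.single [] \<in> ring_iso scalar_algebra ?F"
    unfolding ring_iso_def Ring.ring_hom_def
    by (auto simp: scalar_algebra_def bij_betw_def inj_on_def monoid_algebra_simps
        monoid_algebra_mult_single single_add free_monoid_def
        image_iff split: if_splits)
      (metis lookup_single_eq,
        use single in \<open>auto simp: monoid_algebra_simps free_monoid_def\<close>)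
  moreover have "Poly_Mapping.single [] (c * x) = c \<odot>\<^bsub>?F\<^esub> Poly_Mapping.single [] x" for c x
    by (rule poly_mapping_eqI) (simp add: monoid_algebra_simps lookup_single map.rep_eq when_def)
  ultimately have "alg_isomorphic scalar_algebra ?F"
    unfolding alg_isomorphic_def by (intro bexI) (auto simp: scalar_algebra_def)
  moreover have "presented_algebra {} {} = alg_quot ?F {}"
    by (simp add: presented_algebra_def)
  ultimately show ?thesis
    using alg_quot_empty_isomorphic[OF ring smult]
      alg_quot_empty_isomorphic(1)[OF alg_quot_empty_isomorphic(2,3)[OF ring smult]]
    by (auto simp: cyclotomic_hecke_def intro: alg_isomorphic_trans)
qed


section \<open>Compositions\<close>

definition compositions :: "nat \<Rightarrow> nat \<Rightarrow> nat list set"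
  where "compositions d n = {\<mu>. length \<mu> = d \<and> sum_list \<mu> = n}"

definition multinomial :: "nat list \<Rightarrow> nat"
  where "multinomial \<mu> = fact (sum_list \<mu>) div (\<Prod>k\<leftarrow>\<mu>. fact k)"

definition cyclotomic_hecke_tensor ::
    "nat list \<Rightarrow> ground list \<Rightarrow> (ground, ((nat \<Rightarrow> free_elem set set) \<Rightarrow>\<^sub>0 ground) set) module"
  where "cyclotomic_hecke_tensor \<mu> vs =
    tensor_algebra {..<length \<mu>} (\<lambda>a. cyclotomic_hecke (\<mu> ! a) vs)"

end

theory Submission
  imports Defs "HOL-Combinatorics.Multiset_Permutations"
begin


text \<open>
  The commuting elements \<open>t\<^sub>j\<close> with \<open>t\<^sub>j\<^sup>d = 1\<close> have simultaneous spectral idempotents \<open>E \<chi>\<close>, one for each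
  colouring \<open>\<chi>\<close> of the positions \<open>1, \<dots>, n\<close> by \<open>d\<close> colours, and \<open>g\<^sub>i\<close> exchanges \<open>E \<chi>\<close> with the idempotent of
  \<open>\<chi> \<circ> s\<^sub>i\<close>. If \<open>\<chi> i \<noteq> \<chi> (i + 1)\<close>, then \<open>e\<^sub>i E \<chi> = 0\<close>, so \<open>g\<^sub>i\<^sup>2\<close> acts on \<open>E \<chi>\<close> as the unit \<open>u\<^sup>2\<close>. Sorting a
  colouring by such exchanges gives elements \<open>S \<chi>\<close>, \<open>T \<chi>\<close> with \<open>S \<chi> T \<chi> = E \<sigma>\<close> and \<open>T \<chi> S \<chi> = E \<chi>\<close>, where \<open>\<sigma>\<close> is
  the sorted colouring with the same colour multiplicities \<open>\<mu>\<close>. Hence the algebra is the direct sum over \<open>\<mu>\<close> of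
  the matrix algebras over the corners at \<open>E \<sigma>\<close>.

  Moving \<open>S \<chi>\<close> through the generators shows that this corner is generated by the \<open>g\<^sub>i E \<sigma>\<close> with \<open>i\<close>, \<open>i + 1\<close> in the
  same block of \<open>\<sigma>\<close> and, for each block, the Jucys--Murphy element at its first position, which is conjugate to
  \<open>X\<^sub>1\<close> and so satisfies the cyclotomic relation. This gives a surjection from the tensor product of cyclotomic
  Hecke algebras onto the corner. It is injective because the whole algebra acts on functions from the colourings of
  type \<open>\<mu>\<close> to the tensor product, and there the image of \<open>h\<close> multiplies the value at \<open>\<sigma>\<close> by \<open>h\<close> on the left.
\<close>

section \<open>Algebras and their homomorphisms\<close>

text \<open>No basis of either side is used: a rank count is replaced by the explicit action on
  functions, evaluated at the constant function 1. Two normalisations make this action and the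
  relations in the corners exact. The exchange of unequal colours acts by \<open>u_var\<close> times
  the transposition, because its square has to be \<open>u_var\<^sup>2\<close>; and the
  Jucys--Murphy recursion carries the factor \<open>U_inv\<close>, so that on unequal colours
  conjugation by a generator moves such an element to its neighbour without a scalar. The ground
  ring enters through 1/d, the d-th roots of unity and the inverse of u: the first two give the
  spectral idempotents by finite Fourier inversion, the third makes exchanges invertible. A sorting
  path is not unique, and moving generators through \<open>S\<close> needs a path that begins at a
  convenient descent; the commutation and braid relations make the product independent of the path.
  A colour that does not occur yields a tensor factor isomorphic to K without generators, which is
  why the relations of a block are always stated for positive size.\<close>

locale kalgebra = ring A for A :: "('k::comm_ring_1, 'a) module" (structure) +
  assumes smult_closed [simp, intro]: "x \<in> carrier A \<Longrightarrow> c \<odot> x \<in> carrier A"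
    and smult_r_distr: "\<lbrakk>x \<in> carrier A; y \<in> carrier A\<rbrakk> \<Longrightarrow> c \<odot> (x \<oplus> y) = c \<odot> x \<oplus> c \<odot> y"
    and smult_l_distr: "x \<in> carrier A \<Longrightarrow> (b + c) \<odot> x = b \<odot> x \<oplus> c \<odot> x"
    and smult_smult: "x \<in> carrier A \<Longrightarrow> b \<odot> (c \<odot> x) = (b * c) \<odot> x"
    and one_smult [simp]: "x \<in> carrier A \<Longrightarrow> 1 \<odot> x = x"
    and smult_mult_left: "\<lbrakk>x \<in> carrier A; y \<in> carrier A\<rbrakk> \<Longrightarrow> (c \<odot> x) \<otimes> y = c \<odot> (x \<otimes> y)"
    and smult_mult_right: "\<lbrakk>x \<in> carrier A; y \<in> carrier A\<rbrakk> \<Longrightarrow> x \<otimes> (c \<odot> y) = c \<odot> (x \<otimes> y)"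
begin

lemma zero_smult [simp]: "x \<in> carrier A \<Longrightarrow> 0 \<odot> x = \<zero>"
  using smult_l_distr[of x 0 0] add.l_cancel_one' by fastforce

lemma smult_zero [simp]: "c \<odot> \<zero> = \<zero>"
  using smult_r_distr[of \<zero> \<zero> c] add.l_cancel_one' by fastforce

lemma minus_smult: "x \<in> carrier A \<Longrightarrow> \<ominus> (c \<odot> x) = (- c) \<odot> x"
  using smult_l_distr[of x "-c" c] by (intro minus_equality) auto

lemma minus_eq_zero_iff: "\<lbrakk>x \<in> carrier A; y \<in> carrier A\<rbrakk> \<Longrightarrow> x \<ominus> y = \<zero> \<longleftrightarrow> x = y"
  by (metis a_minus_def add.inv_closed minus_equality minus_minus r_neg)

end

text \<open>Zero is preserved by cancellation from additivity, and a sum over an infinite index set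
  is zero on both sides, so the index set is unrestricted. Scalar multiples, one-sided products,
  homomorphisms and evaluations of operators are all instances.\<close>

lemma finsum_additive_map:
  assumes "abelian_group A" "abelian_group B"
    and h: "\<And>x. x \<in> carrier A \<Longrightarrow> h x \<in> carrier B"
    and add: "\<And>x y. \<lbrakk>x \<in> carrier A; y \<in> carrier A\<rbrakk> \<Longrightarrow> h (x \<oplus>\<^bsub>A\<^esub> y) = h x \<oplus>\<^bsub>B\<^esub> h y"
    and f: "\<And>i. i \<in> S \<Longrightarrow> f i \<in> carrier A"
  shows "h (finsum A f S) = finsum B (\<lambda>i. h (f i)) S"
proof -
  interpret A: abelian_group A by fact
  interpret B: abelian_group B by fact
  have zero: "h \<zero>\<^bsub>A\<^esub> = \<zero>\<^bsub>B\<^esub>"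
    using add[of "\<zero>\<^bsub>A\<^esub>" "\<zero>\<^bsub>A\<^esub>"] B.add.l_cancel_one'[of "h \<zero>\<^bsub>A\<^esub>" "h \<zero>\<^bsub>A\<^esub>"] by (simp add: h)
  show ?thesis
    using f
    by (induction S rule: infinite_finite_induct)
      (simp_all add: zero add h A.finsum_infinite B.finsum_infinite Pi_def)
qed

context kalgebra
begin

lemma finsum_smult:
  assumes "\<And>i. i \<in> S \<Longrightarrow> f i \<in> carrier A"
  shows "c \<odot> (\<Oplus>i\<in>S. f i) = (\<Oplus>i\<in>S. c \<odot> f i)"
  using assms by (intro finsum_additive_map) (auto simp: smult_r_distr abelian_group_axioms)

lemma finsum_mult_left:
  assumes "x \<in> carrier A" "\<And>i. i \<in> S \<Longrightarrow> f i \<in> carrier A"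
  shows "x \<otimes> (\<Oplus>i\<in>S. f i) = (\<Oplus>i\<in>S. x \<otimes> f i)"
  using assms by (intro finsum_additive_map) (auto simp: r_distr abelian_group_axioms)

lemma finsum_mult_right:
  assumes "x \<in> carrier A" "\<And>i. i \<in> S \<Longrightarrow> f i \<in> carrier A"
  shows "(\<Oplus>i\<in>S. f i) \<otimes> x = (\<Oplus>i\<in>S. f i \<otimes> x)"
  using assms by (intro finsum_additive_map) (auto simp: l_distr abelian_group_axioms)

lemma finsum_delta:
  assumes "finite S" "i \<in> S" "x \<in> carrier A" "\<And>j. \<lbrakk>j \<in> S; j \<noteq> i\<rbrakk> \<Longrightarrow> f j = \<zero>" "f i = x"
  shows "(\<Oplus>j\<in>S. f j) = x"
proof -
  have "(\<Oplus>j\<in>S. f j) = (\<Oplus>j\<in>S. if i = j then x else \<zero>)"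
    using assms by (intro add.finprod_cong') auto
  then show ?thesis using assms by (simp add: add.finprod_singleton)
qed

end

locale kalgebra_hom = A: kalgebra A + B: kalgebra B
  for A :: "('k::comm_ring_1, 'a) module" (structure) and B :: "('k, 'b) module" +
  fixes h
  assumes hom_closed [simp, intro]: "x \<in> carrier A \<Longrightarrow> h x \<in> carrier B"
    and hom_add: "\<lbrakk>x \<in> carrier A; y \<in> carrier A\<rbrakk> \<Longrightarrow> h (x \<oplus> y) = h x \<oplus>\<^bsub>B\<^esub> h y"
    and hom_mult: "\<lbrakk>x \<in> carrier A; y \<in> carrier A\<rbrakk> \<Longrightarrow> h (x \<otimes> y) = h x \<otimes>\<^bsub>B\<^esub> h y"
    and hom_one: "h \<one> = \<one>\<^bsub>B\<^esub>"
    and hom_smult: "x \<in> carrier A \<Longrightarrow> h (c \<odot> x) = c \<odot>\<^bsub>B\<^esub> h x"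
begin

sublocale ring_hom_ring A B h
  by unfold_locales (auto simp: Ring.ring_hom_def hom_add hom_mult hom_one)

lemma hom_minus: "\<lbrakk>x \<in> carrier A; y \<in> carrier A\<rbrakk> \<Longrightarrow> h (x \<ominus> y) = h x \<ominus>\<^bsub>B\<^esub> h y"
  by (simp add: A.minus_eq B.minus_eq hom_add)

lemma hom_finsum:
  "(\<And>i. i \<in> S \<Longrightarrow> f i \<in> carrier A) \<Longrightarrow> h (finsum A f S) = finsum B (\<lambda>i. h (f i)) S"
  by (rule finsum_additive_map)
    (auto simp: hom_add A.abelian_group_axioms B.abelian_group_axioms)

end

lemma kalgebra_hom_compose:
  assumes "kalgebra_hom A B f" and "kalgebra_hom B C g"
  shows "kalgebra_hom A C (\<lambda>x. g (f x))"
proof -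
  interpret f: kalgebra_hom A B f by fact
  interpret g: kalgebra_hom B C g by fact
  show ?thesis
    by unfold_locales
      (simp_all add: f.hom_add f.hom_mult f.hom_one f.hom_smult g.hom_add g.hom_mult g.hom_one g.hom_smult)
qed

text \<open>The target is only a record: its laws are inherited through the surjection, without
  first proving it to be a ring. This is how a quotient obtains all its axioms at once.\<close>

lemma kalgebra_surj_image:
  assumes "kalgebra A" and onto: "carrier B = h ` carrier A"
    and add: "\<And>x y. \<lbrakk>x \<in> carrier A; y \<in> carrier A\<rbrakk> \<Longrightarrow> h (x \<oplus>\<^bsub>A\<^esub> y) = h x \<oplus>\<^bsub>B\<^esub> h y"
    and mult: "\<And>x y. \<lbrakk>x \<in> carrier A; y \<in> carrier A\<rbrakk> \<Longrightarrow> h (x \<otimes>\<^bsub>A\<^esub> y) = h x \<otimes>\<^bsub>B\<^esub> h y"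
    and one: "h \<one>\<^bsub>A\<^esub> = \<one>\<^bsub>B\<^esub>" and zero: "h \<zero>\<^bsub>A\<^esub> = \<zero>\<^bsub>B\<^esub>"
    and smult: "\<And>c x. x \<in> carrier A \<Longrightarrow> h (c \<odot>\<^bsub>A\<^esub> x) = c \<odot>\<^bsub>B\<^esub> h x"
  shows "kalgebra B"
proof -
  interpret kalgebra A by fact
  note flip = add[symmetric] mult[symmetric] smult[symmetric] one[symmetric] zero[symmetric]
  have "ring B"
  proof (rule ringI)
    show "abelian_group B"
    proof (rule abelian_groupI)
      fix x assume "x \<in> carrier B"
      then obtain y where "y \<in> carrier A" "x = h y" by (auto simp: onto)
      then show "\<exists>y\<in>carrier B. y \<oplus>\<^bsub>B\<^esub> x = \<zero>\<^bsub>B\<^esub>"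
        by (intro bexI[of _ "h (\<ominus>\<^bsub>A\<^esub> y)"]) (auto simp: onto flip l_neg)
    qed (auto simp: onto flip a_ac)
    show "Group.monoid B"
      by (rule monoidI) (auto simp: onto flip m_assoc)
  qed (auto simp: onto flip l_distr r_distr)
  then show ?thesis
    unfolding kalgebra_def kalgebra_axioms_def
    by (auto simp: onto flip smult_r_distr smult_l_distr smult_smult smult_mult_left smult_mult_right)
qed


section \<open>Quotients and generators\<close>

context kalgebra
begin

context
  fixes S assumes S: "S \<subseteq> carrier A"
begin

lemma ideal_genideal: "ideal (Idl S) A"
  by (rule genideal_ideal[OF S])

lemma alg_quot_proj_eq_iff:
  assumes "x \<in> carrier A" "y \<in> carrier A"
  shows "alg_quot_proj A S x = alg_quot_proj A S y \<longleftrightarrow> x \<ominus> y \<in> Idl S"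
  using assms ideal_genideal quotient_eq_iff_same_a_r_cos[of "Idl S" x y]
  by (auto simp: alg_quot_proj_def)

text \<open>A scalar multiple \<open>c \<odot> i\<close> is the product of the algebra element
  \<open>c \<odot> \<one>\<close> with \<open>i\<close>, so a two-sided ideal absorbs scalars
  although ring ideals mention none.\<close>

lemma smult_genideal: "i \<in> Idl S \<Longrightarrow> c \<odot> i \<in> Idl S"
proof -
  assume i: "i \<in> Idl S"
  interpret I: ideal "Idl S" A by (rule ideal_genideal)
  have "c \<odot> i = (c \<odot> \<one>) \<otimes> i" using I.a_Hcarr[OF i] by (simp add: smult_mult_left)
  then show ?thesis using I.I_l_closed[OF i, of "c \<odot> \<one>"] by simp
qed

text \<open>The scalar multiplication of \<open>alg_quot\<close> is a union over all
  representatives. The cosets in this union coincide, because two representatives differ by an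
  element of the ideal, so the union is a single coset.\<close>

lemma alg_quot_smult:
  assumes x: "x \<in> carrier A"
  shows "c \<odot>\<^bsub>alg_quot A S\<^esub> alg_quot_proj A S x = alg_quot_proj A S (c \<odot> x)"
proof -
  interpret I: ideal "Idl S" A by (rule ideal_genideal)
  have "alg_quot_proj A S (c \<odot> y) = alg_quot_proj A S (c \<odot> x)" if y: "y \<in> alg_quot_proj A S x" for y
  proof -
    obtain i where i: "i \<in> Idl S" "y = i \<oplus> x"
      using y by (auto simp: alg_quot_proj_def a_r_coset_def')
    then have "i \<in> carrier A" using I.a_Hcarr by auto
    then have "c \<odot> y \<ominus> c \<odot> x = c \<odot> i" using x i by (simp add: smult_r_distr minus_eq a_assoc r_neg)
    moreover have "c \<odot> y \<in> carrier A" using i x \<open>i \<in> carrier A\<close> by simp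
    ultimately show ?thesis using i x smult_genideal by (subst alg_quot_proj_eq_iff) auto
  qed
  moreover have "x \<in> alg_quot_proj A S x"
    using I.a_rcos_self x by (auto simp: alg_quot_proj_def)
  ultimately have "(\<Union>y\<in>alg_quot_proj A S x. alg_quot_proj A S (c \<odot> y)) = alg_quot_proj A S (c \<odot> x)"
    by (intro SUP_eq_const) blast+
  then show ?thesis
    unfolding alg_quot_def alg_quot_proj_def Let_def by simp
qed

lemma alg_quot_carrier: "carrier (alg_quot A S) = alg_quot_proj A S ` carrier A"
  by (auto simp: alg_quot_def Let_def FactRing_def A_RCOSETS_def' alg_quot_proj_def)

lemma alg_quot_ops:
  assumes "x \<in> carrier A" "y \<in> carrier A"
  shows "alg_quot_proj A S (x \<oplus> y) = alg_quot_proj A S x \<oplus>\<^bsub>alg_quot A S\<^esub> alg_quot_proj A S y"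
    and "alg_quot_proj A S (x \<otimes> y) = alg_quot_proj A S x \<otimes>\<^bsub>alg_quot A S\<^esub> alg_quot_proj A S y"
proof -
  interpret I: ideal "Idl S" A by (rule ideal_genideal)
  show "alg_quot_proj A S (x \<oplus> y) = alg_quot_proj A S x \<oplus>\<^bsub>alg_quot A S\<^esub> alg_quot_proj A S y"
    "alg_quot_proj A S (x \<otimes> y) = alg_quot_proj A S x \<otimes>\<^bsub>alg_quot A S\<^esub> alg_quot_proj A S y"
    using assms I.rcos_ring_hom
    by (auto simp: alg_quot_def Let_def alg_quot_proj_def Ring.ring_hom_def)
qed

lemma alg_quot_zero: "alg_quot_proj A S \<zero> = \<zero>\<^bsub>alg_quot A S\<^esub>"
proof -
  interpret I: ideal "Idl S" A by (rule ideal_genideal)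
  show ?thesis
    by (auto simp: alg_quot_def Let_def FactRing_def alg_quot_proj_def a_r_coset_def' I.a_Hcarr)
qed

lemma alg_quot_one: "alg_quot_proj A S \<one> = \<one>\<^bsub>alg_quot A S\<^esub>"
  by (auto simp: alg_quot_def Let_def FactRing_def alg_quot_proj_def)

lemma kalgebra_alg_quot: "kalgebra (alg_quot A S)"
  by (rule kalgebra_surj_image[OF kalgebra_axioms alg_quot_carrier])
    (simp_all only: alg_quot_ops alg_quot_zero alg_quot_one alg_quot_smult)

lemma kalgebra_hom_alg_quot_proj: "kalgebra_hom A (alg_quot A S) (alg_quot_proj A S)"
  using kalgebra_alg_quot unfolding kalgebra_hom_def kalgebra_hom_axioms_def
  by (auto simp: alg_quot_carrier alg_quot_ops alg_quot_one alg_quot_smult kalgebra_axioms)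

text \<open>The kernel of \<open>h\<close> is an ideal containing \<open>S\<close>, hence contains
  the ideal generated by \<open>S\<close>; so the value of \<open>h\<close> at a representative
  depends only on the coset.\<close>

lemma alg_quot_lift:
  assumes "kalgebra_hom A B h" and h0: "\<And>s. s \<in> S \<Longrightarrow> h s = \<zero>\<^bsub>B\<^esub>"
  shows "\<exists>h'. kalgebra_hom (alg_quot A S) B h' \<and>
    (\<forall>x\<in>carrier A. h' (alg_quot_proj A S x) = h x)"
proof -
  interpret h: kalgebra_hom A B h by fact
  interpret p: kalgebra_hom A "alg_quot A S" "alg_quot_proj A S" by (rule kalgebra_hom_alg_quot_proj)
  have "Idl S \<subseteq> a_kernel A B h"
    by (rule genideal_minimal[OF h.kernel_is_ideal]) (use S h0 in \<open>unfold a_kernel_def', blast\<close>)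
  then have ker: "h x = \<zero>\<^bsub>B\<^esub>" if "x \<in> Idl S" for x
    using that unfolding a_kernel_def' by blast
  have *: "h x = h y" if "x \<in> carrier A" "y \<in> carrier A" "alg_quot_proj A S x = alg_quot_proj A S y" for x y
    using ker[of "x \<ominus> y"] that alg_quot_proj_eq_iff[of x y]
    by (simp only: h.hom_minus h.B.minus_eq_zero_iff h.hom_closed simp_thms)
  \<comment> \<open>The representative is arbitrary; \<open>*\<close> makes the value independent of
    it.\<close>
  define h' where "h' C = h (SOME x. x \<in> carrier A \<and> alg_quot_proj A S x = C)" for C
  have h': "h' (alg_quot_proj A S x) = h x" if "x \<in> carrier A" for x
  proof -
    have "\<exists>y. y \<in> carrier A \<and> alg_quot_proj A S y = alg_quot_proj A S x" using that by auto
    from someI_ex[OF this] show ?thesis unfolding h'_def using that by (intro *) blast+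
  qed
  have "kalgebra_hom (alg_quot A S) B h'"
    unfolding kalgebra_hom_def kalgebra_hom_axioms_def
    by (auto simp: alg_quot_carrier h' p.B.kalgebra_axioms h.B.kalgebra_axioms h.hom_add h.hom_mult
        h.hom_smult h.hom_one alg_quot_smult
        simp flip: alg_quot_ops alg_quot_one)
  then show ?thesis using h' by blast
qed

end

end

text \<open>Zero and negatives are scalar multiples by 0 and -1, so closure under sums, products and
  scalars is the whole condition. The second-order form of \<open>generates\<close> below turns
  directly into an induction principle.\<close>

definition subalgebra :: "('k, 'a) module \<Rightarrow> 'a set \<Rightarrow> bool"
  where "subalgebra A P \<longleftrightarrow> P \<subseteq> carrier A \<and> \<one>\<^bsub>A\<^esub> \<in> P \<and>
    (\<forall>x\<in>P. \<forall>y\<in>P. x \<oplus>\<^bsub>A\<^esub> y \<in> P \<and> x \<otimes>\<^bsub>A\<^esub> y \<in> P) \<and> (\<forall>c. \<forall>x\<in>P. c \<odot>\<^bsub>A\<^esub> x \<in> P)"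

definition generates :: "('k, 'a) module \<Rightarrow> 'a set \<Rightarrow> bool"
  where "generates A G \<longleftrightarrow> G \<subseteq> carrier A \<and> (\<forall>P. subalgebra A P \<longrightarrow> G \<subseteq> P \<longrightarrow> carrier A \<subseteq> P)"

lemma generates_induct [consumes 2, case_names gen one add mult smult]:
  assumes "generates A G" and "x \<in> carrier A" and "kalgebra A"
    and gen: "\<And>x. x \<in> G \<Longrightarrow> Q x" and one: "Q \<one>\<^bsub>A\<^esub>"
    and add: "\<And>x y. \<lbrakk>x \<in> carrier A; y \<in> carrier A; Q x; Q y\<rbrakk> \<Longrightarrow> Q (x \<oplus>\<^bsub>A\<^esub> y)"
    and mult: "\<And>x y. \<lbrakk>x \<in> carrier A; y \<in> carrier A; Q x; Q y\<rbrakk> \<Longrightarrow> Q (x \<otimes>\<^bsub>A\<^esub> y)"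
    and smult: "\<And>c x. \<lbrakk>x \<in> carrier A; Q x\<rbrakk> \<Longrightarrow> Q (c \<odot>\<^bsub>A\<^esub> x)"
  shows "Q x"
proof -
  interpret kalgebra A by fact
  have "subalgebra A {x \<in> carrier A. Q x}"
    using one add mult smult by (auto simp: subalgebra_def)
  with assms(1) gen have "carrier A \<subseteq> {x \<in> carrier A. Q x}"
    unfolding generates_def by blast
  with assms(2) show ?thesis by auto
qed

lemma subalgebra_vimage:
  assumes "kalgebra_hom A B h" and "subalgebra B P"
  shows "subalgebra A {x \<in> carrier A. h x \<in> P}"
proof -
  interpret kalgebra_hom A B h by fact
  show ?thesis
    using assms(2) unfolding subalgebra_def by (simp add: hom_mult hom_smult hom_one)
qed

lemma generatesD:
  assumes "generates A G"
  shows "G \<subseteq> carrier A" and "\<lbrakk>subalgebra A P; G \<subseteq> P\<rbrakk> \<Longrightarrow> carrier A \<subseteq> P"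
proof -
  show "G \<subseteq> carrier A" using assms unfolding generates_def by (rule conjunct1)
  show "carrier A \<subseteq> P" if "subalgebra A P" "G \<subseteq> P"
    using assms[unfolded generates_def, THEN conjunct2, rule_format, OF that] .
qed

lemma generates_image:
  assumes "kalgebra_hom A B h" and "h ` carrier A = carrier B" and "generates A G"
  shows "generates B (h ` G)"
  unfolding generates_def
proof (intro conjI allI impI)
  show "h ` G \<subseteq> carrier B" unfolding assms(2)[symmetric] by (rule image_mono[OF generatesD(1)[OF assms(3)]])
  fix P assume P: "subalgebra B P" "h ` G \<subseteq> P"
  have "G \<subseteq> {x \<in> carrier A. h x \<in> P}"
    using P(2) generatesD(1)[OF assms(3)] by (simp add: subset_iff image_subset_iff)
  then have "carrier A \<subseteq> {x \<in> carrier A. h x \<in> P}"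
    by (rule generatesD(2)[OF assms(3) subalgebra_vimage[OF assms(1) P(1)]])
  then show "carrier B \<subseteq> P"
    unfolding assms(2)[symmetric] by (simp only: image_subset_iff) (simp add: subset_iff)
qed

text \<open>Elements that commute with a fixed element form a subalgebra, so generators suffice. The
  claim is extended in two rounds: along \<open>H\<close> for a fixed generator of \<open>A\<close>,
  and then along \<open>G\<close> for an arbitrary element of \<open>B\<close>.\<close>

lemma kalgebra_homs_commute:
  assumes "kalgebra_hom A C f" and "kalgebra_hom B C g"
    and G: "generates A G" and H: "generates B H"
    and comm: "\<And>x y. \<lbrakk>x \<in> G; y \<in> H\<rbrakk> \<Longrightarrow> f x \<otimes>\<^bsub>C\<^esub> g y = g y \<otimes>\<^bsub>C\<^esub> f x"
    and x: "x \<in> carrier A" and y: "y \<in> carrier B"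
  shows "f x \<otimes>\<^bsub>C\<^esub> g y = g y \<otimes>\<^bsub>C\<^esub> f x"
proof -
  interpret f: kalgebra_hom A C f by fact
  interpret g: kalgebra_hom B C g by fact
  have 1: "f x \<otimes>\<^bsub>C\<^esub> g y = g y \<otimes>\<^bsub>C\<^esub> f x" if "x \<in> G" for x
  proof -
    have x: "x \<in> carrier A" using that G by (auto simp: generates_def)
    from H y g.A.kalgebra_axioms show ?thesis
    proof (rule generates_induct)
      fix y z assume yz: "y \<in> carrier B" "z \<in> carrier B"
        and *: "f x \<otimes>\<^bsub>C\<^esub> g y = g y \<otimes>\<^bsub>C\<^esub> f x" "f x \<otimes>\<^bsub>C\<^esub> g z = g z \<otimes>\<^bsub>C\<^esub> f x"
      have "f x \<otimes>\<^bsub>C\<^esub> (g y \<otimes>\<^bsub>C\<^esub> g z) = (f x \<otimes>\<^bsub>C\<^esub> g y) \<otimes>\<^bsub>C\<^esub> g z"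
        using x yz by (simp add: f.B.m_assoc)
      also have "\<dots> = g y \<otimes>\<^bsub>C\<^esub> (f x \<otimes>\<^bsub>C\<^esub> g z)" using x yz by (simp add: f.B.m_assoc *(1))
      also have "\<dots> = (g y \<otimes>\<^bsub>C\<^esub> g z) \<otimes>\<^bsub>C\<^esub> f x" using x yz by (simp add: f.B.m_assoc *(2))
      finally show "f x \<otimes>\<^bsub>C\<^esub> g (y \<otimes>\<^bsub>B\<^esub> z) = g (y \<otimes>\<^bsub>B\<^esub> z) \<otimes>\<^bsub>C\<^esub> f x" using yz by (simp add: g.hom_mult)
    qed (use x comm that in \<open>simp_all add: g.hom_one g.hom_add g.hom_smult f.B.l_distr f.B.r_distr
          f.B.smult_mult_left f.B.smult_mult_right\<close>)
  qed
  from G x f.A.kalgebra_axioms show ?thesis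
  proof (rule generates_induct)
    fix u v assume uv: "u \<in> carrier A" "v \<in> carrier A"
      and *: "f u \<otimes>\<^bsub>C\<^esub> g y = g y \<otimes>\<^bsub>C\<^esub> f u" "f v \<otimes>\<^bsub>C\<^esub> g y = g y \<otimes>\<^bsub>C\<^esub> f v"
    have "(f u \<otimes>\<^bsub>C\<^esub> f v) \<otimes>\<^bsub>C\<^esub> g y = f u \<otimes>\<^bsub>C\<^esub> (g y \<otimes>\<^bsub>C\<^esub> f v)"
      using y uv by (simp add: f.B.m_assoc *(2))
    also have "\<dots> = (g y \<otimes>\<^bsub>C\<^esub> f u) \<otimes>\<^bsub>C\<^esub> f v" using y uv by (simp add: f.B.m_assoc[symmetric] *(1)[symmetric])
    finally show "f (u \<otimes>\<^bsub>A\<^esub> v) \<otimes>\<^bsub>C\<^esub> g y = g y \<otimes>\<^bsub>C\<^esub> f (u \<otimes>\<^bsub>A\<^esub> v)"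
      using y uv by (simp add: f.hom_mult f.B.m_assoc)
  qed (use y 1 in \<open>simp_all add: f.hom_one f.hom_add f.hom_smult f.B.l_distr f.B.r_distr
        f.B.smult_mult_left f.B.smult_mult_right\<close>)
qed


section \<open>Monoid algebras\<close>

lemma kalgebra_monoid_algebra:
  fixes M :: "('b, 'c) monoid_scheme"
  assumes "Group.monoid M"
  shows "kalgebra (monoid_algebra M :: ('k::comm_ring_1, _) module)"
proof -
  let ?A = "monoid_algebra M :: ('k, _) module"
  interpret R: ring ?A by (rule ring_monoid_algebra[OF assms])
  have lookup_map: "Poly_Mapping.lookup (Poly_Mapping.map ((*) c) p) k = c * Poly_Mapping.lookup p k"
    for c :: 'k and p :: "'b \<Rightarrow>\<^sub>0 'k" and k
    by (simp add: map.rep_eq when_def)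
  have map_single: "Poly_Mapping.map ((*) c) (Poly_Mapping.single x b) = Poly_Mapping.single x (c * b)" for c b :: 'k and x :: 'b
    by (rule poly_mapping_eqI) (simp add: map.rep_eq lookup_single when_def)
  have map_add: "Poly_Mapping.map ((*) c) (p + q) = Poly_Mapping.map ((*) c) p + Poly_Mapping.map ((*) c) q"
    for c :: 'k and p q :: "'b \<Rightarrow>\<^sub>0 'k"
    by (rule poly_mapping_eqI) (simp add: lookup_map lookup_add distrib_left)
  have map0: "Poly_Mapping.map ((*) c) 0 = 0" for c :: 'k
    by (rule poly_mapping_eqI) (simp add: map.rep_eq)
  \<comment> \<open>Induction over keys in UNIV proves the two scalar laws for all finitely
    supported functions, also outside the carrier.\<close>
  have keys0: "Poly_Mapping.keys p \<subseteq> UNIV" for p :: "'b \<Rightarrow>\<^sub>0 'k" by simp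
  have l: "(c \<odot>\<^bsub>?A\<^esub> p) \<otimes>\<^bsub>?A\<^esub> q = c \<odot>\<^bsub>?A\<^esub> (p \<otimes>\<^bsub>?A\<^esub> q)" for c p q
  proof (induction p rule: keys_induct_in[OF keys0])
    case 1 show ?case by (simp add: monoid_algebra_simps map0 monoid_algebra_mult_zero)
  next
    case (2 x b p)
    have "(c \<odot>\<^bsub>?A\<^esub> Poly_Mapping.single x b) \<otimes>\<^bsub>?A\<^esub> q = c \<odot>\<^bsub>?A\<^esub> (Poly_Mapping.single x b \<otimes>\<^bsub>?A\<^esub> q)"
      by (induction q rule: keys_induct_in[OF keys0])
        (simp_all add: monoid_algebra_simps map0 map_add map_single monoid_algebra_mult_zero monoid_algebra_mult_add_right monoid_algebra_mult_single mult.assoc)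
    with 2 show ?case by (simp add: monoid_algebra_simps map_add monoid_algebra_mult_add_left)
  qed
  have r: "p \<otimes>\<^bsub>?A\<^esub> (c \<odot>\<^bsub>?A\<^esub> q) = c \<odot>\<^bsub>?A\<^esub> (p \<otimes>\<^bsub>?A\<^esub> q)" for c p q
  proof (induction p rule: keys_induct_in[OF keys0])
    case 1 show ?case by (simp add: monoid_algebra_simps map0 monoid_algebra_mult_zero)
  next
    case (2 x b p)
    have "Poly_Mapping.single x b \<otimes>\<^bsub>?A\<^esub> (c \<odot>\<^bsub>?A\<^esub> q) = c \<odot>\<^bsub>?A\<^esub> (Poly_Mapping.single x b \<otimes>\<^bsub>?A\<^esub> q)"
      by (induction q rule: keys_induct_in[OF keys0])
        (simp_all add: monoid_algebra_simps map0 map_add map_single monoid_algebra_mult_zero monoid_algebra_mult_add_right monoid_algebra_mult_single mult.left_commute)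
    with 2 show ?case by (simp add: monoid_algebra_simps map_add monoid_algebra_mult_add_left)
  qed
  show ?thesis
  proof unfold_locales
    fix x :: "'b \<Rightarrow>\<^sub>0 'k" and b c :: 'k
    show "c \<odot>\<^bsub>?A\<^esub> x \<in> carrier ?A" if "x \<in> carrier ?A"
      using that by (auto simp: monoid_algebra_simps in_keys_iff map.rep_eq)
    show "(b + c) \<odot>\<^bsub>?A\<^esub> x = b \<odot>\<^bsub>?A\<^esub> x \<oplus>\<^bsub>?A\<^esub> c \<odot>\<^bsub>?A\<^esub> x"
      unfolding monoid_algebra_simps
      by (rule poly_mapping_eqI) (simp add: lookup_map lookup_add distrib_right)
    show "b \<odot>\<^bsub>?A\<^esub> (c \<odot>\<^bsub>?A\<^esub> x) = (b * c) \<odot>\<^bsub>?A\<^esub> x" "1 \<odot>\<^bsub>?A\<^esub> x = x"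
      unfolding monoid_algebra_simps
      by (rule poly_mapping_eqI; simp add: lookup_map mult.assoc)+
  qed (simp_all only: l r, simp add: monoid_algebra_simps map_add)
qed

lemma monoid_algebra_smult_single:
  "c \<odot>\<^bsub>monoid_algebra M\<^esub> Poly_Mapping.single x b = Poly_Mapping.single x (c * b)"
  unfolding monoid_algebra_simps
  by (rule poly_mapping_eqI) (simp add: map.rep_eq lookup_single when_def)

text \<open>The linear extension of a monoid homomorphism. Multiplicativity is bilinear, so it is
  reduced to monomials one factor at a time.\<close>

lemma monoid_algebra_lift:
  assumes M: "Group.monoid M" and "kalgebra B"
    and f: "\<And>x. x \<in> carrier M \<Longrightarrow> f x \<in> carrier B"
    and mult: "\<And>x y. \<lbrakk>x \<in> carrier M; y \<in> carrier M\<rbrakk> \<Longrightarrow> f (x \<otimes>\<^bsub>M\<^esub> y) = f x \<otimes>\<^bsub>B\<^esub> f y"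
    and one: "f \<one>\<^bsub>M\<^esub> = \<one>\<^bsub>B\<^esub>"
  shows "\<exists>h. kalgebra_hom (monoid_algebra M) B h \<and>
    (\<forall>x\<in>carrier M. \<forall>c. h (Poly_Mapping.single x c) = c \<odot>\<^bsub>B\<^esub> f x)"
proof -
  interpret M: Group.monoid M by fact
  interpret B: kalgebra B by fact
  let ?A = "monoid_algebra M"
  interpret A: kalgebra ?A by (rule kalgebra_monoid_algebra[OF M])
  define h where "h p = finsum B (\<lambda>x. Poly_Mapping.lookup p x \<odot>\<^bsub>B\<^esub> f x) (Poly_Mapping.keys p)" for p
  \<comment> \<open>Sums may be taken over any larger finite set of basis elements, which gives two
    elements and their sum a common index set.\<close>
  have superset: "h p = finsum B (\<lambda>x. Poly_Mapping.lookup p x \<odot>\<^bsub>B\<^esub> f x) S"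
    if "finite S" "Poly_Mapping.keys p \<subseteq> S" "S \<subseteq> carrier M" for p S
    unfolding h_def using that
    by (intro B.add.finprod_mono_neutral_cong_left) (auto simp: in_keys_iff f)
  have closed: "h p \<in> carrier B" if "p \<in> carrier ?A" for p
    unfolding h_def using that by (intro B.finsum_closed) (auto simp: monoid_algebra_simps f)
  have hadd: "h (p + q) = h p \<oplus>\<^bsub>B\<^esub> h q" if "p \<in> carrier ?A" "q \<in> carrier ?A" for p q
  proof -
    let ?S = "Poly_Mapping.keys p \<union> Poly_Mapping.keys q"
    have S: "?S \<subseteq> carrier M" using that by (auto simp: monoid_algebra_simps)
    have "h (p + q) = finsum B (\<lambda>x. Poly_Mapping.lookup p x \<odot>\<^bsub>B\<^esub> f x \<oplus>\<^bsub>B\<^esub> Poly_Mapping.lookup q x \<odot>\<^bsub>B\<^esub> f x) ?S"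
      using S Poly_Mapping.keys_add[of p q]
      by (subst superset[of ?S], simp, simp, simp)
        (auto intro!: B.add.finprod_cong' simp: f lookup_add B.smult_l_distr)
    also have "\<dots> = h p \<oplus>\<^bsub>B\<^esub> h q"
      using S by (subst B.finsum_addf) (auto simp: f superset[of ?S])
    finally show ?thesis .
  qed
  have single: "h (Poly_Mapping.single x c) = c \<odot>\<^bsub>B\<^esub> f x" if "x \<in> carrier M" for x c
    using that by (subst superset[of "{x}"]) (auto simp: f)
  have hzero: "h 0 = \<zero>\<^bsub>B\<^esub>" by (simp add: h_def)
  have in_A: "Poly_Mapping.single x c \<in> carrier ?A" if "x \<in> carrier M" for x c
    using that by (simp add: monoid_algebra_simps)
  have hmult1: "h (Poly_Mapping.single x c \<otimes>\<^bsub>?A\<^esub> q) = h (Poly_Mapping.single x c) \<otimes>\<^bsub>B\<^esub> h q"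
    if "x \<in> carrier M" "q \<in> carrier ?A" for x c q
  proof -
    have "Poly_Mapping.keys q \<subseteq> carrier M" using that by (simp add: monoid_algebra_simps)
    then have "q \<in> carrier ?A \<and> ?thesis"
    proof (induction q rule: keys_induct_in)
      case zero show ?case
        using that by (simp add: monoid_algebra_mult_zero hzero closed in_A monoid_algebra_simps)
    next
      case (add y b q)
      have [simp]: "Poly_Mapping.single y b + q \<in> carrier ?A"
        using A.a_closed[of "Poly_Mapping.single y b" q] add in_A by (simp add: monoid_algebra_simps)
      have "Poly_Mapping.single x c \<otimes>\<^bsub>?A\<^esub> q \<in> carrier ?A" using add that in_A by blast
      then show ?case
        using add that
        by (simp add: monoid_algebra_mult_add_right monoid_algebra_mult_single hadd in_A
            closed single mult f B.r_distr B.smult_mult_left B.smult_mult_right B.smult_smult mult.commute)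
    qed
    then show ?thesis by simp
  qed
  have hmult: "h (p \<otimes>\<^bsub>?A\<^esub> q) = h p \<otimes>\<^bsub>B\<^esub> h q" if "p \<in> carrier ?A" "q \<in> carrier ?A" for p q
  proof -
    have "Poly_Mapping.keys p \<subseteq> carrier M" using that by (simp add: monoid_algebra_simps)
    then have "p \<in> carrier ?A \<and> ?thesis"
    proof (induction p rule: keys_induct_in)
      case zero show ?case
        using that by (simp add: monoid_algebra_mult_zero hzero closed monoid_algebra_simps)
    next
      case (add y b p)
      have [simp]: "Poly_Mapping.single y b + p \<in> carrier ?A"
        using A.a_closed[of "Poly_Mapping.single y b" p] add in_A by (simp add: monoid_algebra_simps)
      have "p \<otimes>\<^bsub>?A\<^esub> q \<in> carrier ?A" "Poly_Mapping.single y b \<otimes>\<^bsub>?A\<^esub> q \<in> carrier ?A"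
        using add that in_A by blast+
      then show ?case
        using add that
        by (simp add: monoid_algebra_mult_add_left hmult1 hadd in_A
            closed B.l_distr)
    qed
    then show ?thesis by simp
  qed
  \<comment> \<open>Scaling by \<open>c\<close> is multiplication by the monomial with coefficient
    \<open>c\<close> at the unit, so this follows from multiplicativity.\<close>
  have hsmult: "h (c \<odot>\<^bsub>?A\<^esub> p) = c \<odot>\<^bsub>B\<^esub> h p" if "p \<in> carrier ?A" for c p
  proof -
    have "c \<odot>\<^bsub>?A\<^esub> p = Poly_Mapping.single \<one>\<^bsub>M\<^esub> c \<otimes>\<^bsub>?A\<^esub> p"
      using A.smult_mult_left[of "\<one>\<^bsub>?A\<^esub>" p c] that
      by (simp only: A.one_closed A.l_one) (simp add: monoid_algebra_simps(2) monoid_algebra_smult_single)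
    then show ?thesis using that by (simp add: hmult in_A single one closed B.smult_mult_left)
  qed
  have "kalgebra_hom ?A B h"
    by unfold_locales (simp_all add: closed hmult hsmult, simp_all add: monoid_algebra_simps hadd single one)
  then show ?thesis using single by blast
qed

lemma monoid_algebra_induct_carrier:
  fixes P :: "('m \<Rightarrow>\<^sub>0 'k::comm_ring_1) set"
  assumes M: "Group.monoid M"
    and "subalgebra (monoid_algebra M) P" and "\<And>x. x \<in> carrier M \<Longrightarrow> Poly_Mapping.single x 1 \<in> P"
  shows "carrier (monoid_algebra M) \<subseteq> P"
proof
  fix p :: "'m \<Rightarrow>\<^sub>0 'k"
  interpret A: kalgebra "monoid_algebra M :: ('k, 'm \<Rightarrow>\<^sub>0 'k) module" by (rule kalgebra_monoid_algebra[OF M])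
  assume "p \<in> carrier (monoid_algebra M)"
  then have "Poly_Mapping.keys p \<subseteq> carrier M" by (simp add: monoid_algebra_simps)
  then show "p \<in> P"
  proof (induction p rule: keys_induct_in)
    case zero
    have "0 \<odot>\<^bsub>monoid_algebra M\<^esub> \<one>\<^bsub>monoid_algebra M\<^esub> \<in> P"
      using assms(2) unfolding subalgebra_def by blast
    then show ?case by (simp only: A.zero_smult A.one_closed) (simp add: monoid_algebra_simps)
  next
    case (add x c q)
    have "c \<odot>\<^bsub>monoid_algebra M\<^esub> Poly_Mapping.single x 1 \<in> P"
      using assms add by (auto simp: subalgebra_def)
    then have "c \<odot>\<^bsub>monoid_algebra M\<^esub> Poly_Mapping.single x 1 \<oplus>\<^bsub>monoid_algebra M\<^esub> q \<in> P"
      using assms(2) add by (auto simp: subalgebra_def)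
    then show ?case by (simp add: monoid_algebra_smult_single monoid_algebra_simps(4))
  qed
qed

lemma free_algebra_generates:
  "generates (free_algebra G :: ('k::comm_ring_1, _) module) ((\<lambda>x. Poly_Mapping.single [x] 1) ` G)"
proof -
  let ?F = "free_algebra G :: ('k, _) module"
  have "carrier ?F \<subseteq> P" if P: "subalgebra ?F P" "(\<lambda>x. Poly_Mapping.single [x] 1) ` G \<subseteq> P" for P
  proof (rule monoid_algebra_induct_carrier[OF monoid_free_monoid P(1)])
    fix w assume "w \<in> carrier (free_monoid G)"
    then have "w \<in> lists G" by (simp add: free_monoid_def)
    then show "Poly_Mapping.single w 1 \<in> P"
    proof (induction w)
      case Nil
      then show ?case using P by (simp add: subalgebra_def monoid_algebra_simps free_monoid_def)
    next
      case (Cons x w)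
      then have "Poly_Mapping.single [x] 1 \<otimes>\<^bsub>?F\<^esub> Poly_Mapping.single w 1 \<in> P"
        using P by (auto simp: subalgebra_def)
      then show ?case by (simp add: monoid_algebra_mult_single free_monoid_def)
    qed
  qed
  then show ?thesis by (auto simp: generates_def monoid_algebra_simps free_monoid_def)
qed

lemma free_algebra_lift:
  fixes B :: "('k::comm_ring_1, 'b) module"
  assumes "kalgebra B" and "\<And>x. x \<in> G \<Longrightarrow> f x \<in> carrier B"
  shows "\<exists>h. kalgebra_hom (free_algebra G) B h \<and> (\<forall>x\<in>G. h (Poly_Mapping.single [x] 1) = f x)"
proof -
  interpret B: kalgebra B by fact
  define ev where "ev w = foldr (\<lambda>x y. f x \<otimes>\<^bsub>B\<^esub> y) w \<one>\<^bsub>B\<^esub>" for w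
  have ev: "ev w \<in> carrier B" if "w \<in> lists G" for w
    using that unfolding ev_def by (induction w) (auto simp: assms)
  have app: "ev (v @ w) = ev v \<otimes>\<^bsub>B\<^esub> ev w" if "v \<in> lists G" "w \<in> lists G" for v w
    using that(1) ev[OF that(2)] ev
    by (induction v) (auto simp: ev_def B.m_assoc assms)
  have "\<exists>h. kalgebra_hom (free_algebra G) B h \<and>
    (\<forall>x\<in>carrier (free_monoid G). \<forall>c. h (Poly_Mapping.single x c) = c \<odot>\<^bsub>B\<^esub> ev x)"
    by (rule monoid_algebra_lift[OF monoid_free_monoid \<open>kalgebra B\<close>])
      (auto simp: free_monoid_def ev app, simp add: ev_def)
  then show ?thesis
    by (rule ex_forward) (auto simp: free_monoid_def ev_def assms)
qed


section \<open>Tensor products\<close>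

text \<open>Relators are written with the subtraction of finitely supported functions, ideals and
  cosets with that of the record; this identifies the two.\<close>

lemma monoid_algebra_minus:
  fixes p q :: "'m \<Rightarrow>\<^sub>0 'k::comm_ring_1"
  assumes "Group.monoid M" "q \<in> carrier (monoid_algebra M)"
  shows "p \<ominus>\<^bsub>monoid_algebra M\<^esub> q = p - q"
proof -
  interpret A: kalgebra "monoid_algebra M :: ('k, 'm \<Rightarrow>\<^sub>0 'k) module"
    by (rule kalgebra_monoid_algebra[OF assms(1)])
  have "- q \<in> carrier (monoid_algebra M)" using assms(2) by (simp add: monoid_algebra_simps in_keys_iff subset_iff)
  then have "\<ominus>\<^bsub>monoid_algebra M\<^esub> q = - q"
    using assms(2) by (intro A.minus_equality) (simp_all add: monoid_algebra_simps)
  then show ?thesis by (simp add: A.minus_eq monoid_algebra_simps)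
qed

locale tensor_factors =
  fixes I :: "'i set" and A :: "'i \<Rightarrow> ('k::comm_ring_1, 'a) module"
  assumes kalgebra_factor: "i \<in> I \<Longrightarrow> kalgebra (A i)"
begin

abbreviation "MA \<equiv> monoid_algebra (product_group I A) :: ('k, ('i \<Rightarrow> 'a) \<Rightarrow>\<^sub>0 'k) module"

lemma monoid_product: "Group.monoid (product_group I A)"
proof (rule monoidI)
  note k = kalgebra_factor
  have m: "Group.monoid (A i)" if "i \<in> I" for i
    using k[OF that] unfolding kalgebra_def ring_def by auto
  show "x \<otimes>\<^bsub>product_group I A\<^esub> y \<in> carrier (product_group I A)"
    if "x \<in> carrier (product_group I A)" "y \<in> carrier (product_group I A)" for x y
    using that m by (auto simp: PiE_iff monoid.m_closed)
  show "x \<otimes>\<^bsub>product_group I A\<^esub> y \<otimes>\<^bsub>product_group I A\<^esub> z = x \<otimes>\<^bsub>product_group I A\<^esub> (y \<otimes>\<^bsub>product_group I A\<^esub> z)"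
    if "x \<in> carrier (product_group I A)" "y \<in> carrier (product_group I A)" "z \<in> carrier (product_group I A)" for x y z
    using that m by (auto simp: PiE_iff monoid.m_assoc intro!: restrict_ext)
  show "\<one>\<^bsub>product_group I A\<^esub> \<in> carrier (product_group I A)"
    using m by (auto simp: monoid.one_closed)
  show "\<one>\<^bsub>product_group I A\<^esub> \<otimes>\<^bsub>product_group I A\<^esub> x = x" "x \<otimes>\<^bsub>product_group I A\<^esub> \<one>\<^bsub>product_group I A\<^esub> = x"
    if "x \<in> carrier (product_group I A)" for x
    using that m by (auto simp: PiE_iff monoid.l_one monoid.r_one extensional_def restrict_def fun_eq_iff)
qed

sublocale MA: kalgebra MA
  by (rule kalgebra_monoid_algebra[OF monoid_product])

lemma upd_in: "\<lbrakk>x \<in> (\<Pi>\<^sub>E i\<in>I. carrier (A i)); i \<in> I; a \<in> carrier (A i)\<rbrakk> \<Longrightarrow> x(i := a) \<in> (\<Pi>\<^sub>E i\<in>I. carrier (A i))"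
  by (auto simp: PiE_iff extensional_def)

lemma single_in: "x \<in> (\<Pi>\<^sub>E i\<in>I. carrier (A i)) \<Longrightarrow> Poly_Mapping.single x c \<in> carrier MA"
  by (simp add: monoid_algebra_simps)

lemma diff_in: "\<lbrakk>p \<in> carrier MA; q \<in> carrier MA\<rbrakk> \<Longrightarrow> p - q \<in> carrier MA"
  by (metis MA.minus_closed monoid_algebra_minus monoid_product)

lemma add_in: "\<lbrakk>p \<in> carrier MA; q \<in> carrier MA\<rbrakk> \<Longrightarrow> p + q \<in> carrier MA"
  by (metis MA.a_closed monoid_algebra_simps(4))

lemma relators_subset: "multilinear_relators I A \<subseteq> carrier MA"
proof -
  have 1: "a \<oplus>\<^bsub>A i\<^esub> b \<in> carrier (A i)" "c \<odot>\<^bsub>A i\<^esub> a \<in> carrier (A i)"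
    if "i \<in> I" "a \<in> carrier (A i)" "b \<in> carrier (A i)" for i a b c
  proof -
    interpret kalgebra "A i" by (rule kalgebra_factor[OF that(1)])
    show "a \<oplus>\<^bsub>A i\<^esub> b \<in> carrier (A i)" "c \<odot>\<^bsub>A i\<^esub> a \<in> carrier (A i)" using that by auto
  qed
  show ?thesis
    unfolding multilinear_relators_def
    by (auto intro!: diff_in add_in single_in upd_in 1)
qed

abbreviation "TA \<equiv> tensor_algebra I A"

sublocale TA: kalgebra TA
  unfolding tensor_algebra_def by (rule MA.kalgebra_alg_quot[OF relators_subset])

definition pure :: "('i \<Rightarrow> 'a) \<Rightarrow> (('i \<Rightarrow> 'a) \<Rightarrow>\<^sub>0 'k) set"
  where "pure x = alg_quot_proj MA (multilinear_relators I A) (Poly_Mapping.single x 1)"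

sublocale proj: kalgebra_hom MA TA "alg_quot_proj MA (multilinear_relators I A)"
  unfolding tensor_algebra_def by (rule MA.kalgebra_hom_alg_quot_proj[OF relators_subset])

lemma pure_closed: "x \<in> (\<Pi>\<^sub>E i\<in>I. carrier (A i)) \<Longrightarrow> pure x \<in> carrier TA"
  unfolding pure_def by (intro proj.hom_closed single_in)

lemma pure_one: "pure (\<lambda>i\<in>I. \<one>\<^bsub>A i\<^esub>) = \<one>\<^bsub>TA\<^esub>"
  using proj.hom_one unfolding pure_def by (simp add: monoid_algebra_simps)

lemma pure_mult:
  "\<lbrakk>x \<in> (\<Pi>\<^sub>E i\<in>I. carrier (A i)); y \<in> (\<Pi>\<^sub>E i\<in>I. carrier (A i))\<rbrakk> \<Longrightarrow>
    pure x \<otimes>\<^bsub>TA\<^esub> pure y = pure (\<lambda>i\<in>I. x i \<otimes>\<^bsub>A i\<^esub> y i)"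
  unfolding pure_def by (simp flip: proj.hom_mult add: single_in monoid_algebra_mult_single)

lemma relator_zero:
  assumes "p \<in> carrier MA" "q \<in> carrier MA" "p - q \<in> multilinear_relators I A"
  shows "alg_quot_proj MA (multilinear_relators I A) p = alg_quot_proj MA (multilinear_relators I A) q"
  using assms MA.genideal_self[OF relators_subset]
  by (subst MA.alg_quot_proj_eq_iff[OF relators_subset]) (auto simp: monoid_algebra_minus[OF monoid_product])

lemma pure_add:
  assumes "x \<in> (\<Pi>\<^sub>E i\<in>I. carrier (A i))" "i \<in> I" "a \<in> carrier (A i)" "b \<in> carrier (A i)"
  shows "pure (x(i := a \<oplus>\<^bsub>A i\<^esub> b)) = pure (x(i := a)) \<oplus>\<^bsub>TA\<^esub> pure (x(i := b))"
proof -
  interpret k: kalgebra "A i" by (rule kalgebra_factor[OF assms(2)])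
  let ?s = "\<lambda>a. Poly_Mapping.single (x(i := a)) (1::'k)"
  have in_MA: "?s c \<in> carrier MA" if "c \<in> carrier (A i)" for c
    using assms that by (intro single_in upd_in)
  have "?s (a \<oplus>\<^bsub>A i\<^esub> b) - (?s a + ?s b) \<in> multilinear_relators I A"
    unfolding multilinear_relators_def using assms by blast
  then have "pure (x(i := a \<oplus>\<^bsub>A i\<^esub> b)) = alg_quot_proj MA (multilinear_relators I A) (?s a + ?s b)"
    unfolding pure_def using assms by (intro relator_zero in_MA add_in) auto
  also have "\<dots> = pure (x(i := a)) \<oplus>\<^bsub>TA\<^esub> pure (x(i := b))"
    unfolding pure_def using in_MA assms by (simp flip: proj.hom_add add: monoid_algebra_simps)
  finally show ?thesis .
qed

lemma pure_smult:
  assumes "x \<in> (\<Pi>\<^sub>E i\<in>I. carrier (A i))" "i \<in> I" "a \<in> carrier (A i)"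
  shows "pure (x(i := c \<odot>\<^bsub>A i\<^esub> a)) = c \<odot>\<^bsub>TA\<^esub> pure (x(i := a))"
proof -
  interpret k: kalgebra "A i" by (rule kalgebra_factor[OF assms(2)])
  have in_MA: "Poly_Mapping.single (x(i := a)) b \<in> carrier MA" if "a \<in> carrier (A i)" for a b
    using assms that by (intro single_in upd_in)
  have "Poly_Mapping.single (x(i := c \<odot>\<^bsub>A i\<^esub> a)) 1 - Poly_Mapping.single (x(i := a)) c \<in> multilinear_relators I A"
    unfolding multilinear_relators_def using assms by blast
  then have "pure (x(i := c \<odot>\<^bsub>A i\<^esub> a)) = alg_quot_proj MA (multilinear_relators I A) (Poly_Mapping.single (x(i := a)) c)"
    unfolding pure_def using assms by (intro relator_zero in_MA) auto
  also have "\<dots> = c \<odot>\<^bsub>TA\<^esub> pure (x(i := a))"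
    unfolding pure_def using in_MA assms by (simp flip: proj.hom_smult add: monoid_algebra_smult_single)
  finally show ?thesis .
qed

lemma one_in: "(\<lambda>i\<in>I. \<one>\<^bsub>A i\<^esub>) \<in> (\<Pi>\<^sub>E i\<in>I. carrier (A i))"
  using monoid.one_closed[OF monoid_product] by simp

text \<open>The map x to 1 \<otimes> ... \<otimes> x \<otimes> ... \<otimes> 1 from the factor
  \<open>i\<close>. The name does not assert injectivity.\<close>

definition inj :: "'i \<Rightarrow> 'a \<Rightarrow> (('i \<Rightarrow> 'a) \<Rightarrow>\<^sub>0 'k) set"
  where "inj i x = pure ((\<lambda>j\<in>I. \<one>\<^bsub>A j\<^esub>)(i := x))"

lemma kalgebra_hom_inj:
  assumes i: "i \<in> I"
  shows "kalgebra_hom (A i) TA (inj i)"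
proof -
  interpret k: kalgebra "A i" by (rule kalgebra_factor[OF i])
  have one: "\<one>\<^bsub>A j\<^esub> \<otimes>\<^bsub>A j\<^esub> \<one>\<^bsub>A j\<^esub> = \<one>\<^bsub>A j\<^esub>" if "j \<in> I" for j
    using kalgebra_factor[OF that] by (simp add: kalgebra_def ring_def monoid.l_one monoid.one_closed)
  have mult: "(\<lambda>j\<in>I. ((\<lambda>j\<in>I. \<one>\<^bsub>A j\<^esub>)(i := x)) j \<otimes>\<^bsub>A j\<^esub> ((\<lambda>j\<in>I. \<one>\<^bsub>A j\<^esub>)(i := y)) j)
      = (\<lambda>j\<in>I. \<one>\<^bsub>A j\<^esub>)(i := x \<otimes>\<^bsub>A i\<^esub> y)" for x y
    using i one by (auto simp: fun_eq_iff)
  have "(\<lambda>j\<in>I. \<one>\<^bsub>A j\<^esub>)(i := \<one>\<^bsub>A i\<^esub>) = (\<lambda>j\<in>I. \<one>\<^bsub>A j\<^esub>)" using i by (auto simp: fun_eq_iff)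
  then have one': "inj i \<one>\<^bsub>A i\<^esub> = \<one>\<^bsub>TA\<^esub>" unfolding inj_def by (simp only: pure_one)
  show ?thesis
  proof unfold_locales
    fix x y c assume x: "x \<in> carrier (A i)"
    show "inj i x \<in> carrier TA" unfolding inj_def by (intro pure_closed upd_in one_in i x)
    show "inj i (c \<odot>\<^bsub>A i\<^esub> x) = c \<odot>\<^bsub>TA\<^esub> inj i x"
      unfolding inj_def by (intro pure_smult one_in i x)
    assume y: "y \<in> carrier (A i)"
    show "inj i (x \<oplus>\<^bsub>A i\<^esub> y) = inj i x \<oplus>\<^bsub>TA\<^esub> inj i y"
      unfolding inj_def by (intro pure_add one_in i x y)
    show "inj i (x \<otimes>\<^bsub>A i\<^esub> y) = inj i x \<otimes>\<^bsub>TA\<^esub> inj i y"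
      unfolding inj_def
      by (subst pure_mult) (intro upd_in one_in i x y refl arg_cong[where f = pure] mult[symmetric])+
  qed (rule one')
qed

lemma inj_commute:
  assumes "i \<in> I" "j \<in> I" "i \<noteq> j" "x \<in> carrier (A i)" "y \<in> carrier (A j)"
  shows "inj i x \<otimes>\<^bsub>TA\<^esub> inj j y = inj j y \<otimes>\<^bsub>TA\<^esub> inj i x"
proof -
  have "Group.monoid (A l)" if "l \<in> I" for l
    using kalgebra_factor[OF that] by (simp add: kalgebra_def ring_def)
  then have "(\<lambda>l\<in>I. ((\<lambda>l\<in>I. \<one>\<^bsub>A l\<^esub>)(i := x)) l \<otimes>\<^bsub>A l\<^esub> ((\<lambda>l\<in>I. \<one>\<^bsub>A l\<^esub>)(j := y)) l)
    = (\<lambda>l\<in>I. ((\<lambda>l\<in>I. \<one>\<^bsub>A l\<^esub>)(j := y)) l \<otimes>\<^bsub>A l\<^esub> ((\<lambda>l\<in>I. \<one>\<^bsub>A l\<^esub>)(i := x)) l)"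
    using assms by (intro restrict_ext) (auto simp: monoid.l_one monoid.r_one)
  then show ?thesis
    unfolding inj_def by (simp only: pure_mult upd_in one_in assms)
qed

text \<open>A pure tensor is the product of the images of its entries. The induction replaces unit
  entries by \<open>x j\<close> one index at a time, which is where finiteness of \<open>I\<close>
  enters.\<close>

lemma tensor_generates:
  assumes "finite I"
  shows "generates TA (\<Union>i\<in>I. inj i ` carrier (A i))"
proof -
  have m: "Group.monoid (A l)" if "l \<in> I" for l
    using kalgebra_factor[OF that] by (simp add: kalgebra_def ring_def)
  have "carrier TA \<subseteq> P" if P: "subalgebra TA P" "(\<Union>i\<in>I. inj i ` carrier (A i)) \<subseteq> P" for P
  proof -
    have P_mult: "a \<otimes>\<^bsub>TA\<^esub> b \<in> P" if "a \<in> P" "b \<in> P" for a b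
      using P(1) that unfolding subalgebra_def by blast
    have pure_P: "pure x \<in> P" if x: "x \<in> (\<Pi>\<^sub>E i\<in>I. carrier (A i))" for x
    proof -
      have "pure (\<lambda>j\<in>I. if j \<in> S then x j else \<one>\<^bsub>A j\<^esub>) \<in> P" if "finite S" "S \<subseteq> I" for S
        using that
      proof (induction S rule: finite_induct)
        case empty
        have "(\<lambda>j\<in>I. if j \<in> {} then x j else \<one>\<^bsub>A j\<^esub>) = (\<lambda>j\<in>I. \<one>\<^bsub>A j\<^esub>)" by simp
        then show ?case using P(1) unfolding subalgebra_def by (simp only: pure_one)
      next
        case (insert i S)
        have xi: "x i \<in> carrier (A i)" using x insert.prems by (simp add: PiE_iff)
        have "(\<lambda>j\<in>I. if j \<in> S then x j else \<one>\<^bsub>A j\<^esub>) \<in> (\<Pi>\<^sub>E i\<in>I. carrier (A i))"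
          using x m by (auto simp: monoid.one_closed)
        note p = pure_mult[OF this upd_in[OF one_in _ xi]]
        have "(\<lambda>l\<in>I. (\<lambda>j\<in>I. if j \<in> S then x j else \<one>\<^bsub>A j\<^esub>) l \<otimes>\<^bsub>A l\<^esub> ((\<lambda>j\<in>I. \<one>\<^bsub>A j\<^esub>)(i := x i)) l)
            = (\<lambda>j\<in>I. if j \<in> insert i S then x j else \<one>\<^bsub>A j\<^esub>)"
        proof (rule restrict_ext)
          fix l assume "l \<in> I"
          moreover have "x l \<in> carrier (A l)" using x \<open>l \<in> I\<close> by (simp add: PiE_iff)
          ultimately show "(\<lambda>j\<in>I. if j \<in> S then x j else \<one>\<^bsub>A j\<^esub>) l \<otimes>\<^bsub>A l\<^esub> ((\<lambda>j\<in>I. \<one>\<^bsub>A j\<^esub>)(i := x i)) l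
              = (if l \<in> insert i S then x l else \<one>\<^bsub>A l\<^esub>)"
            using m[OF \<open>l \<in> I\<close>] insert.hyps
            by (cases "l = i") (simp_all add: monoid.l_one monoid.r_one monoid.one_closed)
        qed
        then have "pure (\<lambda>j\<in>I. if j \<in> S then x j else \<one>\<^bsub>A j\<^esub>) \<otimes>\<^bsub>TA\<^esub> inj i (x i)
            = pure (\<lambda>j\<in>I. if j \<in> insert i S then x j else \<one>\<^bsub>A j\<^esub>)"
          using insert.prems unfolding inj_def by (subst p) (simp_all only: insert_subset)
        moreover have "inj i (x i) \<in> P" by (intro subsetD[OF P(2)] UN_I[of i] imageI xi) (use insert.prems in simp)
        moreover have "pure (\<lambda>j\<in>I. if j \<in> S then x j else \<one>\<^bsub>A j\<^esub>) \<in> P" by (rule insert.IH) (use insert.prems in simp)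
        ultimately have "pure (\<lambda>j\<in>I. if j \<in> insert i S then x j else \<one>\<^bsub>A j\<^esub>) \<in> P"
          using P_mult[of "pure (\<lambda>j\<in>I. if j \<in> S then x j else \<one>\<^bsub>A j\<^esub>)" "inj i (x i)"]
          by (simp only:)
        then show ?case .
      qed
      note this[OF assms subset_refl]
      moreover have "(\<lambda>j\<in>I. if j \<in> I then x j else \<one>\<^bsub>A j\<^esub>) = x"
        by (rule ext) (use x in \<open>simp add: PiE_iff extensional_def restrict_def\<close>)
      ultimately show ?thesis by simp
    qed
    have "subalgebra MA {p \<in> carrier MA. alg_quot_proj MA (multilinear_relators I A) p \<in> P}"
      using P(1) by (rule subalgebra_vimage[OF proj.kalgebra_hom_axioms])
    then have "carrier MA \<subseteq> {p \<in> carrier MA. alg_quot_proj MA (multilinear_relators I A) p \<in> P}"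
      by (rule monoid_algebra_induct_carrier[OF monoid_product])
        (use pure_P single_in in \<open>simp add: pure_def\<close>)
    then have "alg_quot_proj MA (multilinear_relators I A) ` carrier MA \<subseteq> P" by blast
    then show ?thesis
      using MA.alg_quot_carrier[OF relators_subset] unfolding tensor_algebra_def by (simp only:)
  qed
  moreover have "(\<Union>i\<in>I. inj i ` carrier (A i)) \<subseteq> carrier TA"
    by (intro UN_least image_subsetI kalgebra_hom.hom_closed[OF kalgebra_hom_inj])
  ultimately show ?thesis unfolding generates_def by simp
qed

end

lemma multilinear_relators_cases [consumes 1, case_names add smult]:
  assumes "s \<in> multilinear_relators I A"
  obtains x i a b where "x \<in> (\<Pi>\<^sub>E i\<in>I. carrier (A i))" "i \<in> I" "a \<in> carrier (A i)" "b \<in> carrier (A i)"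
      "s = Poly_Mapping.single (x(i := a \<oplus>\<^bsub>A i\<^esub> b)) 1
        - (Poly_Mapping.single (x(i := a)) 1 + Poly_Mapping.single (x(i := b)) 1)"
  | x i a c where "x \<in> (\<Pi>\<^sub>E i\<in>I. carrier (A i))" "i \<in> I" "a \<in> carrier (A i)"
      "s = Poly_Mapping.single (x(i := c \<odot>\<^bsub>A i\<^esub> a)) 1 - Poly_Mapping.single (x(i := a)) c"
  using assms unfolding multilinear_relators_def by blast

text \<open>The value on a pure tensor is the ordered product of the \<open>f i (x i)\<close>;
  natural numbers as indices supply the order. Since the images of different factors commute, this
  product is multiplicative, and it is linear in each entry, so it kills the multilinearity
  relators.\<close>

lemma tensor_algebra_lift:
  fixes A :: "nat \<Rightarrow> ('k::comm_ring_1, 'a) module"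
  assumes "tensor_factors {..<N} A" and "kalgebra B"
    and hom: "\<And>i. i < N \<Longrightarrow> kalgebra_hom (A i) B (f i)"
    and comm: "\<And>i j x y. \<lbrakk>i < N; j < N; i \<noteq> j; x \<in> carrier (A i); y \<in> carrier (A j)\<rbrakk>
      \<Longrightarrow> f i x \<otimes>\<^bsub>B\<^esub> f j y = f j y \<otimes>\<^bsub>B\<^esub> f i x"
  shows "\<exists>h. kalgebra_hom (tensor_algebra {..<N} A) B h \<and>
    (\<forall>i<N. \<forall>x\<in>carrier (A i). h (tensor_factors.inj {..<N} A i x) = f i x)"
proof -
  interpret T: tensor_factors "{..<N}" A by fact
  interpret B: kalgebra B by fact
  define pr where "pr k x = rec_nat \<one>\<^bsub>B\<^esub> (\<lambda>k p. p \<otimes>\<^bsub>B\<^esub> f k (x k)) k" for k x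
  have pr_simps: "pr 0 x = \<one>\<^bsub>B\<^esub>" "pr (Suc k) x = pr k x \<otimes>\<^bsub>B\<^esub> f k (x k)" for k x
    by (simp_all add: pr_def)
  let ?X = "\<Pi>\<^sub>E i\<in>{..<N}. carrier (A i)"
  have f_closed: "f i x \<in> carrier B" if "i < N" "x \<in> carrier (A i)" for i x
    using kalgebra_hom.hom_closed[OF hom] that by blast
  have X: "x i \<in> carrier (A i)" if "x \<in> ?X" "i < N" for x i using that by auto
  have closed: "pr k x \<in> carrier B" if "x \<in> ?X" "k \<le> N" for k x
    using that(2) by (induction k) (auto simp: pr_simps f_closed X that(1))
  \<comment> \<open>Multiplicativity needs one kind of move only: the next factor of
    \<open>x\<close> across the partial product of \<open>y\<close>.\<close>
  have pr_comm: "pr k x \<otimes>\<^bsub>B\<^esub> f j z = f j z \<otimes>\<^bsub>B\<^esub> pr k x"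
    if "x \<in> ?X" "k \<le> j" "j < N" "z \<in> carrier (A j)" for k x j z
    using that(2)
  proof (induction k)
    case 0 then show ?case using that by (simp add: pr_simps f_closed)
  next
    case (Suc k)
    have "pr k x \<otimes>\<^bsub>B\<^esub> f k (x k) \<otimes>\<^bsub>B\<^esub> f j z = pr k x \<otimes>\<^bsub>B\<^esub> (f j z \<otimes>\<^bsub>B\<^esub> f k (x k))"
      using Suc.prems that comm[of k j "x k" z] closed[OF that(1), of k]
      by (simp add: B.m_assoc f_closed X)
    also have "\<dots> = (f j z \<otimes>\<^bsub>B\<^esub> pr k x) \<otimes>\<^bsub>B\<^esub> f k (x k)"
      using Suc that closed[OF that(1), of k] by (simp add: B.m_assoc[symmetric] f_closed X)
    finally show ?case using Suc.prems that closed[OF that(1), of k]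
      by (simp add: B.m_assoc f_closed X pr_simps)
  qed
  have pr_mult: "pr k (\<lambda>i\<in>{..<N}. x i \<otimes>\<^bsub>A i\<^esub> y i) = pr k x \<otimes>\<^bsub>B\<^esub> pr k y"
    if xy: "x \<in> ?X" "y \<in> ?X" and "k \<le> N" for k x y
    using that(3)
  proof (induction k)
    case 0 show ?case by (simp add: pr_simps)
  next
    case (Suc k)
    interpret f: kalgebra_hom "A k" B "f k" by (rule hom) (use Suc.prems in simp)
    note cl = closed[OF xy(1), of k] closed[OF xy(2), of k]
    have IH: "pr k (\<lambda>i\<in>{..<N}. x i \<otimes>\<^bsub>A i\<^esub> y i) = pr k x \<otimes>\<^bsub>B\<^esub> pr k y"
      by (rule Suc.IH) (use Suc in simp)
    have "pr (Suc k) (\<lambda>i\<in>{..<N}. x i \<otimes>\<^bsub>A i\<^esub> y i) = (pr k x \<otimes>\<^bsub>B\<^esub> pr k y) \<otimes>\<^bsub>B\<^esub> (f k (x k) \<otimes>\<^bsub>B\<^esub> f k (y k))"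
      using Suc.prems xy by (simp add: IH pr_simps f.hom_mult X)
    also have "\<dots> = pr k x \<otimes>\<^bsub>B\<^esub> (pr k y \<otimes>\<^bsub>B\<^esub> f k (x k)) \<otimes>\<^bsub>B\<^esub> f k (y k)"
      using Suc xy cl by (simp add: B.m_assoc X)
    also have "\<dots> = pr k x \<otimes>\<^bsub>B\<^esub> (f k (x k) \<otimes>\<^bsub>B\<^esub> pr k y) \<otimes>\<^bsub>B\<^esub> f k (y k)"
      using Suc xy pr_comm[of y k k "x k"] by (simp add: X)
    finally show ?case using Suc xy cl by (simp add: pr_simps B.m_assoc X)
  qed
  \<comment> \<open>An entry at or beyond \<open>k\<close> does not enter the partial product; in
    the linearity claims this isolates the one factor that changes.\<close>
  have pr_upd: "pr k (x(i := v)) = pr k x" if "k \<le> i" for k i x v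
    using that by (induction k) (auto simp: pr_simps)
  have pr_add: "pr k (x(i := a \<oplus>\<^bsub>A i\<^esub> b)) = pr k (x(i := a)) \<oplus>\<^bsub>B\<^esub> pr k (x(i := b))"
    if x: "x \<in> ?X" "i < k" and ab: "a \<in> carrier (A i)" "b \<in> carrier (A i)" and "k \<le> N" for k i x a b
    using that(2,5)
  proof (induction k)
    case (Suc k)
    interpret f: kalgebra_hom "A k" B "f k" by (rule hom) (use Suc.prems in simp)
    have "pr (Suc k) (x(i := a \<oplus>\<^bsub>A i\<^esub> b)) = pr (Suc k) (x(i := a)) \<oplus>\<^bsub>B\<^esub> pr (Suc k) (x(i := b))"
    proof (cases "i = k")
      case True
      then show ?thesis using ab x Suc.prems closed[OF x(1), of k]
        by (simp add: pr_simps pr_upd f.hom_add B.r_distr)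
    next
      case False
      then have i: "i < k" "i < N" "k \<le> N" using Suc.prems False by linarith+
      have IH: "pr k (x(i := a \<oplus>\<^bsub>A i\<^esub> b)) = pr k (x(i := a)) \<oplus>\<^bsub>B\<^esub> pr k (x(i := b))"
        by (rule Suc.IH[OF i(1,3)])
      show ?thesis using i IH Suc.prems x ab closed[OF T.upd_in[OF x(1), of i a], of k] closed[OF T.upd_in[OF x(1), of i b], of k]
        by (simp add: pr_simps B.l_distr X)
    qed
    then show ?case .
  qed simp
  have pr_smult: "pr k (x(i := c \<odot>\<^bsub>A i\<^esub> a)) = c \<odot>\<^bsub>B\<^esub> pr k (x(i := a))"
    if x: "x \<in> ?X" "i < k" and a: "a \<in> carrier (A i)" and "k \<le> N" for k i x a c
    using that(2,4)
  proof (induction k)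
    case (Suc k)
    interpret f: kalgebra_hom "A k" B "f k" by (rule hom) (use Suc.prems in simp)
    have "pr (Suc k) (x(i := c \<odot>\<^bsub>A i\<^esub> a)) = c \<odot>\<^bsub>B\<^esub> pr (Suc k) (x(i := a))"
    proof (cases "i = k")
      case True
      then show ?thesis using a x Suc.prems closed[OF x(1), of k]
        by (simp add: pr_simps pr_upd f.hom_smult B.smult_mult_right)
    next
      case False
      then have i: "i < k" "i < N" "k \<le> N" using Suc.prems False by linarith+
      have IH: "pr k (x(i := c \<odot>\<^bsub>A i\<^esub> a)) = c \<odot>\<^bsub>B\<^esub> pr k (x(i := a))"
        by (rule Suc.IH[OF i(1,3)])
      show ?thesis using i IH Suc.prems x a closed[OF T.upd_in[OF x(1), of i a], of k]
        by (simp add: pr_simps B.smult_mult_left X)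
    qed
    then show ?case .
  qed simp
  have f_one: "f i \<one>\<^bsub>A i\<^esub> = \<one>\<^bsub>B\<^esub>" if "i < N" for i
    using hom[OF that] by (rule kalgebra_hom.hom_one)
  have pr_one: "pr k (\<lambda>i\<in>{..<N}. \<one>\<^bsub>A i\<^esub>) = \<one>\<^bsub>B\<^esub>" if "k \<le> N" for k
    using that by (induction k) (auto simp: pr_simps f_one)
  have "\<exists>g. kalgebra_hom T.MA B g \<and>
    (\<forall>x\<in>carrier (product_group {..<N} A). \<forall>c. g (Poly_Mapping.single x c) = c \<odot>\<^bsub>B\<^esub> pr N x)"
    by (rule monoid_algebra_lift[OF T.monoid_product \<open>kalgebra B\<close>])
      (auto simp: closed pr_mult pr_one)
  then obtain g where "kalgebra_hom T.MA B g" and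
    "\<forall>x\<in>carrier (product_group {..<N} A). \<forall>c. g (Poly_Mapping.single x c) = c \<odot>\<^bsub>B\<^esub> pr N x"
    by (elim exE conjE)
  then have g: "g (Poly_Mapping.single x c) = c \<odot>\<^bsub>B\<^esub> pr N x" if "x \<in> ?X" for x c
    using that unfolding carrier_product_group by blast
  interpret g: kalgebra_hom T.MA B g by fact
  have g_minus: "g (p - q) = g p \<ominus>\<^bsub>B\<^esub> g q" if "p \<in> carrier T.MA" "q \<in> carrier T.MA" for p q
    using g.hom_minus[OF that] unfolding monoid_algebra_minus[OF T.monoid_product that(2)] .
  have g_plus: "g (p + q) = g p \<oplus>\<^bsub>B\<^esub> g q" if "p \<in> carrier T.MA" "q \<in> carrier T.MA" for p q
    using g.hom_add[OF that] unfolding monoid_algebra_simps(4) .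
  have g_relator: "g s = \<zero>\<^bsub>B\<^esub>" if "s \<in> multilinear_relators {..<N} A" for s
    using that
  proof (cases rule: multilinear_relators_cases)
    case (add x i a b)
    note x = add(1-4) and s = add(5)
    interpret k: kalgebra "A i" by (rule T.kalgebra_factor[OF x(2)])
    have u: "x(i := a \<oplus>\<^bsub>A i\<^esub> b) \<in> ?X" "x(i := a) \<in> ?X" "x(i := b) \<in> ?X"
      by (intro T.upd_in x k.a_closed k.smult_closed)+
    note in_MA = u[THEN T.single_in]
    have "i < N" using x by simp
    show ?thesis
      unfolding s g_minus[OF in_MA(1) T.add_in[OF in_MA(2,3)]] g_plus[OF in_MA(2,3)] u[THEN g]
        pr_add[OF x(1) \<open>i < N\<close> x(3,4) order_refl]
      by (simp only: B.minus_eq_zero_iff B.one_smult B.a_closed closed[OF u(2) order_refl] closed[OF u(3) order_refl])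
  next
    case (smult x i a c)
    note x = smult(1-3) and s = smult(4)
    interpret k: kalgebra "A i" by (rule T.kalgebra_factor[OF x(2)])
    have u: "x(i := c \<odot>\<^bsub>A i\<^esub> a) \<in> ?X" "x(i := a) \<in> ?X"
      by (intro T.upd_in x k.a_closed k.smult_closed)+
    note in_MA = u[THEN T.single_in]
    have "i < N" using x by simp
    show ?thesis
      unfolding s g_minus[OF in_MA(1,2)] u[THEN g] pr_smult[OF x(1) \<open>i < N\<close> x(3) order_refl]
      by (simp only: B.minus_eq_zero_iff B.one_smult B.smult_closed closed[OF u(2) order_refl])
  qed
  have "\<exists>h. kalgebra_hom T.TA B h \<and>
    (\<forall>x\<in>carrier T.MA. h (alg_quot_proj T.MA (multilinear_relators {..<N} A) x) = g x)"
    unfolding tensor_algebra_def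
    by (rule T.MA.alg_quot_lift[OF T.relators_subset \<open>kalgebra_hom T.MA B g\<close>]) (rule g_relator)
  then obtain h where h: "kalgebra_hom T.TA B h"
    "\<And>x. x \<in> carrier T.MA \<Longrightarrow> h (alg_quot_proj T.MA (multilinear_relators {..<N} A) x) = g x"
    by (elim exE conjE) (simp only: Ball_def)
  have pr_inj: "pr k ((\<lambda>j\<in>{..<N}. \<one>\<^bsub>A j\<^esub>)(i := x)) = (if i < k then f i x else \<one>\<^bsub>B\<^esub>)"
    if "i < N" "x \<in> carrier (A i)" "k \<le> N" for i x k
    using that(3)
  proof (induction k)
    case (Suc k)
    have IH: "pr k ((\<lambda>j\<in>{..<N}. \<one>\<^bsub>A j\<^esub>)(i := x)) = (if i < k then f i x else \<one>\<^bsub>B\<^esub>)"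
      by (rule Suc.IH) (use Suc.prems in simp)
    have "pr (Suc k) ((\<lambda>j\<in>{..<N}. \<one>\<^bsub>A j\<^esub>)(i := x)) = (if i < Suc k then f i x else \<one>\<^bsub>B\<^esub>)"
      using IH Suc.prems that f_closed[OF that(1,2)]
      by (cases "i = k") (simp_all add: pr_simps f_closed f_one less_Suc_eq)
    then show ?case .
  qed (simp add: pr_simps)
  have h_inj: "h (T.inj i x) = f i x" if "i < N" "x \<in> carrier (A i)" for i x
  proof -
    have u: "(\<lambda>j\<in>{..<N}. \<one>\<^bsub>A j\<^esub>)(i := x) \<in> ?X" using that by (intro T.upd_in T.one_in) simp
    show ?thesis
      unfolding T.inj_def T.pure_def h(2)[OF T.single_in[OF u]] g[OF u]
      using that by (simp only: pr_inj order_refl if_True B.one_smult f_closed)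
  qed
  show ?thesis
    by (intro exI[of _ h] conjI h(1) allI impI ballI h_inj)
qed


section \<open>Corners, matrices and the Peirce decomposition\<close>

text \<open>For an idempotent \<open>e\<close> this is eAe: the elements fixed by \<open>e\<close>
  from both sides are those of the form eye. The operations of \<open>A\<close> are kept; only the
  carrier and the unit change.\<close>

definition corner :: "('k, 'a) module \<Rightarrow> 'a \<Rightarrow> ('k, 'a) module"
  where "corner A e = A\<lparr>carrier := {x \<in> carrier A. e \<otimes>\<^bsub>A\<^esub> x = x \<and> x \<otimes>\<^bsub>A\<^esub> e = x}, one := e\<rparr>"

lemma corner_simps:
  "carrier (corner A e) = {x \<in> carrier A. e \<otimes>\<^bsub>A\<^esub> x = x \<and> x \<otimes>\<^bsub>A\<^esub> e = x}"
  "\<one>\<^bsub>corner A e\<^esub> = e" "\<zero>\<^bsub>corner A e\<^esub> = \<zero>\<^bsub>A\<^esub>" "x \<oplus>\<^bsub>corner A e\<^esub> y = x \<oplus>\<^bsub>A\<^esub> y"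
  "x \<otimes>\<^bsub>corner A e\<^esub> y = x \<otimes>\<^bsub>A\<^esub> y" "c \<odot>\<^bsub>corner A e\<^esub> x = c \<odot>\<^bsub>A\<^esub> x"
  by (simp_all add: corner_def)

context kalgebra
begin

lemma kalgebra_corner:
  assumes e: "e \<in> carrier A" "e \<otimes> e = e"
  shows "kalgebra (corner A e)"
proof -
  have mult: "e \<otimes> (x \<otimes> y) = x \<otimes> y" "(x \<otimes> y) \<otimes> e = x \<otimes> y"
    if "x \<in> carrier A" "e \<otimes> x = x" "y \<in> carrier A" "y \<otimes> e = y" for x y
    using that e by (metis m_assoc, metis m_assoc)
  have neg: "e \<otimes> (\<ominus> x) = \<ominus> x" "(\<ominus> x) \<otimes> e = \<ominus> x"
    if "x \<in> carrier A" "e \<otimes> x = x" "x \<otimes> e = x" for x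
    using that e by (simp_all add: r_minus l_minus)
  have "ring (corner A e)"
  proof (rule ringI)
    show "abelian_group (corner A e)"
    proof (rule abelian_groupI)
      fix x assume "x \<in> carrier (corner A e)"
      then show "\<exists>y\<in>carrier (corner A e). y \<oplus>\<^bsub>corner A e\<^esub> x = \<zero>\<^bsub>corner A e\<^esub>"
        by (intro bexI[of _ "\<ominus> x"]) (simp_all add: corner_simps l_neg neg)
    qed (simp_all add: corner_simps e a_ac l_distr r_distr)
    show "Group.monoid (corner A e)"
      by (rule monoidI) (simp_all add: corner_simps e mult m_assoc)
  qed (simp_all add: corner_simps e l_distr r_distr)
  then show ?thesis
    unfolding kalgebra_def kalgebra_axioms_def
    by (simp add: corner_simps e smult_r_distr smult_l_distr smult_smult smult_mult_left smult_mult_right)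
qed

text \<open>Matrix products over a corner are sums formed in the record of the corner. They have to
  be compared with sums in \<open>A\<close>, where the Peirce computations take place.\<close>

lemma finsum_corner:
  assumes e: "e \<in> carrier A" "e \<otimes> e = e"
    and "finite S" and "\<And>i. i \<in> S \<Longrightarrow> f i \<in> carrier (corner A e)"
  shows "finsum (corner A e) f S = finsum A f S"
proof -
  interpret C: kalgebra "corner A e" by (rule kalgebra_corner[OF e])
  have cl: "x \<in> carrier A" if "x \<in> carrier (corner A e)" for x using that by (simp add: corner_simps)
  show ?thesis
    using assms(3,4)
  proof (induction S rule: finite_induct)
    case empty
    show ?case by (simp add: corner_simps)
  next
    case (insert i S)
    have 1: "f \<in> S \<rightarrow> carrier (corner A e)" "f i \<in> carrier (corner A e)"
      using insert.prems by auto
    have 2: "f \<in> S \<rightarrow> carrier A" "f i \<in> carrier A"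
      using insert.prems[THEN cl] by auto
    show ?case
      using insert.IH[OF insert.prems] insert.hyps
      by (simp add: C.finsum_insert[OF insert.hyps 1] finsum_insert[OF insert.hyps 2] corner_simps)
  qed
qed

end

section \<open>Functoriality of matrix algebras and direct sums\<close>

lemma matrix_algebra_carrier:
  "M \<in> carrier (matrix_algebra r A) \<longleftrightarrow> M \<in> carrier_mat r r \<and> (\<forall>i<r. \<forall>j<r. M $$ (i, j) \<in> carrier A)"
  by (auto simp: matrix_algebra_def elements_mat_def UN_subset_iff image_subset_iff)

lemma matrix_algebra_ops:
  "M \<otimes>\<^bsub>matrix_algebra r A\<^esub> N = mat r r (\<lambda>(i, j). \<Oplus>\<^bsub>A\<^esub>l\<in>{..<r}. M $$ (i, l) \<otimes>\<^bsub>A\<^esub> N $$ (l, j))"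
  "\<one>\<^bsub>matrix_algebra r A\<^esub> = mat r r (\<lambda>(i, j). if i = j then \<one>\<^bsub>A\<^esub> else \<zero>\<^bsub>A\<^esub>)"
  "M \<oplus>\<^bsub>matrix_algebra r A\<^esub> N = mat r r (\<lambda>(i, j). M $$ (i, j) \<oplus>\<^bsub>A\<^esub> N $$ (i, j))"
  "c \<odot>\<^bsub>matrix_algebra r A\<^esub> M = mat r r (\<lambda>(i, j). c \<odot>\<^bsub>A\<^esub> M $$ (i, j))"
  by (simp_all add: matrix_algebra_def)

lemma alg_isomorphic_matrix_algebra:
  fixes h :: "'a \<Rightarrow> 'b"
  assumes "kalgebra_hom A B h" and bij: "bij_betw h (carrier A) (carrier B)"
  shows "alg_isomorphic (matrix_algebra r A) (matrix_algebra r B)"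
proof -
  interpret h: kalgebra_hom A B h by fact
  define H where "H M = mat r r (\<lambda>(i, j). h (M $$ (i, j)))" for M :: "'a mat"
  have H_index: "H M $$ (i, j) = h (M $$ (i, j))" if "i < r" "j < r" for M i j
    using that by (simp add: H_def)
  have H_dim: "H M \<in> carrier_mat r r" for M by (simp add: H_def)
  have H_closed: "H M \<in> carrier (matrix_algebra r B)" if "M \<in> carrier (matrix_algebra r A)" for M
    using that by (simp add: matrix_algebra_carrier H_dim H_index)
  have in_A: "M $$ (i, j) \<in> carrier A" if "M \<in> carrier (matrix_algebra r A)" "i < r" "j < r" for M i j
    using that by (simp add: matrix_algebra_carrier)
  have "H \<in> Ring.ring_hom (matrix_algebra r A) (matrix_algebra r B)"
  proof (rule ring_hom_memI)
    fix M N assume M: "M \<in> carrier (matrix_algebra r A)" and N: "N \<in> carrier (matrix_algebra r A)"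
    show "H (M \<oplus>\<^bsub>matrix_algebra r A\<^esub> N) = H M \<oplus>\<^bsub>matrix_algebra r B\<^esub> H N"
      by (rule eq_matI) (simp_all add: H_def matrix_algebra_ops in_A M N)
    show "H (M \<otimes>\<^bsub>matrix_algebra r A\<^esub> N) = H M \<otimes>\<^bsub>matrix_algebra r B\<^esub> H N"
    proof (rule eq_matI)
      fix i j assume "i < dim_row (H M \<otimes>\<^bsub>matrix_algebra r B\<^esub> H N)"
        "j < dim_col (H M \<otimes>\<^bsub>matrix_algebra r B\<^esub> H N)"
      then have ij: "i < r" "j < r" by (simp_all add: matrix_algebra_ops)
      have "h (\<Oplus>\<^bsub>A\<^esub>l\<in>{..<r}. M $$ (i, l) \<otimes>\<^bsub>A\<^esub> N $$ (l, j))
          = (\<Oplus>\<^bsub>B\<^esub>l\<in>{..<r}. h (M $$ (i, l) \<otimes>\<^bsub>A\<^esub> N $$ (l, j)))"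
        by (rule h.hom_finsum) (simp add: in_A M N ij)
      also have "\<dots> = (\<Oplus>\<^bsub>B\<^esub>l\<in>{..<r}. H M $$ (i, l) \<otimes>\<^bsub>B\<^esub> H N $$ (l, j))"
        by (rule h.B.add.finprod_cong') (simp_all add: in_A M N ij H_index)
      finally show "H (M \<otimes>\<^bsub>matrix_algebra r A\<^esub> N) $$ (i, j) = (H M \<otimes>\<^bsub>matrix_algebra r B\<^esub> H N) $$ (i, j)"
        using ij by (simp add: H_index matrix_algebra_ops)
    qed (simp_all add: H_def matrix_algebra_ops)
  next
    show "H \<one>\<^bsub>matrix_algebra r A\<^esub> = \<one>\<^bsub>matrix_algebra r B\<^esub>"
      by (rule eq_matI) (simp_all add: H_def matrix_algebra_ops)
  qed (rule H_closed)
  moreover have "bij_betw H (carrier (matrix_algebra r A)) (carrier (matrix_algebra r B))"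
  proof (rule bij_betwI')
    fix M N assume M: "M \<in> carrier (matrix_algebra r A)" and N: "N \<in> carrier (matrix_algebra r A)"
    show "(H M = H N) = (M = N)"
    proof
      assume eq: "H M = H N"
      have "M $$ (i, j) = N $$ (i, j)" if "i < r" "j < r" for i j
        using bij_betw_imp_inj_on[OF bij] arg_cong[OF eq, of "\<lambda>M. M $$ (i, j)"] in_A[OF M that] in_A[OF N that]
        by (simp add: H_index that inj_on_eq_iff)
      then show "M = N" using M N by (intro eq_matI) (auto simp: matrix_algebra_carrier)
    qed simp
  next
    fix N assume N: "N \<in> carrier (matrix_algebra r B)"
    define M where "M = mat r r (\<lambda>(i, j). inv_into (carrier A) h (N $$ (i, j)))"
    have N_in: "N $$ (i, j) \<in> h ` carrier A" if "i < r" "j < r" for i j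
      using N that bij_betw_imp_surj_on[OF bij] by (simp add: matrix_algebra_carrier)
    have "M \<in> carrier (matrix_algebra r A)"
      using N_in by (simp add: matrix_algebra_carrier M_def inv_into_into)
    moreover have "N = H M"
      using N N_in by (intro eq_matI) (auto simp: H_def M_def matrix_algebra_carrier f_inv_into_f)
    ultimately show "\<exists>M\<in>carrier (matrix_algebra r A). N = H M" by (intro bexI)
  qed (rule H_closed)
  moreover have "H (c \<odot>\<^bsub>matrix_algebra r A\<^esub> M) = c \<odot>\<^bsub>matrix_algebra r B\<^esub> H M"
    if "M \<in> carrier (matrix_algebra r A)" for c M
    by (rule eq_matI) (simp_all add: H_def matrix_algebra_ops in_A[OF that] h.hom_smult)
  ultimately show ?thesis
    unfolding alg_isomorphic_def ring_iso_def by (intro bexI[of _ H] CollectI conjI allI ballI)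
qed

lemma alg_isomorphic_direct_sum:
  assumes "\<And>i. i \<in> I \<Longrightarrow> alg_isomorphic (A i) (B i)"
  shows "alg_isomorphic (direct_sum_algebra I A) (direct_sum_algebra I B)"
proof -
  have "\<exists>f. f \<in> ring_iso (A i) (B i) \<and> (\<forall>c. \<forall>x\<in>carrier (A i). f (c \<odot>\<^bsub>A i\<^esub> x) = c \<odot>\<^bsub>B i\<^esub> f x)"
    if "i \<in> I" for i
    using assms[OF that] unfolding alg_isomorphic_def by blast
  then obtain f where f: "\<And>i. i \<in> I \<Longrightarrow> f i \<in> ring_iso (A i) (B i)"
    and f_smult: "\<And>i c x. \<lbrakk>i \<in> I; x \<in> carrier (A i)\<rbrakk> \<Longrightarrow> f i (c \<odot>\<^bsub>A i\<^esub> x) = c \<odot>\<^bsub>B i\<^esub> f i x"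
    by metis
  have f_bij: "bij_betw (f i) (carrier (A i)) (carrier (B i))" if "i \<in> I" for i
    using f[OF that] by (simp add: ring_iso_def)
  have f_hom: "f i \<in> Ring.ring_hom (A i) (B i)" if "i \<in> I" for i
    using f[OF that] by (simp add: ring_iso_def)
  note hom = ring_hom_closed[OF f_hom] ring_hom_mult[OF f_hom] ring_hom_add[OF f_hom] ring_hom_one[OF f_hom]
  define H where "H x = (\<lambda>i\<in>I. f i (x i))" for x
  have H_closed: "H x \<in> carrier (direct_sum_algebra I B)" if "x \<in> carrier (direct_sum_algebra I A)" for x
    using that by (auto simp: direct_sum_algebra_def H_def PiE_iff hom)
  have "H \<in> Ring.ring_hom (direct_sum_algebra I A) (direct_sum_algebra I B)"
    by (rule ring_hom_memI, rule H_closed)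
      (auto simp: direct_sum_algebra_def H_def PiE_iff hom intro!: restrict_ext)
  moreover have "bij_betw H (carrier (direct_sum_algebra I A)) (carrier (direct_sum_algebra I B))"
  proof (rule bij_betwI')
    fix x y assume xy: "x \<in> carrier (direct_sum_algebra I A)" "y \<in> carrier (direct_sum_algebra I A)"
    show "(H x = H y) = (x = y)"
    proof
      assume eq: "H x = H y"
      show "x = y"
      proof
        fix i
        show "x i = y i"
        proof (cases "i \<in> I")
          case True
          then have "f i (x i) = f i (y i)" using fun_cong[OF eq, of i] by (simp add: H_def)
          then show ?thesis
            using True xy bij_betw_imp_inj_on[OF f_bij[OF True]]
            by (auto simp: direct_sum_algebra_def PiE_iff dest: inj_onD)
        next
          case False
          then show ?thesis using xy by (auto simp: direct_sum_algebra_def PiE_iff extensional_def)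
        qed
      qed
    qed simp
  next
    fix y assume y: "y \<in> carrier (direct_sum_algebra I B)"
    let ?x = "\<lambda>i\<in>I. inv_into (carrier (A i)) (f i) (y i)"
    have yi: "y i \<in> f i ` carrier (A i)" if "i \<in> I" for i
      using y that bij_betw_imp_surj_on[OF f_bij[OF that]] by (auto simp: direct_sum_algebra_def PiE_iff)
    have "?x \<in> carrier (direct_sum_algebra I A)"
      using yi by (auto simp: direct_sum_algebra_def inv_into_into)
    moreover have "y = H ?x"
      using yi y by (auto simp: H_def f_inv_into_f direct_sum_algebra_def PiE_iff extensional_def fun_eq_iff)
    ultimately show "\<exists>x\<in>carrier (direct_sum_algebra I A). y = H x" by (intro bexI)
  qed (rule H_closed)
  moreover have "H (c \<odot>\<^bsub>direct_sum_algebra I A\<^esub> x) = c \<odot>\<^bsub>direct_sum_algebra I B\<^esub> H x"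
    if "x \<in> carrier (direct_sum_algebra I A)" for c x
    using that by (auto simp: direct_sum_algebra_def H_def PiE_iff f_smult)
  ultimately show ?thesis
    unfolding alg_isomorphic_def ring_iso_def by (intro bexI[of _ H] CollectI conjI allI ballI)
qed

lemma kalgebra_direct_sum:
  fixes A :: "'i \<Rightarrow> ('k::comm_ring_1, 'a) module"
  assumes "\<And>i. i \<in> I \<Longrightarrow> kalgebra (A i)"
  shows "kalgebra (direct_sum_algebra I A)"
proof -
  have r: "ring (A i)" if "i \<in> I" for i using assms[OF that] by (simp add: kalgebra_def)
  note rs = ring.ring_simprules[OF r] kalgebra.smult_closed[OF assms] kalgebra.smult_r_distr[OF assms]
    kalgebra.smult_l_distr[OF assms] kalgebra.smult_smult[OF assms] kalgebra.one_smult[OF assms]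
    kalgebra.smult_mult_left[OF assms] kalgebra.smult_mult_right[OF assms]
  let ?D = "direct_sum_algebra I A"
  note ds = direct_sum_algebra_def PiE_iff extensional_def fun_eq_iff
  have "ring ?D"
  proof (rule ringI)
    show "abelian_group ?D"
    proof (rule abelian_groupI)
      fix x assume x: "x \<in> carrier ?D"
      show "\<exists>y\<in>carrier ?D. y \<oplus>\<^bsub>?D\<^esub> x = \<zero>\<^bsub>?D\<^esub>"
        by (rule bexI[of _ "\<lambda>i\<in>I. \<ominus>\<^bsub>A i\<^esub> x i"]) (use x in \<open>simp_all add: ds rs\<close>)
    qed (simp_all add: ds rs)
    show "Group.monoid ?D"
      by (rule monoidI) (simp_all add: ds rs monoid.r_one[OF ring.is_monoid[OF r]])
  qed (simp_all add: ds rs)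
  then show ?thesis
    unfolding kalgebra_def kalgebra_axioms_def by (simp add: ds rs)
qed

text \<open>The linear endomorphisms of the underlying module of \<open>M\<close>. Operators are
  \<open>undefined\<close> outside the carrier, so agreement on the carrier is equality of
  functions.\<close>

definition end_algebra :: "('k, 'a) module \<Rightarrow> ('k, 'a \<Rightarrow> 'a) module"
  where "end_algebra M =
    \<lparr>carrier = {F \<in> carrier M \<rightarrow>\<^sub>E carrier M.
       (\<forall>x\<in>carrier M. \<forall>y\<in>carrier M. F (x \<oplus>\<^bsub>M\<^esub> y) = F x \<oplus>\<^bsub>M\<^esub> F y) \<and>
       (\<forall>c. \<forall>x\<in>carrier M. F (c \<odot>\<^bsub>M\<^esub> x) = c \<odot>\<^bsub>M\<^esub> F x)},
     monoid.mult = (\<lambda>F G. \<lambda>x\<in>carrier M. F (G x)),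
     one = (\<lambda>x\<in>carrier M. x),
     zero = (\<lambda>x\<in>carrier M. \<zero>\<^bsub>M\<^esub>),
     add = (\<lambda>F G. \<lambda>x\<in>carrier M. F x \<oplus>\<^bsub>M\<^esub> G x),
     module.smult = (\<lambda>c F. \<lambda>x\<in>carrier M. c \<odot>\<^bsub>M\<^esub> F x)\<rparr>"

lemma end_algebra_carrier:
  "F \<in> carrier (end_algebra M) \<longleftrightarrow> F \<in> extensional (carrier M) \<and> (\<forall>x\<in>carrier M. F x \<in> carrier M) \<and>
    (\<forall>x\<in>carrier M. \<forall>y\<in>carrier M. F (x \<oplus>\<^bsub>M\<^esub> y) = F x \<oplus>\<^bsub>M\<^esub> F y) \<and>
    (\<forall>c. \<forall>x\<in>carrier M. F (c \<odot>\<^bsub>M\<^esub> x) = c \<odot>\<^bsub>M\<^esub> F x)"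
  by (auto simp: end_algebra_def PiE_iff)

lemma end_algebra_ops:
  "F \<otimes>\<^bsub>end_algebra M\<^esub> G = (\<lambda>x\<in>carrier M. F (G x))" "\<one>\<^bsub>end_algebra M\<^esub> = (\<lambda>x\<in>carrier M. x)"
  "\<zero>\<^bsub>end_algebra M\<^esub> = (\<lambda>x\<in>carrier M. \<zero>\<^bsub>M\<^esub>)" "F \<oplus>\<^bsub>end_algebra M\<^esub> G = (\<lambda>x\<in>carrier M. F x \<oplus>\<^bsub>M\<^esub> G x)"
  "c \<odot>\<^bsub>end_algebra M\<^esub> F = (\<lambda>x\<in>carrier M. c \<odot>\<^bsub>M\<^esub> F x)"
  by (simp_all add: end_algebra_def)

lemma end_algebra_eqI:
  assumes "F \<in> carrier (end_algebra M)" "G \<in> carrier (end_algebra M)" "\<And>x. x \<in> carrier M \<Longrightarrow> F x = G x"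
  shows "F = G"
  using assms by (intro extensionalityI[of _ "carrier M"]) (simp_all add: end_algebra_carrier)

lemma kalgebra_end_algebra:
  fixes M :: "('k::comm_ring_1, 'a) module"
  assumes "kalgebra M"
  shows "kalgebra (end_algebra M)"
proof -
  interpret M: kalgebra M by fact
  let ?E = "end_algebra M"
  have smult_commute: "b \<odot>\<^bsub>M\<^esub> (c \<odot>\<^bsub>M\<^esub> x) = c \<odot>\<^bsub>M\<^esub> (b \<odot>\<^bsub>M\<^esub> x)" if "x \<in> carrier M" for b c x
    using that by (simp add: M.smult_smult mult.commute)
  note mem = end_algebra_carrier end_algebra_ops
  have neg: "(\<lambda>x\<in>carrier M. (- 1) \<odot>\<^bsub>M\<^esub> F x) \<in> carrier ?E" if "F \<in> carrier ?E" for F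
    using that by (simp add: mem M.smult_r_distr smult_commute)
  have neg0: "(- 1) \<odot>\<^bsub>M\<^esub> x \<oplus>\<^bsub>M\<^esub> x = \<zero>\<^bsub>M\<^esub>" if "x \<in> carrier M" for x
    using M.smult_l_distr[OF that, of "-1" 1] that by simp
  have "ring ?E"
  proof (rule ringI)
    show "abelian_group ?E"
    proof (rule abelian_groupI)
      fix F assume F: "F \<in> carrier ?E"
      show "\<exists>G\<in>carrier ?E. G \<oplus>\<^bsub>?E\<^esub> F = \<zero>\<^bsub>?E\<^esub>"
        by (rule bexI[OF _ neg[OF F]]) (use F in \<open>simp add: mem neg0 cong: restrict_cong\<close>)
    next
      fix F G assume "F \<in> carrier ?E" "G \<in> carrier ?E"
      then show "F \<oplus>\<^bsub>?E\<^esub> G \<in> carrier ?E" by (simp add: mem M.a_ac M.smult_r_distr)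
      show "F \<oplus>\<^bsub>?E\<^esub> G = G \<oplus>\<^bsub>?E\<^esub> F"
        using \<open>F \<in> carrier ?E\<close> \<open>G \<in> carrier ?E\<close> by (simp add: mem M.a_comm cong: restrict_cong)
    next
      fix F G H assume "F \<in> carrier ?E" "G \<in> carrier ?E" "H \<in> carrier ?E"
      then show "F \<oplus>\<^bsub>?E\<^esub> G \<oplus>\<^bsub>?E\<^esub> H = F \<oplus>\<^bsub>?E\<^esub> (G \<oplus>\<^bsub>?E\<^esub> H)"
        by (simp add: mem M.a_assoc cong: restrict_cong)
    next
      fix F assume "F \<in> carrier ?E"
      then show "\<zero>\<^bsub>?E\<^esub> \<oplus>\<^bsub>?E\<^esub> F = F"
        by (simp add: mem fun_eq_iff extensional_def)
    qed (simp add: mem)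
    show "Group.monoid ?E"
      by (rule monoidI) (simp_all add: mem fun_eq_iff extensional_def)
  qed (simp_all add: mem fun_eq_iff)
  then show ?thesis
    unfolding kalgebra_def kalgebra_axioms_def
    by (simp add: mem fun_eq_iff extensional_def M.smult_r_distr M.smult_l_distr M.smult_smult mult.commute M.a_ac)
qed


text \<open>The \<open>P \<mu> i\<close> and \<open>Q \<mu> i\<close> play the role of matrix units:
  an element y is recorded by its entries \<open>Q \<mu> i \<otimes> y \<otimes> P \<mu> j\<close>.
  Entries between different \<open>\<mu>\<close> vanish by \<open>off\<close>, the relation
  \<open>QP\<close> returns the entries of a reassembled matrix unchanged, and \<open>one\<close> is
  what recovers an element from its entries and expands products.\<close>

lemma (in kalgebra) peirce_decomposition:
  fixes I :: "'i set" and N :: "'i \<Rightarrow> nat" and P Q :: "'i \<Rightarrow> nat \<Rightarrow> 'a"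
  assumes fin: "finite I"
    and e: "\<And>\<mu>. \<mu> \<in> I \<Longrightarrow> e \<mu> \<in> carrier A" and ee: "\<And>\<mu>. \<mu> \<in> I \<Longrightarrow> e \<mu> \<otimes> e \<mu> = e \<mu>"
    and P: "\<And>\<mu> i. \<lbrakk>\<mu> \<in> I; i < N \<mu>\<rbrakk> \<Longrightarrow> P \<mu> i \<in> carrier A"
    and Q: "\<And>\<mu> i. \<lbrakk>\<mu> \<in> I; i < N \<mu>\<rbrakk> \<Longrightarrow> Q \<mu> i \<in> carrier A"
    and QP: "\<And>\<mu> \<nu> i j. \<lbrakk>\<mu> \<in> I; \<nu> \<in> I; i < N \<mu>; j < N \<nu>\<rbrakk> \<Longrightarrow>
      Q \<mu> i \<otimes> P \<nu> j = (if \<mu> = \<nu> \<and> i = j then e \<mu> else \<zero>)"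
    and Pe: "\<And>\<mu> i. \<lbrakk>\<mu> \<in> I; i < N \<mu>\<rbrakk> \<Longrightarrow> P \<mu> i \<otimes> e \<mu> = P \<mu> i"
    and eQ: "\<And>\<mu> i. \<lbrakk>\<mu> \<in> I; i < N \<mu>\<rbrakk> \<Longrightarrow> e \<mu> \<otimes> Q \<mu> i = Q \<mu> i"
    and one: "(\<Oplus>k\<in>Sigma I (\<lambda>\<mu>. {..<N \<mu>}). P (fst k) (snd k) \<otimes> Q (fst k) (snd k)) = \<one>"
    and off: "\<And>\<mu> \<nu> y. \<lbrakk>\<mu> \<in> I; \<nu> \<in> I; \<mu> \<noteq> \<nu>; y \<in> carrier A\<rbrakk> \<Longrightarrow> e \<mu> \<otimes> y \<otimes> e \<nu> = \<zero>"
  shows "alg_isomorphic A (direct_sum_algebra I (\<lambda>\<mu>. matrix_algebra (N \<mu>) (corner A (e \<mu>))))"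
proof -
  let ?C = "\<lambda>\<mu>. corner A (e \<mu>)"
  let ?D = "direct_sum_algebra I (\<lambda>\<mu>. matrix_algebra (N \<mu>) (?C \<mu>))"
  define K where "K = Sigma I (\<lambda>\<mu>. {..<N \<mu>})"
  define p where "p k = P (fst k) (snd k)" for k
  define q where "q k = Q (fst k) (snd k)" for k
  have finK: "finite K" unfolding K_def using fin by simp
  have K_iff: "k \<in> K \<longleftrightarrow> fst k \<in> I \<and> snd k < N (fst k)" for k by (cases k) (simp add: K_def)
  have p: "p k \<in> carrier A" and q: "q k \<in> carrier A" if "k \<in> K" for k
    using that P Q by (simp_all add: K_iff p_def q_def)
  have pe: "p k \<otimes> e (fst k) = p k" and eq: "e (fst k) \<otimes> q k = q k" if "k \<in> K" for k
    using that Pe eQ by (simp_all add: K_iff p_def q_def)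
  have qp: "q k \<otimes> p l = (if k = l then e (fst k) else \<zero>)" if "k \<in> K" "l \<in> K" for k l
    using that QP by (simp add: K_iff p_def q_def prod_eq_iff)
  have eK: "e (fst k) \<in> carrier A" if "k \<in> K" for k using that e by (simp add: K_iff)
  have sum1: "(\<Oplus>k\<in>K. p k \<otimes> q k) = \<one>" using one by (simp add: K_def p_def q_def)
  have off': "q k \<otimes> y \<otimes> p l = \<zero>" if "k \<in> K" "l \<in> K" "fst k \<noteq> fst l" "y \<in> carrier A" for k l y
  proof -
    have "q k \<otimes> y \<otimes> p l = (e (fst k) \<otimes> q k) \<otimes> y \<otimes> (p l \<otimes> e (fst l))"
      using that by (simp only: eq pe)
    also have "\<dots> = e (fst k) \<otimes> (q k \<otimes> y \<otimes> p l) \<otimes> e (fst l)"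
      using that by (simp add: m_assoc p q eK)
    also have "\<dots> = \<zero>" using that by (intro off) (simp_all add: K_iff p q)
    finally show ?thesis .
  qed
  have mid: "q k \<otimes> y \<otimes> p l \<in> carrier (?C (fst k))" if "k \<in> K" "l \<in> K" "fst k = fst l" "y \<in> carrier A" for k l y
  proof -
    have "e (fst k) \<otimes> (q k \<otimes> y \<otimes> p l) = (e (fst k) \<otimes> q k) \<otimes> y \<otimes> p l"
      "(q k \<otimes> y \<otimes> p l) \<otimes> e (fst l) = q k \<otimes> y \<otimes> (p l \<otimes> e (fst l))"
      using that by (simp_all add: m_assoc p q eK)
    then show ?thesis using that eq[OF that(1)] pe[OF that(2)] by (simp add: corner_simps p q)
  qed
  define \<Phi> where "\<Phi> y = (\<lambda>\<mu>\<in>I. mat (N \<mu>) (N \<mu>) (\<lambda>(i, j). q (\<mu>, i) \<otimes> y \<otimes> p (\<mu>, j)))" for y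
  have \<Phi>_index: "\<Phi> y \<mu> $$ (i, j) = q (\<mu>, i) \<otimes> y \<otimes> p (\<mu>, j)" if "\<mu> \<in> I" "i < N \<mu>" "j < N \<mu>" for y \<mu> i j
    using that by (simp add: \<Phi>_def)
  have in_K: "(\<mu>, i) \<in> K" if "\<mu> \<in> I" "i < N \<mu>" for \<mu> i using that by (simp add: K_iff)
  have D_carrier: "x \<in> carrier ?D \<longleftrightarrow> x \<in> extensional I \<and> (\<forall>\<mu>\<in>I. x \<mu> \<in> carrier_mat (N \<mu>) (N \<mu>) \<and>
      (\<forall>i<N \<mu>. \<forall>j<N \<mu>. x \<mu> $$ (i, j) \<in> carrier (?C \<mu>)))" for x
    by (auto simp: direct_sum_algebra_def PiE_iff matrix_algebra_carrier)
  have \<Phi>_closed: "\<Phi> y \<in> carrier ?D" if "y \<in> carrier A" for y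
    unfolding D_carrier
  proof (intro conjI ballI allI impI)
    fix \<mu> i j assume "\<mu> \<in> I" "i < N \<mu>" "j < N \<mu>"
    then show "\<Phi> y \<mu> $$ (i, j) \<in> carrier (?C \<mu>)"
      using mid[of "(\<mu>, i)" "(\<mu>, j)" y] that by (simp add: \<Phi>_index in_K)
  qed (simp_all add: \<Phi>_def)
  have \<Phi>_mult: "q (\<mu>, i) \<otimes> (y \<otimes> z) \<otimes> p (\<mu>, j)
      = (\<Oplus>\<^bsub>?C \<mu>\<^esub>l\<in>{..<N \<mu>}. (q (\<mu>, i) \<otimes> y \<otimes> p (\<mu>, l)) \<otimes> (q (\<mu>, l) \<otimes> z \<otimes> p (\<mu>, j)))"
    if y: "y \<in> carrier A" and z: "z \<in> carrier A" and \<mu>: "\<mu> \<in> I" "i < N \<mu>" "j < N \<mu>" for y z \<mu> i j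
  proof -
    note ij = in_K[OF \<mu>(1,2)] in_K[OF \<mu>(1,3)]
    let ?f = "\<lambda>k. (q (\<mu>, i) \<otimes> y \<otimes> p k) \<otimes> (q k \<otimes> z \<otimes> p (\<mu>, j))"
    have f: "?f k \<in> carrier A" if "k \<in> K" for k using that y z ij by (simp add: p q)
    \<comment> \<open>The unit, written as the sum of the \<open>p k \<otimes> q k\<close>, is
      inserted between the two factors; this turns the entry of a product into a row times a
      column.\<close>
    have "q (\<mu>, i) \<otimes> (y \<otimes> z) \<otimes> p (\<mu>, j) = (q (\<mu>, i) \<otimes> y) \<otimes> (\<Oplus>k\<in>K. p k \<otimes> q k) \<otimes> (z \<otimes> p (\<mu>, j))"
      using y z ij by (simp add: sum1 m_assoc p q)
    also have "\<dots> = (\<Oplus>k\<in>K. (q (\<mu>, i) \<otimes> y) \<otimes> (p k \<otimes> q k)) \<otimes> (z \<otimes> p (\<mu>, j))"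
      using y z ij by (subst finsum_mult_left) (simp_all add: p q)
    also have "\<dots> = (\<Oplus>k\<in>K. (q (\<mu>, i) \<otimes> y) \<otimes> (p k \<otimes> q k) \<otimes> (z \<otimes> p (\<mu>, j)))"
      using y z ij by (subst finsum_mult_right) (simp_all add: p q)
    also have "\<dots> = (\<Oplus>k\<in>K. ?f k)"
      using y z ij by (intro add.finprod_cong') (simp_all add: m_assoc p q)
    \<comment> \<open>Indices outside the block of \<open>\<mu>\<close> contribute zero, because the
      left factor is then an entry between different corners.\<close>
    also have "\<dots> = (\<Oplus>k\<in>Pair \<mu> ` {..<N \<mu>}. ?f k)"
    proof (rule add.finprod_mono_neutral_cong_right[OF finK])
      show "Pair \<mu> ` {..<N \<mu>} \<subseteq> K" using \<mu> by (auto simp: K_iff)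
      fix k assume k: "k \<in> K - Pair \<mu> ` {..<N \<mu>}"
      then have "fst k \<noteq> \<mu>" by (cases k) (auto simp: K_iff)
      then have "q (\<mu>, i) \<otimes> y \<otimes> p k = \<zero>" using k y ij by (intro off') auto
      then show "?f k = \<zero>" using k y z ij by (simp add: p q)
    qed (simp_all add: f)
    also have "\<dots> = (\<Oplus>l\<in>{..<N \<mu>}. ?f (\<mu>, l))"
      using f \<mu> by (subst finsum_reindex) (auto simp: in_K inj_on_def)
    also have "\<dots> = (\<Oplus>\<^bsub>?C \<mu>\<^esub>l\<in>{..<N \<mu>}. ?f (\<mu>, l))"
    proof (rule finsum_corner[OF e ee, symmetric])
      interpret C: kalgebra "?C \<mu>" using kalgebra_corner e ee \<mu> by simp
      fix l assume "l \<in> {..<N \<mu>}"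
      then have l: "(\<mu>, l) \<in> K" using \<mu> by (simp add: in_K)
      show "?f (\<mu>, l) \<in> carrier (?C \<mu>)"
        using C.m_closed mid[OF ij(1) l _ y] mid[OF l ij(2) _ z] by (simp add: corner_simps(5))
    qed (simp_all add: \<mu>)
    finally show ?thesis .
  qed
  \<comment> \<open>Multiplying by the decomposed unit on both sides recovers \<open>y\<close> from
    its entries.\<close>
  have expand: "y = (\<Oplus>k\<in>K. \<Oplus>l\<in>K. p k \<otimes> (q k \<otimes> y \<otimes> p l) \<otimes> q l)" if y: "y \<in> carrier A" for y
  proof -
    have "y = (\<Oplus>k\<in>K. p k \<otimes> q k) \<otimes> (y \<otimes> (\<Oplus>l\<in>K. p l \<otimes> q l))" using y by (simp add: sum1)
    also have "\<dots> = (\<Oplus>k\<in>K. (p k \<otimes> q k) \<otimes> (y \<otimes> (\<Oplus>l\<in>K. p l \<otimes> q l)))"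
      using y by (subst finsum_mult_right) (simp_all add: p q)
    also have "\<dots> = (\<Oplus>k\<in>K. \<Oplus>l\<in>K. (p k \<otimes> q k) \<otimes> (y \<otimes> (p l \<otimes> q l)))"
      using y by (intro add.finprod_cong' Pi_I refl finsum_closed) (simp_all add: finsum_mult_left p q)
    also have "\<dots> = (\<Oplus>k\<in>K. \<Oplus>l\<in>K. p k \<otimes> (q k \<otimes> y \<otimes> p l) \<otimes> q l)"
      using y by (intro add.finprod_cong' Pi_I refl finsum_closed) (simp_all add: m_assoc p q)
    finally show ?thesis .
  qed
  have "\<Phi> \<in> Ring.ring_hom A ?D"
  proof (rule ring_hom_memI)
    fix y z assume y: "y \<in> carrier A" and z: "z \<in> carrier A"
    show "\<Phi> y \<in> carrier ?D" by (rule \<Phi>_closed[OF y])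
    show "\<Phi> (y \<oplus> z) = \<Phi> y \<oplus>\<^bsub>?D\<^esub> \<Phi> z"
      using y z
      by (auto simp: \<Phi>_def direct_sum_algebra_def matrix_algebra_ops corner_simps l_distr r_distr p q in_K
          intro!: restrict_ext eq_matI)
    show "\<Phi> (y \<otimes> z) = \<Phi> y \<otimes>\<^bsub>?D\<^esub> \<Phi> z"
    proof
      fix \<mu>
      show "\<Phi> (y \<otimes> z) \<mu> = (\<Phi> y \<otimes>\<^bsub>?D\<^esub> \<Phi> z) \<mu>"
      proof (cases "\<mu> \<in> I")
        case True
        have "\<Phi> (y \<otimes> z) \<mu> = \<Phi> y \<mu> \<otimes>\<^bsub>matrix_algebra (N \<mu>) (?C \<mu>)\<^esub> \<Phi> z \<mu>"
        proof (rule eq_matI)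
          fix i j assume "i < dim_row (\<Phi> y \<mu> \<otimes>\<^bsub>matrix_algebra (N \<mu>) (?C \<mu>)\<^esub> \<Phi> z \<mu>)"
            "j < dim_col (\<Phi> y \<mu> \<otimes>\<^bsub>matrix_algebra (N \<mu>) (?C \<mu>)\<^esub> \<Phi> z \<mu>)"
          then have ij: "i < N \<mu>" "j < N \<mu>" by (simp_all add: matrix_algebra_ops)
          interpret C: kalgebra "?C \<mu>" using kalgebra_corner e ee True by simp
          have c: "(q (\<mu>, i) \<otimes> y \<otimes> p (\<mu>, l)) \<otimes> (q (\<mu>, l) \<otimes> z \<otimes> p (\<mu>, j)) \<in> carrier (?C \<mu>)" if "l < N \<mu>" for l
            using C.m_closed[OF mid[of "(\<mu>, i)" "(\<mu>, l)" y, unfolded fst_conv] mid[of "(\<mu>, l)" "(\<mu>, j)" z, unfolded fst_conv]] that True ij y z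
            by (simp add: corner_simps(5) in_K)
          have "\<Phi> (y \<otimes> z) \<mu> $$ (i, j) = q (\<mu>, i) \<otimes> (y \<otimes> z) \<otimes> p (\<mu>, j)"
            by (rule \<Phi>_index[OF True ij])
          also have "\<dots> = (\<Oplus>\<^bsub>?C \<mu>\<^esub>l\<in>{..<N \<mu>}. (q (\<mu>, i) \<otimes> y \<otimes> p (\<mu>, l)) \<otimes> (q (\<mu>, l) \<otimes> z \<otimes> p (\<mu>, j)))"
            by (rule \<Phi>_mult[OF y z True ij])
          also have "\<dots> = (\<Oplus>\<^bsub>?C \<mu>\<^esub>l\<in>{..<N \<mu>}. \<Phi> y \<mu> $$ (i, l) \<otimes>\<^bsub>?C \<mu>\<^esub> \<Phi> z \<mu> $$ (l, j))"
            by (rule C.add.finprod_cong') (simp_all add: \<Phi>_index True ij corner_simps(5) c)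
          finally show "\<Phi> (y \<otimes> z) \<mu> $$ (i, j) = (\<Phi> y \<mu> \<otimes>\<^bsub>matrix_algebra (N \<mu>) (?C \<mu>)\<^esub> \<Phi> z \<mu>) $$ (i, j)"
            using ij by (simp add: matrix_algebra_ops)
        qed (simp_all add: matrix_algebra_ops \<Phi>_def True)
        then show ?thesis using True by (simp add: direct_sum_algebra_def)
      qed (simp add: \<Phi>_def direct_sum_algebra_def)
    qed
  next
    show "\<Phi> \<one> = \<one>\<^bsub>?D\<^esub>"
      by (auto simp: \<Phi>_def direct_sum_algebra_def matrix_algebra_ops corner_simps p q qp in_K
          intro!: restrict_ext eq_matI)
  qed
  moreover have "bij_betw \<Phi> (carrier A) (carrier ?D)"
  proof (rule bij_betwI')
    fix y z assume y: "y \<in> carrier A" and z: "z \<in> carrier A"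
    show "(\<Phi> y = \<Phi> z) = (y = z)"
    proof
      assume eq: "\<Phi> y = \<Phi> z"
      have entry: "q k \<otimes> y \<otimes> p l = q k \<otimes> z \<otimes> p l" if kl: "k \<in> K" "l \<in> K" for k l
      proof (cases "fst k = fst l")
        case True
        then have "(fst l, snd k) = k" by (simp add: prod_eq_iff)
        then show ?thesis
          using True \<Phi>_index[of "fst k" "snd k" "snd l" y] \<Phi>_index[of "fst k" "snd k" "snd l" z] kl eq
          by (simp add: K_iff)
      next
        case False
        then show ?thesis using off' kl y z by simp
      qed
      show "y = z"
        by (subst expand[OF y], subst expand[OF z], intro add.finprod_cong' Pi_I refl finsum_closed)
          (simp_all add: entry p q z)
    qed simp
  next
    fix y assume "y \<in> carrier A" then show "\<Phi> y \<in> carrier ?D" by (rule \<Phi>_closed)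
  next
    fix M assume "M \<in> carrier ?D"
    then have M_ext: "M \<in> extensional I" and M_dim: "\<And>\<mu>. \<mu> \<in> I \<Longrightarrow> M \<mu> \<in> carrier_mat (N \<mu>) (N \<mu>)"
      and M_C: "\<And>\<mu> i j. \<lbrakk>\<mu> \<in> I; i < N \<mu>; j < N \<mu>\<rbrakk> \<Longrightarrow> M \<mu> $$ (i, j) \<in> carrier (?C \<mu>)"
      unfolding D_carrier by simp_all
    \<comment> \<open>The preimage of a family of matrices is the sum of all
      \<open>p k \<otimes> M \<otimes> q l\<close>, with zero between different blocks.\<close>
    define m where "m k l = (if fst k = fst l then p k \<otimes> M (fst k) $$ (snd k, snd l) \<otimes> q l else \<zero>)" for k l
    have M_A: "M (fst k) $$ (snd k, snd l) \<in> carrier A" "e (fst k) \<otimes> M (fst k) $$ (snd k, snd l) = M (fst k) $$ (snd k, snd l)"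
      "M (fst k) $$ (snd k, snd l) \<otimes> e (fst k) = M (fst k) $$ (snd k, snd l)"
      if "k \<in> K" "l \<in> K" "fst k = fst l" for k l
      using M_C[of "fst k" "snd k" "snd l"] that by (simp_all add: K_iff corner_simps)
    have m: "m k l \<in> carrier A" if "k \<in> K" "l \<in> K" for k l using that M_A by (simp add: m_def p q)
    define y where "y = (\<Oplus>k\<in>K. \<Oplus>l\<in>K. m k l)"
    have y: "y \<in> carrier A" unfolding y_def by (intro finsum_closed Pi_I m)
    have entry: "q a \<otimes> y \<otimes> p b = M (fst a) $$ (snd a, snd b)" if ab: "a \<in> K" "b \<in> K" "fst a = fst b" for a b
    proof -
      have qmp: "q a \<otimes> m k l \<otimes> p b = (if k = a \<and> l = b then M (fst a) $$ (snd a, snd b) else \<zero>)"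
        if kl: "k \<in> K" "l \<in> K" for k l
      proof (cases "fst k = fst l")
        case True
        have "q a \<otimes> m k l \<otimes> p b = (q a \<otimes> p k) \<otimes> M (fst k) $$ (snd k, snd l) \<otimes> (q l \<otimes> p b)"
          using True kl ab M_A[OF kl True] by (simp add: m_def m_assoc p q)
        then show ?thesis using M_A[OF kl True] kl ab True eK[OF ab(1)] eK[OF ab(2)] eK[OF kl(1)] eK[OF kl(2)]
          by (auto simp: qp)
      next
        case False
        then show ?thesis using kl ab by (auto simp: m_def p q)
      qed
      have "q a \<otimes> y \<otimes> p b = (\<Oplus>k\<in>K. \<Oplus>l\<in>K. q a \<otimes> m k l \<otimes> p b)"
        unfolding y_def using ab
        by (simp add: finsum_mult_left finsum_mult_right p q m finsum_closed Pi_def cong: finsum_cong)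
      also have "\<dots> = (\<Oplus>l\<in>K. q a \<otimes> m a l \<otimes> p b)"
      proof (rule finsum_delta[OF finK ab(1) _ _ refl])
        show "(\<Oplus>l\<in>K. q a \<otimes> m a l \<otimes> p b) \<in> carrier A"
          using ab by (intro finsum_closed Pi_I) (simp add: p q m)
        fix k assume "k \<in> K" "k \<noteq> a"
        then show "(\<Oplus>l\<in>K. q a \<otimes> m k l \<otimes> p b) = \<zero>"
          by (intro add.finprod_one_eqI) (simp add: qmp)
      qed
      also have "\<dots> = M (fst a) $$ (snd a, snd b)"
        by (rule finsum_delta[OF finK ab(2)]) (use ab M_A[OF ab] in \<open>simp_all add: qmp\<close>)
      finally show ?thesis .
    qed
    have "M = \<Phi> y"
    proof
      fix \<mu>
      show "M \<mu> = \<Phi> y \<mu>"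
      proof (cases "\<mu> \<in> I")
        case True
        show ?thesis
        proof (rule eq_matI)
          fix i j assume "i < dim_row (\<Phi> y \<mu>)" "j < dim_col (\<Phi> y \<mu>)"
          then have ij: "i < N \<mu>" "j < N \<mu>" using True by (simp_all add: \<Phi>_def)
          show "M \<mu> $$ (i, j) = \<Phi> y \<mu> $$ (i, j)"
            using entry[of "(\<mu>, i)" "(\<mu>, j)"] True ij by (simp add: \<Phi>_index in_K)
        qed (use M_dim[OF True] True in \<open>simp_all add: \<Phi>_def\<close>)
      next
        case False
        then show ?thesis using M_ext by (simp add: \<Phi>_def extensional_def)
      qed
    qed
    then show "\<exists>y\<in>carrier A. M = \<Phi> y" using y by (intro bexI)
  qed
  moreover have "\<Phi> (c \<odot> y) = c \<odot>\<^bsub>?D\<^esub> \<Phi> y" if "y \<in> carrier A" for c y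
    using that
    by (auto simp: \<Phi>_def direct_sum_algebra_def matrix_algebra_ops corner_simps smult_mult_left smult_mult_right p q in_K
        intro!: restrict_ext eq_matI)
  ultimately show ?thesis
    unfolding alg_isomorphic_def ring_iso_def by (intro bexI[of _ \<Phi>] CollectI conjI allI ballI)
qed


section \<open>Colourings\<close>

text \<open>Extensionality fixes the value outside the positions 1 to n, so a colouring is
  determined by its n colours and equality is plain equality of functions.\<close>

definition colourings :: "nat \<Rightarrow> nat \<Rightarrow> (nat \<Rightarrow> nat) set"
  where "colourings d n = {1..n} \<rightarrow>\<^sub>E {..<d}"

definition sw :: "nat \<Rightarrow> (nat \<Rightarrow> nat) \<Rightarrow> nat \<Rightarrow> nat"
  where "sw i \<chi> = (\<lambda>j. \<chi> (transpose i (Suc i) j))"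

text \<open>For \<open>i = n\<close> these are the multiplicities of the colours; for
  \<open>a = \<chi> i\<close> the count is the rank, starting at 1, of position \<open>i\<close>
  among the positions of its own colour.\<close>

definition cnt :: "(nat \<Rightarrow> nat) \<Rightarrow> nat \<Rightarrow> nat \<Rightarrow> nat"
  where "cnt \<chi> i a = card {j \<in> {1..i}. \<chi> j = a}"

definition desc :: "nat \<Rightarrow> (nat \<Rightarrow> nat) \<Rightarrow> nat \<Rightarrow> bool"
  where "desc n \<chi> i \<longleftrightarrow> 1 \<le> i \<and> i < n \<and> \<chi> (Suc i) < \<chi> i"

text \<open>In the sorted colouring, the block of colour \<open>a\<close> starts right after this
  many positions.\<close>

definition smaller :: "nat \<Rightarrow> (nat \<Rightarrow> nat) \<Rightarrow> nat \<Rightarrow> nat"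
  where "smaller n \<chi> a = card {j \<in> {1..n}. \<chi> j < a}"

text \<open>A termination measure that is easier to handle than the number of inversions: the
  coefficients decrease with the position, so exchanging a descent lowers the sum by
  \<open>\<chi> i - \<chi> (Suc i)\<close>.\<close>

definition inversion_weight :: "nat \<Rightarrow> (nat \<Rightarrow> nat) \<Rightarrow> nat"
  where "inversion_weight n \<chi> = (\<Sum>j = 1..n. (n - j) * \<chi> j)"

section \<open>Exchanges and prefix counts\<close>

lemma sw_simps [simp]:
  "sw i \<chi> i = \<chi> (Suc i)" "sw i \<chi> (Suc i) = \<chi> i" "\<lbrakk>j \<noteq> i; j \<noteq> Suc i\<rbrakk> \<Longrightarrow> sw i \<chi> j = \<chi> j"
  by (simp_all add: sw_def transpose_def)

lemma sw_sw [simp]: "sw i (sw i \<chi>) = \<chi>"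
  by (simp add: sw_def)

lemma sw_eq: "\<chi> i = \<chi> (Suc i) \<Longrightarrow> sw i \<chi> = \<chi>"
  by (auto simp: sw_def transpose_def fun_eq_iff)

lemma sw_commute: "Suc i < j \<Longrightarrow> sw i (sw j \<chi>) = sw j (sw i \<chi>)"
  by (auto simp: sw_def transpose_def fun_eq_iff)

lemma sw_braid: "sw i (sw (Suc i) (sw i \<chi>)) = sw (Suc i) (sw i (sw (Suc i) \<chi>))"
  by (auto simp: sw_def transpose_def fun_eq_iff)

lemma colouringsD:
  assumes "\<chi> \<in> colourings d n"
  shows "\<And>j. \<lbrakk>1 \<le> j; j \<le> n\<rbrakk> \<Longrightarrow> \<chi> j < d" and "\<And>j. \<not> (1 \<le> j \<and> j \<le> n) \<Longrightarrow> \<chi> j = undefined"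
  using assms by (auto simp: colourings_def PiE_iff extensional_def)

lemma colourings_eqI:
  "\<lbrakk>\<chi> \<in> colourings d n; \<psi> \<in> colourings d n; \<And>j. \<lbrakk>1 \<le> j; j \<le> n\<rbrakk> \<Longrightarrow> \<chi> j = \<psi> j\<rbrakk> \<Longrightarrow> \<chi> = \<psi>"
  unfolding colourings_def by (rule PiE_ext) auto

lemma finite_colourings: "finite (colourings d n)"
  unfolding colourings_def by (intro finite_PiE) auto

lemma sw_colourings: "\<lbrakk>\<chi> \<in> colourings d n; 1 \<le> i; i < n\<rbrakk> \<Longrightarrow> sw i \<chi> \<in> colourings d n"
  by (auto simp: colourings_def PiE_iff extensional_def sw_def transpose_def)

lemma cnt_0 [simp]: "cnt \<chi> 0 a = 0"
  by (simp add: cnt_def)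

lemma cnt_Suc: "cnt \<chi> (Suc i) a = cnt \<chi> i a + (if \<chi> (Suc i) = a then 1 else 0)"
proof -
  have "{j \<in> {1..Suc i}. \<chi> j = a} = {j \<in> {1..i}. \<chi> j = a} \<union> (if \<chi> (Suc i) = a then {Suc i} else {})"
    by (auto simp: le_Suc_eq)
  then show ?thesis by (simp add: cnt_def card_insert_if)
qed

lemma cnt_mono: "i \<le> j \<Longrightarrow> cnt \<chi> i a \<le> cnt \<chi> j a"
  unfolding cnt_def by (intro card_mono) auto

text \<open>Only the prefix that ends between the two exchanged positions contains one of them
  without the other. The bound on \<open>i\<close> keeps position 0, which is never counted, out of
  the exchange.\<close>

lemma cnt_sw:
  assumes "1 \<le> i" "j \<noteq> i"
  shows "cnt (sw i \<chi>) j a = cnt \<chi> j a"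
proof -
  have below: "cnt (sw i \<chi>) j a = cnt \<chi> j a" if "j < i" for j
    using that unfolding cnt_def by (intro arg_cong[where f = card]) auto
  obtain i' where i': "i = Suc i'" using assms(1) by (cases i) auto
  have "cnt (sw i \<chi>) (Suc i + k) a = cnt \<chi> (Suc i + k) a" for k
    using below[of i'] by (induction k) (auto simp: cnt_Suc i')
  then show ?thesis
    using below[of j] assms(2) le_Suc_ex[of "Suc i" j] by (cases "j < i") auto
qed

text \<open>Stated additively to avoid truncated subtraction; both sides count the first
  \<open>Suc i\<close> positions.\<close>

lemma cnt_sw_self:
  assumes "1 \<le> i"
  shows "cnt (sw i \<chi>) i a + (if \<chi> i = a then 1 else 0) = cnt \<chi> i a + (if \<chi> (Suc i) = a then 1 else 0)"
  using cnt_sw[OF assms, of "Suc i" \<chi> a] by (simp add: cnt_Suc)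

lemma inversion_weight_sw:
  assumes "desc n \<chi> i"
  shows "inversion_weight n (sw i \<chi>) < inversion_weight n \<chi>"
proof -
  have i: "1 \<le> i" "i < n" "\<chi> (Suc i) < \<chi> i" using assms by (auto simp: desc_def)
  have split: "inversion_weight n \<psi> = (\<Sum>j\<in>{1..n} - {i, Suc i}. (n - j) * \<psi> j)
      + ((n - i) * \<psi> i + (n - Suc i) * \<psi> (Suc i))" for \<psi>
    unfolding inversion_weight_def using i
    by (subst sum.subset_diff[of "{i, Suc i}"]) auto
  have rest: "(\<Sum>j\<in>{1..n} - {i, Suc i}. (n - j) * sw i \<chi> j) = (\<Sum>j\<in>{1..n} - {i, Suc i}. (n - j) * \<chi> j)"
    by (intro sum.cong) auto
  obtain k where k: "n - i = Suc k" "n - Suc i = k" using i by (metis Suc_diff_Suc)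
  show ?thesis unfolding split rest k using i(3) by simp
qed

lemma desc_induct [consumes 1, case_names step]:
  assumes "\<chi> \<in> colourings d n"
    and "\<And>\<chi>. \<lbrakk>\<chi> \<in> colourings d n; \<And>i. desc n \<chi> i \<Longrightarrow> P (sw i \<chi>)\<rbrakk> \<Longrightarrow> P \<chi>"
  shows "P \<chi>"
  using assms(1)
proof (induction "inversion_weight n \<chi>" arbitrary: \<chi> rule: less_induct)
  case less
  show ?case
  proof (rule assms(2)[OF less.prems])
    fix i assume d: "desc n \<chi> i"
    show "P (sw i \<chi>)"
      by (rule less.hyps[OF inversion_weight_sw[OF d] sw_colourings[OF less.prems]])
        (use d in \<open>simp_all add: desc_def\<close>)
  qed
qed

section \<open>Sorted colourings and their blocks\<close>

lemma no_desc_mono: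
  assumes "\<And>i. \<not> desc n \<chi> i" and "1 \<le> i" "i \<le> j" "j \<le> n"
  shows "\<chi> i \<le> \<chi> j"
  using assms(3,4)
proof (induction j rule: dec_induct)
  case (step j)
  then show ?case using assms(1)[of j] assms(2) by (force simp: desc_def)
qed simp

text \<open>In a sorted colouring the positions of colour below \<open>a\<close> form an initial
  segment, and \<open>smaller n \<chi> a\<close> is its length.\<close>

lemma sorted_less_iff:
  assumes "\<And>i. \<not> desc n \<chi> i" and i: "1 \<le> i" "i \<le> n"
  shows "\<chi> i < a \<longleftrightarrow> i \<le> smaller n \<chi> a"
proof
  assume "\<chi> i < a"
  then have "\<chi> j < a" if "1 \<le> j" "j \<le> i" for j
    using no_desc_mono[OF assms(1) that i(2)] by simp
  then have "{1..i} \<subseteq> {j \<in> {1..n}. \<chi> j < a}" using i by auto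
  then have "card {1..i} \<le> smaller n \<chi> a" unfolding smaller_def by (intro card_mono) auto
  then show "i \<le> smaller n \<chi> a" by simp
next
  assume le: "i \<le> smaller n \<chi> a"
  show "\<chi> i < a"
  proof (rule ccontr)
    assume "\<not> \<chi> i < a"
    then have "\<not> \<chi> j < a" if "i \<le> j" "j \<le> n" for j
      using no_desc_mono[OF assms(1) i(1) that] by simp
    then have "{j \<in> {1..n}. \<chi> j < a} \<subseteq> {1..<i}" by (auto simp: not_le[symmetric])
    then have "smaller n \<chi> a \<le> card {1..<i}" unfolding smaller_def by (intro card_mono) auto
    then show False using le i by simp
  qed
qed

text \<open>All positions up to \<open>i\<close> have the colour of \<open>i\<close> or a smaller
  one, and all positions of smaller colour come before \<open>i\<close>; so \<open>i\<close> is the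
  offset of its block plus its rank.\<close>

lemma sorted_position:
  assumes "\<And>i. \<not> desc n \<chi> i" and i: "1 \<le> i" "i \<le> n"
  shows "i = smaller n \<chi> (\<chi> i) + cnt \<chi> i (\<chi> i)"
proof -
  have "\<chi> j < \<chi> i \<or> \<chi> j = \<chi> i" if "1 \<le> j" "j \<le> i" for j
    using no_desc_mono[OF assms(1) that i(2)] by linarith
  then have "\<forall>j. 1 \<le> j \<and> j \<le> i \<longrightarrow> \<chi> j < \<chi> i \<or> \<chi> j = \<chi> i" by blast
  moreover have "\<forall>j. j \<le> n \<and> \<chi> j < \<chi> i \<longrightarrow> j \<le> i"
    using no_desc_mono[OF assms(1) i(1)] by (meson leD nat_le_linear)
  ultimately have "{1..i} = {j \<in> {1..n}. \<chi> j < \<chi> i} \<union> {j \<in> {1..i}. \<chi> j = \<chi> i}"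
    using i by auto
  moreover have "card ({j \<in> {1..n}. \<chi> j < \<chi> i} \<union> {j \<in> {1..i}. \<chi> j = \<chi> i})
      = smaller n \<chi> (\<chi> i) + cnt \<chi> i (\<chi> i)"
    unfolding smaller_def cnt_def by (intro card_Un_disjoint) auto
  ultimately show ?thesis by (metis card_atLeastAtMost diff_Suc_1)
qed

lemma smaller_eq_sum: "smaller n \<chi> a = (\<Sum>b<a. cnt \<chi> n b)"
proof -
  have "{j \<in> {1..n}. \<chi> j < a} = (\<Union>b\<in>{..<a}. {j \<in> {1..n}. \<chi> j = b})" by auto
  then show ?thesis
    unfolding smaller_def cnt_def by (simp only:) (intro card_UN_disjoint, auto)
qed

text \<open>The thresholds of \<open>sorted_less_iff\<close> determine every colour and depend on
  the multiplicities alone.\<close>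

lemma sorted_unique:
  assumes "\<chi> \<in> colourings d n" "\<psi> \<in> colourings d n"
    and "\<And>i. \<not> desc n \<chi> i" "\<And>i. \<not> desc n \<psi> i" and "cnt \<chi> n = cnt \<psi> n"
  shows "\<chi> = \<psi>"
proof (rule colourings_eqI[OF assms(1,2)])
  fix j assume j: "1 \<le> j" "j \<le> n"
  have "\<chi> j < a \<longleftrightarrow> \<psi> j < a" for a
    using assms(5) by (simp add: sorted_less_iff[OF assms(3) j] sorted_less_iff[OF assms(4) j] smaller_eq_sum)
  then show "\<chi> j = \<psi> j" by (metis linorder_neqE_nat nat_less_le)
qed

lemma sorted_block:
  assumes "\<And>i. \<not> desc n \<chi> i" and "1 \<le> k" "k \<le> cnt \<chi> n a"
  shows "smaller n \<chi> a + k \<le> n" and "\<chi> (smaller n \<chi> a + k) = a" and "cnt \<chi> (smaller n \<chi> a + k) a = k"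
proof -
  let ?i = "smaller n \<chi> a + k"
  have s: "smaller n \<chi> (Suc a) = smaller n \<chi> a + cnt \<chi> n a" by (simp add: smaller_eq_sum)
  have "smaller n \<chi> (Suc a) \<le> card {1..n}" unfolding smaller_def by (intro card_mono) auto
  then show i: "?i \<le> n" using assms(3) s by simp
  have "\<not> \<chi> ?i < a" "\<chi> ?i < Suc a"
    using assms(2,3) by (simp_all add: sorted_less_iff[OF assms(1) _ i] s)
  then show a: "\<chi> ?i = a" by simp
  show "cnt \<chi> ?i a = k" using sorted_position[OF assms(1) _ i] assms(2) a by simp
qed

text \<open>The choice of the descent is immaterial: the sorted colouring depends only on the multiplicities of the colours.\<close>

definition pick_desc :: "nat \<Rightarrow> (nat \<Rightarrow> nat) \<Rightarrow> nat"
  where "pick_desc n \<chi> = (SOME i. desc n \<chi> i)"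

text \<open>A complete run of sorting by adjacent exchanges, recorded as a list with the earliest
  exchange first.\<close>

function descents :: "nat \<Rightarrow> (nat \<Rightarrow> nat) \<Rightarrow> nat list"
  where "descents n \<chi> =
    (if \<exists>i. desc n \<chi> i then pick_desc n \<chi> # descents n (sw (pick_desc n \<chi>) \<chi>) else [])"
  by auto

lemma pick_desc: "\<exists>i. desc n \<chi> i \<Longrightarrow> desc n \<chi> (pick_desc n \<chi>)"
  unfolding pick_desc_def by (rule someI_ex)

termination descents
  by (relation "measure (\<lambda>(n, \<chi>). inversion_weight n \<chi>)")
    (auto intro: inversion_weight_sw pick_desc)

declare descents.simps [simp del]

definition sort_col :: "nat \<Rightarrow> (nat \<Rightarrow> nat) \<Rightarrow> nat \<Rightarrow> nat"
  where "sort_col n \<chi> = fold sw (descents n \<chi>) \<chi>"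

lemma sort_col_step:
  "\<exists>i. desc n \<chi> i \<Longrightarrow> sort_col n \<chi> = sort_col n (sw (pick_desc n \<chi>) \<chi>)"
  by (simp add: sort_col_def descents.simps[of n \<chi>])

lemma sort_col_sorted: "\<nexists>i. desc n \<chi> i \<Longrightarrow> sort_col n \<chi> = \<chi>"
  unfolding sort_col_def by (subst descents.simps) (simp only: if_False fold_simps)

lemma sort_col:
  assumes "\<chi> \<in> colourings d n"
  shows "sort_col n \<chi> \<in> colourings d n \<and> (\<forall>i. \<not> desc n (sort_col n \<chi>) i) \<and>
    cnt (sort_col n \<chi>) n = cnt \<chi> n"
  using assms
proof (induction rule: desc_induct)
  case (step \<chi>)
  show ?case
  proof (cases "\<exists>i. desc n \<chi> i")
    case True
    note d = pick_desc[OF True]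
    then have "cnt (sw (pick_desc n \<chi>) \<chi>) n = cnt \<chi> n"
      by (intro ext cnt_sw) (auto simp: desc_def)
    then show ?thesis using step.IH[OF d] by (simp add: sort_col_step[OF True])
  next
    case False
    then show ?thesis using step.hyps by (simp add: sort_col_sorted)
  qed
qed

lemma sort_col_eq_iff:
  assumes "\<chi> \<in> colourings d n" "\<psi> \<in> colourings d n"
  shows "sort_col n \<chi> = sort_col n \<psi> \<longleftrightarrow> cnt \<chi> n = cnt \<psi> n"
proof
  note sorted1 = sort_col[OF assms(1)] and sorted2 = sort_col[OF assms(2)]
  note c1 = sorted1[THEN conjunct2, THEN conjunct2] and c2 = sorted2[THEN conjunct2, THEN conjunct2]
  {
    assume "sort_col n \<chi> = sort_col n \<psi>"
    then have "cnt (sort_col n \<chi>) n = cnt (sort_col n \<psi>) n" by (rule arg_cong)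
    then show "cnt \<chi> n = cnt \<psi> n" by (simp only: c1 c2)
  next
    assume "cnt \<chi> n = cnt \<psi> n"
    then have "cnt (sort_col n \<chi>) n = cnt (sort_col n \<psi>) n" by (simp only: c1 c2)
    then show "sort_col n \<chi> = sort_col n \<psi>"
      by (rule sorted_unique[OF sorted1[THEN conjunct1] sorted2[THEN conjunct1]
            sorted1[THEN conjunct2, THEN conjunct1, THEN spec] sorted2[THEN conjunct2, THEN conjunct1, THEN spec]])
  }
qed

lemma cnt_sw_total: "\<lbrakk>1 \<le> i; i < n\<rbrakk> \<Longrightarrow> cnt (sw i \<chi>) n = cnt \<chi> n"
  by (intro ext cnt_sw) auto

lemma sort_col_sw:
  assumes "\<chi> \<in> colourings d n" "1 \<le> i" "i < n"
  shows "sort_col n (sw i \<chi>) = sort_col n \<chi>"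
  by (rule iffD2[OF sort_col_eq_iff[OF sw_colourings[OF assms] assms(1)] cnt_sw_total[OF assms(2,3)]])


subsection \<open>Colourings with a given type\<close>

definition col_type :: "nat \<Rightarrow> nat \<Rightarrow> (nat \<Rightarrow> nat) \<Rightarrow> nat list"
  where "col_type d n \<chi> = map (cnt \<chi> n) [0..<d]"

lemma col_type_nth: "a < d \<Longrightarrow> col_type d n \<chi> ! a = cnt \<chi> n a"
  by (simp add: col_type_def)

lemma cnt_outside:
  assumes "\<chi> \<in> colourings d n" "d \<le> a" "i \<le> n"
  shows "cnt \<chi> i a = 0"
proof -
  have "\<chi> j \<noteq> a" if "j \<in> {1..i}" for j
    using colouringsD(1)[OF assms(1), of j] that assms(2,3) by simp
  then have "{j \<in> {1..i}. \<chi> j = a} = {}" by blast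
  then show ?thesis by (simp only: cnt_def card.empty)
qed

lemma col_type_eq_iff:
  assumes "\<chi> \<in> colourings d n" "\<psi> \<in> colourings d n"
  shows "col_type d n \<chi> = col_type d n \<psi> \<longleftrightarrow> cnt \<chi> n = cnt \<psi> n"
proof
  assume eq: "col_type d n \<chi> = col_type d n \<psi>"
  show "cnt \<chi> n = cnt \<psi> n"
  proof
    fix a show "cnt \<chi> n a = cnt \<psi> n a"
    proof (cases "a < d")
      case True
      then show ?thesis using col_type_nth[of a d n \<chi>] col_type_nth[of a d n \<psi>] eq by simp
    next
      case False
      then show ?thesis using cnt_outside[OF assms(1), of a n] cnt_outside[OF assms(2), of a n] by simp
    qed
  qed
qed (simp add: col_type_def)

lemma col_type_compositions:
  assumes "\<chi> \<in> colourings d n"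
  shows "col_type d n \<chi> \<in> compositions d n"
proof -
  have "(\<Sum>a\<in>{..<d}. \<Sum>j | j \<in> {1..n} \<and> \<chi> j = a. 1) = (\<Sum>j\<in>{1..n}. 1::nat)"
  proof (rule sum.group)
    show "\<chi> ` {1..n} \<subseteq> {..<d}"
      using colouringsD(1)[OF assms] by (intro image_subsetI) simp
  qed simp_all
  then have "(\<Sum>a<d. cnt \<chi> n a) = n" by (simp add: cnt_def)
  moreover have "sum_list (map (cnt \<chi> n) [0..<d]) = (\<Sum>a<d. cnt \<chi> n a)"
    by (simp only: interv_sum_list_conv_sum_set_nat atLeast0LessThan set_upt)
  ultimately show ?thesis by (simp add: compositions_def col_type_def)
qed

lemma finite_compositions: "finite (compositions d n)"
proof (rule finite_subset)
  show "compositions d n \<subseteq> {xs. set xs \<subseteq> {..n} \<and> length xs = d}"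
  proof (intro subsetI CollectI conjI)
    fix xs x assume "xs \<in> compositions d n"
    then have xs: "length xs = d" "sum_list xs = n" by (simp_all add: compositions_def)
    show "length xs = d" by (rule xs)
    assume "x \<in> set xs"
    then show "x \<in> {..n}" using member_le_sum_list[of x xs] xs by simp
  qed
qed (simp add: finite_lists_length_eq)

text \<open>A colouring is read as the word of its colours; list positions start at 0, hence the
  shift by one. Colourings of type \<open>\<mu>\<close> become the permutations of the multiset with
  \<open>\<mu> ! a\<close> copies of \<open>a\<close>, whose number is known.\<close>

lemma bij_colourings_permutations:
  assumes "\<mu> \<in> compositions d n"
  shows "bij_betw (\<lambda>xs. \<lambda>j\<in>{1..n}. xs ! (j - 1))
    (permutations_of_multiset (\<Sum>a<d. replicate_mset (\<mu> ! a) a))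
    {\<chi> \<in> colourings d n. col_type d n \<chi> = \<mu>}"
proof -
  let ?M = "\<Sum>a<d. replicate_mset (\<mu> ! a) a"
  let ?f = "\<lambda>xs. \<lambda>j\<in>{1..n}. xs ! (j - 1)" and ?g = "\<lambda>\<chi>. map (\<lambda>i. \<chi> (Suc i)) [0..<n]"
  have \<mu>: "length \<mu> = d" "sum_list \<mu> = n" using assms by (auto simp: compositions_def)
  have count_M: "count ?M a = (if a < d then \<mu> ! a else 0)" for a
    by (simp add: count_sum sum.delta)
  have size_M: "size ?M = n"
    using \<mu> by (simp add: sum_list_sum_nth atLeast0LessThan)
  have cnt_list: "cnt (?f xs) n a = count (mset xs) a" if "length xs = n" for xs a
  proof -
    have "{j \<in> {1..n}. ?f xs j = a} = Suc ` {i. i < length xs \<and> xs ! i = a}"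
    proof (intro equalityI subsetI)
      fix j assume "j \<in> {j \<in> {1..n}. ?f xs j = a}"
      then show "j \<in> Suc ` {i. i < length xs \<and> xs ! i = a}"
        using that by (intro image_eqI[of _ _ "j - 1"]) auto
    qed (use that in auto)
    moreover have "{i. i < length xs \<and> xs ! i = a} = {i. i < length xs \<and> a = xs ! i}" by auto
    ultimately show ?thesis
      unfolding cnt_def count_mset count_list_eq_length_filter length_filter_conv_card
      by (simp only: card_image inj_Suc)
  qed
  show ?thesis
  proof (rule bij_betw_byWitness[where f' = ?g])
    show "\<forall>xs\<in>permutations_of_multiset ?M. ?g (?f xs) = xs"
    proof
      fix xs assume "xs \<in> permutations_of_multiset ?M"
      then have "mset xs = ?M" by (rule permutations_of_multisetD)
      then have "length xs = n" using size_M by (simp only: flip: size_mset)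
      then show "?g (?f xs) = xs" by (auto intro: nth_equalityI)
    qed
    show "\<forall>\<chi>\<in>{\<chi> \<in> colourings d n. col_type d n \<chi> = \<mu>}. ?f (?g \<chi>) = \<chi>"
      by (auto simp: fun_eq_iff dest: colouringsD(2))
    show "?f ` permutations_of_multiset ?M \<subseteq> {\<chi> \<in> colourings d n. col_type d n \<chi> = \<mu>}"
    proof (intro image_subsetI CollectI conjI)
      fix xs assume "xs \<in> permutations_of_multiset ?M"
      then have "mset xs = ?M" by (rule permutations_of_multisetD)
      moreover from this have "length xs = n" using size_M by (simp only: flip: size_mset)
      ultimately have xs: "mset xs = ?M" "length xs = n" .
      have "x < d" if "x \<in> set xs" for x
      proof -
        have "count (mset xs) x > 0" using that by simp
        then show ?thesis unfolding xs(1) count_M by (simp split: if_splits)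
      qed
      then show "?f xs \<in> colourings d n"
        using xs(2) by (auto simp: colourings_def)
      show "col_type d n (?f xs) = \<mu>"
      proof (rule nth_equalityI)
        fix a assume "a < length (col_type d n (?f xs))"
        then have "a < d" by (simp add: col_type_def)
        then show "col_type d n (?f xs) ! a = \<mu> ! a"
          by (simp only: col_type_nth cnt_list[OF xs(2)] xs(1) count_M if_True)
      qed (simp add: col_type_def \<mu>)
    qed
    show "?g ` {\<chi> \<in> colourings d n. col_type d n \<chi> = \<mu>} \<subseteq> permutations_of_multiset ?M"
    proof (intro image_subsetI)
      fix \<chi> assume \<chi>: "\<chi> \<in> {\<chi> \<in> colourings d n. col_type d n \<chi> = \<mu>}"
      have fg: "?f (?g \<chi>) = \<chi>" using \<chi> by (auto simp: fun_eq_iff dest: colouringsD(2))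
      have "count (mset (?g \<chi>)) a = count ?M a" for a
      proof -
        have "count (mset (?g \<chi>)) a = cnt (?f (?g \<chi>)) n a" by (rule cnt_list[symmetric]) simp
        also have "\<dots> = cnt \<chi> n a" by (simp only: fg)
        also have "\<dots> = count ?M a"
          using \<chi> cnt_outside[of \<chi> d n a n] col_type_nth[of a d n \<chi>] by (auto simp: count_M)
        finally show ?thesis .
      qed
      then show "?g \<chi> \<in> permutations_of_multiset ?M"
        by (intro permutations_of_multisetI multiset_eqI)
    qed
  qed
qed

text \<open>The count gives the matrix size; the existence claim gives a representative from which
  the sorted colouring of type \<open>\<mu>\<close> is obtained.\<close>

lemma card_colourings_of_type:
  assumes "\<mu> \<in> compositions d n"
  shows "card {\<chi> \<in> colourings d n. col_type d n \<chi> = \<mu>} = multinomial \<mu>"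
    and "\<exists>\<chi>. \<chi> \<in> colourings d n \<and> col_type d n \<chi> = \<mu>"
proof -
  let ?M = "\<Sum>a<d. replicate_mset (\<mu> ! a) a"
  have \<mu>: "length \<mu> = d" "sum_list \<mu> = n" using assms by (auto simp: compositions_def)
  have count_M: "count ?M a = (if a < d then \<mu> ! a else 0)" for a
    by (simp add: count_sum sum.delta)
  have size_M: "size ?M = n"
    using \<mu> by (simp add: sum_list_sum_nth atLeast0LessThan)
  note bij = bij_colourings_permutations[OF assms]
  \<comment> \<open>Colours that do not occur contribute \<open>fact 0 = 1\<close>, so the support
    may be enlarged to all colours.\<close>
  have "(\<Prod>x\<in>set_mset ?M. fact (count ?M x)) = (\<Prod>x<d. fact (\<mu> ! x) :: nat)"
    by (rule prod.mono_neutral_cong_left)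
      (auto simp: count_M simp flip: count_greater_zero_iff split: if_splits)
  also have "\<dots> = (\<Prod>k\<leftarrow>\<mu>. fact k)"
    using \<mu> by (simp add: prod.list_conv_set_nth atLeast0LessThan)
  finally have "card (permutations_of_multiset ?M) = fact n div (\<Prod>k\<leftarrow>\<mu>. fact k)"
    by (simp only: card_permutations_of_multiset(1) size_M)
  then have "card (permutations_of_multiset ?M) = multinomial \<mu>" by (simp add: multinomial_def \<mu>)
  then show "card {\<chi> \<in> colourings d n. col_type d n \<chi> = \<mu>} = multinomial \<mu>"
    using bij_betw_same_card[OF bij] by simp
  have "permutations_of_multiset ?M \<noteq> {}" by simp
  then show "\<exists>\<chi>. \<chi> \<in> colourings d n \<and> col_type d n \<chi> = \<mu>"
    using bij_betw_imp_surj_on[OF bij] by blast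
qed


section \<open>Scalars\<close>

lemma const_ground_mult: "const_ground a * const_ground b = const_ground (a * b)"
  by (simp add: const_ground_def mult_single)

lemma const_ground_add: "const_ground a + const_ground b = const_ground (a + b)"
  by (simp add: const_ground_def single_add)

lemma const_ground_1: "const_ground 1 = 1"
  by (simp add: const_ground_def single_one flip: zero_prod_def)

lemma const_ground_0: "const_ground 0 = 0"
  by (simp add: const_ground_def)

lemma const_ground_sum: "(\<Sum>i\<in>S. const_ground (f i)) = const_ground (\<Sum>i\<in>S. f i)"
  by (induction S rule: infinite_finite_induct) (simp_all add: const_ground_0 const_ground_add)

definition u_inv :: ground where "u_inv = Poly_Mapping.single (- 1, 0) 1"

lemma u_inv: "u_var * u_inv = 1"
  by (simp add: u_var_def u_inv_def mult_single single_one flip: zero_prod_def)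

definition U :: ground where "U = u_var ^ 2"
definition U_inv :: ground where "U_inv = u_inv ^ 2"

lemma U_inv [simp]: "U * U_inv = 1" "U_inv * U = 1"
  using u_inv by (simp_all add: U_def U_inv_def power2_eq_square mult.left_commute) (metis mult.assoc mult.commute mult_1)+

definition zeta :: "nat \<Rightarrow> complex" where "zeta d = cis (2 * pi / d)"

text \<open>The eigenvalue of \<open>t j\<close> on the part where position \<open>j\<close> has
  colour \<open>k\<close>, as a scalar of the ground ring.\<close>

definition zp :: "nat \<Rightarrow> nat \<Rightarrow> ground" where "zp d k = const_ground (zeta d ^ k)"

lemma zeta_neq_0: "zeta d \<noteq> 0" by (simp add: zeta_def)

lemma zeta_power_d: "d \<ge> 1 \<Longrightarrow> zeta d ^ d = 1"
  by (simp add: zeta_def DeMoivre)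

lemma zeta_power_power_d:
  assumes "d \<ge> 1"
  shows "(zeta d ^ a) ^ d = 1"
proof -
  have "(zeta d ^ a) ^ d = (zeta d ^ d) ^ a" by (simp only: power_mult[symmetric] mult.commute)
  then show ?thesis by (simp add: zeta_power_d[OF assms])
qed

lemma zeta_power_eq_iff:
  assumes "a < d" "b < d"
  shows "zeta d ^ a = zeta d ^ b \<longleftrightarrow> a = b"
proof
  assume "zeta d ^ a = zeta d ^ b"
  then have "cis (2 * pi * a / d) = cis (2 * pi * b / d)"
    by (simp add: zeta_def DeMoivre mult_ac)
  then show "a = b"
    using inj_onD[OF bij_betw_imp_inj_on[OF bij_betw_roots_unity[of d]], of a b] assms by simp
qed simp

text \<open>A geometric sum of a d-th root of unity. Both ranges occur: the idempotents sum over
  exponents below \<open>d\<close>, the elements \<open>e i\<close> over exponents from 1 to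
  \<open>d\<close>.\<close>

lemma character_sum:
  assumes "a < d" "b < d"
  shows "(\<Sum>s<d. (zeta d ^ a / zeta d ^ b) ^ s) = (if a = b then of_nat d else 0)"
    and "(\<Sum>s = 1..d. (zeta d ^ a / zeta d ^ b) ^ s) = (if a = b then of_nat d else 0)"
proof -
  let ?q = "zeta d ^ a / zeta d ^ b"
  have qd: "?q ^ d = 1"
    using assms by (simp add: power_divide zeta_power_power_d)
  show 1: "(\<Sum>s<d. ?q ^ s) = (if a = b then of_nat d else 0)"
    using zeta_power_eq_iff[OF assms] qd zeta_neq_0[of d] by (auto simp: sum_gp_strict)
  \<comment> \<open>Shifting the index multiplies the sum by \<open>?q\<close>; this changes
    nothing, since either \<open>?q\<close> is 1 or the sum is zero.\<close>
  have "(\<Sum>s = 1..d. ?q ^ s) = ?q * (\<Sum>s<d. ?q ^ s)"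
    by (simp add: sum_distrib_left sum.shift_bounds_Suc_ivl[symmetric] lessThan_atLeast0 atLeastLessThanSuc_atLeastAtMost
        flip: power_Suc sum.atLeast_Suc_lessThan_Suc_shift)
  then show "(\<Sum>s = 1..d. ?q ^ s) = (if a = b then of_nat d else 0)"
    using 1 by (auto simp: zeta_neq_0)
qed

lemma zp_power: "zp d b ^ s = const_ground ((zeta d ^ b) ^ s)"
  by (induction s) (simp_all add: zp_def const_ground_1 const_ground_mult)

text \<open>The scalar by which \<open>e i\<close> acts where positions \<open>i\<close> and
  \<open>i + 1\<close> have colours \<open>a\<close> and \<open>b\<close>. Since the d-th power of
  \<open>zeta d ^ b\<close> is 1, the exponent \<open>d - s\<close> amounts to \<open>-s\<close>,
  and a character sum remains.\<close>

lemma e_scalar: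
  assumes "a < d" "b < d"
  shows "const_ground (1 / of_nat d) * (\<Sum>s\<in>{1..d}. zp d a ^ s * zp d b ^ (d - s)) = (if a = b then 1 else 0)"
proof -
  have d: "d \<ge> 1" using assms by simp
  have sc: "zp d a ^ s * zp d b ^ (d - s) = const_ground ((zeta d ^ a / zeta d ^ b) ^ s)" if "s \<in> {1..d}" for s
  proof -
    have "(zeta d ^ b) ^ (d - s) = (zeta d ^ b) ^ d / (zeta d ^ b) ^ s"
      using that by (intro power_diff) (simp_all add: zeta_neq_0)
    then show ?thesis
      by (simp add: zp_power const_ground_mult zeta_power_power_d[OF d] power_divide)
  qed
  have "(\<Sum>s\<in>{1..d}. zp d a ^ s * zp d b ^ (d - s)) = (\<Sum>s\<in>{1..d}. const_ground ((zeta d ^ a / zeta d ^ b) ^ s))"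
    by (intro sum.cong refl sc)
  then show ?thesis
    unfolding const_ground_sum using d
    by (simp only: character_sum(2)[OF assms]) (simp add: const_ground_mult const_ground_1 const_ground_0)
qed


section \<open>Spectral idempotents of an element of finite order\<close>

context kalgebra
begin

lemma finsum_scalar:
  assumes "x \<in> carrier A"
  shows "(\<Oplus>i\<in>S. c i \<odot> x) = (\<Sum>i\<in>S. c i) \<odot> x"
  by (induction S rule: infinite_finite_induct) (simp_all add: assms smult_l_distr finsum_infinite)

lemma finsum_swap:
  assumes "finite S" "finite T" "\<And>i j. \<lbrakk>i \<in> S; j \<in> T\<rbrakk> \<Longrightarrow> f i j \<in> carrier A"
  shows "(\<Oplus>i\<in>S. \<Oplus>j\<in>T. f i j) = (\<Oplus>j\<in>T. \<Oplus>i\<in>S. f i j)"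
  using assms(1,3)
proof (induction S rule: finite_induct)
  case (insert i S)
  have c: "f i j \<in> carrier A" if "j \<in> T" for j using insert.prems that by simp
  have cs: "f k j \<in> carrier A" if "k \<in> S" "j \<in> T" for k j using insert.prems that by simp
  have "(\<Oplus>k\<in>insert i S. \<Oplus>j\<in>T. f k j) = (\<Oplus>j\<in>T. f i j) \<oplus> (\<Oplus>k\<in>S. \<Oplus>j\<in>T. f k j)"
    using insert.hyps c cs by (intro finsum_insert) (auto intro!: finsum_closed)
  also have "(\<Oplus>k\<in>S. \<Oplus>j\<in>T. f k j) = (\<Oplus>j\<in>T. \<Oplus>k\<in>S. f k j)" by (rule insert.IH) (rule cs)
  also have "(\<Oplus>j\<in>T. f i j) \<oplus> \<dots> = (\<Oplus>j\<in>T. f i j \<oplus> (\<Oplus>k\<in>S. f k j))"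
    using c cs by (intro finsum_addf[symmetric]) (auto intro!: finsum_closed)
  also have "\<dots> = (\<Oplus>j\<in>T. \<Oplus>k\<in>insert i S. f k j)"
    using c cs insert.hyps by (intro add.finprod_cong' refl) (auto intro!: finsum_closed)
  finally show ?case .
qed simp

end

locale root_algebra = kalgebra A for A :: "(ground, 'a) module" (structure) +
  fixes d :: nat
  assumes d_pos: "d \<ge> 1"
begin

text \<open>Discrete Fourier inversion: if the d-th power of \<open>x\<close> is 1, this is the
  projector onto the eigenspace of \<open>x\<close> with eigenvalue
  \<open>zeta d ^ a\<close>.\<close>

definition eps :: "'a \<Rightarrow> nat \<Rightarrow> 'a"
  where "eps x a = const_ground (1 / of_nat d) \<odot> (\<Oplus>s\<in>{..<d}. const_ground ((1 / zeta d ^ a) ^ s) \<odot> x [^] s)"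

lemma eps_closed [simp]: "x \<in> carrier A \<Longrightarrow> eps x a \<in> carrier A"
  by (simp add: eps_def Pi_def)

lemma eigen_power:
  assumes "x \<in> carrier A" "y \<in> carrier A" "x \<otimes> y = c \<odot> y"
  shows "x [^] s \<otimes> y = c ^ s \<odot> y"
proof (induction s)
  case (Suc s)
  have "x [^] Suc s \<otimes> y = x [^] s \<otimes> (x \<otimes> y)" using assms by (simp add: m_assoc)
  also have "\<dots> = c \<odot> (x [^] s \<otimes> y)" using assms by (simp add: smult_mult_right)
  finally show ?case using assms(2) by (simp add: Suc smult_smult)
qed (simp add: assms)

lemma eigen_power_right:
  assumes "x \<in> carrier A" "y \<in> carrier A" "y \<otimes> x = c \<odot> y"
  shows "y \<otimes> x [^] s = c ^ s \<odot> y"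
proof (induction s)
  case (Suc s)
  have "y \<otimes> x [^] Suc s = (y \<otimes> x [^] s) \<otimes> x" using assms by (simp add: m_assoc)
  then show ?case using assms by (simp add: Suc smult_mult_left smult_smult mult.commute)
qed (simp add: assms)

lemma eps_scalar:
  assumes "a < d" "b < d"
  shows "const_ground (1 / of_nat d) * (\<Sum>s<d. const_ground ((1 / zeta d ^ a) ^ s) * zp d b ^ s)
    = (if a = b then 1 else 0)"
proof -
  have "(\<Sum>s<d. const_ground ((1 / zeta d ^ a) ^ s) * zp d b ^ s) = const_ground (\<Sum>s<d. (zeta d ^ b / zeta d ^ a) ^ s)"
    by (simp add: zp_power const_ground_mult const_ground_sum power_divide)
  then show ?thesis
    using assms d_pos by (simp add: character_sum const_ground_mult const_ground_1 const_ground_0)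
qed

lemma eps_eigen:
  assumes "x \<in> carrier A" "y \<in> carrier A" "x \<otimes> y = zp d b \<odot> y" "a < d" "b < d"
  shows "eps x a \<otimes> y = (if a = b then y else \<zero>)"
proof -
  have "eps x a \<otimes> y = const_ground (1 / of_nat d) \<odot> (\<Oplus>s\<in>{..<d}. (const_ground ((1 / zeta d ^ a) ^ s) * zp d b ^ s) \<odot> y)"
    unfolding eps_def using assms
    by (simp add: smult_mult_left finsum_mult_right eigen_power[OF assms(1-3)] smult_smult Pi_def)
  then show ?thesis
    using assms eps_scalar[OF assms(4,5)] by (simp add: finsum_scalar smult_smult)
qed

lemma eps_eigen_right:
  assumes "x \<in> carrier A" "y \<in> carrier A" "y \<otimes> x = zp d b \<odot> y" "a < d" "b < d"
  shows "y \<otimes> eps x a = (if a = b then y else \<zero>)"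
proof -
  have "y \<otimes> eps x a = const_ground (1 / of_nat d) \<odot> (\<Oplus>s\<in>{..<d}. (const_ground ((1 / zeta d ^ a) ^ s) * zp d b ^ s) \<odot> y)"
    unfolding eps_def using assms
    by (simp add: smult_mult_right finsum_mult_left eigen_power_right[OF assms(1-3)] smult_smult Pi_def)
  then show ?thesis
    using assms eps_scalar[OF assms(4,5)] by (simp add: finsum_scalar smult_smult)
qed

text \<open>Multiplying by \<open>zp d a\<close> gives the sum of the \<open>f s\<close>,
  multiplying by \<open>x\<close> the sum of the \<open>f (Suc s)\<close>. The two agree cyclically:
  the term at \<open>d\<close> equals the term at 0, because \<open>x\<close> and the root of unity
  both have d-th power 1.\<close>

lemma mult_eps:
  assumes x: "x \<in> carrier A" "x [^] d = \<one>" and "a < d"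
  shows "x \<otimes> eps x a = zp d a \<odot> eps x a" and "eps x a \<otimes> x = zp d a \<odot> eps x a"
proof -
  define f where "f s = const_ground (zeta d ^ a * (1 / zeta d ^ a) ^ s) \<odot> x [^] s" for s
  have f: "f s \<in> carrier A" for s using x by (simp add: f_def)
  obtain d' where d': "d = Suc d'" using d_pos by (cases d) auto
  have fd: "f d = f 0"
  proof -
    have "(1 / zeta d ^ a) ^ d = 1"
      by (simp add: power_divide zeta_power_power_d[OF d_pos])
    then show ?thesis using x by (simp add: f_def)
  qed
  have "(\<Oplus>s\<in>{..d'}. f (Suc s)) \<oplus> f 0 = (\<Oplus>s\<in>{..Suc d'}. f s)"
    using f by (subst finsum_Suc2) (simp_all add: Pi_def)
  also have "\<dots> = f (Suc d') \<oplus> (\<Oplus>s\<in>{..d'}. f s)"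
    using f by (subst finsum_Suc) (simp_all add: Pi_def)
  also have "\<dots> = (\<Oplus>s\<in>{..d'}. f s) \<oplus> f 0"
    using fd f d' by (simp add: a_comm Pi_def)
  finally have shift: "(\<Oplus>s\<in>{..<d}. f (Suc s)) = (\<Oplus>s\<in>{..<d}. f s)"
    using f by (simp add: d' lessThan_Suc_atMost Pi_def)
  have r: "zp d a \<odot> eps x a = const_ground (1 / of_nat d) \<odot> (\<Oplus>s\<in>{..<d}. f s)"
    unfolding eps_def f_def using x
    by (simp add: smult_smult finsum_smult const_ground_mult zp_def mult_ac Pi_def)
  have step: "f (Suc s) = const_ground ((1 / zeta d ^ a) ^ s) \<odot> x [^] Suc s" for s
    by (simp add: f_def zeta_neq_0)
  have pow: "x \<otimes> x [^] s = x [^] Suc s" for s using x(1) by (metis nat_pow_Suc2)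
  have "x \<otimes> eps x a = const_ground (1 / of_nat d) \<odot> (\<Oplus>s\<in>{..<d}. f (Suc s))"
    unfolding eps_def step using x
    by (simp add: smult_mult_right finsum_mult_left Pi_def pow del: nat_pow_Suc)
  then show "x \<otimes> eps x a = zp d a \<odot> eps x a" by (simp only: r shift)
  have "eps x a \<otimes> x = const_ground (1 / of_nat d) \<odot> (\<Oplus>s\<in>{..<d}. f (Suc s))"
    unfolding eps_def step using x
    by (simp add: smult_mult_left finsum_mult_right Pi_def)
  then show "eps x a \<otimes> x = zp d a \<odot> eps x a" by (simp only: r shift)
qed

text \<open>Summing over the eigenvalues before the exponents leaves a character sum, which kills
  every power of \<open>x\<close> except the zeroth.\<close>

lemma sum_eps:
  assumes "x \<in> carrier A"
  shows "(\<Oplus>a\<in>{..<d}. eps x a) = \<one>"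
proof -
  have "(\<Oplus>a\<in>{..<d}. eps x a) = (\<Oplus>a\<in>{..<d}. \<Oplus>s\<in>{..<d}. const_ground ((1 / of_nat d) * (1 / zeta d ^ a) ^ s) \<odot> x [^] s)"
    using assms by (intro add.finprod_cong' refl) (simp_all add: eps_def finsum_smult smult_smult const_ground_mult Pi_def)
  also have "\<dots> = (\<Oplus>s\<in>{..<d}. \<Oplus>a\<in>{..<d}. const_ground ((1 / of_nat d) * (1 / zeta d ^ a) ^ s) \<odot> x [^] s)"
    using assms by (intro finsum_swap) simp_all
  also have "\<dots> = (\<Oplus>s\<in>{..<d}. (if s = 0 then 1 else 0) \<odot> x [^] s)"
  proof (rule add.finprod_cong')
    fix s assume "s \<in> {..<d}"
    then have s: "s < d" by simp
    have "(\<Sum>a<d. (1 / zeta d ^ a) ^ s) = (\<Sum>a<d. (zeta d ^ 0 / zeta d ^ s) ^ a)"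
      by (intro sum.cong refl) (simp add: power_divide mult.commute flip: power_mult)
    also have "\<dots> = (if s = 0 then of_nat d else 0)"
      using character_sum(1)[of 0 d s] s by auto
    finally have "(\<Sum>a<d. const_ground ((1 / of_nat d) * (1 / zeta d ^ a) ^ s)) = (if s = 0 then 1 else 0)"
      using d_pos unfolding const_ground_sum sum_distrib_left[symmetric]
      by (simp add: const_ground_1 const_ground_0)
    then show "(\<Oplus>a\<in>{..<d}. const_ground ((1 / of_nat d) * (1 / zeta d ^ a) ^ s) \<odot> x [^] s) = (if s = 0 then 1 else 0) \<odot> x [^] s"
      using assms by (simp add: finsum_scalar)
  qed (use assms in simp_all)
  also have "\<dots> = \<one>"
    by (rule finsum_delta[of _ 0]) (use d_pos assms in simp_all)
  finally show ?thesis .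
qed

lemma eps_commute:
  assumes "x \<in> carrier A" "y \<in> carrier A" "x \<otimes> y = y \<otimes> x"
  shows "y \<otimes> eps x a = eps x a \<otimes> y"
proof -
  have "y \<otimes> x [^] s = x [^] s \<otimes> y" for s :: nat
  proof (induction s)
    case (Suc s)
    have "y \<otimes> x [^] Suc s = (y \<otimes> x [^] s) \<otimes> x" using assms by (simp add: m_assoc)
    also have "\<dots> = x [^] s \<otimes> (y \<otimes> x)" using assms by (simp add: Suc m_assoc)
    finally show ?case using assms by (simp add: m_assoc)
  qed (simp add: assms)
  then show ?thesis
    unfolding eps_def using assms
    by (simp add: smult_mult_left smult_mult_right finsum_mult_left finsum_mult_right Pi_def)
qed

end


section \<open>Algebras satisfying the Yokonuma--Hecke relations\<close>

text \<open>One interface for the relations, independent of the presentation. It is met by the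
  cyclotomic algebra itself, by each block of a corner and each tensor factor (there with d = 1 and
  all \<open>t j\<close> equal to 1), and by the operators on functions. Closure is demanded at
  every index, so that products can be formed without range conditions, while the relations are
  restricted to valid indices.\<close>

locale yh_rep = root_algebra A d for A :: "(ground, 'a) module" (structure) and d +
  fixes n :: nat and vs :: "ground list" and g t :: "nat \<Rightarrow> 'a" and X Xi :: 'a
  assumes g_closed [simp]: "g i \<in> carrier A" and t_closed [simp]: "t j \<in> carrier A"
    and X_closed [simp]: "X \<in> carrier A" and Xi_closed [simp]: "Xi \<in> carrier A"
    and g_commute: "\<lbrakk>1 \<le> i; Suc i < j; j < n\<rbrakk> \<Longrightarrow> g i \<otimes> g j = g j \<otimes> g i"
    and g_braid: "\<lbrakk>1 \<le> i; Suc i < n\<rbrakk> \<Longrightarrow> g i \<otimes> (g (Suc i) \<otimes> g i) = g (Suc i) \<otimes> (g i \<otimes> g (Suc i))"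
    and X_Xi: "X \<otimes> Xi = \<one>" and Xi_X: "Xi \<otimes> X = \<one>"
    and X_g_braid: "1 < n \<Longrightarrow> X \<otimes> (g 1 \<otimes> (X \<otimes> g 1)) = g 1 \<otimes> (X \<otimes> (g 1 \<otimes> X))"
    and X_g: "\<lbrakk>2 \<le> i; i < n\<rbrakk> \<Longrightarrow> X \<otimes> g i = g i \<otimes> X"
    and t_commute: "\<lbrakk>i \<in> {1..n}; j \<in> {1..n}\<rbrakk> \<Longrightarrow> t i \<otimes> t j = t j \<otimes> t i"
    and g_t: "\<lbrakk>1 \<le> i; i < n; j \<in> {1..n}\<rbrakk> \<Longrightarrow> g i \<otimes> t j = t (transpose i (Suc i) j) \<otimes> g i"
    and t_power: "j \<in> {1..n} \<Longrightarrow> t j [^] d = \<one>"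
    and X_t: "j \<in> {1..n} \<Longrightarrow> X \<otimes> t j = t j \<otimes> X"
    and g_square: "\<lbrakk>1 \<le> i; i < n\<rbrakk> \<Longrightarrow> g i \<otimes> g i = U \<odot> \<one> \<oplus> v_var \<odot> ((const_ground (1 / of_nat d) \<odot>
        (\<Oplus>s\<in>{1..d}. t i [^] s \<otimes> t (Suc i) [^] (d - s))) \<otimes> g i)"
    and X_cyclotomic: "foldr (\<lambda>c y. (X \<ominus> c \<odot> \<one>) \<otimes> y) vs \<one> = \<zero>"
begin

lemma g_comm: "\<lbrakk>1 \<le> i; i < n; 1 \<le> j; j < n; Suc i < j \<or> Suc j < i\<rbrakk> \<Longrightarrow> g i \<otimes> g j = g j \<otimes> g i"
  using g_commute[of i j] g_commute[of j i] by auto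


subsection \<open>The idempotents of the colourings\<close>

text \<open>Partial products over the first \<open>k\<close> positions, so that statements about the
  full idempotent \<open>tE n\<close> can be proved by induction on \<open>k\<close>.\<close>

definition tE :: "nat \<Rightarrow> (nat \<Rightarrow> nat) \<Rightarrow> 'a"
  where "tE k \<chi> = rec_nat \<one> (\<lambda>j p. p \<otimes> eps (t (Suc j)) (\<chi> (Suc j))) k"

abbreviation E :: "(nat \<Rightarrow> nat) \<Rightarrow> 'a" where "E \<equiv> tE n"

lemma tE_0 [simp]: "tE 0 \<chi> = \<one>" and tE_Suc: "tE (Suc k) \<chi> = tE k \<chi> \<otimes> eps (t (Suc k)) (\<chi> (Suc k))"
  by (simp_all add: tE_def)

lemma tE_closed [simp]: "tE k \<chi> \<in> carrier A"
  by (induction k) (simp_all add: tE_Suc)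

definition left_eigen :: "(nat \<Rightarrow> nat) \<Rightarrow> 'a \<Rightarrow> bool"
  where "left_eigen \<psi> y \<longleftrightarrow> y \<in> carrier A \<and> (\<forall>j\<in>{1..n}. t j \<otimes> y = zp d (\<psi> j) \<odot> y)"

definition right_eigen :: "(nat \<Rightarrow> nat) \<Rightarrow> 'a \<Rightarrow> bool"
  where "right_eigen \<psi> y \<longleftrightarrow> y \<in> carrier A \<and> (\<forall>j\<in>{1..n}. y \<otimes> t j = zp d (\<psi> j) \<odot> y)"

text \<open>On a simultaneous eigenvector each factor acts as 1 or 0 according to whether its colour
  is the right one, so the whole product tests equality of colourings.\<close>

lemma E_left_eigen:
  assumes "left_eigen \<psi> y" "\<chi> \<in> colourings d n" "\<psi> \<in> colourings d n"
  shows "E \<chi> \<otimes> y = (if \<chi> = \<psi> then y else \<zero>)"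
proof -
  have y: "y \<in> carrier A" and eig: "\<And>j. j \<in> {1..n} \<Longrightarrow> t j \<otimes> y = zp d (\<psi> j) \<odot> y"
    using assms(1) by (auto simp: left_eigen_def)
  have "tE k \<chi> \<otimes> y = (if \<forall>j\<in>{1..k}. \<chi> j = \<psi> j then y else \<zero>)" if "k \<le> n" for k
    using that
  proof (induction k)
    case 0 then show ?case using y by simp
  next
    case (Suc k)
    have j: "Suc k \<in> {1..n}" using Suc.prems by simp
    have "eps (t (Suc k)) (\<chi> (Suc k)) \<otimes> y = (if \<chi> (Suc k) = \<psi> (Suc k) then y else \<zero>)"
      using j colouringsD(1)[OF assms(2)] colouringsD(1)[OF assms(3)]
      by (intro eps_eigen) (simp_all add: y eig)
    then have "tE (Suc k) \<chi> \<otimes> y = tE k \<chi> \<otimes> (if \<chi> (Suc k) = \<psi> (Suc k) then y else \<zero>)"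
      using y by (simp add: tE_Suc m_assoc)
    then show ?case using Suc y by (auto simp: le_Suc_eq)
  qed
  note this[of n]
  moreover have "(\<forall>j\<in>{1..n}. \<chi> j = \<psi> j) \<longleftrightarrow> \<chi> = \<psi>"
    using colourings_eqI[OF assms(2,3)] by (metis atLeastAtMost_iff)
  ultimately show ?thesis by simp
qed

lemma E_right_eigen:
  assumes "right_eigen \<psi> y" "\<chi> \<in> colourings d n" "\<psi> \<in> colourings d n"
  shows "y \<otimes> E \<chi> = (if \<chi> = \<psi> then y else \<zero>)"
proof -
  have y: "y \<in> carrier A" and eig: "\<And>j. j \<in> {1..n} \<Longrightarrow> y \<otimes> t j = zp d (\<psi> j) \<odot> y"
    using assms(1) by (auto simp: right_eigen_def)
  have "y \<otimes> tE k \<chi> = (if \<forall>j\<in>{1..k}. \<chi> j = \<psi> j then y else \<zero>)" if "k \<le> n" for k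
    using that
  proof (induction k)
    case 0 then show ?case using y by simp
  next
    case (Suc k)
    have j: "Suc k \<in> {1..n}" using Suc.prems by simp
    have eps: "y \<otimes> eps (t (Suc k)) (\<chi> (Suc k)) = (if \<chi> (Suc k) = \<psi> (Suc k) then y else \<zero>)"
      using j colouringsD(1)[OF assms(2)] colouringsD(1)[OF assms(3)]
      by (intro eps_eigen_right) (simp_all add: y eig)
    have "y \<otimes> tE (Suc k) \<chi> = (y \<otimes> tE k \<chi>) \<otimes> eps (t (Suc k)) (\<chi> (Suc k))"
      using y by (simp add: tE_Suc m_assoc)
    then show ?case using Suc y eps by (auto simp: le_Suc_eq)
  qed
  note this[of n]
  moreover have "(\<forall>j\<in>{1..n}. \<chi> j = \<psi> j) \<longleftrightarrow> \<chi> = \<psi>"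
    using colourings_eqI[OF assms(2,3)] by (metis atLeastAtMost_iff)
  ultimately show ?thesis by simp
qed

lemma t_tE_commute: "\<lbrakk>j \<in> {1..n}; k \<le> n\<rbrakk> \<Longrightarrow> t j \<otimes> tE k \<chi> = tE k \<chi> \<otimes> t j"
proof (induction k)
  case (Suc k)
  have e: "t j \<otimes> eps (t (Suc k)) (\<chi> (Suc k)) = eps (t (Suc k)) (\<chi> (Suc k)) \<otimes> t j"
    using Suc.prems by (intro eps_commute t_commute) simp_all
  have "t j \<otimes> tE (Suc k) \<chi> = (t j \<otimes> tE k \<chi>) \<otimes> eps (t (Suc k)) (\<chi> (Suc k))"
    by (simp add: tE_Suc m_assoc)
  also have "\<dots> = tE k \<chi> \<otimes> (t j \<otimes> eps (t (Suc k)) (\<chi> (Suc k)))" using Suc by (simp add: m_assoc)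
  finally show ?case by (simp add: e tE_Suc m_assoc)
qed simp

lemma t_E:
  assumes j: "j \<in> {1..n}" and \<chi>: "\<chi> \<in> colourings d n"
  shows "t j \<otimes> E \<chi> = zp d (\<chi> j) \<odot> E \<chi>" and "E \<chi> \<otimes> t j = zp d (\<chi> j) \<odot> E \<chi>"
proof -
  have "t j \<otimes> tE k \<chi> = zp d (\<chi> j) \<odot> tE k \<chi>" if "j \<le> k" "k \<le> n" for k
    using that
  proof (induction k)
    case 0 then show ?case using j by simp
  next
    case (Suc k)
    let ?e = "eps (t (Suc k)) (\<chi> (Suc k))"
    show ?case
    proof (cases "j = Suc k")
      case True
      have "t j \<otimes> tE (Suc k) \<chi> = tE k \<chi> \<otimes> (t j \<otimes> ?e)"
        using Suc.prems j by (simp add: tE_Suc m_assoc[symmetric] t_tE_commute)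
      also have "t j \<otimes> ?e = zp d (\<chi> j) \<odot> ?e"
        unfolding True using True j t_power[OF j] colouringsD(1)[OF \<chi>, of j] by (intro mult_eps) simp_all
      finally show ?thesis by (simp add: tE_Suc smult_mult_right)
    next
      case False
      then have "t j \<otimes> tE k \<chi> = zp d (\<chi> j) \<odot> tE k \<chi>" using Suc by simp
      then have "t j \<otimes> tE k \<chi> \<otimes> ?e = zp d (\<chi> j) \<odot> tE k \<chi> \<otimes> ?e" by simp
      then show ?thesis by (simp add: tE_Suc smult_mult_left m_assoc)
    qed
  qed
  from this[of n] show 1: "t j \<otimes> E \<chi> = zp d (\<chi> j) \<odot> E \<chi>" using j by simp
  then show "E \<chi> \<otimes> t j = zp d (\<chi> j) \<odot> E \<chi>" using t_tE_commute[OF j order_refl, of \<chi>] by simp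
qed

lemma E_eigen: "\<chi> \<in> colourings d n \<Longrightarrow> left_eigen \<chi> (E \<chi>)" "\<chi> \<in> colourings d n \<Longrightarrow> right_eigen \<chi> (E \<chi>)"
  by (simp_all add: left_eigen_def right_eigen_def t_E)

lemma E_E: "\<lbrakk>\<chi> \<in> colourings d n; \<psi> \<in> colourings d n\<rbrakk> \<Longrightarrow> E \<chi> \<otimes> E \<psi> = (if \<chi> = \<psi> then E \<psi> else \<zero>)"
  by (rule E_left_eigen[OF E_eigen(1)])

lemma E_E_assoc:
  "\<lbrakk>\<chi> \<in> colourings d n; y \<in> carrier A\<rbrakk> \<Longrightarrow> E \<chi> \<otimes> (E \<chi> \<otimes> y) = E \<chi> \<otimes> y"
  by (simp add: m_assoc[symmetric] E_E)

text \<open>Completeness of the idempotents, by downward induction on the number of factors: summing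
  over the colours of position \<open>Suc k\<close> removes the last factor, since the
  \<open>eps\<close> of one element add up to 1.\<close>

lemma all_E_zero:
  assumes y: "y \<in> carrier A" and z: "\<And>\<chi>. \<chi> \<in> colourings d n \<Longrightarrow> y \<otimes> E \<chi> = \<zero>"
  shows "y = \<zero>"
proof -
  have "\<forall>\<chi>\<in>colourings d n. y \<otimes> tE k \<chi> = \<zero>" if "k \<le> n" for k
    using that
  proof (induction k rule: inc_induct)
    case base then show ?case using z by simp
  next
    case (step k)
    show ?case
    proof
      fix \<chi> assume \<chi>: "\<chi> \<in> colourings d n"
      have upd: "tE k (\<chi>(Suc k := a)) = tE k \<chi>" for a
      proof -
        have "tE l (\<chi>(Suc k := a)) = tE l \<chi>" if "l \<le> k" for l
          using that by (induction l) (simp_all add: tE_Suc)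
        then show ?thesis by simp
      qed
      have z': "y \<otimes> tE k \<chi> \<otimes> eps (t (Suc k)) a = \<zero>" if "a < d" for a
      proof -
        have "\<chi>(Suc k := a) \<in> colourings d n"
          using \<chi> that step.hyps by (auto simp: colourings_def PiE_iff extensional_def)
        then have "y \<otimes> tE (Suc k) (\<chi>(Suc k := a)) = \<zero>" using step.IH by blast
        then show ?thesis using y by (simp add: tE_Suc upd m_assoc)
      qed
      have "y \<otimes> tE k \<chi> = (y \<otimes> tE k \<chi>) \<otimes> (\<Oplus>a\<in>{..<d}. eps (t (Suc k)) a)"
        using y by (simp add: sum_eps)
      also have "\<dots> = (\<Oplus>a\<in>{..<d}. (y \<otimes> tE k \<chi>) \<otimes> eps (t (Suc k)) a)"
        using y by (intro finsum_mult_left) simp_all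
      also have "\<dots> = \<zero>" by (intro add.finprod_one_eqI) (simp add: z')
      finally show "y \<otimes> tE k \<chi> = \<zero>" .
    qed
  qed
  \<comment> \<open>\<open>tE 0\<close> does not depend on the colouring, but some colouring must
    exist; colour 0 is available because \<open>d\<close> is positive.\<close>
  moreover have "(\<lambda>j\<in>{1..n}. 0) \<in> colourings d n"
    using d_pos by (simp add: colourings_def)
  ultimately have "y \<otimes> tE 0 (\<lambda>j\<in>{1..n}. 0) = \<zero>" by blast
  then show ?thesis using y by simp
qed

lemma eq_by_E:
  assumes "x \<in> carrier A" "y \<in> carrier A" "\<And>\<chi>. \<chi> \<in> colourings d n \<Longrightarrow> x \<otimes> E \<chi> = y \<otimes> E \<chi>"
  shows "x = y"
proof -
  have diff: "(x \<ominus> y) \<otimes> E \<chi> = \<zero>" if "\<chi> \<in> colourings d n" for \<chi>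
  proof -
    have "(x \<ominus> y) \<otimes> E \<chi> = x \<otimes> E \<chi> \<ominus> y \<otimes> E \<chi>"
      using assms(1,2) by (simp add: minus_eq l_distr l_minus)
    also have "\<dots> = \<zero>" using assms(2) by (simp add: assms(3)[OF that] minus_eq r_neg)
    finally show ?thesis .
  qed
  have "x \<ominus> y = \<zero>" by (rule all_E_zero[OF minus_closed[OF assms(1,2)] diff])
  then show ?thesis using assms(1,2) by (simp only: minus_eq_zero_iff)
qed

lemma sum_E: "(\<Oplus>\<chi>\<in>colourings d n. E \<chi>) = \<one>"
proof (rule eq_by_E)
  fix \<psi> assume \<psi>: "\<psi> \<in> colourings d n"
  have "(\<Oplus>\<chi>\<in>colourings d n. E \<chi>) \<otimes> E \<psi> = (\<Oplus>\<chi>\<in>colourings d n. E \<chi> \<otimes> E \<psi>)"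
    by (rule finsum_mult_right) simp_all
  also have "\<dots> = E \<psi>"
    by (rule finsum_delta[OF finite_colourings \<psi>]) (use \<psi> in \<open>simp_all add: E_E\<close>)
  finally show "(\<Oplus>\<chi>\<in>colourings d n. E \<chi>) \<otimes> E \<psi> = \<one> \<otimes> E \<psi>" by simp
qed simp_all

text \<open>Since \<open>X\<close> commutes with the \<open>t j\<close>,
  \<open>X \<otimes> E \<chi>\<close> is a left eigenvector and \<open>E \<chi> \<otimes> X\<close>
  a right one, with the eigenvalues of \<open>\<chi>\<close>; so both equal
  \<open>E \<chi> \<otimes> X \<otimes> E \<chi>\<close>.\<close>

lemma X_E: "\<chi> \<in> colourings d n \<Longrightarrow> X \<otimes> E \<chi> = E \<chi> \<otimes> X"
proof -
  assume \<chi>: "\<chi> \<in> colourings d n"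
  have "left_eigen \<chi> (X \<otimes> E \<chi>)"
    unfolding left_eigen_def
  proof (intro conjI ballI)
    fix j assume j: "j \<in> {1..n}"
    have "t j \<otimes> (X \<otimes> E \<chi>) = X \<otimes> (t j \<otimes> E \<chi>)" using j by (simp add: m_assoc[symmetric] X_t)
    then show "t j \<otimes> (X \<otimes> E \<chi>) = zp d (\<chi> j) \<odot> (X \<otimes> E \<chi>)" using j \<chi> by (simp add: t_E smult_mult_right)
  qed simp
  then have 1: "E \<chi> \<otimes> (X \<otimes> E \<chi>) = X \<otimes> E \<chi>" using E_left_eigen[of \<chi>] \<chi> by simp
  have "right_eigen \<chi> (E \<chi> \<otimes> X)"
    unfolding right_eigen_def
  proof (intro conjI ballI)
    fix j assume j: "j \<in> {1..n}"
    have "(E \<chi> \<otimes> X) \<otimes> t j = (E \<chi> \<otimes> t j) \<otimes> X" using j by (simp add: m_assoc X_t)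
    then show "(E \<chi> \<otimes> X) \<otimes> t j = zp d (\<chi> j) \<odot> (E \<chi> \<otimes> X)" using j \<chi> by (simp add: t_E smult_mult_left)
  qed simp
  then have "(E \<chi> \<otimes> X) \<otimes> E \<chi> = E \<chi> \<otimes> X" using E_right_eigen[of \<chi>] \<chi> by simp
  then show ?thesis using 1 by (simp add: m_assoc)
qed

lemma Xi_E: "\<chi> \<in> colourings d n \<Longrightarrow> Xi \<otimes> E \<chi> = E \<chi> \<otimes> Xi"
proof -
  assume \<chi>: "\<chi> \<in> colourings d n"
  have "Xi \<otimes> E \<chi> = Xi \<otimes> (E \<chi> \<otimes> X) \<otimes> Xi" by (simp add: m_assoc X_Xi)
  also have "\<dots> = (Xi \<otimes> X) \<otimes> E \<chi> \<otimes> Xi" using \<chi> by (simp add: X_E[symmetric] m_assoc)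
  finally show ?thesis by (simp add: Xi_X)
qed

text \<open>Multiplying by \<open>g i\<close> permutes the eigenvalues of the \<open>t j\<close> by
  the transposition. Both sides therefore equal
  \<open>E (sw i \<chi>) \<otimes> g i \<otimes> E \<chi>\<close>.\<close>

lemma g_E:
  assumes \<chi>: "\<chi> \<in> colourings d n" and i: "1 \<le> i" "i < n"
  shows "g i \<otimes> E \<chi> = E (sw i \<chi>) \<otimes> g i"
proof -
  have sw: "sw i \<chi> \<in> colourings d n" using assms by (intro sw_colourings)
  have tr: "transpose i (Suc i) j \<in> {1..n}" if "j \<in> {1..n}" for j
    using that i by (simp add: transpose_def)
  have "left_eigen (sw i \<chi>) (g i \<otimes> E \<chi>)"
    unfolding left_eigen_def
  proof (intro conjI ballI)
    fix j assume j: "j \<in> {1..n}"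
    \<comment> \<open>The transposition is written twice, so that \<open>g_t\<close> can be applied
      from right to left.\<close>
    have "t j \<otimes> (g i \<otimes> E \<chi>) = (t (transpose i (Suc i) (transpose i (Suc i) j)) \<otimes> g i) \<otimes> E \<chi>"
      by (simp add: m_assoc)
    also have "\<dots> = g i \<otimes> (t (transpose i (Suc i) j) \<otimes> E \<chi>)"
      using i tr[OF j] by (simp only: g_t[symmetric] m_assoc g_closed t_closed tE_closed)
    finally show "t j \<otimes> (g i \<otimes> E \<chi>) = zp d (sw i \<chi> j) \<odot> (g i \<otimes> E \<chi>)"
      using tr[OF j] \<chi> by (simp add: t_E smult_mult_right sw_def)
  qed simp
  then have 1: "E (sw i \<chi>) \<otimes> (g i \<otimes> E \<chi>) = g i \<otimes> E \<chi>"
    using E_left_eigen[of "sw i \<chi>"] sw by simp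
  have "right_eigen \<chi> (E (sw i \<chi>) \<otimes> g i)"
    unfolding right_eigen_def
  proof (intro conjI ballI)
    fix j assume j: "j \<in> {1..n}"
    have "(E (sw i \<chi>) \<otimes> g i) \<otimes> t j = (E (sw i \<chi>) \<otimes> t (transpose i (Suc i) j)) \<otimes> g i"
      using i j by (simp add: m_assoc g_t)
    then show "(E (sw i \<chi>) \<otimes> g i) \<otimes> t j = zp d (\<chi> j) \<odot> (E (sw i \<chi>) \<otimes> g i)"
      using tr[OF j] sw by (simp add: t_E smult_mult_left) (simp add: sw_def)
  qed simp
  then have "(E (sw i \<chi>) \<otimes> g i) \<otimes> E \<chi> = E (sw i \<chi>) \<otimes> g i"
    using E_right_eigen[of \<chi>] \<chi> by simp
  then show ?thesis using 1 by (simp add: m_assoc)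
qed

section \<open>The elements e_i and the inverses of the generators g_i\<close>

definition e :: "nat \<Rightarrow> 'a"
  where "e i = const_ground (1 / of_nat d) \<odot> (\<Oplus>s\<in>{1..d}. t i [^] s \<otimes> t (Suc i) [^] (d - s))"

lemma e_closed [simp]: "e i \<in> carrier A"
  by (simp add: e_def Pi_def)

lemma e_E:
  assumes \<chi>: "\<chi> \<in> colourings d n" and i: "1 \<le> i" "i < n"
  shows "e i \<otimes> E \<chi> = (if \<chi> i = \<chi> (Suc i) then E \<chi> else \<zero>)"
proof -
  have lt: "\<chi> i < d" "\<chi> (Suc i) < d" using colouringsD(1)[OF \<chi>] i by simp_all
  have pow: "t j [^] s \<otimes> E \<chi> = zp d (\<chi> j) ^ s \<odot> E \<chi>" if "j \<in> {1..n}" for j s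
    using that by (intro eigen_power) (simp_all add: t_E \<chi>)
  have "e i \<otimes> E \<chi> = const_ground (1 / of_nat d) \<odot> (\<Oplus>s\<in>{1..d}. (zp d (\<chi> i) ^ s * zp d (\<chi> (Suc i)) ^ (d - s)) \<odot> E \<chi>)"
  proof -
    have 1: "t i [^] s \<otimes> t (Suc i) [^] (d - s) \<otimes> E \<chi> = (zp d (\<chi> i) ^ s * zp d (\<chi> (Suc i)) ^ (d - s)) \<odot> E \<chi>" for s
      using i by (simp add: m_assoc pow smult_mult_right smult_smult mult.commute)
    show ?thesis unfolding e_def
      by (simp add: smult_mult_left finsum_mult_right Pi_def 1)
  qed
  also have "\<dots> = (const_ground (1 / of_nat d) * (\<Sum>s\<in>{1..d}. zp d (\<chi> i) ^ s * zp d (\<chi> (Suc i)) ^ (d - s))) \<odot> E \<chi>"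
    by (simp only: finsum_scalar[OF tE_closed] smult_smult[OF tE_closed])
  finally show ?thesis by (simp only: e_scalar[OF lt]) simp
qed

lemma g_g: "\<lbrakk>1 \<le> i; i < n\<rbrakk> \<Longrightarrow> g i \<otimes> g i = U \<odot> \<one> \<oplus> v_var \<odot> (e i \<otimes> g i)"
  using g_square[of i] by (simp add: e_def)

text \<open>\<open>g i\<close> carries \<open>E \<chi>\<close> to \<open>E (sw i \<chi>)\<close>,
  whose colours at \<open>i\<close> and \<open>Suc i\<close> still differ, so \<open>e i\<close>
  annihilates the product and the linear term of the quadratic relation vanishes.\<close>

lemma g_g_E:
  assumes \<chi>: "\<chi> \<in> colourings d n" and i: "1 \<le> i" "i < n" and ne: "\<chi> i \<noteq> \<chi> (Suc i)"
  shows "g i \<otimes> (g i \<otimes> E \<chi>) = U \<odot> E \<chi>"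
proof -
  have sw: "sw i \<chi> \<in> colourings d n" using assms by (intro sw_colourings)
  have "e i \<otimes> g i \<otimes> E \<chi> = e i \<otimes> E (sw i \<chi>) \<otimes> g i" using \<chi> i by (simp add: m_assoc g_E)
  also have "\<dots> = \<zero>" using e_E[OF sw i] ne by simp
  finally have "e i \<otimes> g i \<otimes> E \<chi> = \<zero>" .
  moreover have "g i \<otimes> (g i \<otimes> E \<chi>) = (U \<odot> \<one> \<oplus> v_var \<odot> (e i \<otimes> g i)) \<otimes> E \<chi>"
    using i by (simp add: m_assoc[symmetric] g_g)
  ultimately show ?thesis by (simp add: l_distr smult_mult_left)
qed

text \<open>The quadratic relation solved for the inverse:
  \<open>g i \<otimes> (g i \<ominus> v_var \<odot> e i)\<close> is the unit scalar
  \<open>U\<close>.\<close>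

definition gi :: "nat \<Rightarrow> 'a" where "gi i = U_inv \<odot> (g i \<ominus> v_var \<odot> e i)"

lemma gi_closed [simp]: "gi i \<in> carrier A" by (simp add: gi_def)

text \<open>Tested on the idempotents: both products give \<open>g i \<otimes> E \<chi>\<close> when
  the two colours agree and zero otherwise.\<close>

lemma g_e:
  assumes i: "1 \<le> i" "i < n"
  shows "g i \<otimes> e i = e i \<otimes> g i"
proof (rule eq_by_E)
  fix \<chi> assume \<chi>: "\<chi> \<in> colourings d n"
  have sw: "sw i \<chi> \<in> colourings d n" using \<chi> i by (intro sw_colourings)
  have "e i \<otimes> g i \<otimes> E \<chi> = e i \<otimes> E (sw i \<chi>) \<otimes> g i" using \<chi> i by (simp add: m_assoc g_E)
  also have "\<dots> = (if \<chi> i = \<chi> (Suc i) then g i \<otimes> E \<chi> else \<zero>)" using e_E[OF sw i] \<chi> i by (auto simp: g_E)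
  also have "\<dots> = g i \<otimes> e i \<otimes> E \<chi>" using e_E[OF \<chi> i] by (simp add: m_assoc)
  finally show "g i \<otimes> e i \<otimes> E \<chi> = e i \<otimes> g i \<otimes> E \<chi>" by simp
qed simp_all

lemma add_cancel: "\<lbrakk>x \<in> carrier A; y \<in> carrier A\<rbrakk> \<Longrightarrow> (x \<oplus> y) \<ominus> y = x"
  by (simp add: minus_eq a_assoc r_neg)

lemma g_gi:
  assumes i: "1 \<le> i" "i < n"
  shows "gi i \<otimes> g i = \<one>" and "g i \<otimes> gi i = \<one>"
proof -
  have "(g i \<ominus> v_var \<odot> e i) \<otimes> g i = g i \<otimes> g i \<ominus> v_var \<odot> (e i \<otimes> g i)"
    by (simp add: minus_eq l_distr l_minus smult_mult_left)
  also have "\<dots> = U \<odot> \<one>" unfolding g_g[OF i] by (rule add_cancel) simp_all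
  finally have 1: "(g i \<ominus> v_var \<odot> e i) \<otimes> g i = U \<odot> \<one>" .
  then show "gi i \<otimes> g i = \<one>" by (simp add: gi_def smult_mult_left smult_smult)
  have "g i \<otimes> (g i \<ominus> v_var \<odot> e i) = (g i \<ominus> v_var \<odot> e i) \<otimes> g i"
    by (simp add: minus_eq l_distr l_minus r_distr r_minus smult_mult_left smult_mult_right g_e[OF i])
  then show "g i \<otimes> gi i = \<one>" using 1 by (simp add: gi_def smult_mult_right smult_smult)
qed

end


text \<open>Unlike \<open>desc_induct\<close>, this reaches every colouring of smaller weight, in
  particular those two exchanges away, which the braid cases below require.\<close>

lemma weight_induct [consumes 1, case_names less]:
  assumes "\<chi> \<in> colourings d n"
    and "\<And>\<chi>. \<lbrakk>\<chi> \<in> colourings d n;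
      \<And>\<psi>. \<lbrakk>\<psi> \<in> colourings d n; inversion_weight n \<psi> < inversion_weight n \<chi>\<rbrakk> \<Longrightarrow> P \<psi>\<rbrakk> \<Longrightarrow> P \<chi>"
  shows "P \<chi>"
  using assms(1) by (induction "inversion_weight n \<chi>" arbitrary: \<chi> rule: less_induct) (rule assms(2))

section \<open>Commutation and polynomials in one element\<close>

context kalgebra
begin

lemma commute_mult:
  assumes "x \<otimes> y = y \<otimes> x" "x \<otimes> z = z \<otimes> x" "x \<in> carrier A" "y \<in> carrier A" "z \<in> carrier A"
  shows "x \<otimes> (y \<otimes> z) = (y \<otimes> z) \<otimes> x"
proof -
  have "x \<otimes> (y \<otimes> z) = (x \<otimes> y) \<otimes> z" using assms(3-5) by (simp add: m_assoc)
  also have "\<dots> = y \<otimes> (x \<otimes> z)" using assms(3-5) by (simp add: assms(1) m_assoc)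
  finally show ?thesis using assms(3-5) by (simp add: assms(2) m_assoc)
qed

lemma inverse_commute:
  assumes "x \<in> carrier A" "xi \<in> carrier A" "y \<in> carrier A"
    and "x \<otimes> xi = \<one>" "xi \<otimes> x = \<one>" "x \<otimes> y = y \<otimes> x"
  shows "xi \<otimes> y = y \<otimes> xi"
proof -
  have "xi \<otimes> y = xi \<otimes> (y \<otimes> x) \<otimes> xi" using assms(1-3) by (simp add: m_assoc assms(4))
  also have "\<dots> = (xi \<otimes> x) \<otimes> y \<otimes> xi" using assms(1-3) by (simp add: assms(6)[symmetric] m_assoc)
  finally show ?thesis using assms(1-3) by (simp add: assms(5))
qed

definition poly_at :: "'k list \<Rightarrow> 'a \<Rightarrow> 'a"
  where "poly_at ws x = foldr (\<lambda>c y. (x \<ominus> c \<odot> \<one>) \<otimes> y) ws \<one>"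

lemma poly_at_simps [simp]: "poly_at [] x = \<one>" "poly_at (c # ws) x = (x \<ominus> c \<odot> \<one>) \<otimes> poly_at ws x"
  by (simp_all add: poly_at_def)

lemma poly_at_closed [simp]: "x \<in> carrier A \<Longrightarrow> poly_at ws x \<in> carrier A"
  by (induction ws) simp_all

text \<open>An element that intertwines \<open>x\<close> with \<open>z\<close> intertwines every
  polynomial in them. With \<open>x = z\<close> this is commutation; between neighbouring
  Jucys--Murphy elements it transports the cyclotomic relation.\<close>

lemma poly_at_intertwine:
  assumes "x \<in> carrier A" "y \<in> carrier A" "z \<in> carrier A" "x \<otimes> y = y \<otimes> z"
  shows "poly_at ws x \<otimes> y = y \<otimes> poly_at ws z"
proof (induction ws)
  case Nil
  then show ?case using assms(2) by simp
next
  case (Cons c ws)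
  have 1: "(x \<ominus> c \<odot> \<one>) \<otimes> y = y \<otimes> (z \<ominus> c \<odot> \<one>)"
    using assms(1-3) by (simp add: minus_eq l_distr r_distr l_minus r_minus smult_mult_left smult_mult_right assms(4))
  have "poly_at (c # ws) x \<otimes> y = (x \<ominus> c \<odot> \<one>) \<otimes> (poly_at ws x \<otimes> y)" using assms(1-3) by (simp add: m_assoc)
  also have "\<dots> = ((x \<ominus> c \<odot> \<one>) \<otimes> y) \<otimes> poly_at ws z" using assms(1-3) by (simp add: Cons m_assoc)
  also have "\<dots> = y \<otimes> poly_at (c # ws) z" using assms(1-3) by (simp only: 1) (simp add: m_assoc)
  finally show ?case .
qed

end

context yh_rep
begin

subsection \<open>Jucys--Murphy elements\<close>

text \<open>\<open>J k\<close> is the element usually denoted \<open>X\<^sub>k\<^sub>+\<^sub>1\<close>, and \<open>JI k\<close> is its inverse.\<close>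

definition J :: "nat \<Rightarrow> 'a"
  where "J k = rec_nat X (\<lambda>k p. U_inv \<odot> (g (Suc k) \<otimes> (p \<otimes> g (Suc k)))) k"

definition JI :: "nat \<Rightarrow> 'a"
  where "JI k = rec_nat Xi (\<lambda>k p. U \<odot> (gi (Suc k) \<otimes> (p \<otimes> gi (Suc k)))) k"

lemma J_0: "J 0 = X" and J_Suc: "J (Suc k) = U_inv \<odot> (g (Suc k) \<otimes> (J k \<otimes> g (Suc k)))"
  by (simp_all add: J_def)

lemma JI_0: "JI 0 = Xi" and JI_Suc: "JI (Suc k) = U \<odot> (gi (Suc k) \<otimes> (JI k \<otimes> gi (Suc k)))"
  by (simp_all add: JI_def)

lemma J_closed [simp]: "J k \<in> carrier A" and JI_closed [simp]: "JI k \<in> carrier A"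
  by (induction k) (simp_all add: J_0 J_Suc JI_0 JI_Suc)

lemma cancel_assoc: "\<lbrakk>x \<otimes> y = \<one>; x \<in> carrier A; y \<in> carrier A; z \<in> carrier A\<rbrakk> \<Longrightarrow> x \<otimes> (y \<otimes> z) = z"
  by (simp add: m_assoc[symmetric])

lemma J_JI:
  assumes "k < n"
  shows "J k \<otimes> JI k = \<one> \<and> JI k \<otimes> J k = \<one>"
  using assms
proof (induction k)
  case 0 then show ?case by (simp add: J_0 JI_0 X_Xi Xi_X)
next
  case (Suc k)
  have gg: "gi (Suc k) \<otimes> g (Suc k) = \<one>" "g (Suc k) \<otimes> gi (Suc k) = \<one>"
    using Suc.prems g_gi[of "Suc k"] by simp_all
  have IH: "J k \<otimes> JI k = \<one>" "JI k \<otimes> J k = \<one>" using Suc by simp_all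
  show ?case
    by (simp add: J_Suc JI_Suc smult_mult_left smult_mult_right smult_smult m_assoc
        cancel_assoc[OF gg(1)] cancel_assoc[OF gg(2)] cancel_assoc[OF IH(1)] cancel_assoc[OF IH(2)] gg)
qed

text \<open>In the usual indexing, X_(k+1) commutes with g_i unless i is k or k+1. For i = k-1 the
  factors of the recursion do not commute with g_i one by one; unfolding two levels makes the braid
  relation applicable on both sides.\<close>

lemma g_J: "\<lbrakk>1 \<le> i; i < n; k < n; i \<noteq> k; i \<noteq> Suc k\<rbrakk> \<Longrightarrow> g i \<otimes> J k = J k \<otimes> g i"
proof (induction k arbitrary: i rule: less_induct)
  case (less k)
  show ?case
  proof (cases k)
    case 0
    then have "X \<otimes> g i = g i \<otimes> X" using less.prems by (intro X_g) simp_all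
    then show ?thesis by (simp add: 0 J_0)
  next
    case (Suc k')
    show ?thesis
    proof (cases "i = k'")
      case False
      have c1: "g i \<otimes> g k = g k \<otimes> g i"
        using less.prems Suc False by (intro g_comm) linarith+
      have c2: "g i \<otimes> J k' = J k' \<otimes> g i"
        by (rule less.IH) (use less.prems Suc False in simp_all)
      have "g i \<otimes> (g k \<otimes> (J k' \<otimes> g k)) = (g k \<otimes> (J k' \<otimes> g k)) \<otimes> g i"
        by (intro commute_mult c1 c2 m_closed g_closed J_closed)
      then show ?thesis by (simp add: Suc J_Suc smult_mult_left smult_mult_right)
    next
      case True
      then obtain k'' where k'': "k' = Suc k''" using less.prems by (cases k') auto
      let ?a = "g k'" and ?b = "g k" and ?j = "J k''"
      have br: "?a \<otimes> (?b \<otimes> ?a) = ?b \<otimes> (?a \<otimes> ?b)"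
        using g_braid[of k'] k'' Suc less.prems by simp
      have bj: "?b \<otimes> ?j = ?j \<otimes> ?b"
        by (rule less.IH) (use less.prems Suc k'' in simp_all)
      have "?a \<otimes> (?b \<otimes> (?a \<otimes> (?j \<otimes> (?a \<otimes> ?b)))) = (?a \<otimes> (?b \<otimes> ?a)) \<otimes> (?j \<otimes> (?a \<otimes> ?b))"
        by (simp add: m_assoc)
      also have "\<dots> = ?b \<otimes> (?a \<otimes> ((?b \<otimes> ?j) \<otimes> (?a \<otimes> ?b)))" by (simp only: br) (simp add: m_assoc)
      also have "\<dots> = ?b \<otimes> (?a \<otimes> (?j \<otimes> (?b \<otimes> (?a \<otimes> ?b))))" by (simp only: bj) (simp add: m_assoc)
      also have "\<dots> = (?b \<otimes> (?a \<otimes> (?j \<otimes> (?a \<otimes> ?b)))) \<otimes> ?a" by (simp only: br[symmetric]) (simp add: m_assoc)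
      finally have main: "?a \<otimes> (?b \<otimes> (?a \<otimes> (?j \<otimes> (?a \<otimes> ?b)))) = (?b \<otimes> (?a \<otimes> (?j \<otimes> (?a \<otimes> ?b)))) \<otimes> ?a" .
      have Jk: "J k = (U_inv * U_inv) \<odot> (?b \<otimes> (?a \<otimes> (?j \<otimes> (?a \<otimes> ?b))))"
        by (simp add: Suc J_Suc k'' smult_mult_left smult_mult_right smult_smult m_assoc)
      show ?thesis unfolding True Jk using main by (simp add: smult_mult_left smult_mult_right)
    qed
  qed
qed

text \<open>Induction through the next but one element: \<open>J k\<close> commutes with both
  ingredients of \<open>J (k + 2)\<close>, and \<open>J (k + 2)\<close> commutes with
  \<open>g (k + 1)\<close> by \<open>g_J\<close>; so it commutes with \<open>J (k + 1)\<close>,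
  which is built from \<open>J k\<close> and \<open>g (k + 1)\<close>.\<close>

lemma J_Suc_commute: "Suc k < n \<Longrightarrow> J k \<otimes> J (Suc k) = J (Suc k) \<otimes> J k"
proof (induction k)
  case 0
  have "X \<otimes> (g 1 \<otimes> (X \<otimes> g 1)) = (g 1 \<otimes> (X \<otimes> g 1)) \<otimes> X"
    using X_g_braid 0 by (simp add: m_assoc)
  then show ?case by (simp add: J_0 J_Suc smult_mult_left smult_mult_right)
next
  case (Suc k)
  let ?a = "g (Suc k)" and ?b = "g (Suc (Suc k))"
  have "J k \<otimes> (?b \<otimes> (J (Suc k) \<otimes> ?b)) = (?b \<otimes> (J (Suc k) \<otimes> ?b)) \<otimes> J k"
    by (intro commute_mult g_J[symmetric] Suc.IH m_closed g_closed J_closed) (use Suc.prems in simp_all)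
  then have c1: "J (Suc (Suc k)) \<otimes> J k = J k \<otimes> J (Suc (Suc k))"
    by (simp add: J_Suc[of "Suc k"] smult_mult_left smult_mult_right)
  have c2: "J (Suc (Suc k)) \<otimes> ?a = ?a \<otimes> J (Suc (Suc k))"
    by (rule g_J[symmetric]) (use Suc.prems in simp_all)
  have "J (Suc (Suc k)) \<otimes> (?a \<otimes> (J k \<otimes> ?a)) = (?a \<otimes> (J k \<otimes> ?a)) \<otimes> J (Suc (Suc k))"
    by (intro commute_mult c1 c2 m_closed g_closed J_closed)
  then show ?case by (simp add: J_Suc[of k] smult_mult_left smult_mult_right)
qed

lemma J_commute_add: "Suc k + m < n \<Longrightarrow> J k \<otimes> J (Suc k + m) = J (Suc k + m) \<otimes> J k"
proof (induction m)
  case 0 then show ?case using J_Suc_commute by simp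
next
  case (Suc m)
  let ?l = "Suc k + m"
  have "J k \<otimes> (g (Suc ?l) \<otimes> (J ?l \<otimes> g (Suc ?l))) = (g (Suc ?l) \<otimes> (J ?l \<otimes> g (Suc ?l))) \<otimes> J k"
    by (intro commute_mult g_J[symmetric] Suc.IH m_closed g_closed J_closed) (use Suc.prems in simp_all)
  then show ?case by (simp add: J_Suc[of ?l, simplified] smult_mult_left smult_mult_right)
qed

lemma J_commute: "\<lbrakk>k < n; l < n\<rbrakk> \<Longrightarrow> J k \<otimes> J l = J l \<otimes> J k"
  using J_commute_add[of k "l - Suc k"] J_commute_add[of l "k - Suc l"]
  by (cases k l rule: linorder_cases) simp_all

lemma g_J_g: "g (Suc k) \<otimes> (J k \<otimes> g (Suc k)) = U \<odot> J (Suc k)"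
  by (simp add: J_Suc smult_smult)

text \<open>A rewriting of the commutation of \<open>J k\<close> with \<open>J (Suc k)\<close>. In a
  block that starts at position \<open>Suc k\<close> it becomes the relation between X_1 and
  g_1.\<close>

lemma J_g_braid:
  assumes "Suc k < n"
  shows "J k \<otimes> (g (Suc k) \<otimes> (J k \<otimes> g (Suc k))) = g (Suc k) \<otimes> (J k \<otimes> (g (Suc k) \<otimes> J k))"
proof -
  have "g (Suc k) \<otimes> (J k \<otimes> (g (Suc k) \<otimes> J k)) = (g (Suc k) \<otimes> (J k \<otimes> g (Suc k))) \<otimes> J k"
    by (simp add: m_assoc)
  then show ?thesis using J_Suc_commute[OF assms] by (simp add: g_J_g smult_mult_left smult_mult_right)
qed

text \<open>The two factors \<open>g (Suc k)\<close> in the recursion move the idempotent to the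
  exchanged colouring and back.\<close>

lemma J_E: "\<lbrakk>k < n; \<chi> \<in> colourings d n\<rbrakk> \<Longrightarrow> J k \<otimes> E \<chi> = E \<chi> \<otimes> J k"
proof (induction k arbitrary: \<chi>)
  case 0 then show ?case by (simp add: J_0 X_E)
next
  case (Suc k)
  have sw: "sw (Suc k) \<chi> \<in> colourings d n" using Suc.prems by (intro sw_colourings) simp_all
  have gE: "g (Suc k) \<otimes> E \<chi> = E (sw (Suc k) \<chi>) \<otimes> g (Suc k)"
    "g (Suc k) \<otimes> E (sw (Suc k) \<chi>) = E \<chi> \<otimes> g (Suc k)"
    using g_E[of \<chi> "Suc k"] g_E[OF sw, of "Suc k"] Suc.prems by simp_all
  have JE: "J k \<otimes> E (sw (Suc k) \<chi>) = E (sw (Suc k) \<chi>) \<otimes> J k" using Suc sw by simp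
  let ?g = "g (Suc k)" and ?E = "E (sw (Suc k) \<chi>)"
  have "(?g \<otimes> (J k \<otimes> ?g)) \<otimes> E \<chi> = ?g \<otimes> (J k \<otimes> (?g \<otimes> E \<chi>))" by (simp add: m_assoc)
  also have "\<dots> = ?g \<otimes> ((J k \<otimes> ?E) \<otimes> ?g)" by (simp only: gE(1)) (simp add: m_assoc)
  also have "\<dots> = (?g \<otimes> ?E) \<otimes> (J k \<otimes> ?g)" by (simp only: JE) (simp add: m_assoc)
  also have "\<dots> = E \<chi> \<otimes> (?g \<otimes> (J k \<otimes> ?g))" by (simp only: gE(2)) (simp add: m_assoc)
  finally show ?case by (simp add: J_Suc smult_mult_left smult_mult_right)
qed

text \<open>Where the two colours differ, \<open>g (Suc k)\<close> squares to \<open>U\<close>,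
  which the factor \<open>U_inv\<close> of the recursion cancels; so it conjugates
  \<open>J k\<close> and \<open>J (Suc k)\<close> into each other without a scalar.\<close>

lemma J_g_E:
  assumes k: "Suc k < n" and \<chi>: "\<chi> \<in> colourings d n" and ne: "\<chi> (Suc k) \<noteq> \<chi> (Suc (Suc k))"
  shows "J (Suc k) \<otimes> (g (Suc k) \<otimes> E \<chi>) = g (Suc k) \<otimes> (J k \<otimes> E \<chi>)"
    and "g (Suc k) \<otimes> (J (Suc k) \<otimes> E \<chi>) = J k \<otimes> (g (Suc k) \<otimes> E \<chi>)"
proof -
  let ?g = "g (Suc k)" and ?\<psi> = "sw (Suc k) \<chi>"
  have sw: "?\<psi> \<in> colourings d n" using k \<chi> by (intro sw_colourings) simp_all
  have gE: "?g \<otimes> E \<chi> = E ?\<psi> \<otimes> ?g" using g_E[OF \<chi>, of "Suc k"] k by simp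
  have gg: "?g \<otimes> (?g \<otimes> E \<chi>) = U \<odot> E \<chi>" using g_g_E[OF \<chi>, of "Suc k"] k ne by simp
  have gg': "?g \<otimes> (?g \<otimes> E ?\<psi>) = U \<odot> E ?\<psi>" using g_g_E[OF sw, of "Suc k"] k ne by simp
  have "J (Suc k) \<otimes> (?g \<otimes> E \<chi>) = U_inv \<odot> (?g \<otimes> (J k \<otimes> (?g \<otimes> (?g \<otimes> E \<chi>))))"
    by (simp add: J_Suc smult_mult_left m_assoc)
  also have "\<dots> = ?g \<otimes> (J k \<otimes> E \<chi>)" by (simp add: gg smult_mult_right smult_smult)
  finally show "J (Suc k) \<otimes> (?g \<otimes> E \<chi>) = ?g \<otimes> (J k \<otimes> E \<chi>)" .
  have JE: "J k \<otimes> E ?\<psi> = E ?\<psi> \<otimes> J k" using k sw by (intro J_E) simp_all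
  have "?g \<otimes> (J (Suc k) \<otimes> E \<chi>) = U_inv \<odot> (?g \<otimes> (?g \<otimes> (J k \<otimes> (?g \<otimes> E \<chi>))))"
    by (simp add: J_Suc smult_mult_left smult_mult_right m_assoc)
  also have "J k \<otimes> (?g \<otimes> E \<chi>) = E ?\<psi> \<otimes> (J k \<otimes> ?g)"
    by (simp add: gE m_assoc[symmetric] JE)
  also have "U_inv \<odot> (?g \<otimes> (?g \<otimes> (E ?\<psi> \<otimes> (J k \<otimes> ?g)))) = U_inv \<odot> ((?g \<otimes> (?g \<otimes> E ?\<psi>)) \<otimes> (J k \<otimes> ?g))"
    by (simp add: m_assoc)
  also have "\<dots> = E ?\<psi> \<otimes> (J k \<otimes> ?g)" by (simp add: gg' smult_mult_left smult_smult)
  also have "\<dots> = J k \<otimes> (?g \<otimes> E \<chi>)" by (simp add: gE m_assoc[symmetric] JE)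
  finally show "?g \<otimes> (J (Suc k) \<otimes> E \<chi>) = J k \<otimes> (?g \<otimes> E \<chi>)" .
qed

lemma JI_E: "\<lbrakk>k < n; \<chi> \<in> colourings d n\<rbrakk> \<Longrightarrow> JI k \<otimes> E \<chi> = E \<chi> \<otimes> JI k"
  by (rule inverse_commute[OF J_closed JI_closed tE_closed conjunct1[OF J_JI] conjunct2[OF J_JI] J_E])

text \<open>On \<open>E \<chi>\<close> the element \<open>J k\<close> is conjugate to \<open>X\<close> when the colour at \<open>Suc k\<close> did not occur before.\<close>

lemma poly_at_J_E:
  assumes "k < n" "\<chi> \<in> colourings d n" "cnt \<chi> k (\<chi> (Suc k)) = 0"
  shows "poly_at vs (J k) \<otimes> E \<chi> = \<zero>"
  using assms
proof (induction k arbitrary: \<chi>)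
  case 0
  then show ?case using X_cyclotomic by (simp add: J_0 poly_at_def)
next
  case (Suc k)
  let ?g = "g (Suc k)" and ?\<psi> = "sw (Suc k) \<chi>"
  \<comment> \<open>A colour absent from the first \<open>Suc k\<close> positions differs from its
    left neighbour, so it can be exchanged to the left, where it is absent from the first
    \<open>k\<close> positions.\<close>
  have ne: "\<chi> (Suc k) \<noteq> \<chi> (Suc (Suc k))" using Suc.prems(3) by (auto simp: cnt_Suc)
  have sw: "?\<psi> \<in> colourings d n" using Suc.prems by (intro sw_colourings) simp_all
  have cnt: "cnt ?\<psi> k (?\<psi> (Suc k)) = 0"
    using Suc.prems(3) by (simp add: cnt_sw cnt_Suc)
  have k: "k < n" "Suc k < n" using Suc.prems by simp_all
  have IH: "poly_at vs (J k) \<otimes> E ?\<psi> = \<zero>" by (rule Suc.IH[OF k(1) sw cnt])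
  have JE: "J k \<otimes> E ?\<psi> = E ?\<psi> \<otimes> J k" by (rule J_E[OF k(1) sw])
  have "J (Suc k) \<otimes> (?g \<otimes> E ?\<psi>) = (?g \<otimes> E ?\<psi>) \<otimes> J k"
    using J_g_E(1)[OF k(2) sw] ne by (simp add: JE m_assoc)
  then have "poly_at vs (J (Suc k)) \<otimes> (?g \<otimes> E ?\<psi>) = (?g \<otimes> E ?\<psi>) \<otimes> poly_at vs (J k)"
    by (intro poly_at_intertwine) simp_all
  also have "\<dots> = ?g \<otimes> (poly_at vs (J k) \<otimes> E ?\<psi>)"
    using poly_at_intertwine[OF _ _ _ JE] by (simp add: m_assoc)
  finally have 0: "poly_at vs (J (Suc k)) \<otimes> (?g \<otimes> E ?\<psi>) = \<zero>" by (simp add: IH)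
  have gE: "?g \<otimes> E \<chi> = E ?\<psi> \<otimes> ?g" using g_E[of \<chi> "Suc k"] Suc.prems by simp
  have "E \<chi> = U_inv \<odot> (?g \<otimes> (?g \<otimes> E \<chi>))"
    using g_g_E[of \<chi> "Suc k"] Suc.prems ne by (simp add: smult_smult)
  also have "\<dots> = U_inv \<odot> ((?g \<otimes> E ?\<psi>) \<otimes> ?g)" by (simp add: gE m_assoc)
  finally have "poly_at vs (J (Suc k)) \<otimes> E \<chi> = U_inv \<odot> ((poly_at vs (J (Suc k)) \<otimes> (?g \<otimes> E ?\<psi>)) \<otimes> ?g)"
    by (simp add: smult_mult_right m_assoc)
  then show ?case by (simp add: 0)
qed


subsection \<open>Intertwining with the sorted colouring\<close>

text \<open>The product of the exchanges that sort \<open>\<chi>\<close>, with the earliest exchange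
  next to \<open>E \<chi>\<close>. It lies between \<open>E \<chi>\<close> on the right and the
  idempotent of the sorted colouring on the left.\<close>

definition S :: "(nat \<Rightarrow> nat) \<Rightarrow> 'a"
  where "S \<chi> = foldr (\<lambda>i y. y \<otimes> g i) (descents n \<chi>) \<one> \<otimes> E \<chi>"

text \<open>The path back, again with the earliest exchange next to \<open>E \<chi>\<close>. All
  factors \<open>U_inv\<close> are placed here, so that \<open>S\<close> is a plain product of
  generators and the braid relations apply to it directly.\<close>

definition T :: "(nat \<Rightarrow> nat) \<Rightarrow> 'a"
  where "T \<chi> = E \<chi> \<otimes> foldr (\<lambda>i y. U_inv \<odot> (g i \<otimes> y)) (descents n \<chi>) \<one>"

lemma foldr_closed [simp]:
  "foldr (\<lambda>i y. y \<otimes> g i) p \<one> \<in> carrier A" "foldr (\<lambda>i y. U_inv \<odot> (g i \<otimes> y)) p \<one> \<in> carrier A"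
  by (induction p) simp_all

lemma S_closed [simp]: "S \<chi> \<in> carrier A" and T_closed [simp]: "T \<chi> \<in> carrier A"
  by (simp_all add: S_def T_def)

lemma S_sorted: "\<nexists>i. desc n \<chi> i \<Longrightarrow> S \<chi> = E \<chi>" and T_sorted: "\<nexists>i. desc n \<chi> i \<Longrightarrow> T \<chi> = E \<chi>"
  unfolding S_def T_def by (subst descents.simps, simp only: if_False foldr.simps id_apply l_one r_one tE_closed)+

lemma desc_range: "desc n \<chi> i \<Longrightarrow> 1 \<le> i \<and> i < n \<and> \<chi> i \<noteq> \<chi> (Suc i)"
  by (auto simp: desc_def)

lemma S_pick:
  assumes "\<exists>i. desc n \<chi> i" "\<chi> \<in> colourings d n" "i = pick_desc n \<chi>"
  shows "S \<chi> = S (sw i \<chi>) \<otimes> g i" and "T \<chi> = U_inv \<odot> (g i \<otimes> T (sw i \<chi>))"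
proof -
  have i: "1 \<le> i" "i < n" using desc_range[OF pick_desc[OF assms(1)]] assms(3) by simp_all
  have sw: "sw i \<chi> \<in> colourings d n" using assms(2) i by (rule sw_colourings)
  have dd: "descents n \<chi> = i # descents n (sw i \<chi>)"
    using assms(1,3) by (subst descents.simps) (simp only: if_True)
  show "S \<chi> = S (sw i \<chi>) \<otimes> g i"
    unfolding S_def dd using g_E[OF assms(2) i] by (simp add: m_assoc)
  have "E \<chi> \<otimes> (g i \<otimes> z) = g i \<otimes> (E (sw i \<chi>) \<otimes> z)" if "z \<in> carrier A" for z
    using g_E[OF sw i] that by (simp add: m_assoc[symmetric])
  then show "T \<chi> = U_inv \<odot> (g i \<otimes> T (sw i \<chi>))"
    unfolding T_def dd by (simp add: smult_mult_right)
qed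

lemma S_E: "\<chi> \<in> colourings d n \<Longrightarrow> S \<chi> \<otimes> E \<chi> = S \<chi>" and E_T: "\<chi> \<in> colourings d n \<Longrightarrow> E \<chi> \<otimes> T \<chi> = T \<chi>"
  by (simp_all add: S_def T_def m_assoc E_E E_E_assoc)

text \<open>Independence of the sorting path, by a diamond argument: two distant descents are joined
  by the commutation relation, two adjacent ones by the braid relation. Later proofs may therefore
  begin the path at any descent.\<close>

lemma S_desc:
  assumes "\<chi> \<in> colourings d n" "desc n \<chi> j"
  shows "S \<chi> = S (sw j \<chi>) \<otimes> g j"
  using assms
proof (induction arbitrary: j rule: weight_induct)
  case (less \<chi>)
  have ex: "\<exists>i. desc n \<chi> i" using less.prems by blast
  define i where "i = pick_desc n \<chi>"
  have di: "desc n \<chi> i" unfolding i_def by (rule pick_desc[OF ex])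
  have Si: "S \<chi> = S (sw i \<chi>) \<otimes> g i" by (rule S_pick(1)[OF ex less.hyps i_def])
  note dj = less.prems
  have ri: "1 \<le> i" "i < n" "\<chi> (Suc i) < \<chi> i" and rj: "1 \<le> j" "j < n" "\<chi> (Suc j) < \<chi> j"
    using di dj by (auto simp: desc_def)
  have IH: "S (sw k \<chi>) = S (sw l (sw k \<chi>)) \<otimes> g l" if "desc n \<chi> k" "desc n (sw k \<chi>) l" for k l
  proof (rule less.IH)
    show "sw k \<chi> \<in> colourings d n"
      using desc_range[OF that(1)] less.hyps by (intro sw_colourings) simp_all
  qed (use that inversion_weight_sw[OF that(1)] in simp_all)
  \<comment> \<open>Adjacent descents peel off three generators on each side, hence an induction
    hypothesis after two exchanges.\<close>
  have IH2: "S (sw l (sw k \<chi>)) = S (sw m (sw l (sw k \<chi>))) \<otimes> g m"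
    if "desc n \<chi> k" "desc n (sw k \<chi>) l" "desc n (sw l (sw k \<chi>)) m" for k l m
  proof (rule less.IH)
    have "sw k \<chi> \<in> colourings d n"
      using desc_range[OF that(1)] less.hyps by (intro sw_colourings) simp_all
    then show "sw l (sw k \<chi>) \<in> colourings d n"
      using desc_range[OF that(2)] by (rule_tac sw_colourings) simp_all
  qed (use that inversion_weight_sw[OF that(1)] inversion_weight_sw[OF that(2)] in simp_all)
  have far: "S (sw i \<chi>) \<otimes> g i = S (sw j \<chi>) \<otimes> g j" if "desc n \<chi> i" "desc n \<chi> j" "Suc i < j" for i j
  proof -
    have d: "desc n (sw i \<chi>) j" "desc n (sw j \<chi>) i" using that by (auto simp: desc_def)
    have "S (sw i \<chi>) \<otimes> g i = S (sw j (sw i \<chi>)) \<otimes> (g j \<otimes> g i)"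
      using IH[OF that(1) d(1)] by (simp add: m_assoc)
    also have "\<dots> = S (sw i (sw j \<chi>)) \<otimes> (g i \<otimes> g j)"
    proof -
      have "g j \<otimes> g i = g i \<otimes> g j" using that g_commute[of i j] by (simp add: desc_def)
      then show ?thesis by (simp only: sw_commute[OF that(3)])
    qed
    also have "\<dots> = S (sw j \<chi>) \<otimes> g j" using IH[OF that(2) d(2)] by (simp add: m_assoc)
    finally show ?thesis .
  qed
  have near: "S (sw i \<chi>) \<otimes> g i = S (sw (Suc i) \<chi>) \<otimes> g (Suc i)" if "desc n \<chi> i" "desc n \<chi> (Suc i)" for i
  proof -
    have d: "desc n (sw i \<chi>) (Suc i)" "desc n (sw (Suc i) (sw i \<chi>)) i"
      "desc n (sw (Suc i) \<chi>) i" "desc n (sw i (sw (Suc i) \<chi>)) (Suc i)"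
      using that by (auto simp: desc_def)
    have "S (sw i \<chi>) \<otimes> g i = S (sw i (sw (Suc i) (sw i \<chi>))) \<otimes> (g i \<otimes> (g (Suc i) \<otimes> g i))"
      using IH[OF that(1) d(1)] IH2[OF that(1) d(1,2)] by (simp add: m_assoc)
    also have "\<dots> = S (sw (Suc i) (sw i (sw (Suc i) \<chi>))) \<otimes> (g (Suc i) \<otimes> (g i \<otimes> g (Suc i)))"
      using that g_braid[of i] by (simp add: sw_braid desc_def)
    also have "\<dots> = S (sw (Suc i) \<chi>) \<otimes> g (Suc i)"
      using IH[OF that(2) d(3)] IH2[OF that(2) d(3,4)] by (simp add: m_assoc)
    finally show ?thesis .
  qed
  consider "i = j" | "Suc i < j" | "Suc j < i" | "j = Suc i" | "i = Suc j" by linarith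
  then show ?case
  proof cases
    case 1 then show ?thesis using Si by simp
  next
    case 2 then show ?thesis using Si far[OF di dj] by simp
  next
    case 3 then show ?thesis using Si far[OF dj di] by simp
  next
    case 4 then show ?thesis using Si near[of i] di dj by simp
  next
    case 5 then show ?thesis using Si near[of j] di dj by simp
  qed
qed

text \<open>Along one exchange, \<open>S\<close> gains a factor \<open>g i\<close> and
  \<open>T\<close> gains \<open>g i\<close> and \<open>U_inv\<close>. The two generators meet at an
  idempotent with different colours at \<open>i\<close> and \<open>Suc i\<close>, where
  \<open>g i\<close> squares to \<open>U\<close>.\<close>

lemma S_T:
  assumes "\<chi> \<in> colourings d n"
  shows "E (sort_col n \<chi>) \<otimes> S \<chi> = S \<chi> \<and> T \<chi> \<otimes> E (sort_col n \<chi>) = T \<chi> \<and>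
    S \<chi> \<otimes> T \<chi> = E (sort_col n \<chi>) \<and> T \<chi> \<otimes> S \<chi> = E \<chi>"
  using assms
proof (induction rule: desc_induct)
  case (step \<chi>)
  show ?case
  proof (cases "\<exists>i. desc n \<chi> i")
    case False
    then show ?thesis using step.hyps by (simp add: S_sorted T_sorted sort_col_sorted E_E)
  next
    case True
    define i where "i = pick_desc n \<chi>"
    have di: "desc n \<chi> i" unfolding i_def by (rule pick_desc[OF True])
    have i: "1 \<le> i" "i < n" "\<chi> i \<noteq> \<chi> (Suc i)" using desc_range[OF di] by simp_all
    have sw: "sw i \<chi> \<in> colourings d n" using step.hyps i by (intro sw_colourings)
    note SP = S_pick(1)[OF True step.hyps i_def] and TP = S_pick(2)[OF True step.hyps i_def]
    have sort: "sort_col n (sw i \<chi>) = sort_col n \<chi>" using step.hyps i by (intro sort_col_sw)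
    note IH = step.IH[OF di, unfolded sort]
    have IH1: "E (sort_col n \<chi>) \<otimes> S (sw i \<chi>) = S (sw i \<chi>)" and IH2: "T (sw i \<chi>) \<otimes> E (sort_col n \<chi>) = T (sw i \<chi>)"
      and IH3: "S (sw i \<chi>) \<otimes> T (sw i \<chi>) = E (sort_col n \<chi>)" and IH4: "T (sw i \<chi>) \<otimes> S (sw i \<chi>) = E (sw i \<chi>)"
      by (rule IH[THEN conjunct1] IH[THEN conjunct2, THEN conjunct1]
          IH[THEN conjunct2, THEN conjunct2, THEN conjunct1] IH[THEN conjunct2, THEN conjunct2, THEN conjunct2])+
    have gE: "g i \<otimes> E \<chi> = E (sw i \<chi>) \<otimes> g i" using g_E step.hyps i by simp
    have gg: "g i \<otimes> (g i \<otimes> E (sw i \<chi>)) = U \<odot> E (sw i \<chi>)" using g_g_E[OF sw i(1,2)] i(3) by simp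
    have "S \<chi> \<otimes> T \<chi> = U_inv \<odot> (S (sw i \<chi>) \<otimes> (g i \<otimes> (g i \<otimes> T (sw i \<chi>))))"
      by (simp add: SP TP smult_mult_right m_assoc)
    also have "g i \<otimes> (g i \<otimes> T (sw i \<chi>)) = (g i \<otimes> (g i \<otimes> E (sw i \<chi>))) \<otimes> T (sw i \<chi>)"
      using sw by (simp add: m_assoc E_T)
    also have "\<dots> = U \<odot> T (sw i \<chi>)" using sw by (simp only: gg) (simp add: smult_mult_left E_T)
    finally have ST: "S \<chi> \<otimes> T \<chi> = E (sort_col n \<chi>)" by (simp add: smult_mult_right smult_smult IH3)
    have "T \<chi> \<otimes> S \<chi> = U_inv \<odot> (g i \<otimes> ((T (sw i \<chi>) \<otimes> S (sw i \<chi>)) \<otimes> g i))"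
      by (simp add: SP TP smult_mult_left m_assoc)
    also have "\<dots> = U_inv \<odot> (g i \<otimes> (g i \<otimes> E \<chi>))" by (simp only: IH4 gE)
    also have "\<dots> = E \<chi>" using g_g_E[OF step.hyps i] by (simp add: smult_smult)
    finally have TS: "T \<chi> \<otimes> S \<chi> = E \<chi>" .
    show ?thesis
      using ST TS by (simp add: SP TP m_assoc[symmetric] IH1) (simp add: m_assoc smult_mult_left IH2)
  qed
qed

lemmas sort_S = S_T[THEN conjunct1] and T_sort = S_T[THEN conjunct2, THEN conjunct1]
  and S_T_same = S_T[THEN conjunct2, THEN conjunct2, THEN conjunct1]
  and T_S = S_T[THEN conjunct2, THEN conjunct2, THEN conjunct2]

lemma S_T_diff:
  assumes "\<chi> \<in> colourings d n" "\<psi> \<in> colourings d n" "\<chi> \<noteq> \<psi>"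
  shows "S \<chi> \<otimes> T \<psi> = \<zero>"
proof -
  have "S \<chi> \<otimes> T \<psi> = (S \<chi> \<otimes> E \<chi>) \<otimes> (E \<psi> \<otimes> T \<psi>)" using assms by (simp only: S_E E_T)
  also have "\<dots> = S \<chi> \<otimes> ((E \<chi> \<otimes> E \<psi>) \<otimes> T \<psi>)" by (simp add: m_assoc)
  finally show ?thesis using assms by (simp add: E_E)
qed

text \<open>If \<open>i\<close> is a descent of \<open>\<chi>\<close>, the scalar is 1. Otherwise
  \<open>i\<close> is a descent of \<open>sw i \<chi>\<close>, the generator appears squared, and
  the scalar is \<open>U\<close>.\<close>

lemma S_sw_g:
  assumes "\<chi> \<in> colourings d n" "1 \<le> i" "i < n" "\<chi> i \<noteq> \<chi> (Suc i)"
  shows "\<exists>c. S (sw i \<chi>) \<otimes> g i = c \<odot> S \<chi>"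
proof (cases "desc n \<chi> i")
  case True
  then have "S (sw i \<chi>) \<otimes> g i = 1 \<odot> S \<chi>" using S_desc[OF assms(1) True] by simp
  then show ?thesis ..
next
  case False
  have sw: "sw i \<chi> \<in> colourings d n" using assms by (intro sw_colourings)
  have "desc n (sw i \<chi>) i" using False assms by (auto simp: desc_def)
  then have "S (sw i \<chi>) = S \<chi> \<otimes> g i" using S_desc[OF sw] by simp
  then have "S (sw i \<chi>) \<otimes> g i = S \<chi> \<otimes> (g i \<otimes> g i)" by (simp add: m_assoc)
  also have "\<dots> = (S \<chi> \<otimes> E \<chi>) \<otimes> (g i \<otimes> g i)" using assms(1) by (simp add: S_E)
  also have "\<dots> = S \<chi> \<otimes> (g i \<otimes> (g i \<otimes> E \<chi>))"
    using g_E[OF assms(1-3)] g_E[OF sw assms(2,3)] by (simp add: m_assoc) (simp add: m_assoc[symmetric])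
  also have "\<dots> = U \<odot> S \<chi>" using g_g_E[OF assms] assms(1) by (simp add: smult_mult_right S_E)
  finally show ?thesis ..
qed

lemma smaller_sw: "\<lbrakk>1 \<le> i; i < n\<rbrakk> \<Longrightarrow> smaller n (sw i \<chi>) a = smaller n \<chi> a"
  by (simp add: smaller_eq_sum cnt_sw_total)

text \<open>Sorting preserves the order of positions of the same colour, so the pair
  \<open>i\<close>, \<open>Suc i\<close> ends up at rank \<open>cnt \<chi> i a\<close> and the next
  one in the block of \<open>a\<close>. A descent away from the pair commutes with
  \<open>g i\<close>. A descent at one end of it is completed by a second exchange that carries the
  third colour across the pair, and the braid relation turns \<open>g i\<close> into its
  neighbour.\<close>

lemma S_g:
  assumes "\<chi> \<in> colourings d n" "1 \<le> i" "i < n" "\<chi> i = a" "\<chi> (Suc i) = a"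
  shows "S \<chi> \<otimes> g i = g (smaller n \<chi> a + cnt \<chi> i a) \<otimes> S \<chi>"
  using assms
proof (induction arbitrary: i rule: weight_induct)
  case (less \<chi>)
  note i = less.prems
  show ?case
  proof (cases "\<exists>j. desc n \<chi> j")
    case False
    then have "i = smaller n \<chi> a + cnt \<chi> i a"
      using sorted_position[of n \<chi> i] i by simp
    moreover have "sw i \<chi> = \<chi>" using i by (intro sw_eq) simp
    ultimately show ?thesis using g_E[OF less.hyps i(1,2)] False by (simp add: S_sorted)
  next
    case True
    then obtain j where dj: "desc n \<chi> j" ..
    have j: "1 \<le> j" "j < n" "\<chi> (Suc j) < \<chi> j" using dj by (auto simp: desc_def)
    have sw: "sw j \<chi> \<in> colourings d n" using less.hyps j by (intro sw_colourings)
    note Sj = S_desc[OF less.hyps dj]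
    have "j \<noteq> i" using i j by auto
    then consider "Suc j < i \<or> Suc i < j" | "j = Suc i" | "i = Suc j" by linarith
    then show ?thesis
    proof cases
      case 1
      have "g j \<otimes> g i = g i \<otimes> g j" using 1 i j by (intro g_comm) auto
      then have "S \<chi> \<otimes> g i = (S (sw j \<chi>) \<otimes> g i) \<otimes> g j" by (simp add: Sj m_assoc)
      also have "S (sw j \<chi>) \<otimes> g i = g (smaller n (sw j \<chi>) a + cnt (sw j \<chi>) i a) \<otimes> S (sw j \<chi>)"
        using 1 i by (intro less.IH sw inversion_weight_sw[OF dj]) auto
      finally show ?thesis using j \<open>j \<noteq> i\<close> by (simp add: Sj m_assoc smaller_sw cnt_sw)
    next
      case 2
      let ?\<psi> = "sw j \<chi>"
      \<comment> \<open>Colours a, a, b with b < a become b, a, a after the exchanges at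
        \<open>j\<close> and \<open>i\<close>, so the equal pair now starts at
        \<open>j\<close>.\<close>
      have di: "desc n ?\<psi> i" using i j 2 by (simp add: desc_def)
      have sw2: "sw i ?\<psi> \<in> colourings d n" by (rule sw_colourings[OF sw i(1,2)])
      have S2: "S \<chi> = S (sw i ?\<psi>) \<otimes> (g i \<otimes> g j)"
        using S_desc[OF sw di] by (simp add: Sj m_assoc)
      have br: "g i \<otimes> (g j \<otimes> g i) = g j \<otimes> (g i \<otimes> g j)" using g_braid[of i] i j 2 by simp
      have IH: "S (sw i ?\<psi>) \<otimes> g j = g (smaller n (sw i ?\<psi>) a + cnt (sw i ?\<psi>) j a) \<otimes> S (sw i ?\<psi>)"
        using 2 i j inversion_weight_sw[OF dj] inversion_weight_sw[OF di] by (intro less.IH sw2) auto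
      have c: "cnt (sw i ?\<psi>) j a = cnt \<chi> i a"
        using cnt_sw_self[OF i(1), of ?\<psi> a] i j 2 by (simp add: cnt_Suc cnt_sw)
      have "S \<chi> \<otimes> g i = (S (sw i ?\<psi>) \<otimes> g j) \<otimes> (g i \<otimes> g j)" by (simp add: S2 m_assoc br)
      then show ?thesis unfolding IH using i j by (simp add: S2 m_assoc smaller_sw c)
    next
      case 3
      let ?\<psi> = "sw j \<chi>"
      \<comment> \<open>Colours b, a, a with b > a become a, a, b, so the equal pair now starts at
        \<open>j\<close>, one place to the left.\<close>
      have di: "desc n ?\<psi> i" using i j 3 by (simp add: desc_def)
      have sw2: "sw i ?\<psi> \<in> colourings d n" by (rule sw_colourings[OF sw i(1,2)])
      have S2: "S \<chi> = S (sw i ?\<psi>) \<otimes> (g i \<otimes> g j)"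
        using S_desc[OF sw di] by (simp add: Sj m_assoc)
      have br: "g i \<otimes> (g j \<otimes> g i) = g j \<otimes> (g i \<otimes> g j)" using g_braid[of j] i j 3 by simp
      have IH: "S (sw i ?\<psi>) \<otimes> g j = g (smaller n (sw i ?\<psi>) a + cnt (sw i ?\<psi>) j a) \<otimes> S (sw i ?\<psi>)"
        using 3 i j inversion_weight_sw[OF dj] inversion_weight_sw[OF di] by (intro less.IH sw2) auto
      have c: "cnt (sw i ?\<psi>) j a = cnt \<chi> i a"
        using cnt_sw_self[OF j(1), of \<chi> a] i j 3 by (simp add: cnt_Suc cnt_sw)
      have "S \<chi> \<otimes> g i = (S (sw i ?\<psi>) \<otimes> g j) \<otimes> (g i \<otimes> g j)" by (simp add: S2 m_assoc br)
      then show ?thesis unfolding IH using i j by (simp add: S2 m_assoc smaller_sw c)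
    qed
  qed
qed

text \<open>Along the sorting path, the first occurrence of a colour stays the first one. An
  exchange that moves it replaces \<open>J k\<close> by its neighbour, by \<open>J_g_E\<close>; in
  the end it is the first position of its block.\<close>

lemma S_J:
  assumes "\<chi> \<in> colourings d n" "k < n" "\<chi> (Suc k) = a" "cnt \<chi> k a = 0"
  shows "S \<chi> \<otimes> J k = J (smaller n \<chi> a) \<otimes> S \<chi>"
  using assms
proof (induction arbitrary: k rule: weight_induct)
  case (less \<chi>)
  note k = less.prems
  show ?case
  proof (cases "\<exists>j. desc n \<chi> j")
    case False
    then have "Suc k = smaller n \<chi> a + cnt \<chi> (Suc k) a"
      using sorted_position[of n \<chi> "Suc k"] k by simp
    then have "k = smaller n \<chi> a" using k by (simp add: cnt_Suc)
    then show ?thesis using J_E[OF k(1) less.hyps] False by (simp add: S_sorted)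
  next
    case True
    then obtain j where dj: "desc n \<chi> j" ..
    have j: "1 \<le> j" "j < n" "\<chi> (Suc j) < \<chi> j" using dj by (auto simp: desc_def)
    have sw: "sw j \<chi> \<in> colourings d n" using less.hyps j by (intro sw_colourings)
    note Sj = S_desc[OF less.hyps dj]
    have ne: "\<chi> j \<noteq> \<chi> (Suc j)" using j by simp
    have S\<chi>: "S \<chi> = S \<chi> \<otimes> E \<chi>" using less.hyps by (simp add: S_E)
    consider "j \<noteq> k" "j \<noteq> Suc k" | "j = Suc k" | "j = k" by linarith
    then show ?thesis
    proof cases
      case 1
      have "g j \<otimes> J k = J k \<otimes> g j" using 1 k j by (intro g_J) auto
      then have "S \<chi> \<otimes> J k = (S (sw j \<chi>) \<otimes> J k) \<otimes> g j" by (simp add: Sj m_assoc)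
      also have "S (sw j \<chi>) \<otimes> J k = J (smaller n (sw j \<chi>) a) \<otimes> S (sw j \<chi>)"
        using 1 k j by (intro less.IH sw inversion_weight_sw[OF dj]) (auto simp: cnt_sw)
      finally show ?thesis using j by (simp add: Sj m_assoc smaller_sw)
    next
      case 2
      have "S \<chi> \<otimes> J k = (S \<chi> \<otimes> E \<chi>) \<otimes> J k" using S\<chi> by simp
      also have "\<dots> = S \<chi> \<otimes> (J k \<otimes> E \<chi>)" using J_E[OF k(1) less.hyps] by (simp add: m_assoc)
      also have "\<dots> = S (sw j \<chi>) \<otimes> (g j \<otimes> (J k \<otimes> E \<chi>))" by (simp add: Sj m_assoc)
      \<comment> \<open>The exchange moves the first occurrence one place to the right, from
        \<open>Suc k\<close> to \<open>Suc j\<close>.\<close>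
      also have "g j \<otimes> (J k \<otimes> E \<chi>) = J j \<otimes> (g j \<otimes> E \<chi>)"
        using J_g_E(1)[of k \<chi>] 2 j less.hyps ne by simp
      also have "S (sw j \<chi>) \<otimes> (J j \<otimes> (g j \<otimes> E \<chi>)) = (S (sw j \<chi>) \<otimes> J j) \<otimes> (g j \<otimes> E \<chi>)"
        by (simp add: m_assoc)
      also have "S (sw j \<chi>) \<otimes> J j = J (smaller n (sw j \<chi>) a) \<otimes> S (sw j \<chi>)"
        using 2 k j cnt_sw_self[OF j(1), of \<chi> a]
        by (intro less.IH sw inversion_weight_sw[OF dj]) (auto simp: cnt_Suc)
      also have "(J (smaller n (sw j \<chi>) a) \<otimes> S (sw j \<chi>)) \<otimes> (g j \<otimes> E \<chi>)
          = J (smaller n \<chi> a) \<otimes> ((S (sw j \<chi>) \<otimes> g j) \<otimes> E \<chi>)"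
        using j by (simp add: m_assoc smaller_sw)
      finally show ?thesis using Sj S\<chi> by simp
    next
      case 3
      then obtain k' where k': "k = Suc k'" using j by (cases k) auto
      have "S \<chi> \<otimes> J k = (S \<chi> \<otimes> E \<chi>) \<otimes> J k" using S\<chi> by simp
      also have "\<dots> = S \<chi> \<otimes> (J k \<otimes> E \<chi>)" using J_E[OF k(1) less.hyps] by (simp add: m_assoc)
      also have "\<dots> = S (sw j \<chi>) \<otimes> (g j \<otimes> (J k \<otimes> E \<chi>))" by (simp add: Sj m_assoc)
      \<comment> \<open>The exchange moves the first occurrence one place to the left, from
        \<open>Suc k\<close> to \<open>k\<close>.\<close>
      also have "g j \<otimes> (J k \<otimes> E \<chi>) = J k' \<otimes> (g j \<otimes> E \<chi>)"
        using J_g_E(2)[of k' \<chi>] 3 k' k less.hyps ne by simp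
      also have "S (sw j \<chi>) \<otimes> (J k' \<otimes> (g j \<otimes> E \<chi>)) = (S (sw j \<chi>) \<otimes> J k') \<otimes> (g j \<otimes> E \<chi>)"
        by (simp add: m_assoc)
      also have "S (sw j \<chi>) \<otimes> J k' = J (smaller n (sw j \<chi>) a) \<otimes> S (sw j \<chi>)"
      proof (intro less.IH sw inversion_weight_sw[OF dj])
        show "k' < n" using k k' by simp
        show "sw j \<chi> (Suc k') = a" using 3 k' k by simp
        show "cnt (sw j \<chi>) k' a = 0" using 3 k' k j by (simp add: cnt_sw cnt_Suc)
      qed
      also have "(J (smaller n (sw j \<chi>) a) \<otimes> S (sw j \<chi>)) \<otimes> (g j \<otimes> E \<chi>)
          = J (smaller n \<chi> a) \<otimes> ((S (sw j \<chi>) \<otimes> g j) \<otimes> E \<chi>)"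
        using j by (simp add: m_assoc smaller_sw)
      finally show ?thesis using Sj S\<chi> by simp
    qed
  qed
qed

end


section \<open>The presented algebras\<close>

lemma kalgebra_free_algebra: "kalgebra (free_algebra G :: ('k::comm_ring_1, 'g list \<Rightarrow>\<^sub>0 'k) module)"
  by (rule kalgebra_monoid_algebra[OF monoid_free_monoid])

text \<open>Connects \<open>yh_e\<close>, written with the sum of the type, to sums in the record,
  which homomorphisms preserve.\<close>

lemma monoid_algebra_finsum:
  fixes f :: "'i \<Rightarrow> ('m \<Rightarrow>\<^sub>0 'k::comm_ring_1)"
  assumes "Group.monoid M" "\<And>i. i \<in> S \<Longrightarrow> f i \<in> carrier (monoid_algebra M)"
  shows "finsum (monoid_algebra M) f S = sum f S"
proof -
  interpret A: kalgebra "monoid_algebra M :: ('k, 'm \<Rightarrow>\<^sub>0 'k) module"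
    by (rule kalgebra_monoid_algebra[OF assms(1)])
  show ?thesis
    using assms(2)
  proof (induction S rule: infinite_finite_induct)
    case (infinite S)
    then show ?case by (simp add: A.finsum_infinite monoid_algebra_simps(3))
  next
    case empty
    show ?case by (simp add: monoid_algebra_simps(3))
  next
    case (insert i S)
    have "finsum (monoid_algebra M) f (insert i S) = f i \<oplus>\<^bsub>monoid_algebra M\<^esub> finsum (monoid_algebra M) f S"
      using insert.prems by (intro A.finsum_insert insert.hyps) simp_all
    then show ?case using insert by (simp add: monoid_algebra_simps(4))
  qed
qed

lemma (in kalgebra_hom) hom_poly_at:
  "x \<in> carrier A \<Longrightarrow> h (A.poly_at ws x) = B.poly_at ws (h x)"
  by (induction ws) (simp_all add: hom_one hom_mult hom_minus hom_smult)

abbreviation yh_free :: "nat \<Rightarrow> (ground, free_elem) module"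
  where "yh_free n \<equiv> free_algebra (yh_gens n)"

lemma word_closed: "w \<in> lists (yh_gens n) \<Longrightarrow> word w \<in> carrier (yh_free n)"
  by (simp add: word_def monoid_algebra_simps free_monoid_def)

lemma word_append: "word (v @ w) = word v \<otimes>\<^bsub>yh_free n\<^esub> word w"
  by (simp add: word_def monoid_algebra_mult_single free_monoid_def)

lemma word_Nil: "word [] = \<one>\<^bsub>yh_free n\<^esub>"
  by (simp add: word_def monoid_algebra_simps free_monoid_def)

lemma yh_gens_simps:
  "gen_g i \<in> yh_gens n \<longleftrightarrow> 1 \<le> i \<and> i < n" "gen_t j \<in> yh_gens n \<longleftrightarrow> 1 \<le> j \<and> j \<le> n"
  "gen_X \<in> yh_gens n" "gen_Xinv \<in> yh_gens n"
  by (auto simp: yh_gens_def)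

text \<open>The evaluation of words and of \<open>yh_e\<close> is done once for an arbitrary
  homomorphism and used for three: the identity, the projection to the cyclotomic algebra, and the
  map to an algebra that satisfies the relations.\<close>

locale yh_free_hom = kalgebra_hom "yh_free n" B h
  for n :: nat and B :: "(ground, 'b) module" and h +
  fixes d :: nat
begin

lemma h_Nil: "h (word []) = \<one>\<^bsub>B\<^esub>"
  using hom_one by (simp only: word_Nil[of n])

text \<open>The tail is a nonempty word, so that as a rewrite rule this stops at one-letter
  words.\<close>

lemma h_Cons:
  assumes "x \<in> yh_gens n" "y # w \<in> lists (yh_gens n)"
  shows "h (word (x # y # w)) = h (word [x]) \<otimes>\<^bsub>B\<^esub> h (word (y # w))"
proof -
  have "word (x # y # w) = word [x] \<otimes>\<^bsub>yh_free n\<^esub> word (y # w)"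
    using word_append[of "[x]" "y # w" n] by simp
  then show ?thesis using hom_mult[OF word_closed[of "[x]"] word_closed[of "y # w"]] assms by simp
qed

lemma gen_closed: "x \<in> yh_gens n \<Longrightarrow> h (word [x]) \<in> carrier B"
  by (rule hom_closed[OF word_closed]) simp

lemma h_replicate: "x \<in> yh_gens n \<Longrightarrow> h (word (replicate s x)) = h (word [x]) [^]\<^bsub>B\<^esub> s"
proof (induction s)
  case 0 then show ?case by (simp add: h_Nil)
next
  case (Suc s)
  have r: "replicate s x \<in> lists (yh_gens n)" "[x] \<in> lists (yh_gens n)" using Suc.prems by auto
  have "word (replicate (Suc s) x) = word (replicate s x) \<otimes>\<^bsub>yh_free n\<^esub> word [x]"
    unfolding word_append[symmetric] by (simp add: replicate_append_same)
  then show ?case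
    by (simp only: hom_mult[OF word_closed[OF r(1)] word_closed[OF r(2)]] Suc.IH[OF Suc.prems] B.nat_pow_Suc)
qed

lemma e_summand_closed:
  assumes "1 \<le> i" "i < n"
  shows "word (replicate s (gen_t i) @ replicate k (gen_t (i + 1))) \<in> carrier (yh_free n)"
  using assms by (intro word_closed) (auto simp: yh_gens_simps)

lemma yh_e_eq:
  assumes "1 \<le> i" "i < n"
  shows "yh_e d n i = const_ground (1 / of_nat d) \<odot>\<^bsub>yh_free n\<^esub>
    finsum (yh_free n) (\<lambda>s. word (replicate s (gen_t i) @ replicate (d - s) (gen_t (i + 1)))) {1..d}"
  unfolding yh_e_def
  by (subst monoid_algebra_finsum[OF monoid_free_monoid]) (rule e_summand_closed[OF assms], rule refl)

lemma yh_e_closed: "\<lbrakk>1 \<le> i; i < n\<rbrakk> \<Longrightarrow> yh_e d n i \<in> carrier (yh_free n)"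
  unfolding yh_e_eq by (intro A.smult_closed A.finsum_closed Pi_I e_summand_closed)

lemma h_yh_e:
  assumes "1 \<le> i" "i < n"
  shows "h (yh_e d n i) = const_ground (1 / of_nat d) \<odot>\<^bsub>B\<^esub>
    (\<Oplus>\<^bsub>B\<^esub>s\<in>{1..d}. h (word [gen_t i]) [^]\<^bsub>B\<^esub> s \<otimes>\<^bsub>B\<^esub> h (word [gen_t (Suc i)]) [^]\<^bsub>B\<^esub> (d - s))"
proof -
  have gens: "gen_t i \<in> yh_gens n" "gen_t (Suc i) \<in> yh_gens n" using assms by (simp_all add: yh_gens_simps)
  have "h (word (replicate s (gen_t i) @ replicate k (gen_t (Suc i))))
    = h (word [gen_t i]) [^]\<^bsub>B\<^esub> s \<otimes>\<^bsub>B\<^esub> h (word [gen_t (Suc i)]) [^]\<^bsub>B\<^esub> k" for s k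
  proof -
    have r: "replicate s (gen_t i) \<in> lists (yh_gens n)" "replicate k (gen_t (Suc i)) \<in> lists (yh_gens n)"
      using gens by auto
    show ?thesis
      unfolding word_append[of _ _ n] hom_mult[OF word_closed[OF r(1)] word_closed[OF r(2)]]
      by (simp only: h_replicate gens)
  qed
  note eq = this
  show ?thesis
    unfolding yh_e_eq[OF assms]
    by (subst hom_smult[OF A.finsum_closed[OF Pi_I[OF e_summand_closed[OF assms]]]],
        subst hom_finsum[OF e_summand_closed[OF assms]]) (simp only: Suc_eq_plus1[symmetric] eq)
qed

lemma h_square_rhs:
  assumes "1 \<le> i" "i < n"
  shows "h (u_var\<^sup>2 \<odot>\<^bsub>yh_free n\<^esub> word [] + v_var \<odot>\<^bsub>yh_free n\<^esub> (yh_e d n i \<otimes>\<^bsub>yh_free n\<^esub> word [gen_g i]))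
    = U \<odot>\<^bsub>B\<^esub> \<one>\<^bsub>B\<^esub> \<oplus>\<^bsub>B\<^esub> v_var \<odot>\<^bsub>B\<^esub> (h (yh_e d n i) \<otimes>\<^bsub>B\<^esub> h (word [gen_g i]))"
    "u_var\<^sup>2 \<odot>\<^bsub>yh_free n\<^esub> word [] + v_var \<odot>\<^bsub>yh_free n\<^esub> (yh_e d n i \<otimes>\<^bsub>yh_free n\<^esub> word [gen_g i]) \<in> carrier (yh_free n)"
proof -
  have g: "word [gen_g i] \<in> carrier (yh_free n)" using assms by (intro word_closed) (simp add: yh_gens_simps)
  note e = yh_e_closed[OF assms]
  note cl = A.smult_closed[OF A.one_closed] A.smult_closed[OF A.m_closed[OF e g]]
  have "u_var\<^sup>2 \<odot>\<^bsub>yh_free n\<^esub> word [] + v_var \<odot>\<^bsub>yh_free n\<^esub> (yh_e d n i \<otimes>\<^bsub>yh_free n\<^esub> word [gen_g i])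
    = u_var\<^sup>2 \<odot>\<^bsub>yh_free n\<^esub> \<one>\<^bsub>yh_free n\<^esub> \<oplus>\<^bsub>yh_free n\<^esub> v_var \<odot>\<^bsub>yh_free n\<^esub> (yh_e d n i \<otimes>\<^bsub>yh_free n\<^esub> word [gen_g i])"
    (is "?l = ?r")
    unfolding word_Nil[of n] monoid_algebra_simps(4) ..
  moreover have "h ?r = U \<odot>\<^bsub>B\<^esub> \<one>\<^bsub>B\<^esub> \<oplus>\<^bsub>B\<^esub> v_var \<odot>\<^bsub>B\<^esub> (h (yh_e d n i) \<otimes>\<^bsub>B\<^esub> h (word [gen_g i]))"
    by (simp only: hom_add[OF cl] hom_smult[OF A.one_closed] hom_smult[OF A.m_closed[OF e g]] hom_mult[OF e g] hom_one U_def)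
  moreover have "?r \<in> carrier (yh_free n)" by (intro A.a_closed cl)
  ultimately show "h ?l = U \<odot>\<^bsub>B\<^esub> \<one>\<^bsub>B\<^esub> \<oplus>\<^bsub>B\<^esub> v_var \<odot>\<^bsub>B\<^esub> (h (yh_e d n i) \<otimes>\<^bsub>B\<^esub> h (word [gen_g i]))"
    "?l \<in> carrier (yh_free n)" by (simp_all only:)
qed

end

lemma yh_relations_closed:
  assumes "(l, r) \<in> yh_relations d n"
  shows "l \<in> carrier (yh_free n)" and "r \<in> carrier (yh_free n)"
proof -
  \<comment> \<open>With the identity as homomorphism, the closure facts of the locale speak about
    the free algebra itself.\<close>
  interpret yh_free_hom n "yh_free n" "\<lambda>x. x" d
    by (intro yh_free_hom.intro kalgebra_hom.intro kalgebra_free_algebra) (unfold_locales, simp_all)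
  have tr: "gen_t (transpose i (i + 1) j) \<in> yh_gens n" if "i \<in> {1..<n}" "j \<in> {1..n}" for i j
    using that by (auto simp: yh_gens_simps transpose_def)
  have "l \<in> carrier (yh_free n) \<and> r \<in> carrier (yh_free n)"
    using assms
  proof (cases rule: yh_relations.cases)
    case (g_square i)
    then show ?thesis using h_square_rhs(2)[of i] by (simp add: word_closed yh_gens_simps)
  next
    case (t_power j)
    then have "replicate d (gen_t j) \<in> lists (yh_gens n)" by (auto simp: yh_gens_simps)
    then show ?thesis unfolding t_power by (simp add: word_closed)
  next
    case (g_t i j)
    then show ?thesis using tr[of i j] by (simp add: word_closed yh_gens_simps)
  qed (simp_all add: word_closed yh_gens_simps)
  then show "l \<in> carrier (yh_free n)" and "r \<in> carrier (yh_free n)" by simp_all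
qed

section \<open>The affine and the cyclotomic quotient\<close>

abbreviation yh_relators :: "nat \<Rightarrow> nat \<Rightarrow> free_elem set"
  where "yh_relators d n \<equiv> {l - r | l r. (l, r) \<in> yh_relations d n}"

lemma yh_relators_minus:
  assumes "(l, r) \<in> yh_relations d n"
  shows "l \<ominus>\<^bsub>yh_free n\<^esub> r = l - r"
  by (rule monoid_algebra_minus[OF monoid_free_monoid yh_relations_closed(2)[OF assms]])

lemma yh_relators_subset: "yh_relators d n \<subseteq> carrier (yh_free n)"
proof -
  interpret kalgebra "yh_free n" by (rule kalgebra_free_algebra)
  show ?thesis
  proof
    fix p assume "p \<in> yh_relators d n"
    then obtain l r where lr: "(l, r) \<in> yh_relations d n" "p = l - r" by auto
    show "p \<in> carrier (yh_free n)"
      unfolding lr(2) yh_relators_minus[OF lr(1), symmetric]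
      by (intro minus_closed yh_relations_closed[OF lr(1)])
  qed
qed

lemma affine_YH_eq: "affine_YH d n = alg_quot (yh_free n) (yh_relators d n)"
  by (simp add: affine_YH_def presented_algebra_def)

lemma kalgebra_affine_YH: "kalgebra (affine_YH d n)"
  unfolding affine_YH_eq by (rule kalgebra.kalgebra_alg_quot[OF kalgebra_free_algebra yh_relators_subset])

lemma affine_proj_hom: "kalgebra_hom (yh_free n) (affine_YH d n) (alg_quot_proj (yh_free n) (yh_relators d n))"
  unfolding affine_YH_eq by (rule kalgebra.kalgebra_hom_alg_quot_proj[OF kalgebra_free_algebra yh_relators_subset])

lemma affine_X_closed: "affine_X d n \<in> carrier (affine_YH d n)"
  unfolding affine_X_def
  by (rule kalgebra_hom.hom_closed[OF affine_proj_hom]) (simp add: word_closed yh_gens_simps)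

lemma cyclotomic_relator_eq:
  "cyclotomic_relator d n vs = kalgebra.poly_at (affine_YH d n) vs (affine_X d n)"
  unfolding cyclotomic_relator_def kalgebra.poly_at_def[OF kalgebra_affine_YH] ..

lemma cyclotomic_relator_subset: "{cyclotomic_relator d n vs} \<subseteq> carrier (affine_YH d n)"
  using kalgebra.poly_at_closed[OF kalgebra_affine_YH affine_X_closed]
  by (simp add: cyclotomic_relator_eq)

lemma kalgebra_cyclotomic_YH: "kalgebra (cyclotomic_YH d n vs)"
  unfolding cyclotomic_YH_def
  by (rule kalgebra.kalgebra_alg_quot[OF kalgebra_affine_YH cyclotomic_relator_subset])

lemma cyclotomic_proj_hom:
  "kalgebra_hom (affine_YH d n) (cyclotomic_YH d n vs) (alg_quot_proj (affine_YH d n) {cyclotomic_relator d n vs})"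
  unfolding cyclotomic_YH_def
  by (rule kalgebra.kalgebra_hom_alg_quot_proj[OF kalgebra_affine_YH cyclotomic_relator_subset])

definition yh_proj :: "nat \<Rightarrow> nat \<Rightarrow> ground list \<Rightarrow> free_elem \<Rightarrow> free_elem set set"
  where "yh_proj d n vs x =
    alg_quot_proj (affine_YH d n) {cyclotomic_relator d n vs} (alg_quot_proj (yh_free n) (yh_relators d n) x)"

lemma yh_proj_hom: "kalgebra_hom (yh_free n) (cyclotomic_YH d n vs) (yh_proj d n vs)"
  unfolding yh_proj_def by (rule kalgebra_hom_compose[OF affine_proj_hom cyclotomic_proj_hom])

lemma yh_proj_surj: "yh_proj d n vs ` carrier (yh_free n) = carrier (cyclotomic_YH d n vs)"
proof -
  have 1: "alg_quot_proj (yh_free n) (yh_relators d n) ` carrier (yh_free n) = carrier (affine_YH d n)"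
    unfolding affine_YH_eq by (rule kalgebra.alg_quot_carrier[OF kalgebra_free_algebra yh_relators_subset, symmetric])
  have 2: "alg_quot_proj (affine_YH d n) {cyclotomic_relator d n vs} ` carrier (affine_YH d n) = carrier (cyclotomic_YH d n vs)"
    unfolding cyclotomic_YH_def
    by (rule kalgebra.alg_quot_carrier[OF kalgebra_affine_YH cyclotomic_relator_subset, symmetric])
  show ?thesis unfolding 2[symmetric] 1[symmetric] yh_proj_def image_image ..
qed

definition ygen :: "nat \<Rightarrow> nat \<Rightarrow> ground list \<Rightarrow> gen \<Rightarrow> free_elem set set"
  where "ygen d n vs x = yh_proj d n vs (word [x])"

lemma cyclotomic_YH_generates: "generates (cyclotomic_YH d n vs) (ygen d n vs ` yh_gens n)"
  using generates_image[OF yh_proj_hom yh_proj_surj free_algebra_generates]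
  by (simp add: image_image ygen_def word_def)

lemma yh_proj_relation:
  assumes "(l, r) \<in> yh_relations d n"
  shows "yh_proj d n vs l = yh_proj d n vs r"
proof -
  interpret F: kalgebra "yh_free n" by (rule kalgebra_free_algebra)
  have "l - r \<in> Idl\<^bsub>yh_free n\<^esub> yh_relators d n"
    using F.genideal_self[OF yh_relators_subset] assms by blast
  then have "alg_quot_proj (yh_free n) (yh_relators d n) l = alg_quot_proj (yh_free n) (yh_relators d n) r"
    using F.alg_quot_proj_eq_iff[OF yh_relators_subset yh_relations_closed[OF assms]]
    by (simp only: yh_relators_minus[OF assms])
  then show ?thesis by (simp only: yh_proj_def)
qed

lemma yh_proj_cyclotomic:
  "kalgebra.poly_at (cyclotomic_YH d n vs) vs (ygen d n vs gen_X) = \<zero>\<^bsub>cyclotomic_YH d n vs\<^esub>"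
proof -
  interpret p: kalgebra_hom "affine_YH d n" "cyclotomic_YH d n vs" "alg_quot_proj (affine_YH d n) {cyclotomic_relator d n vs}"
    by (rule cyclotomic_proj_hom)
  let ?r = "cyclotomic_relator d n vs"
  have r: "?r \<in> carrier (affine_YH d n)" using cyclotomic_relator_subset by (simp only: insert_subset)
  have "?r \<ominus>\<^bsub>affine_YH d n\<^esub> \<zero>\<^bsub>affine_YH d n\<^esub> = ?r" using r by (simp only: p.A.minus_eq p.A.minus_zero p.A.r_zero)
  then have "?r \<ominus>\<^bsub>affine_YH d n\<^esub> \<zero>\<^bsub>affine_YH d n\<^esub> \<in> Idl\<^bsub>affine_YH d n\<^esub> {?r}"
    using p.A.genideal_self[OF cyclotomic_relator_subset] by (simp only: insert_subset)
  then have "alg_quot_proj (affine_YH d n) {?r} ?r = alg_quot_proj (affine_YH d n) {?r} \<zero>\<^bsub>affine_YH d n\<^esub>"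
    by (simp only: p.A.alg_quot_proj_eq_iff[OF cyclotomic_relator_subset r p.A.zero_closed])
  then have "alg_quot_proj (affine_YH d n) {?r} ?r = \<zero>\<^bsub>cyclotomic_YH d n vs\<^esub>"
    by (simp only: p.hom_zero)
  moreover have "alg_quot_proj (affine_YH d n) {?r} ?r = p.B.poly_at vs (alg_quot_proj (affine_YH d n) {?r} (affine_X d n))"
    using p.hom_poly_at[OF affine_X_closed] by (simp only: cyclotomic_relator_eq[symmetric])
  moreover have "ygen d n vs gen_X = alg_quot_proj (affine_YH d n) {?r} (affine_X d n)"
    by (simp only: ygen_def yh_proj_def affine_X_def)
  ultimately show ?thesis by (simp only:)
qed

text \<open>The value 1 outside the valid range makes the family total, with all values in the
  carrier, as \<open>yh_rep\<close> requires.\<close>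

definition yh_g :: "nat \<Rightarrow> nat \<Rightarrow> ground list \<Rightarrow> nat \<Rightarrow> free_elem set set"
  where "yh_g d n vs i = (if 1 \<le> i \<and> i < n then ygen d n vs (gen_g i) else \<one>\<^bsub>cyclotomic_YH d n vs\<^esub>)"

definition yh_t :: "nat \<Rightarrow> nat \<Rightarrow> ground list \<Rightarrow> nat \<Rightarrow> free_elem set set"
  where "yh_t d n vs j = (if 1 \<le> j \<and> j \<le> n then ygen d n vs (gen_t j) else \<one>\<^bsub>cyclotomic_YH d n vs\<^esub>)"

lemma yh_rep_cyclotomic_YH:
  assumes "d \<ge> 1"
  shows "yh_rep (cyclotomic_YH d n vs) d n vs (yh_g d n vs) (yh_t d n vs) (ygen d n vs gen_X) (ygen d n vs gen_Xinv)"
proof -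
  let ?Y = "cyclotomic_YH d n vs"
  interpret yh_free_hom n ?Y "yh_proj d n vs" d
    by (intro yh_free_hom.intro yh_proj_hom)
  have gen: "yh_proj d n vs (word [x]) = ygen d n vs x" for x by (simp add: ygen_def)
  note gcl = gen_closed[unfolded gen]
  note rel = yh_proj_relation[of _ _ d n vs]
  have tr: "1 \<le> transpose i (Suc i) j \<and> transpose i (Suc i) j \<le> n" if "1 \<le> i" "i < n" "j \<in> {1..n}" for i j
    using that by (auto simp: transpose_def)
  note simps = h_Nil h_Cons gen yh_gens_simps yh_g_def yh_t_def gcl
  show ?thesis
  proof (intro yh_rep.intro root_algebra.intro yh_rep_axioms.intro root_algebra_axioms.intro)
    show "kalgebra ?Y" by (rule kalgebra_cyclotomic_YH)
    show "1 \<le> d" by (rule assms)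
    show "yh_g d n vs i \<in> carrier ?Y" "yh_t d n vs i \<in> carrier ?Y"
      "ygen d n vs gen_X \<in> carrier ?Y" "ygen d n vs gen_Xinv \<in> carrier ?Y" for i
      by (simp_all add: simps)
    fix i j :: nat
    show "yh_g d n vs i \<otimes>\<^bsub>?Y\<^esub> yh_g d n vs j = yh_g d n vs j \<otimes>\<^bsub>?Y\<^esub> yh_g d n vs i"
      if "1 \<le> i" "Suc i < j" "j < n"
      using rel[OF yh_relations.g_commute[of i n j d]] that by (simp add: simps)
    show "yh_g d n vs i \<otimes>\<^bsub>?Y\<^esub> (yh_g d n vs (Suc i) \<otimes>\<^bsub>?Y\<^esub> yh_g d n vs i)
        = yh_g d n vs (Suc i) \<otimes>\<^bsub>?Y\<^esub> (yh_g d n vs i \<otimes>\<^bsub>?Y\<^esub> yh_g d n vs (Suc i))"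
      if "1 \<le> i" "Suc i < n"
      using rel[OF yh_relations.g_braid[of i n d]] that by (simp add: simps)
    show "ygen d n vs gen_X \<otimes>\<^bsub>?Y\<^esub> ygen d n vs gen_Xinv = \<one>\<^bsub>?Y\<^esub>"
      using rel[OF yh_relations.X_Xinv] by (simp add: simps)
    show "ygen d n vs gen_Xinv \<otimes>\<^bsub>?Y\<^esub> ygen d n vs gen_X = \<one>\<^bsub>?Y\<^esub>"
      using rel[OF yh_relations.Xinv_X] by (simp add: simps)
    show "ygen d n vs gen_X \<otimes>\<^bsub>?Y\<^esub> (yh_g d n vs 1 \<otimes>\<^bsub>?Y\<^esub> (ygen d n vs gen_X \<otimes>\<^bsub>?Y\<^esub> yh_g d n vs 1))
        = yh_g d n vs 1 \<otimes>\<^bsub>?Y\<^esub> (ygen d n vs gen_X \<otimes>\<^bsub>?Y\<^esub> (yh_g d n vs 1 \<otimes>\<^bsub>?Y\<^esub> ygen d n vs gen_X))"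
      if "1 < n"
      using rel[OF yh_relations.X_g_braid[of n d]] that by (simp add: simps)
    show "ygen d n vs gen_X \<otimes>\<^bsub>?Y\<^esub> yh_g d n vs i = yh_g d n vs i \<otimes>\<^bsub>?Y\<^esub> ygen d n vs gen_X"
      if "2 \<le> i" "i < n"
      using rel[OF yh_relations.X_g_commute[of i n d]] that by (simp add: simps)
    show "yh_t d n vs i \<otimes>\<^bsub>?Y\<^esub> yh_t d n vs j = yh_t d n vs j \<otimes>\<^bsub>?Y\<^esub> yh_t d n vs i"
      if "i \<in> {1..n}" "j \<in> {1..n}"
      using rel[OF yh_relations.t_commute[OF that]] that by (simp add: simps)
    show "yh_g d n vs i \<otimes>\<^bsub>?Y\<^esub> yh_t d n vs j = yh_t d n vs (transpose i (Suc i) j) \<otimes>\<^bsub>?Y\<^esub> yh_g d n vs i"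
      if "1 \<le> i" "i < n" "j \<in> {1..n}"
      using rel[OF yh_relations.g_t[of i n j d]] that tr[OF that] by (simp add: simps)
    show "yh_t d n vs j [^]\<^bsub>?Y\<^esub> d = \<one>\<^bsub>?Y\<^esub>" if "j \<in> {1..n}"
      using rel[OF yh_relations.t_power[OF that]] that h_replicate[of "gen_t j" d] by (simp add: simps)
    show "ygen d n vs gen_X \<otimes>\<^bsub>?Y\<^esub> yh_t d n vs j = yh_t d n vs j \<otimes>\<^bsub>?Y\<^esub> ygen d n vs gen_X" if "j \<in> {1..n}"
      using rel[OF yh_relations.X_t[OF that]] that by (simp add: simps)
    show "yh_g d n vs i \<otimes>\<^bsub>?Y\<^esub> yh_g d n vs i = U \<odot>\<^bsub>?Y\<^esub> \<one>\<^bsub>?Y\<^esub> \<oplus>\<^bsub>?Y\<^esub>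
        v_var \<odot>\<^bsub>?Y\<^esub> (const_ground (1 / of_nat d) \<odot>\<^bsub>?Y\<^esub>
          (\<Oplus>\<^bsub>?Y\<^esub>s\<in>{1..d}. yh_t d n vs i [^]\<^bsub>?Y\<^esub> s \<otimes>\<^bsub>?Y\<^esub> yh_t d n vs (Suc i) [^]\<^bsub>?Y\<^esub> (d - s)) \<otimes>\<^bsub>?Y\<^esub> yh_g d n vs i)"
      if i: "1 \<le> i" "i < n"
    proof -
      have "yh_proj d n vs (word [gen_g i, gen_g i]) = yh_g d n vs i \<otimes>\<^bsub>?Y\<^esub> yh_g d n vs i"
        using i by (simp add: simps)
      moreover have "yh_g d n vs i = ygen d n vs (gen_g i)" "yh_t d n vs i = ygen d n vs (gen_t i)"
        "yh_t d n vs (Suc i) = ygen d n vs (gen_t (Suc i))" using i by (simp_all add: yh_g_def yh_t_def)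
      ultimately show ?thesis
        using rel[OF yh_relations.g_square[of i n d]] i
        by (simp only: h_square_rhs(1)[OF i] h_yh_e[OF i] gen) simp
    qed
    show "foldr (\<lambda>c y. (ygen d n vs gen_X \<ominus>\<^bsub>?Y\<^esub> c \<odot>\<^bsub>?Y\<^esub> \<one>\<^bsub>?Y\<^esub>) \<otimes>\<^bsub>?Y\<^esub> y) vs \<one>\<^bsub>?Y\<^esub> = \<zero>\<^bsub>?Y\<^esub>"
      using yh_proj_cyclotomic[of d n vs] unfolding kalgebra.poly_at_def[OF kalgebra_cyclotomic_YH] .
  qed
qed

text \<open>The universal property, obtained by passing through the free algebra, the affine
  quotient and the cyclotomic quotient.\<close>

lemma cyclotomic_YH_lift:
  assumes "yh_rep B d n vs g t X Xi"
  shows "\<exists>h. kalgebra_hom (cyclotomic_YH d n vs) B h \<and> (\<forall>i. 1 \<le> i \<and> i < n \<longrightarrow> h (ygen d n vs (gen_g i)) = g i) \<and>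
    (\<forall>j. 1 \<le> j \<and> j \<le> n \<longrightarrow> h (ygen d n vs (gen_t j)) = t j) \<and>
    h (ygen d n vs gen_X) = X \<and> h (ygen d n vs gen_Xinv) = Xi"
proof -
  interpret B: yh_rep B d n vs g t X Xi by fact
  have "\<exists>h. kalgebra_hom (yh_free n) B h \<and> (\<forall>x\<in>yh_gens n. h (Poly_Mapping.single [x] 1) = case_gen g X Xi t x)"
    by (rule free_algebra_lift[OF B.kalgebra_axioms]) (simp split: gen.split)
  then obtain h0 where h0: "kalgebra_hom (yh_free n) B h0"
    and h0_gen: "\<forall>x\<in>yh_gens n. h0 (word [x]) = case_gen g X Xi t x" by (auto simp: word_def)
  interpret h0: yh_free_hom n B h0 d by (intro yh_free_hom.intro h0)
  have tr: "1 \<le> transpose i (Suc i) j \<and> transpose i (Suc i) j \<le> n" if "i \<in> {1..<n}" "j \<in> {1..n}" for i j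
    using that by (auto simp: transpose_def)
  have gen: "\<And>i. \<lbrakk>1 \<le> i; i < n\<rbrakk> \<Longrightarrow> h0 (word [gen_g i]) = g i" "\<And>j. \<lbrakk>1 \<le> j; j \<le> n\<rbrakk> \<Longrightarrow> h0 (word [gen_t j]) = t j"
    "h0 (word [gen_X]) = X" "h0 (word [gen_Xinv]) = Xi"
    using h0_gen by (simp_all add: yh_gens_simps)
  note simps = h0.h_Nil h0.h_Cons gen yh_gens_simps
  have rel: "h0 l = h0 r" if "(l, r) \<in> yh_relations d n" for l r
    using that
  proof (cases rule: yh_relations.cases)
    case (g_commute i j)
    then show ?thesis using B.g_comm[of i j] by (simp add: simps)
  next
    case (g_braid i)
    then show ?thesis using B.g_braid[of i] by (simp add: simps)
  next
    case X_Xinv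
    then show ?thesis by (simp add: simps B.X_Xi)
  next
    case Xinv_X
    then show ?thesis by (simp add: simps B.Xi_X)
  next
    case X_g_braid
    then show ?thesis using B.X_g_braid by (simp add: simps)
  next
    case (X_g_commute i)
    then show ?thesis using B.X_g[of i] by (simp add: simps)
  next
    case (t_commute i j)
    then show ?thesis using B.t_commute[of i j] by (simp add: simps)
  next
    case (g_t i j)
    then show ?thesis using B.g_t[of i j] tr[of i j] by (simp add: simps)
  next
    case (t_power j)
    then show ?thesis using B.t_power[of j] h0.h_replicate[of "gen_t j" d] by (simp add: simps)
  next
    case (X_t j)
    then show ?thesis using B.X_t[of j] by (simp add: simps)
  next
    case (g_square i)
    then have i: "1 \<le> i" "i < n" by simp_all
    have "h0 l = g i \<otimes>\<^bsub>B\<^esub> g i" using g_square i by (simp add: simps)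
    moreover have "h0 r = U \<odot>\<^bsub>B\<^esub> \<one>\<^bsub>B\<^esub> \<oplus>\<^bsub>B\<^esub> v_var \<odot>\<^bsub>B\<^esub> (h0 (yh_e d n i) \<otimes>\<^bsub>B\<^esub> h0 (word [gen_g i]))"
      unfolding g_square(2) by (rule h0.h_square_rhs(1)[OF i])
    moreover have "h0 (yh_e d n i) = B.e i"
      unfolding h0.h_yh_e[OF i] B.e_def using i by (simp add: gen)
    ultimately show ?thesis using B.g_g[OF i] gen(1)[OF i] by (simp only:)
  qed
  have h0_zero: "h0 s = \<zero>\<^bsub>B\<^esub>" if s: "s \<in> yh_relators d n" for s
  proof -
    obtain l r where lr: "(l, r) \<in> yh_relations d n" "s = l - r" using s by auto
    have "h0 s = h0 l \<ominus>\<^bsub>B\<^esub> h0 r"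
      unfolding lr(2) yh_relators_minus[OF lr(1), symmetric] by (rule h0.hom_minus[OF yh_relations_closed[OF lr(1)]])
    then show ?thesis
      using h0.hom_closed[OF yh_relations_closed(2)[OF lr(1)]]
      by (simp only: rel[OF lr(1)] B.minus_eq B.r_neg)
  qed
  have "\<exists>h. kalgebra_hom (affine_YH d n) B h \<and>
    (\<forall>x\<in>carrier (yh_free n). h (alg_quot_proj (yh_free n) (yh_relators d n) x) = h0 x)"
    unfolding affine_YH_eq
    by (rule kalgebra.alg_quot_lift[OF kalgebra_free_algebra yh_relators_subset h0]) (rule h0_zero)
  then obtain h1 where h1: "kalgebra_hom (affine_YH d n) B h1"
    and h1_proj: "\<And>x. x \<in> carrier (yh_free n) \<Longrightarrow> h1 (alg_quot_proj (yh_free n) (yh_relators d n) x) = h0 x"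
    by (elim exE conjE) (simp only: Ball_def)
  have X: "h1 (affine_X d n) = X"
    unfolding affine_X_def using h1_proj[OF word_closed[of "[gen_X]"]] by (simp add: gen yh_gens_simps)
  have "h1 (cyclotomic_relator d n vs) = \<zero>\<^bsub>B\<^esub>"
    unfolding cyclotomic_relator_eq kalgebra_hom.hom_poly_at[OF h1 affine_X_closed] X
    using B.X_cyclotomic unfolding B.poly_at_def .
  then have h1_zero: "h1 s = \<zero>\<^bsub>B\<^esub>" if "s \<in> {cyclotomic_relator d n vs}" for s
    using that by (simp only: singleton_iff)
  have "\<exists>h. kalgebra_hom (cyclotomic_YH d n vs) B h \<and>
    (\<forall>x\<in>carrier (affine_YH d n). h (alg_quot_proj (affine_YH d n) {cyclotomic_relator d n vs} x) = h1 x)"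
    unfolding cyclotomic_YH_def
    by (rule kalgebra.alg_quot_lift[OF kalgebra_affine_YH cyclotomic_relator_subset h1]) (rule h1_zero)
  then obtain h where h: "kalgebra_hom (cyclotomic_YH d n vs) B h"
    and h_proj: "\<And>x. x \<in> carrier (affine_YH d n) \<Longrightarrow> h (alg_quot_proj (affine_YH d n) {cyclotomic_relator d n vs} x) = h1 x"
    by (elim exE conjE) (simp only: Ball_def)
  have "h (ygen d n vs x) = h0 (word [x])" if "x \<in> yh_gens n" for x
  proof -
    have w: "word [x] \<in> carrier (yh_free n)" using that by (intro word_closed) simp
    show ?thesis unfolding ygen_def yh_proj_def
      by (simp only: h_proj[OF kalgebra_hom.hom_closed[OF affine_proj_hom w]] h1_proj[OF w])
  qed
  then show ?thesis using h gen by (intro exI[of _ h]) (simp add: yh_gens_simps)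
qed


subsection \<open>Cyclotomic Hecke algebras\<close>

text \<open>For k = 0 the algebra is K by convention and has no generators; \<open>yh_gens 0\<close>
  would still contain \<open>gen_X\<close>.\<close>

definition hecke_gens :: "nat \<Rightarrow> ground list \<Rightarrow> free_elem set set set"
  where "hecke_gens k vs = (if k = 0 then {} else ygen 1 k vs ` yh_gens k)"

lemma cyclotomic_hecke_pos: "k \<ge> 1 \<Longrightarrow> cyclotomic_hecke k vs = cyclotomic_YH 1 k vs"
  by (simp add: cyclotomic_hecke_def cyclotomic_YH_def)

lemma cyclotomic_hecke_zero:
  "cyclotomic_hecke 0 vs = alg_quot (alg_quot (free_algebra {}) {}) {}"
  by (simp add: cyclotomic_hecke_def presented_algebra_def)

lemma kalgebra_cyclotomic_hecke: "kalgebra (cyclotomic_hecke k vs)"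
proof (cases "k = 0")
  case True
  show ?thesis
    unfolding True cyclotomic_hecke_zero
    by (intro kalgebra.kalgebra_alg_quot kalgebra_free_algebra empty_subsetI)
next
  case False
  then show ?thesis by (simp add: cyclotomic_hecke_pos kalgebra_cyclotomic_YH)
qed

lemma cyclotomic_hecke_generates: "generates (cyclotomic_hecke k vs) (hecke_gens k vs)"
proof (cases "k = 0")
  case True
  let ?F = "free_algebra {} :: (ground, free_elem) module"
  have k1: "kalgebra ?F" by (rule kalgebra_free_algebra)
  have k2: "kalgebra (alg_quot ?F {})" by (rule kalgebra.kalgebra_alg_quot[OF k1 empty_subsetI])
  have "generates (alg_quot ?F {}) (alg_quot_proj ?F {} ` {})"
    using generates_image[OF kalgebra.kalgebra_hom_alg_quot_proj[OF k1 empty_subsetI]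
        kalgebra.alg_quot_carrier[OF k1 empty_subsetI, symmetric] free_algebra_generates] by simp
  from generates_image[OF kalgebra.kalgebra_hom_alg_quot_proj[OF k2 empty_subsetI]
      kalgebra.alg_quot_carrier[OF k2 empty_subsetI, symmetric] this]
  show ?thesis unfolding True cyclotomic_hecke_zero hecke_gens_def by simp
next
  case False
  then show ?thesis using cyclotomic_YH_generates[of 1 k vs] by (simp add: cyclotomic_hecke_pos hecke_gens_def)
qed

text \<open>For k = 0 the only datum is the structure map from K, so relations are demanded for
  positive \<open>k\<close> alone.\<close>

lemma cyclotomic_hecke_lift:
  fixes B :: "(ground, 'b) module"
  assumes "kalgebra B" and rep: "k \<ge> 1 \<Longrightarrow> yh_rep B 1 k vs g (\<lambda>_. \<one>\<^bsub>B\<^esub>) X Xi"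
  shows "\<exists>h. kalgebra_hom (cyclotomic_hecke k vs) B h \<and>
    (k \<ge> 1 \<longrightarrow> (\<forall>i. 1 \<le> i \<and> i < k \<longrightarrow> h (ygen 1 k vs (gen_g i)) = g i) \<and>
      h (ygen 1 k vs gen_X) = X \<and> h (ygen 1 k vs gen_Xinv) = Xi)"
proof (cases "k = 0")
  case True
  let ?F = "free_algebra {} :: (ground, free_elem) module"
  have k1: "kalgebra ?F" by (rule kalgebra_free_algebra)
  have k2: "kalgebra (alg_quot ?F {})" by (rule kalgebra.kalgebra_alg_quot[OF k1 empty_subsetI])
  have "\<exists>h. kalgebra_hom ?F B h \<and> (\<forall>x\<in>{}. h (Poly_Mapping.single [x] 1) = \<one>\<^bsub>B\<^esub>)"
    by (rule free_algebra_lift[OF assms(1)]) simp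
  then obtain h0 where h0: "kalgebra_hom ?F B h0" by (elim exE conjE)
  obtain h1 where h1: "kalgebra_hom (alg_quot ?F {}) B h1"
    using kalgebra.alg_quot_lift[OF k1 empty_subsetI h0] by blast
  obtain h2 where "kalgebra_hom (alg_quot (alg_quot ?F {}) {}) B h2"
    using kalgebra.alg_quot_lift[OF k2 empty_subsetI h1] by blast
  then show ?thesis unfolding True cyclotomic_hecke_zero by auto
next
  case False
  then have k: "k \<ge> 1" by simp
  show ?thesis
    using cyclotomic_YH_lift[OF rep[OF k]] unfolding cyclotomic_hecke_pos[OF k] by blast
qed

lemma (in kalgebra) nat_pow_1: "x \<in> carrier A \<Longrightarrow> x [^] (1::nat) = x"
  by simp

lemma hecke_t:
  assumes "1 \<le> j" "j \<le> k"
  shows "ygen 1 k vs (gen_t j) = \<one>\<^bsub>cyclotomic_YH 1 k vs\<^esub>"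
proof -
  interpret yh_rep "cyclotomic_YH 1 k vs" 1 k vs "yh_g 1 k vs" "yh_t 1 k vs" "ygen 1 k vs gen_X" "ygen 1 k vs gen_Xinv"
    by (rule yh_rep_cyclotomic_YH) simp
  have "yh_t 1 k vs j = \<one>\<^bsub>cyclotomic_YH 1 k vs\<^esub>"
    using t_power[of j] assms unfolding nat_pow_1[OF t_closed] by simp
  then show ?thesis using assms by (simp add: yh_t_def)
qed


section \<open>The action on functions on colourings\<close>

text \<open>\<open>Z\<close> is an abstract copy of the tensor product: one family of Hecke
  generators per colour, families of different colours commuting. The verification of the action
  rests on these facts; the tensor product itself is inserted later.\<close>

locale col_action = Z: kalgebra Z for Z :: "(ground, 'z) module" +
  fixes d n :: nat and \<mu> :: "nat list" and vs :: "ground list"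
    and gb :: "nat \<Rightarrow> nat \<Rightarrow> 'z" and Xb Xib :: "nat \<Rightarrow> 'z"
  assumes d_pos: "d \<ge> 1" and n_pos: "n \<ge> 1"
    and gb_closed [simp]: "gb a i \<in> carrier Z" and Xb_closed [simp]: "Xb a \<in> carrier Z"
    and Xib_closed [simp]: "Xib a \<in> carrier Z"
    and hecke: "\<lbrakk>a < d; 1 \<le> \<mu> ! a\<rbrakk> \<Longrightarrow> yh_rep Z 1 (\<mu> ! a) vs (gb a) (\<lambda>_. \<one>\<^bsub>Z\<^esub>) (Xb a) (Xib a)"
    and gb_gb: "\<lbrakk>a < d; b < d; a \<noteq> b; 1 \<le> i; i < \<mu> ! a; 1 \<le> j; j < \<mu> ! b\<rbrakk> \<Longrightarrow> gb a i \<otimes>\<^bsub>Z\<^esub> gb b j = gb b j \<otimes>\<^bsub>Z\<^esub> gb a i"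
    and Xb_gb: "\<lbrakk>a < d; b < d; a \<noteq> b; 1 \<le> \<mu> ! a; 1 \<le> j; j < \<mu> ! b\<rbrakk> \<Longrightarrow> Xb a \<otimes>\<^bsub>Z\<^esub> gb b j = gb b j \<otimes>\<^bsub>Z\<^esub> Xb a"
    and Xb_Xb: "\<lbrakk>a < d; b < d; a \<noteq> b; 1 \<le> \<mu> ! a; 1 \<le> \<mu> ! b\<rbrakk> \<Longrightarrow> Xb a \<otimes>\<^bsub>Z\<^esub> Xb b = Xb b \<otimes>\<^bsub>Z\<^esub> Xb a"
begin

definition Col :: "(nat \<Rightarrow> nat) set" where "Col = {\<chi> \<in> colourings d n. col_type d n \<chi> = \<mu>}"

abbreviation M where "M \<equiv> direct_sum_algebra Col (\<lambda>_. Z)"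

abbreviation En where "En \<equiv> end_algebra M"

lemma kalgebra_M: "kalgebra M" by (intro kalgebra_direct_sum Z.kalgebra_axioms)

lemma kalgebra_En: "kalgebra En" by (rule kalgebra_end_algebra[OF kalgebra_M])

lemma M_carrier: "f \<in> carrier M \<longleftrightarrow> f \<in> extensional Col \<and> (\<forall>\<chi>\<in>Col. f \<chi> \<in> carrier Z)"
  by (auto simp: direct_sum_algebra_def PiE_iff)

lemma M_ops:
  "\<chi> \<in> Col \<Longrightarrow> (f \<oplus>\<^bsub>M\<^esub> f') \<chi> = f \<chi> \<oplus>\<^bsub>Z\<^esub> f' \<chi>" "\<chi> \<in> Col \<Longrightarrow> (c \<odot>\<^bsub>M\<^esub> f) \<chi> = c \<odot>\<^bsub>Z\<^esub> f \<chi>"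
  "f \<oplus>\<^bsub>M\<^esub> f' \<in> extensional Col" "c \<odot>\<^bsub>M\<^esub> f \<in> extensional Col"
  by (simp_all add: direct_sum_algebra_def)

lemma M_val: "\<lbrakk>f \<in> carrier M; \<chi> \<in> Col\<rbrakk> \<Longrightarrow> f \<chi> \<in> carrier Z"
  by (simp add: M_carrier)

lemma M_eqI: "\<lbrakk>f \<in> carrier M; f' \<in> carrier M; \<And>\<chi>. \<chi> \<in> Col \<Longrightarrow> f \<chi> = f' \<chi>\<rbrakk> \<Longrightarrow> f = f'"
  by (rule extensionalityI[of _ Col]) (simp_all add: M_carrier)

text \<open>The new value at \<open>\<chi>\<close> may depend on the whole of \<open>f\<close>,
  because an exchange reads \<open>f\<close> at another colouring.\<close>

definition oper :: "((nat \<Rightarrow> nat) \<Rightarrow> ((nat \<Rightarrow> nat) \<Rightarrow> 'z) \<Rightarrow> 'z) \<Rightarrow> ((nat \<Rightarrow> nat) \<Rightarrow> 'z) \<Rightarrow> (nat \<Rightarrow> nat) \<Rightarrow> 'z"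
  where "oper F = (\<lambda>f\<in>carrier M. \<lambda>\<chi>\<in>Col. F \<chi> f)"

lemma oper_closed:
  assumes "\<And>\<chi> f. \<lbrakk>\<chi> \<in> Col; f \<in> carrier M\<rbrakk> \<Longrightarrow> F \<chi> f \<in> carrier Z"
    and "\<And>\<chi> f f'. \<lbrakk>\<chi> \<in> Col; f \<in> carrier M; f' \<in> carrier M\<rbrakk> \<Longrightarrow> F \<chi> (f \<oplus>\<^bsub>M\<^esub> f') = F \<chi> f \<oplus>\<^bsub>Z\<^esub> F \<chi> f'"
    and "\<And>\<chi> f c. \<lbrakk>\<chi> \<in> Col; f \<in> carrier M\<rbrakk> \<Longrightarrow> F \<chi> (c \<odot>\<^bsub>M\<^esub> f) = c \<odot>\<^bsub>Z\<^esub> F \<chi> f"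
  shows "oper F \<in> carrier En"
proof -
  interpret M: kalgebra M by (rule kalgebra_M)
  have cl: "(\<lambda>\<chi>\<in>Col. F \<chi> f) \<in> carrier M" if "f \<in> carrier M" for f
    using assms(1)[OF _ that] by (simp add: M_carrier)
  have add: "(\<lambda>\<chi>\<in>Col. F \<chi> (f \<oplus>\<^bsub>M\<^esub> f')) = (\<lambda>\<chi>\<in>Col. F \<chi> f) \<oplus>\<^bsub>M\<^esub> (\<lambda>\<chi>\<in>Col. F \<chi> f')"
    if "f \<in> carrier M" "f' \<in> carrier M" for f f'
    by (rule M_eqI[OF cl[OF M.a_closed[OF that]] M.a_closed[OF cl[OF that(1)] cl[OF that(2)]]])
      (simp add: M_ops assms(2)[OF _ that])
  have sm: "(\<lambda>\<chi>\<in>Col. F \<chi> (c \<odot>\<^bsub>M\<^esub> f)) = c \<odot>\<^bsub>M\<^esub> (\<lambda>\<chi>\<in>Col. F \<chi> f)" if "f \<in> carrier M" for f c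
    by (rule M_eqI[OF cl[OF M.smult_closed[OF that]] M.smult_closed[OF cl[OF that]]])
      (simp add: M_ops assms(3)[OF _ that])
  show ?thesis
    unfolding end_algebra_carrier oper_def
    using cl add sm M.a_closed M.smult_closed by simp
qed

lemma oper_apply: "\<lbrakk>f \<in> carrier M; \<chi> \<in> Col\<rbrakk> \<Longrightarrow> oper F f \<chi> = F \<chi> f"
  by (simp add: oper_def)

lemma En_apply:
  assumes "f \<in> carrier M" "\<chi> \<in> Col"
  shows "(F \<otimes>\<^bsub>En\<^esub> G) f = F (G f)" "\<one>\<^bsub>En\<^esub> f = f" "(F \<oplus>\<^bsub>En\<^esub> G) f \<chi> = F f \<chi> \<oplus>\<^bsub>Z\<^esub> G f \<chi>"
    "(c \<odot>\<^bsub>En\<^esub> F) f \<chi> = c \<odot>\<^bsub>Z\<^esub> F f \<chi>"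
  using assms by (simp_all add: end_algebra_ops M_ops)

lemma En_closed: "\<lbrakk>F \<in> carrier En; f \<in> carrier M\<rbrakk> \<Longrightarrow> F f \<in> carrier M"
  by (simp add: end_algebra_carrier)

lemma En_eqI:
  assumes "F \<in> carrier En" "G \<in> carrier En" "\<And>f \<chi>. \<lbrakk>f \<in> carrier M; \<chi> \<in> Col\<rbrakk> \<Longrightarrow> F f \<chi> = G f \<chi>"
  shows "F = G"
proof (rule end_algebra_eqI[OF assms(1,2)])
  fix f assume f: "f \<in> carrier M"
  show "F f = G f" by (rule M_eqI[OF En_closed[OF assms(1) f] En_closed[OF assms(2) f] assms(3)[OF f]])
qed

lemma En_finsum:
  assumes "\<And>s. s \<in> R \<Longrightarrow> F s \<in> carrier En" "f \<in> carrier M" "\<chi> \<in> Col"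
  shows "(finsum En F R) f \<chi> = (\<Oplus>\<^bsub>Z\<^esub>s\<in>R. F s f \<chi>)"
proof -
  have "abelian_group En" using kalgebra_En by (simp add: kalgebra_def ring_def)
  note additive = finsum_additive_map[of En Z "\<lambda>F. F f \<chi>" R F, OF this Z.abelian_group_axioms]
  show ?thesis
  proof (rule additive)
    show "F f \<chi> \<in> carrier Z" if "F \<in> carrier En" for F
      by (rule M_val[OF En_closed[OF that assms(2)] assms(3)])
    show "(F \<oplus>\<^bsub>En\<^esub> G) f \<chi> = F f \<chi> \<oplus>\<^bsub>Z\<^esub> G f \<chi>" for F G
      by (rule En_apply(3)[OF assms(2,3)])
    show "F s \<in> carrier En" if "s \<in> R" for s by (rule assms(1)[OF that])
  qed
qed

lemma Col_D: "\<chi> \<in> Col \<Longrightarrow> \<chi> \<in> colourings d n" by (simp add: Col_def)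

lemma sw_Col:
  assumes "\<chi> \<in> Col" "1 \<le> i" "i < n"
  shows "sw i \<chi> \<in> Col"
proof -
  have c: "\<chi> \<in> colourings d n" by (rule Col_D[OF assms(1)])
  have "sw i \<chi> \<in> colourings d n" by (rule sw_colourings[OF c assms(2,3)])
  moreover have "col_type d n (sw i \<chi>) = col_type d n \<chi>" by (simp add: col_type_def cnt_sw_total[OF assms(2,3)])
  ultimately show ?thesis using assms(1) by (simp add: Col_def)
qed

lemma Col_val: "\<lbrakk>\<chi> \<in> Col; 1 \<le> j; j \<le> n\<rbrakk> \<Longrightarrow> \<chi> j < d"
  by (rule colouringsD(1)[OF Col_D])

lemma Col_cnt: "\<lbrakk>\<chi> \<in> Col; a < d\<rbrakk> \<Longrightarrow> cnt \<chi> n a = \<mu> ! a"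
  using col_type_nth[of a d n \<chi>] by (simp add: Col_def)

text \<open>Two equal neighbours of colour \<open>a\<close> have consecutive ranks, both at most
  \<open>\<mu> ! a\<close>, so the lower rank is a valid index for a generator of that
  block.\<close>

lemma rank_bounds:
  assumes "\<chi> \<in> Col" "1 \<le> i" "i < n" "\<chi> i = \<chi> (Suc i)"
  shows "\<chi> i < d" "1 \<le> cnt \<chi> i (\<chi> i)" "cnt \<chi> i (\<chi> i) < \<mu> ! \<chi> i" "1 \<le> \<mu> ! \<chi> i"
proof -
  show d: "\<chi> i < d" using Col_val[of \<chi> i] assms by simp
  obtain i' where "i = Suc i'" using assms(2) by (cases i) auto
  then show "1 \<le> cnt \<chi> i (\<chi> i)" by (simp add: cnt_Suc)
  have "cnt \<chi> (Suc i) (\<chi> i) \<le> \<mu> ! \<chi> i"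
    using cnt_mono[of "Suc i" n \<chi> "\<chi> i"] assms Col_cnt[OF assms(1) d] by simp
  then show "cnt \<chi> i (\<chi> i) < \<mu> ! \<chi> i" using assms(4) by (simp add: cnt_Suc)
  then show "1 \<le> \<mu> ! \<chi> i" by simp
qed

lemma first_bound:
  assumes "\<chi> \<in> Col" "1 \<le> j" "j \<le> n"
  shows "1 \<le> \<mu> ! \<chi> j"
proof -
  obtain j' where "j = Suc j'" using assms(2) by (cases j) auto
  then have "1 \<le> cnt \<chi> j (\<chi> j)" by (simp add: cnt_Suc)
  also have "\<dots> \<le> \<mu> ! \<chi> j" using cnt_mono[OF assms(3), of \<chi> "\<chi> j"] Col_cnt[OF assms(1) Col_val[OF assms]] by simp
  finally show ?thesis .
qed

text \<open>At equal neighbours: the generator of their block, indexed by the rank of the left one.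
  At unequal neighbours: the exchange, scaled by \<open>u_var\<close>, since its square has to be
  \<open>u_var\<^sup>2\<close> where \<open>e i\<close> acts as zero.\<close>

definition aG :: "nat \<Rightarrow> ((nat \<Rightarrow> nat) \<Rightarrow> 'z) \<Rightarrow> (nat \<Rightarrow> nat) \<Rightarrow> 'z"
  where "aG i = (if 1 \<le> i \<and> i < n then oper (\<lambda>\<chi> f. if \<chi> i = \<chi> (Suc i)
      then gb (\<chi> i) (cnt \<chi> i (\<chi> i)) \<otimes>\<^bsub>Z\<^esub> f \<chi> else u_var \<odot>\<^bsub>Z\<^esub> f (sw i \<chi>)) else \<one>\<^bsub>En\<^esub>)"

definition aT :: "nat \<Rightarrow> ((nat \<Rightarrow> nat) \<Rightarrow> 'z) \<Rightarrow> (nat \<Rightarrow> nat) \<Rightarrow> 'z"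
  where "aT j = oper (\<lambda>\<chi> f. zp d (\<chi> j) \<odot>\<^bsub>Z\<^esub> f \<chi>)"

text \<open>Position 1 has rank 1 in its colour, so X acts as the X of the block of colour
  \<open>\<chi> 1\<close>.\<close>

definition aM :: "(nat \<Rightarrow> 'z) \<Rightarrow> ((nat \<Rightarrow> nat) \<Rightarrow> 'z) \<Rightarrow> (nat \<Rightarrow> nat) \<Rightarrow> 'z"
  where "aM x = oper (\<lambda>\<chi> f. x (\<chi> 1) \<otimes>\<^bsub>Z\<^esub> f \<chi>)"

lemma aG_closed: "aG i \<in> carrier En"
proof (cases "1 \<le> i \<and> i < n")
  case True
  then have sw: "sw i \<chi> \<in> Col" if "\<chi> \<in> Col" for \<chi> using that sw_Col by simp
  have "oper (\<lambda>\<chi> f. if \<chi> i = \<chi> (Suc i) then gb (\<chi> i) (cnt \<chi> i (\<chi> i)) \<otimes>\<^bsub>Z\<^esub> f \<chi> else u_var \<odot>\<^bsub>Z\<^esub> f (sw i \<chi>)) \<in> carrier En"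
    by (rule oper_closed) (simp_all add: M_ops M_val sw Z.r_distr Z.smult_r_distr Z.smult_smult Z.smult_mult_right mult.commute)
  then show ?thesis using True by (simp add: aG_def)
next
  case False
  interpret En: kalgebra En by (rule kalgebra_En)
  show ?thesis using False En.one_closed by (simp only: aG_def if_False)
qed

lemma aT_closed: "aT j \<in> carrier En"
  unfolding aT_def
  by (rule oper_closed) (simp_all add: M_ops M_val Z.smult_r_distr Z.smult_smult mult.commute)

lemma aM_closed: "(\<And>a. x a \<in> carrier Z) \<Longrightarrow> aM x \<in> carrier En"
  unfolding aM_def
  by (rule oper_closed) (simp_all add: M_ops M_val Z.r_distr Z.smult_mult_right)

lemma aG_apply:
  "\<lbrakk>f \<in> carrier M; \<chi> \<in> Col; 1 \<le> i; i < n\<rbrakk> \<Longrightarrow> aG i f \<chi> =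
    (if \<chi> i = \<chi> (Suc i) then gb (\<chi> i) (cnt \<chi> i (\<chi> i)) \<otimes>\<^bsub>Z\<^esub> f \<chi> else u_var \<odot>\<^bsub>Z\<^esub> f (sw i \<chi>))"
  by (simp add: aG_def oper_apply)

lemma aT_apply: "\<lbrakk>f \<in> carrier M; \<chi> \<in> Col\<rbrakk> \<Longrightarrow> aT j f \<chi> = zp d (\<chi> j) \<odot>\<^bsub>Z\<^esub> f \<chi>"
  by (simp add: aT_def oper_apply)

lemma aM_apply: "\<lbrakk>f \<in> carrier M; \<chi> \<in> Col\<rbrakk> \<Longrightarrow> aM x f \<chi> = x (\<chi> 1) \<otimes>\<^bsub>Z\<^esub> f \<chi>"
  by (simp add: aM_def oper_apply)

lemma aT_pow:
  assumes "f \<in> carrier M" "\<chi> \<in> Col"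
  shows "(aT j [^]\<^bsub>En\<^esub> (s::nat)) f \<chi> = zp d (\<chi> j) ^ s \<odot>\<^bsub>Z\<^esub> f \<chi>"
  using assms(1)
proof (induction s arbitrary: f)
  interpret En: kalgebra En by (rule kalgebra_En)
  case 0
  then show ?case using assms(2) by (simp add: En.nat_pow_0 En_apply M_val)
next
  interpret En: kalgebra En by (rule kalgebra_En)
  case (Suc s)
  have "(aT j [^]\<^bsub>En\<^esub> Suc s) f \<chi> = (aT j [^]\<^bsub>En\<^esub> s) (aT j f) \<chi>"
    by (simp only: En.nat_pow_Suc En_apply(1)[OF Suc.prems assms(2)])
  also have "\<dots> = zp d (\<chi> j) ^ s \<odot>\<^bsub>Z\<^esub> aT j f \<chi>" by (rule Suc.IH[OF En_closed[OF aT_closed Suc.prems]])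
  finally show ?case
    by (simp only: aT_apply[OF Suc.prems assms(2)] Z.smult_smult M_val[OF Suc.prems assms(2)] power_Suc2)
qed

lemma poly_at_apply:
  assumes x: "\<And>a. x a \<in> carrier Z" and \<chi>: "\<chi> \<in> Col" and f: "f \<in> carrier M"
  shows "kalgebra.poly_at En ws (aM x) f \<chi> = Z.poly_at ws (x (\<chi> 1)) \<otimes>\<^bsub>Z\<^esub> f \<chi>"
  using f
proof (induction ws arbitrary: f)
  interpret En: kalgebra En by (rule kalgebra_En)
  case Nil
  then show ?case using \<chi> M_val by (simp add: En_apply)
next
  interpret En: kalgebra En by (rule kalgebra_En)
  case (Cons c ws)
  let ?P = "En.poly_at ws (aM x)"
  have P: "?P \<in> carrier En" by (intro En.poly_at_closed aM_closed x)
  have Pf: "?P f \<in> carrier M" by (rule En_closed[OF P Cons.prems])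
  have "En.poly_at (c # ws) (aM x) f \<chi> = ((aM x \<ominus>\<^bsub>En\<^esub> c \<odot>\<^bsub>En\<^esub> \<one>\<^bsub>En\<^esub>) (?P f)) \<chi>"
    by (simp only: En.poly_at_simps En_apply(1)[OF Cons.prems \<chi>])
  also have "aM x \<ominus>\<^bsub>En\<^esub> c \<odot>\<^bsub>En\<^esub> \<one>\<^bsub>En\<^esub> = aM x \<oplus>\<^bsub>En\<^esub> (- c) \<odot>\<^bsub>En\<^esub> \<one>\<^bsub>En\<^esub>"
    by (simp only: En.minus_eq En.minus_smult En.one_closed)
  also have "(aM x \<oplus>\<^bsub>En\<^esub> (- c) \<odot>\<^bsub>En\<^esub> \<one>\<^bsub>En\<^esub>) (?P f) \<chi> = x (\<chi> 1) \<otimes>\<^bsub>Z\<^esub> ?P f \<chi> \<oplus>\<^bsub>Z\<^esub> (- c) \<odot>\<^bsub>Z\<^esub> ?P f \<chi>"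
    by (simp only: En_apply[OF Pf \<chi>] aM_apply[OF Pf \<chi>])
  also have "\<dots> = (x (\<chi> 1) \<ominus>\<^bsub>Z\<^esub> c \<odot>\<^bsub>Z\<^esub> \<one>\<^bsub>Z\<^esub>) \<otimes>\<^bsub>Z\<^esub> ?P f \<chi>"
    using M_val[OF Pf \<chi>] x by (simp add: Z.minus_eq Z.minus_smult Z.l_distr Z.smult_mult_left)
  also have "?P f \<chi> = Z.poly_at ws (x (\<chi> 1)) \<otimes>\<^bsub>Z\<^esub> f \<chi>" by (rule Cons.IH[OF Cons.prems])
  finally show ?case using x M_val[OF Cons.prems \<chi>] by (simp add: Z.m_assoc)
qed

lemma hecke_square:
  assumes "a < d" "1 \<le> i" "i < \<mu> ! a"
  shows "gb a i \<otimes>\<^bsub>Z\<^esub> gb a i = U \<odot>\<^bsub>Z\<^esub> \<one>\<^bsub>Z\<^esub> \<oplus>\<^bsub>Z\<^esub> v_var \<odot>\<^bsub>Z\<^esub> gb a i"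
proof -
  interpret H: yh_rep Z 1 "\<mu> ! a" vs "gb a" "\<lambda>_. \<one>\<^bsub>Z\<^esub>" "Xb a" "Xib a"
    using assms by (intro hecke) simp_all
  have "H.e i = \<one>\<^bsub>Z\<^esub>" unfolding H.e_def by (simp add: const_ground_1)
  then show ?thesis using H.g_g[of i] assms by simp
qed

section \<open>Verification of the relations for the operators\<close>

lemma m_left: "\<lbrakk>x \<otimes>\<^bsub>Z\<^esub> y = y \<otimes>\<^bsub>Z\<^esub> x; x \<in> carrier Z; y \<in> carrier Z; z \<in> carrier Z\<rbrakk> \<Longrightarrow>
    x \<otimes>\<^bsub>Z\<^esub> (y \<otimes>\<^bsub>Z\<^esub> z) = y \<otimes>\<^bsub>Z\<^esub> (x \<otimes>\<^bsub>Z\<^esub> z)"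
  by (simp add: Z.m_assoc[symmetric])

lemma aG_val: "f \<in> carrier M \<Longrightarrow> aG i f \<in> carrier M" by (rule En_closed[OF aG_closed])

lemma aG_commute:
  assumes f: "f \<in> carrier M" and \<chi>: "\<chi> \<in> Col" and i: "1 \<le> i" "Suc i < j" "j < n"
  shows "aG i (aG j f) \<chi> = aG j (aG i f) \<chi>"
proof -
  have ij: "1 \<le> j" "i < n" "i \<noteq> j" "j \<noteq> Suc i" "Suc j \<noteq> i" "Suc j \<noteq> Suc i" using i by simp_all
  have swi: "sw i \<chi> \<in> Col" "sw j \<chi> \<in> Col" using sw_Col[OF \<chi>] i ij by simp_all
  have v: "\<And>\<chi>. \<chi> \<in> Col \<Longrightarrow> f \<chi> \<in> carrier Z" using M_val[OF f] .
  note ap = aG_apply[OF aG_val[OF f]] aG_apply[OF f]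
  have vals: "sw i \<chi> j = \<chi> j" "sw i \<chi> (Suc j) = \<chi> (Suc j)" "sw j \<chi> i = \<chi> i" "sw j \<chi> (Suc i) = \<chi> (Suc i)"
    using ij by (simp_all add: sw_def transpose_def)
  have cn: "cnt (sw i \<chi>) j a = cnt \<chi> j a" "cnt (sw j \<chi>) i a = cnt \<chi> i a" for a
    using ij i by (simp_all add: cnt_sw)
  consider "\<chi> i = \<chi> (Suc i)" "\<chi> j = \<chi> (Suc j)" | "\<chi> i \<noteq> \<chi> (Suc i)" "\<chi> j = \<chi> (Suc j)"
    | "\<chi> i = \<chi> (Suc i)" "\<chi> j \<noteq> \<chi> (Suc j)" | "\<chi> i \<noteq> \<chi> (Suc i)" "\<chi> j \<noteq> \<chi> (Suc j)" by blast
  then show ?thesis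
  proof cases
    case 1
    let ?x = "gb (\<chi> i) (cnt \<chi> i (\<chi> i))" and ?y = "gb (\<chi> j) (cnt \<chi> j (\<chi> j))"
    note ri = rank_bounds[OF \<chi> i(1) ij(2) 1(1)] and rj = rank_bounds[OF \<chi> ij(1) i(3) 1(2)]
    have "?x \<otimes>\<^bsub>Z\<^esub> ?y = ?y \<otimes>\<^bsub>Z\<^esub> ?x"
    proof (cases "\<chi> i = \<chi> j")
      \<comment> \<open>In one block, the ranks of \<open>i\<close> and \<open>j\<close> differ by
        at least 2, so the commutation relation of that block applies.\<close>
      case True
      interpret H: yh_rep Z 1 "\<mu> ! \<chi> i" vs "gb (\<chi> i)" "\<lambda>_. \<one>\<^bsub>Z\<^esub>" "Xb (\<chi> i)" "Xib (\<chi> i)"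
        by (rule hecke[OF ri(1,4)])
      obtain j' where j': "j = Suc j'" "Suc i \<le> j'" using i by (cases j) simp_all
      have "cnt \<chi> (Suc i) (\<chi> i) \<le> cnt \<chi> j' (\<chi> i)" by (rule cnt_mono[OF j'(2)])
      then have "Suc (cnt \<chi> i (\<chi> i)) < cnt \<chi> j (\<chi> i)" using 1(1) True j'(1) by (simp add: cnt_Suc)
      then show ?thesis using H.g_commute[of "cnt \<chi> i (\<chi> i)" "cnt \<chi> j (\<chi> j)"] ri rj True by simp
    next
      case False
      then show ?thesis using ri rj by (intro gb_gb)
    qed
    then show ?thesis using 1 i ij \<chi> v by (simp add: ap m_left)
  next
    case 2
    then show ?thesis using i ij \<chi> swi v by (simp add: ap vals cn Z.smult_mult_right)
  next
    case 3
    then show ?thesis using i ij \<chi> swi v by (simp add: ap vals cn Z.smult_mult_right)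
  next
    case 4
    then show ?thesis using i ij \<chi> swi v sw_commute[OF i(2)] by (simp add: ap vals)
  qed
qed

text \<open>By the equality pattern of three neighbouring colours. Three equal colours reduce to the
  braid relation of their block, three different ones to that of exchanges. In the mixed patterns
  the equal pair keeps its ranks while the third colour passes it, so the same generator appears on
  both sides.\<close>

lemma aG_braid:
  assumes f: "f \<in> carrier M" and \<chi>: "\<chi> \<in> Col" and i: "1 \<le> i" "Suc i < n"
  shows "aG i (aG (Suc i) (aG i f)) \<chi> = aG (Suc i) (aG i (aG (Suc i) f)) \<chi>"
proof -
  let ?j = "Suc i"
  obtain i' where i': "i = Suc i'" using i(1) by (cases i) auto
  have ij: "1 \<le> ?j" "i < n" using i by simp_all
  have C: "sw k \<psi> \<in> Col" if "\<psi> \<in> Col" "k = i \<or> k = ?j" for k \<psi> using sw_Col[OF that(1), of k] that(2) i ij by auto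
  have v: "\<And>\<chi>. \<chi> \<in> Col \<Longrightarrow> f \<chi> \<in> carrier Z" using M_val[OF f] .
  note ap = aG_apply[OF aG_val[OF aG_val[OF f]]] aG_apply[OF aG_val[OF f]] aG_apply[OF f]
  note C' = C[of _ i, simplified] C[of _ ?j, simplified]
  have vals: "sw i \<psi> (Suc ?j) = \<psi> (Suc ?j)" "sw ?j \<psi> i = \<psi> i" for \<psi> by simp_all
  have cn: "cnt \<psi> i a = cnt \<psi> i' a + (if \<psi> i = a then 1 else 0)"
    "cnt \<psi> ?j a = cnt \<psi> i' a + (if \<psi> i = a then 1 else 0) + (if \<psi> ?j = a then 1 else 0)"
    "cnt (sw i \<psi>) i' a = cnt \<psi> i' a" "cnt (sw ?j \<psi>) i' a = cnt \<psi> i' a" for \<psi> a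
    using i' by (simp_all add: cnt_Suc cnt_sw)
  consider "\<chi> i = \<chi> ?j" "\<chi> ?j = \<chi> (Suc ?j)" | "\<chi> i = \<chi> ?j" "\<chi> ?j \<noteq> \<chi> (Suc ?j)"
    | "\<chi> i \<noteq> \<chi> ?j" "\<chi> ?j = \<chi> (Suc ?j)" | "\<chi> i \<noteq> \<chi> ?j" "\<chi> ?j \<noteq> \<chi> (Suc ?j)" "\<chi> i = \<chi> (Suc ?j)"
    | "\<chi> i \<noteq> \<chi> ?j" "\<chi> ?j \<noteq> \<chi> (Suc ?j)" "\<chi> i \<noteq> \<chi> (Suc ?j)" by blast
  then show ?thesis
  proof cases
    case 1
    note ri = rank_bounds[OF \<chi> i(1) ij(2) 1(1)] and rj = rank_bounds[OF \<chi> ij(1) i(2) 1(2)]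
    interpret H: yh_rep Z 1 "\<mu> ! \<chi> i" vs "gb (\<chi> i)" "\<lambda>_. \<one>\<^bsub>Z\<^esub>" "Xb (\<chi> i)" "Xib (\<chi> i)"
      by (rule hecke[OF ri(1,4)])
    let ?k = "cnt \<chi> i (\<chi> i)"
    let ?x = "gb (\<chi> i) ?k" and ?y = "gb (\<chi> i) (Suc ?k)"
    have k: "cnt \<chi> ?j (\<chi> i) = Suc ?k" using 1 by (simp add: cnt_Suc)
    have "?x \<otimes>\<^bsub>Z\<^esub> (?y \<otimes>\<^bsub>Z\<^esub> ?x) = ?y \<otimes>\<^bsub>Z\<^esub> (?x \<otimes>\<^bsub>Z\<^esub> ?y)"
      using H.g_braid[of ?k] ri(2) rj(3) k 1 by simp
    then have "?x \<otimes>\<^bsub>Z\<^esub> (?y \<otimes>\<^bsub>Z\<^esub> ?x) \<otimes>\<^bsub>Z\<^esub> f \<chi> = ?y \<otimes>\<^bsub>Z\<^esub> (?x \<otimes>\<^bsub>Z\<^esub> ?y) \<otimes>\<^bsub>Z\<^esub> f \<chi>" by (simp only:)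
    then have eq: "?x \<otimes>\<^bsub>Z\<^esub> (?y \<otimes>\<^bsub>Z\<^esub> (?x \<otimes>\<^bsub>Z\<^esub> f \<chi>)) = ?y \<otimes>\<^bsub>Z\<^esub> (?x \<otimes>\<^bsub>Z\<^esub> (?y \<otimes>\<^bsub>Z\<^esub> f \<chi>))"
      using v[OF \<chi>] by (simp add: Z.m_assoc)
    have "\<chi> ?j = \<chi> i" "\<chi> (Suc ?j) = \<chi> i" using 1 by simp_all
    then show ?thesis using i ij \<chi> eq k by (simp add: ap)
  next
    case 2
    then show ?thesis using i ij \<chi> v C'
      by (simp add: ap vals Z.smult_mult_right) (simp add: cn)
  next
    case 3
    then have "\<chi> i \<noteq> \<chi> (Suc ?j)" by simp
    then show ?thesis using 3 i ij \<chi> v C'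
      by (simp add: ap vals Z.smult_mult_right) (simp add: cn)
  next
    case 4
    then show ?thesis using i ij \<chi> v C'
      by (simp add: ap vals Z.smult_mult_right) (simp add: cn)
  next
    case 5
    then show ?thesis using i ij \<chi> v C' sw_braid[of i \<chi>]
      by (simp add: ap vals)
  qed
qed

text \<open>If position 1 has the colour of \<open>i\<close>, then \<open>i\<close> has rank at
  least 2 in it and the relation of the block applies; otherwise the two factors belong to different
  blocks.\<close>

lemma X_g_commutes:
  assumes f: "f \<in> carrier M" and \<chi>: "\<chi> \<in> Col" and i: "2 \<le> i" "i < n"
  shows "aM Xb (aG i f) \<chi> = aG i (aM Xb f) \<chi>"
proof -
  have i1: "1 \<le> i" using i by simp
  have Mf: "aM Xb f \<in> carrier M" by (intro En_closed[OF aM_closed] f Xb_closed)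
  note ap = aG_apply[OF f] aG_apply[OF Mf] aM_apply[OF aG_val[OF f]] aM_apply[OF f]
  have v: "\<And>\<chi>. \<chi> \<in> Col \<Longrightarrow> f \<chi> \<in> carrier Z" using M_val[OF f] .
  show ?thesis
  proof (cases "\<chi> i = \<chi> (Suc i)")
    case True
    note r = rank_bounds[OF \<chi> i1 i(2) True]
    have d1: "\<chi> 1 < d" "1 \<le> \<mu> ! \<chi> 1" using Col_val[OF \<chi>, of 1] first_bound[OF \<chi>, of 1] n_pos by simp_all
    have "Xb (\<chi> 1) \<otimes>\<^bsub>Z\<^esub> gb (\<chi> i) (cnt \<chi> i (\<chi> i)) = gb (\<chi> i) (cnt \<chi> i (\<chi> i)) \<otimes>\<^bsub>Z\<^esub> Xb (\<chi> 1)"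
    proof (cases "\<chi> 1 = \<chi> i")
      case same: True
      interpret H: yh_rep Z 1 "\<mu> ! \<chi> i" vs "gb (\<chi> i)" "\<lambda>_. \<one>\<^bsub>Z\<^esub>" "Xb (\<chi> i)" "Xib (\<chi> i)"
        by (rule hecke[OF r(1,4)])
      obtain i' where i': "i = Suc i'" "1 \<le> i'" using i by (cases i) simp_all
      have "cnt \<chi> 1 (\<chi> i) \<le> cnt \<chi> i' (\<chi> i)" by (rule cnt_mono[OF i'(2)])
      moreover have "cnt \<chi> 1 (\<chi> i) = 1" using same by (simp add: cnt_Suc[of \<chi> 0, simplified])
      ultimately have "2 \<le> cnt \<chi> i (\<chi> i)" using i'(1) by (simp add: cnt_Suc)
      then show ?thesis using H.X_g[of "cnt \<chi> i (\<chi> i)"] r same by simp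
    next
      case False
      then show ?thesis using d1 r by (intro Xb_gb) simp_all
    qed
    then show ?thesis using True i i1 \<chi> v[OF \<chi>] by (simp add: ap m_left)
  next
    case False
    have "sw i \<chi> 1 = \<chi> 1" using i by simp
    then show ?thesis using False i i1 \<chi> v sw_Col[OF \<chi> i1 i(2)] by (simp add: ap Z.smult_mult_right)
  qed
qed

text \<open>With unequal colours at positions 1 and 2, each side multiplies by the X of both blocks,
  in opposite order, and by \<open>u_var\<close> twice; here the X of different blocks have to
  commute.\<close>

lemma X_g_braids:
  assumes f: "f \<in> carrier M" and \<chi>: "\<chi> \<in> Col" and n: "1 < n"
  shows "aM Xb (aG 1 (aM Xb (aG 1 f))) \<chi> = aG 1 (aM Xb (aG 1 (aM Xb f))) \<chi>"
proof -
  have Mv: "aM Xb f \<in> carrier M" if "f \<in> carrier M" for f by (intro En_closed[OF aM_closed] that Xb_closed)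
  note mem = Mv aG_val f
  have ap: "aM Xb (aG 1 (aM Xb (aG 1 f))) \<psi> = Xb (\<psi> 1) \<otimes>\<^bsub>Z\<^esub> aG 1 (aM Xb (aG 1 f)) \<psi>"
    "aM Xb (aG 1 f) \<psi> = Xb (\<psi> 1) \<otimes>\<^bsub>Z\<^esub> aG 1 f \<psi>" "aM Xb (aG 1 (aM Xb f)) \<psi> = Xb (\<psi> 1) \<otimes>\<^bsub>Z\<^esub> aG 1 (aM Xb f) \<psi>"
    "aM Xb f \<psi> = Xb (\<psi> 1) \<otimes>\<^bsub>Z\<^esub> f \<psi>" if "\<psi> \<in> Col" for \<psi>
    by (rule aM_apply[OF _ that], intro mem)+
  have apG: "aG 1 h \<psi> = (if \<psi> 1 = \<psi> 2 then gb (\<psi> 1) 1 \<otimes>\<^bsub>Z\<^esub> h \<psi> else u_var \<odot>\<^bsub>Z\<^esub> h (sw 1 \<psi>))"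
    if "h \<in> carrier M" "\<psi> \<in> Col" for h \<psi>
    using aG_apply[OF that order_refl n] by (simp add: cnt_Suc[of \<psi> 0, simplified] numeral_2_eq_2)
  note apG' = apG[OF mem(3)] apG[OF mem(1)[OF mem(3)]] apG[OF mem(1)[OF mem(2)[OF mem(3)]]]
    apG[OF mem(1)[OF mem(2)[OF mem(1)[OF mem(3)]]]]
  have v: "\<And>\<chi>. \<chi> \<in> Col \<Longrightarrow> f \<chi> \<in> carrier Z" using M_val[OF f] .
  have sw: "sw 1 \<chi> \<in> Col" by (rule sw_Col[OF \<chi> order_refl n])
  have sv: "sw 1 \<chi> 1 = \<chi> 2" "sw 1 \<chi> 2 = \<chi> 1" by (simp_all add: sw_def transpose_def numeral_2_eq_2)
  have two: "\<chi> (Suc 1) = \<chi> 2" by (simp add: numeral_2_eq_2)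
  show ?thesis
  proof (cases "\<chi> 1 = \<chi> 2")
    case True
    have r: "\<chi> 1 < d" "1 < \<mu> ! \<chi> 1" "1 \<le> \<mu> ! \<chi> 1"
      using rank_bounds[OF \<chi> order_refl n] True two by (simp_all add: cnt_Suc[of \<chi> 0, simplified])
    interpret H: yh_rep Z 1 "\<mu> ! \<chi> 1" vs "gb (\<chi> 1)" "\<lambda>_. \<one>\<^bsub>Z\<^esub>" "Xb (\<chi> 1)" "Xib (\<chi> 1)"
      by (rule hecke[OF r(1,3)])
    let ?x = "Xb (\<chi> 1)" and ?g = "gb (\<chi> 1) 1"
    have "(?x \<otimes>\<^bsub>Z\<^esub> (?g \<otimes>\<^bsub>Z\<^esub> (?x \<otimes>\<^bsub>Z\<^esub> ?g))) \<otimes>\<^bsub>Z\<^esub> f \<chi> = (?g \<otimes>\<^bsub>Z\<^esub> (?x \<otimes>\<^bsub>Z\<^esub> (?g \<otimes>\<^bsub>Z\<^esub> ?x))) \<otimes>\<^bsub>Z\<^esub> f \<chi>"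
      using H.X_g_braid[OF r(2)] by (simp only:)
    then have "?x \<otimes>\<^bsub>Z\<^esub> (?g \<otimes>\<^bsub>Z\<^esub> (?x \<otimes>\<^bsub>Z\<^esub> (?g \<otimes>\<^bsub>Z\<^esub> f \<chi>))) = ?g \<otimes>\<^bsub>Z\<^esub> (?x \<otimes>\<^bsub>Z\<^esub> (?g \<otimes>\<^bsub>Z\<^esub> (?x \<otimes>\<^bsub>Z\<^esub> f \<chi>)))"
      using v[OF \<chi>] by (simp only: Z.m_assoc Z.m_closed gb_closed Xb_closed)
    then show ?thesis by (simp only: ap[OF \<chi>] apG'[OF \<chi>] True if_True simp_thms)
  next
    case False
    have d1: "\<chi> 1 < d" "\<chi> 2 < d" "1 \<le> \<mu> ! \<chi> 1" "1 \<le> \<mu> ! \<chi> 2"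
      using Col_val[OF \<chi>] first_bound[OF \<chi>] n by simp_all
    have x: "Xb (\<chi> 1) \<otimes>\<^bsub>Z\<^esub> Xb (\<chi> 2) = Xb (\<chi> 2) \<otimes>\<^bsub>Z\<^esub> Xb (\<chi> 1)" using d1 False by (intro Xb_Xb)
    have F2: "(\<chi> 2 = \<chi> 1) = False" "(\<chi> 1 = \<chi> 2) = False" using False by simp_all
    have "aM Xb (aG 1 (aM Xb (aG 1 f))) \<chi> = (u_var * u_var) \<odot>\<^bsub>Z\<^esub> (Xb (\<chi> 1) \<otimes>\<^bsub>Z\<^esub> (Xb (\<chi> 2) \<otimes>\<^bsub>Z\<^esub> f \<chi>))"
      by (simp only: ap[OF \<chi>] ap[OF sw] apG'[OF \<chi>] apG'[OF sw] sv F2 if_False sw_sw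
          Z.smult_mult_right Z.smult_smult Z.smult_closed Z.m_closed Xb_closed v[OF \<chi>])
    moreover have "aG 1 (aM Xb (aG 1 (aM Xb f))) \<chi> = (u_var * u_var) \<odot>\<^bsub>Z\<^esub> (Xb (\<chi> 2) \<otimes>\<^bsub>Z\<^esub> (Xb (\<chi> 1) \<otimes>\<^bsub>Z\<^esub> f \<chi>))"
      by (simp only: ap[OF \<chi>] ap[OF sw] apG'[OF \<chi>] apG'[OF sw] sv F2 if_False sw_sw
          Z.smult_mult_right Z.smult_smult Z.smult_closed Z.m_closed Xb_closed v[OF \<chi>])
    ultimately show ?thesis by (simp only: m_left[OF x Xb_closed Xb_closed v[OF \<chi>]])
  qed
qed

lemma e_apply:
  assumes f: "f \<in> carrier M" and \<chi>: "\<chi> \<in> Col" and i: "1 \<le> i" "i < n"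
  shows "(const_ground (1 / of_nat d) \<odot>\<^bsub>En\<^esub> (\<Oplus>\<^bsub>En\<^esub>s\<in>{1..d}. aT i [^]\<^bsub>En\<^esub> s \<otimes>\<^bsub>En\<^esub> aT (Suc i) [^]\<^bsub>En\<^esub> (d - s))) f \<chi>
    = (if \<chi> i = \<chi> (Suc i) then f \<chi> else \<zero>\<^bsub>Z\<^esub>)"
proof -
  interpret En: kalgebra En by (rule kalgebra_En)
  have cl: "aT i [^]\<^bsub>En\<^esub> s \<otimes>\<^bsub>En\<^esub> aT (Suc i) [^]\<^bsub>En\<^esub> (d - s) \<in> carrier En" for s
    by (intro En.m_closed En.nat_pow_closed aT_closed)
  have v: "f \<chi> \<in> carrier Z" by (rule M_val[OF f \<chi>])
  have one: "(aT i [^]\<^bsub>En\<^esub> s \<otimes>\<^bsub>En\<^esub> aT (Suc i) [^]\<^bsub>En\<^esub> (d - s)) f \<chi>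
      = (zp d (\<chi> i) ^ s * zp d (\<chi> (Suc i)) ^ (d - s)) \<odot>\<^bsub>Z\<^esub> f \<chi>" for s
    by (simp only: En_apply(1)[OF f \<chi>] aT_pow[OF f \<chi>] aT_pow[OF En_closed[OF En.nat_pow_closed[OF aT_closed] f] \<chi>]
        Z.smult_smult[OF v])
  have lt: "\<chi> i < d" "\<chi> (Suc i) < d" using Col_val[OF \<chi>] i by simp_all
  have "(const_ground (1 / of_nat d) \<odot>\<^bsub>En\<^esub> (\<Oplus>\<^bsub>En\<^esub>s\<in>{1..d}. aT i [^]\<^bsub>En\<^esub> s \<otimes>\<^bsub>En\<^esub> aT (Suc i) [^]\<^bsub>En\<^esub> (d - s))) f \<chi>
    = (const_ground (1 / of_nat d) * (\<Sum>s\<in>{1..d}. zp d (\<chi> i) ^ s * zp d (\<chi> (Suc i)) ^ (d - s))) \<odot>\<^bsub>Z\<^esub> f \<chi>"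
    by (simp only: En_apply(4)[OF f \<chi>] En_finsum[OF cl f \<chi>] one Z.finsum_scalar[OF v] Z.smult_smult[OF v])
  then show ?thesis using v by (simp only: e_scalar[OF lt]) simp
qed

lemma yh_rep_En:
  "yh_rep En d n vs aG aT (aM Xb) (aM Xib)"
proof -
  interpret En: kalgebra En by (rule kalgebra_En)
  note cl = aG_closed aT_closed aM_closed[OF Xb_closed] aM_closed[OF Xib_closed]
  have Mv: "aM Xb f \<in> carrier M" "aM Xib f \<in> carrier M" "aT j f \<in> carrier M" if "f \<in> carrier M" for f j
    by (rule En_closed[OF cl(3) that] En_closed[OF cl(4) that] En_closed[OF cl(2) that])+
  have one1: "\<chi> 1 < d" "1 \<le> \<mu> ! \<chi> 1" if "\<chi> \<in> Col" for \<chi>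
    using Col_val[OF that, of 1] first_bound[OF that, of 1] n_pos by simp_all
  have hX: "Xb (\<chi> 1) \<otimes>\<^bsub>Z\<^esub> Xib (\<chi> 1) = \<one>\<^bsub>Z\<^esub>" "Xib (\<chi> 1) \<otimes>\<^bsub>Z\<^esub> Xb (\<chi> 1) = \<one>\<^bsub>Z\<^esub>"
    "Z.poly_at vs (Xb (\<chi> 1)) = \<zero>\<^bsub>Z\<^esub>" if "\<chi> \<in> Col" for \<chi>
  proof -
    interpret H: yh_rep Z 1 "\<mu> ! \<chi> 1" vs "gb (\<chi> 1)" "\<lambda>_. \<one>\<^bsub>Z\<^esub>" "Xb (\<chi> 1)" "Xib (\<chi> 1)"
      by (rule hecke[OF one1[OF that]])
    show "Xb (\<chi> 1) \<otimes>\<^bsub>Z\<^esub> Xib (\<chi> 1) = \<one>\<^bsub>Z\<^esub>" "Xib (\<chi> 1) \<otimes>\<^bsub>Z\<^esub> Xb (\<chi> 1) = \<one>\<^bsub>Z\<^esub>" by (rule H.X_Xi H.Xi_X)+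
    show "Z.poly_at vs (Xb (\<chi> 1)) = \<zero>\<^bsub>Z\<^esub>" using H.X_cyclotomic unfolding Z.poly_at_def .
  qed
  show ?thesis
  proof (intro yh_rep.intro root_algebra.intro yh_rep_axioms.intro root_algebra_axioms.intro kalgebra_En d_pos cl)
    fix i j :: nat
    show "aG i \<otimes>\<^bsub>En\<^esub> aG j = aG j \<otimes>\<^bsub>En\<^esub> aG i" if "1 \<le> i" "Suc i < j" "j < n"
      by (rule En_eqI[OF En.m_closed[OF cl(1) cl(1)] En.m_closed[OF cl(1) cl(1)]])
        (simp only: En_apply aG_commute[OF _ _ that])
    show "aG i \<otimes>\<^bsub>En\<^esub> (aG (Suc i) \<otimes>\<^bsub>En\<^esub> aG i) = aG (Suc i) \<otimes>\<^bsub>En\<^esub> (aG i \<otimes>\<^bsub>En\<^esub> aG (Suc i))" if "1 \<le> i" "Suc i < n"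
      by (rule En_eqI[OF En.m_closed[OF cl(1) En.m_closed[OF cl(1) cl(1)]] En.m_closed[OF cl(1) En.m_closed[OF cl(1) cl(1)]]])
        (simp only: En_apply aG_braid[OF _ _ that])
    show "aM Xb \<otimes>\<^bsub>En\<^esub> aM Xib = \<one>\<^bsub>En\<^esub>"
      by (rule En_eqI[OF En.m_closed[OF cl(3,4)] En.one_closed])
        (simp only: En_apply aM_apply Mv Z.m_assoc[symmetric] Xb_closed Xib_closed M_val hX Z.l_one)
    show "aM Xib \<otimes>\<^bsub>En\<^esub> aM Xb = \<one>\<^bsub>En\<^esub>"
      by (rule En_eqI[OF En.m_closed[OF cl(4,3)] En.one_closed])
        (simp only: En_apply aM_apply Mv Z.m_assoc[symmetric] Xb_closed Xib_closed M_val hX Z.l_one)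
    show "aM Xb \<otimes>\<^bsub>En\<^esub> (aG 1 \<otimes>\<^bsub>En\<^esub> (aM Xb \<otimes>\<^bsub>En\<^esub> aG 1)) = aG 1 \<otimes>\<^bsub>En\<^esub> (aM Xb \<otimes>\<^bsub>En\<^esub> (aG 1 \<otimes>\<^bsub>En\<^esub> aM Xb))" if "1 < n"
      by (rule En_eqI[OF En.m_closed[OF cl(3) En.m_closed[OF cl(1) En.m_closed[OF cl(3,1)]]]
            En.m_closed[OF cl(1) En.m_closed[OF cl(3) En.m_closed[OF cl(1,3)]]]])
        (simp only: En_apply X_g_braids[OF _ _ that])
    show "aM Xb \<otimes>\<^bsub>En\<^esub> aG i = aG i \<otimes>\<^bsub>En\<^esub> aM Xb" if "2 \<le> i" "i < n"
      by (rule En_eqI[OF En.m_closed[OF cl(3,1)] En.m_closed[OF cl(1,3)]])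
        (simp only: En_apply X_g_commutes[OF _ _ that])
    show "aT i \<otimes>\<^bsub>En\<^esub> aT j = aT j \<otimes>\<^bsub>En\<^esub> aT i"
      by (rule En_eqI[OF En.m_closed[OF cl(2) cl(2)] En.m_closed[OF cl(2) cl(2)]])
        (simp add: En_apply aT_apply Mv M_val Z.smult_smult mult.commute)
    show "aM Xb \<otimes>\<^bsub>En\<^esub> aT j = aT j \<otimes>\<^bsub>En\<^esub> aM Xb"
      by (rule En_eqI[OF En.m_closed[OF cl(3,2)] En.m_closed[OF cl(2,3)]])
        (simp only: En_apply aT_apply aM_apply Mv M_val Z.smult_mult_right Xb_closed)
    show "aT j [^]\<^bsub>En\<^esub> d = \<one>\<^bsub>En\<^esub>"
    proof (rule En_eqI[OF En.nat_pow_closed[OF cl(2)] En.one_closed])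
      fix f \<chi> assume f: "f \<in> carrier M" and \<chi>: "\<chi> \<in> Col"
      have "zp d (\<chi> j) ^ d = const_ground ((zeta d ^ \<chi> j) ^ d)"
        by (rule zp_power)
      then have "zp d (\<chi> j) ^ d = 1" by (simp add: zeta_power_power_d[OF d_pos] const_ground_1)
      then show "(aT j [^]\<^bsub>En\<^esub> d) f \<chi> = \<one>\<^bsub>En\<^esub> f \<chi>"
        by (simp only: aT_pow[OF f \<chi>] En_apply(2)[OF f \<chi>] Z.one_smult[OF M_val[OF f \<chi>]])
    qed
    show "aG i \<otimes>\<^bsub>En\<^esub> aT j = aT (transpose i (Suc i) j) \<otimes>\<^bsub>En\<^esub> aG i" if i: "1 \<le> i" "i < n" "j \<in> {1..n}"
    proof (rule En_eqI[OF En.m_closed[OF cl(1,2)] En.m_closed[OF cl(2,1)]])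
      fix f \<chi> assume f: "f \<in> carrier M" and \<chi>: "\<chi> \<in> Col"
      have sw: "sw i \<chi> \<in> Col" by (rule sw_Col[OF \<chi> i(1,2)])
      have v: "f \<chi> \<in> carrier Z" "f (sw i \<chi>) \<in> carrier Z" by (rule M_val[OF f \<chi>] M_val[OF f sw])+
      have t: "sw i \<chi> j = \<chi> (transpose i (Suc i) j)" by (simp add: sw_def)
      show "(aG i \<otimes>\<^bsub>En\<^esub> aT j) f \<chi> = (aT (transpose i (Suc i) j) \<otimes>\<^bsub>En\<^esub> aG i) f \<chi>"
      proof (cases "\<chi> i = \<chi> (Suc i)")
        case True
        have "\<chi> (transpose i (Suc i) j) = \<chi> j" using True by (simp add: transpose_def)
        then show ?thesis using True v
          by (simp add: En_apply[OF f \<chi>] aG_apply[OF Mv(3)[OF f] \<chi> i(1,2)] aG_apply[OF f \<chi> i(1,2)] aT_apply[OF f \<chi>]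
              aT_apply[OF aG_val[OF f] \<chi>] Z.smult_mult_right)
      next
        case False
        then show ?thesis using v t
          by (simp add: En_apply[OF f \<chi>] aG_apply[OF Mv(3)[OF f] \<chi> i(1,2)] aG_apply[OF f \<chi> i(1,2)] aT_apply[OF f sw]
              aT_apply[OF aG_val[OF f] \<chi>] Z.smult_smult mult.commute)
      qed
    qed
    show "aG i \<otimes>\<^bsub>En\<^esub> aG i = U \<odot>\<^bsub>En\<^esub> \<one>\<^bsub>En\<^esub> \<oplus>\<^bsub>En\<^esub> v_var \<odot>\<^bsub>En\<^esub> (const_ground (1 / of_nat d) \<odot>\<^bsub>En\<^esub>
        (\<Oplus>\<^bsub>En\<^esub>s\<in>{1..d}. aT i [^]\<^bsub>En\<^esub> s \<otimes>\<^bsub>En\<^esub> aT (Suc i) [^]\<^bsub>En\<^esub> (d - s)) \<otimes>\<^bsub>En\<^esub> aG i)" (is "_ = ?r")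
      if i: "1 \<le> i" "i < n"
    proof (rule En_eqI[OF En.m_closed[OF cl(1) cl(1)]])
      show "?r \<in> carrier En"
        by (intro En.a_closed En.smult_closed En.one_closed En.m_closed En.finsum_closed Pi_I En.nat_pow_closed cl)
      fix f \<chi> assume f: "f \<in> carrier M" and \<chi>: "\<chi> \<in> Col"
      have sw: "sw i \<chi> \<in> Col" by (rule sw_Col[OF \<chi> i])
      have v: "f \<chi> \<in> carrier Z" "f (sw i \<chi>) \<in> carrier Z" by (rule M_val[OF f \<chi>] M_val[OF f sw])+
      have r: "?r f \<chi> = U \<odot>\<^bsub>Z\<^esub> f \<chi> \<oplus>\<^bsub>Z\<^esub> v_var \<odot>\<^bsub>Z\<^esub> (if \<chi> i = \<chi> (Suc i) then aG i f \<chi> else \<zero>\<^bsub>Z\<^esub>)"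
        by (simp only: En_apply[OF f \<chi>] e_apply[OF aG_val[OF f] \<chi> i])
      have l: "(aG i \<otimes>\<^bsub>En\<^esub> aG i) f \<chi> = aG i (aG i f) \<chi>" by (simp only: En_apply[OF f \<chi>])
      show "(aG i \<otimes>\<^bsub>En\<^esub> aG i) f \<chi> = ?r f \<chi>"
      proof (cases "\<chi> i = \<chi> (Suc i)")
        case True
        note rb = rank_bounds[OF \<chi> i True]
        let ?g = "gb (\<chi> i) (cnt \<chi> i (\<chi> i))"
        have "aG i (aG i f) \<chi> = (?g \<otimes>\<^bsub>Z\<^esub> ?g) \<otimes>\<^bsub>Z\<^esub> f \<chi>"
          using True v by (simp add: aG_apply[OF aG_val[OF f] \<chi> i] aG_apply[OF f \<chi> i] Z.m_assoc)
        also have "\<dots> = U \<odot>\<^bsub>Z\<^esub> f \<chi> \<oplus>\<^bsub>Z\<^esub> v_var \<odot>\<^bsub>Z\<^esub> (?g \<otimes>\<^bsub>Z\<^esub> f \<chi>)"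
          using v by (simp add: hecke_square[OF rb(1-3)] Z.l_distr Z.smult_mult_left)
        finally show ?thesis unfolding l r using True by (simp add: aG_apply[OF f \<chi> i])
      next
        case False
        then show ?thesis unfolding l r
          using v by (simp add: aG_apply[OF aG_val[OF f] \<chi> i] aG_apply[OF f sw i] Z.smult_smult U_def power2_eq_square)
      qed
    qed
    show "foldr (\<lambda>c y. (aM Xb \<ominus>\<^bsub>En\<^esub> c \<odot>\<^bsub>En\<^esub> \<one>\<^bsub>En\<^esub>) \<otimes>\<^bsub>En\<^esub> y) vs \<one>\<^bsub>En\<^esub> = \<zero>\<^bsub>En\<^esub>"
      unfolding En.poly_at_def[symmetric]
    proof (rule En_eqI[OF En.poly_at_closed[OF cl(3)] En.zero_closed])
      fix f \<chi> assume f: "f \<in> carrier M" and \<chi>: "\<chi> \<in> Col"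
      have "En.poly_at vs (aM Xb) f \<chi> = \<zero>\<^bsub>Z\<^esub>"
        by (simp only: poly_at_apply[OF Xb_closed \<chi> f] hX(3)[OF \<chi>] Z.l_null M_val[OF f \<chi>])
      moreover have "\<zero>\<^bsub>En\<^esub> f \<chi> = \<zero>\<^bsub>Z\<^esub>" using f \<chi> by (simp add: end_algebra_ops direct_sum_algebra_def)
      ultimately show "En.poly_at vs (aM Xb) f \<chi> = \<zero>\<^bsub>En\<^esub> f \<chi>" by (simp only:)
    qed
  qed
qed

end


section \<open>Blocks of a sorted colouring\<close>

lemma smaller_block_mono: "a < b \<Longrightarrow> smaller n \<chi> a + cnt \<chi> n a \<le> smaller n \<chi> b"
proof -
  assume "a < b"
  then have "(\<Sum>c<Suc a. cnt \<chi> n c) \<le> (\<Sum>c<b. cnt \<chi> n c)" by (intro sum_mono2) auto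
  then show ?thesis by (simp add: smaller_eq_sum)
qed

section \<open>Products and polynomials inside a corner\<close>

context kalgebra
begin

context
  fixes e assumes e: "e \<in> carrier A" "e \<otimes> e = e"
begin

lemma corner_mult:
  assumes "x \<in> carrier A" "y \<in> carrier A" "y \<otimes> e = e \<otimes> y"
  shows "(x \<otimes> e) \<otimes> (y \<otimes> e) = (x \<otimes> y) \<otimes> e"
proof -
  have "(x \<otimes> e) \<otimes> (y \<otimes> e) = x \<otimes> ((e \<otimes> y) \<otimes> e)" using assms(1,2) e(1) by (simp add: m_assoc)
  also have "\<dots> = x \<otimes> (y \<otimes> (e \<otimes> e))" using assms(1,2) e(1) by (simp only: assms(3)[symmetric] m_assoc m_closed)
  finally show ?thesis using assms(1,2) e by (simp add: m_assoc)
qed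

lemma corner_memI:
  assumes "x \<in> carrier A" "x \<otimes> e = e \<otimes> x"
  shows "x \<otimes> e \<in> carrier (corner A e)"
proof -
  have "e \<otimes> (x \<otimes> e) = (e \<otimes> e) \<otimes> x" unfolding assms(2) by (rule m_assoc[symmetric, OF e(1) e(1) assms(1)])
  then have "e \<otimes> (x \<otimes> e) = x \<otimes> e" by (simp only: e(2) assms(2))
  moreover have "(x \<otimes> e) \<otimes> e = x \<otimes> e" using assms(1) e by (simp add: m_assoc)
  ultimately show ?thesis using assms(1) e by (simp add: corner_simps)
qed

lemma corner_commute:
  assumes "x \<in> carrier A" "y \<in> carrier A" "x \<otimes> e = e \<otimes> x" "y \<otimes> e = e \<otimes> y"
  shows "(x \<otimes> y) \<otimes> e = e \<otimes> (x \<otimes> y)"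
proof -
  have "(x \<otimes> y) \<otimes> e = x \<otimes> (e \<otimes> y)" unfolding assms(4)[symmetric] using assms(1,2) e(1) by (rule m_assoc)
  also have "\<dots> = (x \<otimes> e) \<otimes> y" using assms(1) e(1) assms(2) by (rule m_assoc[symmetric])
  also have "\<dots> = e \<otimes> (x \<otimes> y)" unfolding assms(3) using e(1) assms(1,2) by (rule m_assoc)
  finally show ?thesis .
qed

lemma poly_at_corner:
  assumes x: "x \<in> carrier A" "x \<otimes> e = e \<otimes> x"
  shows "kalgebra.poly_at (corner A e) ws (x \<otimes> e) = poly_at ws x \<otimes> e"
proof -
  interpret C: kalgebra "corner A e" by (rule kalgebra_corner[OF e])
  show ?thesis
  proof (induction ws)
    case Nil
    show ?case using e by (simp add: corner_simps)
  next
    case (Cons c ws)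
    have comm: "poly_at ws x \<otimes> e = e \<otimes> poly_at ws x"
      using poly_at_intertwine[OF x(1) e(1) x(1) x(2)] .
    have "x \<otimes> e \<ominus>\<^bsub>corner A e\<^esub> c \<odot>\<^bsub>corner A e\<^esub> \<one>\<^bsub>corner A e\<^esub> = x \<otimes> e \<oplus> (- c) \<odot> e"
      by (simp only: C.minus_eq C.minus_smult[OF C.one_closed]) (simp add: corner_simps)
    also have "\<dots> = (x \<ominus> c \<odot> \<one>) \<otimes> e"
      using x(1) e(1) by (simp add: minus_eq minus_smult l_distr smult_mult_left)
    finally have lin: "x \<otimes> e \<ominus>\<^bsub>corner A e\<^esub> c \<odot>\<^bsub>corner A e\<^esub> \<one>\<^bsub>corner A e\<^esub> = (x \<ominus> c \<odot> \<one>) \<otimes> e" .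
    have "((x \<ominus> c \<odot> \<one>) \<otimes> e) \<otimes> (poly_at ws x \<otimes> e) = ((x \<ominus> c \<odot> \<one>) \<otimes> poly_at ws x) \<otimes> e"
      using x(1) by (intro corner_mult comm) simp_all
    then show ?case by (simp only: C.poly_at_simps lin Cons poly_at_simps corner_simps(5))
  qed
qed

end

end

context yh_rep
begin

lemma inverse_intertwine:
  assumes "x \<in> carrier A" "xi \<in> carrier A" "y \<in> carrier A" "z \<in> carrier A" "zi \<in> carrier A"
    and "xi \<otimes> x = \<one>" "z \<otimes> zi = \<one>" "y \<otimes> z = x \<otimes> y"
  shows "y \<otimes> zi = xi \<otimes> y"
proof -
  have "y \<otimes> zi = (xi \<otimes> x) \<otimes> (y \<otimes> zi)" using assms(1-5) by (simp add: assms(6))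
  also have "\<dots> = xi \<otimes> ((x \<otimes> y) \<otimes> zi)" using assms(1-5) by (simp add: m_assoc)
  also have "\<dots> = xi \<otimes> (y \<otimes> (z \<otimes> zi))" using assms(1-5) by (simp only: assms(8)[symmetric] m_assoc m_closed)
  finally show ?thesis using assms(1-5) by (simp add: assms(7))
qed

text \<open>For \<open>\<chi> = \<psi>\<close> sorted, \<open>S \<chi>\<close> and \<open>T \<psi>\<close> are both \<open>E \<chi>\<close>: then \<open>D \<chi>\<close> contains the whole corner at
  \<open>E \<chi>\<close>. For sorted \<open>\<chi> \<noteq> \<psi>\<close> the corners are orthogonal.\<close>

lemma sandwich:
  assumes gen: "generates A (g ` {1..<n} \<union> t ` {1..n} \<union> {X, Xi})"
    and D: "\<And>\<sigma>. D \<sigma> \<subseteq> carrier A"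
    and D_add: "\<And>\<sigma> x y. \<lbrakk>x \<in> D \<sigma>; y \<in> D \<sigma>\<rbrakk> \<Longrightarrow> x \<oplus> y \<in> D \<sigma>"
    and D_mult: "\<And>\<sigma> x y. \<lbrakk>x \<in> D \<sigma>; y \<in> D \<sigma>\<rbrakk> \<Longrightarrow> x \<otimes> y \<in> D \<sigma>"
    and D_smult: "\<And>\<sigma> x c. x \<in> D \<sigma> \<Longrightarrow> c \<odot> x \<in> D \<sigma>"
    and D_E: "\<And>\<sigma>. \<lbrakk>\<sigma> \<in> colourings d n; \<nexists>i. desc n \<sigma> i\<rbrakk> \<Longrightarrow> E \<sigma> \<in> D \<sigma>"
    and D_g: "\<And>\<sigma> a k. \<lbrakk>\<sigma> \<in> colourings d n; \<nexists>i. desc n \<sigma> i; a < d; 1 \<le> k; k < cnt \<sigma> n a\<rbrakk> \<Longrightarrow>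
      g (smaller n \<sigma> a + k) \<otimes> E \<sigma> \<in> D \<sigma>"
    and D_J: "\<And>\<sigma> a. \<lbrakk>\<sigma> \<in> colourings d n; \<nexists>i. desc n \<sigma> i; a < d; 1 \<le> cnt \<sigma> n a\<rbrakk> \<Longrightarrow>
      J (smaller n \<sigma> a) \<otimes> E \<sigma> \<in> D \<sigma> \<and> JI (smaller n \<sigma> a) \<otimes> E \<sigma> \<in> D \<sigma>"
    and n: "n \<ge> 1" and y: "y \<in> carrier A"
  shows "\<forall>\<chi>\<in>colourings d n. \<forall>\<psi>\<in>colourings d n.
    S \<chi> \<otimes> y \<otimes> T \<psi> \<in> (if sort_col n \<chi> = sort_col n \<psi> then D (sort_col n \<chi>) else {\<zero>})"
proof -
  have sorted: "sort_col n \<chi> \<in> colourings d n" "\<nexists>i. desc n (sort_col n \<chi>) i" "cnt (sort_col n \<chi>) n = cnt \<chi> n"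
    if "\<chi> \<in> colourings d n" for \<chi>
    using sort_col[OF that] by simp_all
  have sm: "smaller n (sort_col n \<chi>) = smaller n \<chi>" if "\<chi> \<in> colourings d n" for \<chi>
    by (intro ext) (simp only: smaller_eq_sum sorted(3)[OF that])
  have D_sE: "E (sort_col n \<chi>) \<in> D (sort_col n \<chi>)" if "\<chi> \<in> colourings d n" for \<chi>
    by (rule D_E[OF sorted(1,2)[OF that]])
  have D0: "\<zero> \<in> D (sort_col n \<chi>)" if "\<chi> \<in> colourings d n" for \<chi>
    using D_smult[OF D_sE[OF that], of 0] by simp
  have zero: "\<zero> \<in> (if sort_col n \<chi> = sort_col n \<psi> then D (sort_col n \<chi>) else {\<zero>})"
    if "\<chi> \<in> colourings d n" for \<chi> \<psi>
  proof (cases "sort_col n \<chi> = sort_col n \<psi>")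
    case True
    show ?thesis unfolding if_P[OF True] by (rule D0[OF that])
  next
    case False
    show ?thesis unfolding if_not_P[OF False] by simp
  qed
  have ST: "S \<chi> \<otimes> T \<chi> = E (sort_col n \<chi>)" if "\<chi> \<in> colourings d n" for \<chi> by (rule S_T_same[OF that])
  \<comment> \<open>Covers all generators that commute with the idempotents, namely X, its inverse
    and the \<open>t j\<close>.\<close>
  have diag: "S \<chi> \<otimes> y \<otimes> T \<psi> = \<zero>"
    if "\<chi> \<in> colourings d n" "\<psi> \<in> colourings d n" "\<chi> \<noteq> \<psi>" "y \<in> carrier A" "y \<otimes> E \<psi> = E \<psi> \<otimes> y" for \<chi> \<psi> y
  proof -
    have "S \<chi> \<otimes> y \<otimes> T \<psi> = (S \<chi> \<otimes> E \<chi>) \<otimes> y \<otimes> (E \<psi> \<otimes> T \<psi>)" using that by (simp only: S_E E_T)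
    also have "\<dots> = S \<chi> \<otimes> (E \<chi> \<otimes> ((y \<otimes> E \<psi>) \<otimes> T \<psi>))" using that(4) by (simp add: m_assoc)
    also have "\<dots> = S \<chi> \<otimes> ((E \<chi> \<otimes> E \<psi>) \<otimes> (y \<otimes> T \<psi>))" using that(4) by (simp add: that(5) m_assoc)
    finally show ?thesis using that by (simp add: E_E)
  qed
  let ?R = "\<lambda>\<chi> \<psi>. if sort_col n \<chi> = sort_col n \<psi> then D (sort_col n \<chi>) else {\<zero>}"
  let ?Q = "\<lambda>y. \<forall>\<chi>\<in>colourings d n. \<forall>\<psi>\<in>colourings d n. S \<chi> \<otimes> y \<otimes> T \<psi> \<in> ?R \<chi> \<psi>"
  have Q_g: "?Q (g i)" if i: "1 \<le> i" "i < n" for i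
  proof (intro ballI)
    fix \<chi> \<psi> assume \<chi>: "\<chi> \<in> colourings d n" and \<psi>: "\<psi> \<in> colourings d n"
    have sw: "sw i \<psi> \<in> colourings d n" by (rule sw_colourings[OF \<psi> i])
    show "S \<chi> \<otimes> g i \<otimes> T \<psi> \<in> ?R \<chi> \<psi>"
    \<comment> \<open>\<open>g i\<close> carries \<open>E \<psi>\<close> to
      \<open>E (sw i \<psi>)\<close>, so every other entry vanishes.\<close>
    proof (cases "\<chi> = sw i \<psi>")
      case False
      have "S \<chi> \<otimes> g i \<otimes> T \<psi> = (S \<chi> \<otimes> E \<chi>) \<otimes> g i \<otimes> (E \<psi> \<otimes> T \<psi>)" using \<chi> \<psi> by (simp only: S_E E_T)
      also have "\<dots> = S \<chi> \<otimes> (E \<chi> \<otimes> ((g i \<otimes> E \<psi>) \<otimes> T \<psi>))" by (simp add: m_assoc)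
      also have "\<dots> = S \<chi> \<otimes> ((E \<chi> \<otimes> E (sw i \<psi>)) \<otimes> (g i \<otimes> T \<psi>))" by (simp add: g_E[OF \<psi> i] m_assoc)
      also have "\<dots> = \<zero>" using False \<chi> sw by (simp add: E_E)
      finally show ?thesis using zero[OF \<chi>] by simp
    next
      case True
      have sort: "sort_col n \<chi> = sort_col n \<psi>" unfolding True by (rule sort_col_sw[OF \<psi> i])
      show ?thesis
      proof (cases "\<psi> i = \<psi> (Suc i)")
        case same: True
        let ?a = "\<psi> i" and ?k = "cnt \<psi> i (\<psi> i)"
        have "\<chi> = \<psi>" unfolding True by (rule sw_eq[OF same])
        then have "S \<chi> \<otimes> g i \<otimes> T \<psi> = g (smaller n \<psi> ?a + ?k) \<otimes> S \<psi> \<otimes> T \<psi>"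
          using S_g[OF \<psi> i refl] same by simp
        also have "\<dots> = g (smaller n (sort_col n \<psi>) ?a + ?k) \<otimes> E (sort_col n \<psi>)"
          by (simp add: m_assoc ST[OF \<psi>] sm[OF \<psi>])
        finally have eq: "S \<chi> \<otimes> g i \<otimes> T \<psi> = g (smaller n (sort_col n \<psi>) ?a + ?k) \<otimes> E (sort_col n \<psi>)" .
        obtain i' where i': "i = Suc i'" using i by (cases i) simp_all
        have "cnt \<psi> (Suc i) ?a \<le> cnt \<psi> n ?a" using i by (intro cnt_mono) simp
        then have "?k < cnt \<psi> n ?a" using same by (simp add: cnt_Suc)
        moreover have "1 \<le> ?k" by (simp add: i' cnt_Suc)
        moreover have "?a < d" using colouringsD(1)[OF \<psi>] i by simp
        ultimately have "g (smaller n (sort_col n \<psi>) ?a + ?k) \<otimes> E (sort_col n \<psi>) \<in> D (sort_col n \<psi>)"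
          by (intro D_g[OF sorted(1,2)[OF \<psi>]]) (simp_all add: sorted(3)[OF \<psi>])
        then show ?thesis by (simp add: eq sort)
      next
        case False
        obtain c where "S (sw i \<psi>) \<otimes> g i = c \<odot> S \<psi>" using S_sw_g[OF \<psi> i False] ..
        then have "S \<chi> \<otimes> g i \<otimes> T \<psi> = c \<odot> E (sort_col n \<psi>)" by (simp add: True smult_mult_left ST[OF \<psi>])
        then show ?thesis using D_smult[OF D_sE[OF \<psi>]] sort by simp
      qed
    qed
  qed
  have XX: "S \<chi> \<otimes> X = J (smaller n \<chi> (\<chi> 1)) \<otimes> S \<chi>" "S \<chi> \<otimes> Xi = JI (smaller n \<chi> (\<chi> 1)) \<otimes> S \<chi>"
    "J (smaller n \<chi> (\<chi> 1)) \<otimes> E (sort_col n \<chi>) \<in> D (sort_col n \<chi>)"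
    "JI (smaller n \<chi> (\<chi> 1)) \<otimes> E (sort_col n \<chi>) \<in> D (sort_col n \<chi>)"
    if \<chi>: "\<chi> \<in> colourings d n" for \<chi>
  proof -
    let ?a = "\<chi> 1" let ?o = "smaller n \<chi> ?a"
    show 1: "S \<chi> \<otimes> X = J ?o \<otimes> S \<chi>" using S_J[OF \<chi>, of 0 ?a] n by (simp add: J_0)
    have a: "?a < d" using colouringsD(1)[OF \<chi>, of 1] n by simp
    have "cnt \<chi> 1 ?a \<le> cnt \<chi> n ?a" by (rule cnt_mono[OF n])
    then have c: "1 \<le> cnt (sort_col n \<chi>) n ?a" by (simp add: sorted(3)[OF \<chi>] cnt_Suc[of \<chi> 0, simplified])
    have "J ?o \<otimes> E (sort_col n \<chi>) \<in> D (sort_col n \<chi>) \<and> JI ?o \<otimes> E (sort_col n \<chi>) \<in> D (sort_col n \<chi>)"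
      using D_J[OF sorted(1,2)[OF \<chi>] a c] by (simp only: sm[OF \<chi>])
    then show "J ?o \<otimes> E (sort_col n \<chi>) \<in> D (sort_col n \<chi>)" "JI ?o \<otimes> E (sort_col n \<chi>) \<in> D (sort_col n \<chi>)" by simp_all
    have "\<not> (\<exists>i. desc n (sort_col n \<chi>) i)" by (rule sorted(2)[OF \<chi>])
    then have "smaller n (sort_col n \<chi>) ?a + 1 \<le> n" using c by (intro sorted_block(1)) simp_all
    then have "?o < n" by (simp add: sm[OF \<chi>])
    then show "S \<chi> \<otimes> Xi = JI ?o \<otimes> S \<chi>"
      using J_JI[of ?o] by (intro inverse_intertwine[OF _ _ _ _ _ _ X_Xi 1]) simp_all
  qed
  have Q_X: "?Q x" if "x \<in> {X, Xi}" for x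
  proof (intro ballI)
    fix \<chi> \<psi> assume \<chi>: "\<chi> \<in> colourings d n" and \<psi>: "\<psi> \<in> colourings d n"
    have x: "x \<in> carrier A" "x \<otimes> E \<psi> = E \<psi> \<otimes> x" using that X_E[OF \<psi>] Xi_E[OF \<psi>] by auto
    show "S \<chi> \<otimes> x \<otimes> T \<psi> \<in> ?R \<chi> \<psi>"
    proof (cases "\<chi> = \<psi>")
      case False
      then show ?thesis using diag[OF \<chi> \<psi> False x] zero[OF \<chi>] by simp
    next
      case True
      have "S \<chi> \<otimes> X \<otimes> T \<chi> = J (smaller n \<chi> (\<chi> 1)) \<otimes> E (sort_col n \<chi>)"
        "S \<chi> \<otimes> Xi \<otimes> T \<chi> = JI (smaller n \<chi> (\<chi> 1)) \<otimes> E (sort_col n \<chi>)"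
        by (simp_all add: XX(1,2)[OF \<chi>] m_assoc ST[OF \<chi>])
      then show ?thesis using XX(3,4)[OF \<chi>] that True by auto
    qed
  qed
  have Q_t: "?Q (t j)" if j: "j \<in> {1..n}" for j
  proof (intro ballI)
    fix \<chi> \<psi> assume \<chi>: "\<chi> \<in> colourings d n" and \<psi>: "\<psi> \<in> colourings d n"
    show "S \<chi> \<otimes> t j \<otimes> T \<psi> \<in> ?R \<chi> \<psi>"
    proof (cases "\<chi> = \<psi>")
      case False
      have "S \<chi> \<otimes> t j \<otimes> T \<psi> = \<zero>" using j \<psi> by (intro diag[OF \<chi> \<psi> False]) (simp_all add: t_E)
      then show ?thesis using zero[OF \<chi>] by simp
    next
      case True
      have "S \<chi> \<otimes> t j \<otimes> T \<chi> = S \<chi> \<otimes> ((t j \<otimes> E \<chi>) \<otimes> T \<chi>)" using \<chi> by (simp add: m_assoc E_T)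
      also have "\<dots> = zp d (\<chi> j) \<odot> E (sort_col n \<chi>)"
        using j \<chi> by (simp add: t_E smult_mult_left smult_mult_right E_T ST[OF \<chi>])
      finally show ?thesis using True D_smult[OF D_sE[OF \<chi>]] by simp
    qed
  qed
  show ?thesis
    using gen y kalgebra_axioms
  proof (rule generates_induct)
    fix x assume "x \<in> g ` {1..<n} \<union> t ` {1..n} \<union> {X, Xi}"
    then show "?Q x"
    proof (elim UnE imageE)
      fix i assume "x = g i" and i: "i \<in> {1..<n}"
      then show ?thesis using i by (simp only:) (rule Q_g, simp_all)
    next
      fix j assume "x = t j" and "j \<in> {1..n}"
      then show ?thesis by (simp only:) (rule Q_t)
    qed (rule Q_X)
  next
    show "?Q \<one>"
    proof (intro ballI)
      fix \<chi> \<psi> assume \<chi>: "\<chi> \<in> colourings d n" and \<psi>: "\<psi> \<in> colourings d n"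
      show "S \<chi> \<otimes> \<one> \<otimes> T \<psi> \<in> ?R \<chi> \<psi>"
        using S_T_diff[OF \<chi> \<psi>] ST[OF \<chi>] D_sE[OF \<chi>] zero[OF \<chi>] by (cases "\<chi> = \<psi>") simp_all
    qed
  next
    fix x z assume x: "x \<in> carrier A" "?Q x" and z: "z \<in> carrier A" "?Q z"
    show "?Q (x \<oplus> z)"
    proof (intro ballI)
      fix \<chi> \<psi> assume \<chi>: "\<chi> \<in> colourings d n" and \<psi>: "\<psi> \<in> colourings d n"
      have "S \<chi> \<otimes> (x \<oplus> z) \<otimes> T \<psi> = S \<chi> \<otimes> x \<otimes> T \<psi> \<oplus> S \<chi> \<otimes> z \<otimes> T \<psi>"
        using x(1) z(1) by (simp add: l_distr r_distr)
      moreover have "S \<chi> \<otimes> x \<otimes> T \<psi> \<in> ?R \<chi> \<psi>" "S \<chi> \<otimes> z \<otimes> T \<psi> \<in> ?R \<chi> \<psi>" using x(2) z(2) \<chi> \<psi> by blast+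
      ultimately show "S \<chi> \<otimes> (x \<oplus> z) \<otimes> T \<psi> \<in> ?R \<chi> \<psi>" by (simp add: D_add split: if_splits)
    qed
    show "?Q (x \<otimes> z)"
    proof (intro ballI)
      fix \<chi> \<psi> assume \<chi>: "\<chi> \<in> colourings d n" and \<psi>: "\<psi> \<in> colourings d n"
      \<comment> \<open>Inserting 1 as the sum of the \<open>T \<theta> \<otimes> S \<theta>\<close>
        writes the entry of a product as a sum of products of entries, so closure of
        \<open>D\<close> under sums and products suffices.\<close>
      let ?f = "\<lambda>\<theta>. (S \<chi> \<otimes> x \<otimes> T \<theta>) \<otimes> (S \<theta> \<otimes> z \<otimes> T \<psi>)"
      have "S \<chi> \<otimes> (x \<otimes> z) \<otimes> T \<psi> = (S \<chi> \<otimes> x) \<otimes> (\<Oplus>\<theta>\<in>colourings d n. E \<theta>) \<otimes> (z \<otimes> T \<psi>)"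
        using x(1) z(1) by (simp add: sum_E m_assoc)
      also have "\<dots> = (\<Oplus>\<theta>\<in>colourings d n. (S \<chi> \<otimes> x) \<otimes> E \<theta>) \<otimes> (z \<otimes> T \<psi>)"
        using x(1) by (subst finsum_mult_left) simp_all
      also have "\<dots> = (\<Oplus>\<theta>\<in>colourings d n. (S \<chi> \<otimes> x) \<otimes> E \<theta> \<otimes> (z \<otimes> T \<psi>))"
        using x(1) z(1) by (subst finsum_mult_right) simp_all
      also have "\<dots> = (\<Oplus>\<theta>\<in>colourings d n. ?f \<theta>)"
      proof (rule add.finprod_cong'[OF refl])
        show "?f \<in> colourings d n \<rightarrow> carrier A" using x(1) z(1) by simp
        fix \<theta> assume \<theta>: "\<theta> \<in> colourings d n"
        have "?f \<theta> = (S \<chi> \<otimes> x) \<otimes> (T \<theta> \<otimes> S \<theta>) \<otimes> (z \<otimes> T \<psi>)" using x(1) z(1) by (simp add: m_assoc)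
        then show "(S \<chi> \<otimes> x) \<otimes> E \<theta> \<otimes> (z \<otimes> T \<psi>) = ?f \<theta>" by (simp only: T_S[OF \<theta>])
      qed
      finally have eq: "S \<chi> \<otimes> (x \<otimes> z) \<otimes> T \<psi> = (\<Oplus>\<theta>\<in>colourings d n. ?f \<theta>)" .
      have f_R: "?f \<theta> \<in> ?R \<chi> \<psi>" if \<theta>: "\<theta> \<in> colourings d n" for \<theta>
      proof -
        have xz: "S \<chi> \<otimes> x \<otimes> T \<theta> \<in> ?R \<chi> \<theta>" "S \<theta> \<otimes> z \<otimes> T \<psi> \<in> ?R \<theta> \<psi>" using x(2) z(2) \<chi> \<psi> \<theta> by blast+
        have cl: "S \<chi> \<otimes> x \<otimes> T \<theta> \<in> carrier A" "S \<theta> \<otimes> z \<otimes> T \<psi> \<in> carrier A" using x(1) z(1) by simp_all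
        consider "sort_col n \<chi> = sort_col n \<theta>" "sort_col n \<theta> = sort_col n \<psi>"
          | "sort_col n \<chi> \<noteq> sort_col n \<theta>" | "sort_col n \<theta> \<noteq> sort_col n \<psi>" by blast
        then show ?thesis
        proof cases
          case 1
          have "S \<chi> \<otimes> x \<otimes> T \<theta> \<in> D (sort_col n \<chi>)" using xz(1) unfolding if_P[OF 1(1)] .
          moreover have "S \<theta> \<otimes> z \<otimes> T \<psi> \<in> D (sort_col n \<chi>)" using xz(2) unfolding if_P[OF 1(2)] 1(1) .
          ultimately show ?thesis unfolding if_P[OF trans[OF 1]] by (rule D_mult)
        next
          case 2
          then have "?f \<theta> = \<zero>" using xz(1) cl by simp
          then show ?thesis using zero[OF \<chi>] by simp
        next
          case 3
          then have "?f \<theta> = \<zero>" using xz(2) cl by simp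
          then show ?thesis using zero[OF \<chi>] by simp
        qed
      qed
      have "(\<Oplus>\<theta>\<in>R. ?f \<theta>) \<in> ?R \<chi> \<psi>" if "finite R" "R \<subseteq> colourings d n" for R
        using that
      proof (induction R rule: finite_induct)
        case empty
        show ?case using zero[OF \<chi>] by simp
      next
        case (insert \<theta> R)
        have "(\<Oplus>\<theta>\<in>insert \<theta> R. ?f \<theta>) = ?f \<theta> \<oplus> (\<Oplus>\<theta>\<in>R. ?f \<theta>)"
          using x(1) z(1) by (intro finsum_insert insert.hyps) simp_all
        moreover have "?f \<theta> \<in> ?R \<chi> \<psi>" "(\<Oplus>\<theta>\<in>R. ?f \<theta>) \<in> ?R \<chi> \<psi>"
          using f_R insert.prems insert.IH by simp_all
        ultimately show ?case by (simp add: D_add split: if_splits)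
      qed
      from this[OF finite_colourings subset_refl] show "S \<chi> \<otimes> (x \<otimes> z) \<otimes> T \<psi> \<in> ?R \<chi> \<psi>" by (simp only: eq)
    qed
  next
    fix c x assume x: "x \<in> carrier A" "?Q x"
    show "?Q (c \<odot> x)"
    proof (intro ballI)
      fix \<chi> \<psi> assume \<chi>: "\<chi> \<in> colourings d n" and \<psi>: "\<psi> \<in> colourings d n"
      have "S \<chi> \<otimes> (c \<odot> x) \<otimes> T \<psi> = c \<odot> (S \<chi> \<otimes> x \<otimes> T \<psi>)"
        using x(1) by (simp add: smult_mult_left smult_mult_right)
      moreover have "S \<chi> \<otimes> x \<otimes> T \<psi> \<in> ?R \<chi> \<psi>" using x(2) \<chi> \<psi> by blast
      ultimately show "S \<chi> \<otimes> (c \<odot> x) \<otimes> T \<psi> \<in> ?R \<chi> \<psi>" by (simp add: D_smult split: if_splits)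
    qed
  qed
qed

section \<open>The generators of one block inside the corner\<close>

context
  fixes \<sigma> assumes \<sigma>: "\<sigma> \<in> colourings d n" and \<sigma>_sorted: "\<nexists>i. desc n \<sigma> i"
begin

abbreviation "block_start a \<equiv> smaller n \<sigma> a"

lemma E_idem: "E \<sigma> \<in> carrier A" "E \<sigma> \<otimes> E \<sigma> = E \<sigma>"
  using \<sigma> by (simp_all add: E_E)

text \<open>Outside the range of the block the value is the unit of the corner, so that closure
  holds at every index.\<close>

definition cg :: "nat \<Rightarrow> nat \<Rightarrow> 'a"
  where "cg a k = (if 1 \<le> k \<and> k < cnt \<sigma> n a then g (block_start a + k) \<otimes> E \<sigma> else E \<sigma>)"

definition cX :: "nat \<Rightarrow> 'a" where "cX a = J (block_start a) \<otimes> E \<sigma>"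
definition cXi :: "nat \<Rightarrow> 'a" where "cXi a = JI (block_start a) \<otimes> E \<sigma>"

lemma block:
  assumes "1 \<le> k" "k < cnt \<sigma> n a"
  shows "1 \<le> block_start a + k" "Suc (block_start a + k) \<le> n" "\<sigma> (block_start a + k) = a" "\<sigma> (Suc (block_start a + k)) = a"
    "g (block_start a + k) \<otimes> E \<sigma> = E \<sigma> \<otimes> g (block_start a + k)"
proof -
  have nd: "\<And>i. \<not> desc n \<sigma> i" using \<sigma>_sorted by simp
  show 1: "1 \<le> block_start a + k" using assms by simp
  show 2: "Suc (block_start a + k) \<le> n" using sorted_block(1)[OF nd, of "Suc k" a] assms by simp
  show 3: "\<sigma> (block_start a + k) = a" using sorted_block(2)[OF nd, of k a] assms by simp
  show 4: "\<sigma> (Suc (block_start a + k)) = a" using sorted_block(2)[OF nd, of "Suc k" a] assms by simp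
  have "sw (block_start a + k) \<sigma> = \<sigma>" by (rule sw_eq) (simp only: 3 4)
  then show "g (block_start a + k) \<otimes> E \<sigma> = E \<sigma> \<otimes> g (block_start a + k)"
    using g_E[OF \<sigma> 1] 2 by simp
qed

lemma block_first:
  assumes "1 \<le> cnt \<sigma> n a"
  shows "block_start a < n" "\<sigma> (Suc (block_start a)) = a" "cnt \<sigma> (block_start a) a = 0"
proof -
  have nd: "\<And>i. \<not> desc n \<sigma> i" using \<sigma>_sorted by simp
  show "block_start a < n" using sorted_block(1)[OF nd order_refl assms] by simp
  show 1: "\<sigma> (Suc (block_start a)) = a" using sorted_block(2)[OF nd order_refl assms] by simp
  show "cnt \<sigma> (block_start a) a = 0" using sorted_block(3)[OF nd order_refl assms] 1 by (simp add: cnt_Suc)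
qed

lemma J_comm: "1 \<le> cnt \<sigma> n a \<Longrightarrow> J (block_start a) \<otimes> E \<sigma> = E \<sigma> \<otimes> J (block_start a)"
  "1 \<le> cnt \<sigma> n a \<Longrightarrow> JI (block_start a) \<otimes> E \<sigma> = E \<sigma> \<otimes> JI (block_start a)"
  by (rule J_E[OF block_first(1) \<sigma>], assumption, rule JI_E[OF block_first(1) \<sigma>], assumption)

lemma cg_closed: "cg a k \<in> carrier (corner A (E \<sigma>))"
proof (cases "1 \<le> k \<and> k < cnt \<sigma> n a")
  case True
  then show ?thesis using corner_memI[OF E_idem g_closed block(5)[of k a]] by (simp add: cg_def)
next
  case False
  then show ?thesis using E_idem unfolding cg_def if_not_P[OF False] by (simp add: corner_simps)
qed

lemma cX_closed: "1 \<le> cnt \<sigma> n a \<Longrightarrow> cX a \<in> carrier (corner A (E \<sigma>))"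
  "1 \<le> cnt \<sigma> n a \<Longrightarrow> cXi a \<in> carrier (corner A (E \<sigma>))"
  unfolding cX_def cXi_def by (rule corner_memI[OF E_idem J_closed J_comm(1)], assumption)
    (rule corner_memI[OF E_idem JI_closed J_comm(2)], assumption)

text \<open>Inside a block all colours agree, so \<open>e\<close> acts as 1 and the quadratic
  relation is that of a Hecke algebra. The first position of a block carries a new colour, so
  \<open>poly_at_J_E\<close> gives the cyclotomic relation for its Jucys--Murphy element, which
  takes the place of X.\<close>

lemma yh_rep_block:
  assumes a: "1 \<le> cnt \<sigma> n a"
  shows "yh_rep (corner A (E \<sigma>)) 1 (cnt \<sigma> n a) vs (cg a) (\<lambda>_. \<one>\<^bsub>corner A (E \<sigma>)\<^esub>) (cX a) (cXi a)"
proof -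
  let ?C = "corner A (E \<sigma>)" and ?o = "block_start a" and ?m = "cnt \<sigma> n a"
  interpret C: kalgebra ?C by (rule kalgebra_corner[OF E_idem])
  note cm = corner_mult[OF E_idem]
  note fst = block_first[OF a]
  have cg: "cg a k = g (?o + k) \<otimes> E \<sigma>" if "1 \<le> k" "k < ?m" for k using that by (simp add: cg_def)
  note Jc = J_comm[OF a]
  note JJ = J_JI[OF fst(1)]
  show ?thesis
  proof (intro yh_rep.intro root_algebra.intro yh_rep_axioms.intro root_algebra_axioms.intro
      C.kalgebra_axioms order_refl cg_closed C.one_closed cX_closed[OF a])
    fix i j :: nat
    show "cg a i \<otimes>\<^bsub>?C\<^esub> cg a j = cg a j \<otimes>\<^bsub>?C\<^esub> cg a i" if "1 \<le> i" "Suc i < j" "j < ?m"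
    proof -
      have ij: "1 \<le> j" "i < ?m" using that by simp_all
      note bi = block[OF that(1) ij(2)] and bj = block[OF ij(1) that(3)]
      have "g (?o + i) \<otimes> g (?o + j) = g (?o + j) \<otimes> g (?o + i)"
        using that bi bj by (intro g_commute) simp_all
      then show ?thesis
        by (simp only: corner_simps(5) cg[OF that(1) ij(2)] cg[OF ij(1) that(3)] cm[OF g_closed g_closed bj(5)] cm[OF g_closed g_closed bi(5)])
    qed
    show "cg a i \<otimes>\<^bsub>?C\<^esub> (cg a (Suc i) \<otimes>\<^bsub>?C\<^esub> cg a i) = cg a (Suc i) \<otimes>\<^bsub>?C\<^esub> (cg a i \<otimes>\<^bsub>?C\<^esub> cg a (Suc i))"
      if "1 \<le> i" "Suc i < ?m"
    proof -
      have i: "i < ?m" "1 \<le> Suc i" using that by simp_all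
      let ?x = "g (?o + i)" and ?y = "g (?o + Suc i)"
      note bi = block[OF that(1) i(1)] and bj = block[OF i(2) that(2)]
      have "?x \<otimes> (?y \<otimes> ?x) = ?y \<otimes> (?x \<otimes> ?y)" using g_braid[of "?o + i"] bi bj by simp
      note braid = this
      have c: "(?y \<otimes> ?x) \<otimes> E \<sigma> = E \<sigma> \<otimes> (?y \<otimes> ?x)" "(?x \<otimes> ?y) \<otimes> E \<sigma> = E \<sigma> \<otimes> (?x \<otimes> ?y)"
        by (rule corner_commute[OF E_idem g_closed g_closed bj(5) bi(5)], rule corner_commute[OF E_idem g_closed g_closed bi(5) bj(5)])
      show ?thesis
        unfolding corner_simps(5) cg[OF that(1) i(1)] cg[OF i(2) that(2)] cm[OF g_closed g_closed bi(5)]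
          cm[OF g_closed g_closed bj(5)] cm[OF g_closed m_closed[OF g_closed g_closed] c(1)]
          cm[OF g_closed m_closed[OF g_closed g_closed] c(2)] braid ..
    qed
    show "cX a \<otimes>\<^bsub>?C\<^esub> cXi a = \<one>\<^bsub>?C\<^esub>" "cXi a \<otimes>\<^bsub>?C\<^esub> cX a = \<one>\<^bsub>?C\<^esub>"
      unfolding corner_simps cX_def cXi_def cm[OF J_closed JI_closed Jc(2)] cm[OF JI_closed J_closed Jc(1)]
      using JJ by simp_all
    show "cX a \<otimes>\<^bsub>?C\<^esub> (cg a 1 \<otimes>\<^bsub>?C\<^esub> (cX a \<otimes>\<^bsub>?C\<^esub> cg a 1)) = cg a 1 \<otimes>\<^bsub>?C\<^esub> (cX a \<otimes>\<^bsub>?C\<^esub> (cg a 1 \<otimes>\<^bsub>?C\<^esub> cX a))"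
      if "1 < ?m"
    proof -
      let ?x = "J ?o" and ?g = "g (?o + 1)"
      note b = block[OF order_refl that]
      have "?x \<otimes> (?g \<otimes> (?x \<otimes> ?g)) = ?g \<otimes> (?x \<otimes> (?g \<otimes> ?x))" using J_g_braid[of ?o] b(2) by simp
      note braid = this
      have c: "(?x \<otimes> ?g) \<otimes> E \<sigma> = E \<sigma> \<otimes> (?x \<otimes> ?g)" "(?g \<otimes> ?x) \<otimes> E \<sigma> = E \<sigma> \<otimes> (?g \<otimes> ?x)"
        by (rule corner_commute[OF E_idem J_closed g_closed Jc(1) b(5)], rule corner_commute[OF E_idem g_closed J_closed b(5) Jc(1)])
      have c': "(?g \<otimes> (?x \<otimes> ?g)) \<otimes> E \<sigma> = E \<sigma> \<otimes> (?g \<otimes> (?x \<otimes> ?g))"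
        "(?x \<otimes> (?g \<otimes> ?x)) \<otimes> E \<sigma> = E \<sigma> \<otimes> (?x \<otimes> (?g \<otimes> ?x))"
        by (rule corner_commute[OF E_idem g_closed m_closed[OF J_closed g_closed] b(5) c(1)],
            rule corner_commute[OF E_idem J_closed m_closed[OF g_closed J_closed] Jc(1) c(2)])
      show ?thesis
        unfolding corner_simps(5) cX_def cg[OF order_refl that] cm[OF J_closed g_closed b(5)] cm[OF g_closed J_closed Jc(1)]
          cm[OF g_closed m_closed[OF J_closed g_closed] c(1)] cm[OF J_closed m_closed[OF g_closed J_closed] c(2)]
          cm[OF J_closed m_closed[OF g_closed m_closed[OF J_closed g_closed]] c'(1)]
          cm[OF g_closed m_closed[OF J_closed m_closed[OF g_closed J_closed]] c'(2)] braid ..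
    qed
    show "cX a \<otimes>\<^bsub>?C\<^esub> cg a i = cg a i \<otimes>\<^bsub>?C\<^esub> cX a" if "2 \<le> i" "i < ?m"
    proof -
      have i: "1 \<le> i" using that by simp
      note b = block[OF i that(2)]
      have "g (?o + i) \<otimes> J ?o = J ?o \<otimes> g (?o + i)"
        using that b fst by (intro g_J) simp_all
      then show ?thesis
        by (simp only: corner_simps(5) cX_def cg[OF i that(2)] cm[OF J_closed g_closed b(5)] cm[OF g_closed J_closed Jc(1)])
    qed
    show "cg a i \<otimes>\<^bsub>?C\<^esub> \<one>\<^bsub>?C\<^esub> = \<one>\<^bsub>?C\<^esub> \<otimes>\<^bsub>?C\<^esub> cg a i"
      by (simp only: C.l_one C.r_one cg_closed)
    show "\<one>\<^bsub>?C\<^esub> [^]\<^bsub>?C\<^esub> (1::nat) = \<one>\<^bsub>?C\<^esub>" by (rule C.nat_pow_one)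
    show "cX a \<otimes>\<^bsub>?C\<^esub> \<one>\<^bsub>?C\<^esub> = \<one>\<^bsub>?C\<^esub> \<otimes>\<^bsub>?C\<^esub> cX a"
      by (simp only: C.l_one C.r_one cX_closed[OF a])
    show "cg a i \<otimes>\<^bsub>?C\<^esub> cg a i = U \<odot>\<^bsub>?C\<^esub> \<one>\<^bsub>?C\<^esub> \<oplus>\<^bsub>?C\<^esub> v_var \<odot>\<^bsub>?C\<^esub> (const_ground (1 / of_nat 1) \<odot>\<^bsub>?C\<^esub>
        (\<Oplus>\<^bsub>?C\<^esub>s\<in>{1..1::nat}. \<one>\<^bsub>?C\<^esub> [^]\<^bsub>?C\<^esub> s \<otimes>\<^bsub>?C\<^esub> \<one>\<^bsub>?C\<^esub> [^]\<^bsub>?C\<^esub> (1 - s)) \<otimes>\<^bsub>?C\<^esub> cg a i)"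
      if i: "1 \<le> i" "i < ?m"
    proof -
      let ?i = "?o + i"
      note b = block[OF i]
      have in_n: "?i < n" using b(2) by simp
      have eE: "e ?i \<otimes> E \<sigma> = E \<sigma>" using e_E[OF \<sigma> b(1) in_n] b(3,4) by simp
      \<comment> \<open>For d = 1 the averaged sum has a single term, equal to 1.\<close>
      have one: "const_ground (1 / of_nat 1) \<odot>\<^bsub>?C\<^esub>
        (\<Oplus>\<^bsub>?C\<^esub>s\<in>{1..1::nat}. \<one>\<^bsub>?C\<^esub> [^]\<^bsub>?C\<^esub> s \<otimes>\<^bsub>?C\<^esub> \<one>\<^bsub>?C\<^esub> [^]\<^bsub>?C\<^esub> (1 - s)) = \<one>\<^bsub>?C\<^esub>"
      proof -
        have s: "(\<lambda>s. \<one>\<^bsub>?C\<^esub> [^]\<^bsub>?C\<^esub> s \<otimes>\<^bsub>?C\<^esub> \<one>\<^bsub>?C\<^esub> [^]\<^bsub>?C\<^esub> (1 - s)) = (\<lambda>s::nat. \<one>\<^bsub>?C\<^esub>)"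
          by (intro ext) (simp only: C.nat_pow_one C.l_one C.one_closed)
        have "{1..1::nat} = insert 1 {}" by simp
        then show ?thesis unfolding s
          by (simp only: C.finsum_insert finite.emptyI empty_iff not_False_eq_True C.one_closed Pi_I C.finsum_empty C.r_zero
              of_nat_1 div_by_1 const_ground_1 C.one_smult)
      qed
      have "(e ?i \<otimes> g ?i) \<otimes> E \<sigma> = (e ?i \<otimes> E \<sigma>) \<otimes> g ?i" by (simp add: m_assoc b(5))
      then have eg: "(e ?i \<otimes> g ?i) \<otimes> E \<sigma> = g ?i \<otimes> E \<sigma>" by (simp only: eE b(5))
      have "cg a i \<otimes>\<^bsub>?C\<^esub> cg a i = (U \<odot> \<one> \<oplus> v_var \<odot> (e ?i \<otimes> g ?i)) \<otimes> E \<sigma>"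
        by (simp only: corner_simps(5) cg[OF i] cm[OF g_closed g_closed b(5)] g_g[OF b(1) in_n])
      also have "\<dots> = U \<odot> E \<sigma> \<oplus> v_var \<odot> (g ?i \<otimes> E \<sigma>)"
        using eg by (simp add: l_distr smult_mult_left)
      finally show ?thesis
        unfolding one C.l_one[OF cg_closed] by (simp only: corner_simps cg[OF i])
    qed
    have "poly_at vs (J ?o) \<otimes> E \<sigma> = \<zero>" using fst \<sigma> by (intro poly_at_J_E) simp_all
    then have "C.poly_at vs (cX a) = \<zero>\<^bsub>?C\<^esub>"
      unfolding cX_def poly_at_corner[OF E_idem J_closed Jc(1)] by (simp only: corner_simps)
    then show "foldr (\<lambda>c y. (cX a \<ominus>\<^bsub>?C\<^esub> c \<odot>\<^bsub>?C\<^esub> \<one>\<^bsub>?C\<^esub>) \<otimes>\<^bsub>?C\<^esub> y) vs \<one>\<^bsub>?C\<^esub> = \<zero>\<^bsub>?C\<^esub>"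
      unfolding C.poly_at_def .
  qed simp_all
qed

lemma cX_inverse:
  assumes "1 \<le> cnt \<sigma> n a"
  shows "cX a \<otimes>\<^bsub>corner A (E \<sigma>)\<^esub> cXi a = \<one>\<^bsub>corner A (E \<sigma>)\<^esub>" "cXi a \<otimes>\<^bsub>corner A (E \<sigma>)\<^esub> cX a = \<one>\<^bsub>corner A (E \<sigma>)\<^esub>"
proof -
  interpret R: yh_rep "corner A (E \<sigma>)" 1 "cnt \<sigma> n a" vs "cg a" "\<lambda>_. \<one>\<^bsub>corner A (E \<sigma>)\<^esub>" "cX a" "cXi a"
    by (rule yh_rep_block[OF assms])
  show "cX a \<otimes>\<^bsub>corner A (E \<sigma>)\<^esub> cXi a = \<one>\<^bsub>corner A (E \<sigma>)\<^esub>" "cXi a \<otimes>\<^bsub>corner A (E \<sigma>)\<^esub> cX a = \<one>\<^bsub>corner A (E \<sigma>)\<^esub>"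
    by (rule R.X_Xi R.Xi_X)+
qed

text \<open>Different blocks occupy disjoint intervals. A generator inside block \<open>b\<close>
  therefore avoids the two indices excluded by \<open>g_J\<close> for the Jucys--Murphy element at
  the start of block \<open>a\<close>.\<close>

lemma blocks_commute:
  assumes ab: "a \<noteq> b"
  shows "\<lbrakk>1 \<le> i; i < cnt \<sigma> n a; 1 \<le> j; j < cnt \<sigma> n b\<rbrakk> \<Longrightarrow> cg a i \<otimes> cg b j = cg b j \<otimes> cg a i"
    and "\<lbrakk>1 \<le> cnt \<sigma> n a; 1 \<le> j; j < cnt \<sigma> n b\<rbrakk> \<Longrightarrow> cX a \<otimes> cg b j = cg b j \<otimes> cX a"
    and "\<lbrakk>1 \<le> cnt \<sigma> n a; 1 \<le> cnt \<sigma> n b\<rbrakk> \<Longrightarrow> cX a \<otimes> cX b = cX b \<otimes> cX a"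
proof -
  note cm = corner_mult[OF E_idem]
  have ord: "block_start a + cnt \<sigma> n a \<le> block_start b \<or> block_start b + cnt \<sigma> n b \<le> block_start a"
    using smaller_block_mono[of a b n \<sigma>] smaller_block_mono[of b a n \<sigma>] ab by linarith
  show "cg a i \<otimes> cg b j = cg b j \<otimes> cg a i" if "1 \<le> i" "i < cnt \<sigma> n a" "1 \<le> j" "j < cnt \<sigma> n b"
  proof -
    note bi = block[OF that(1,2)] and bj = block[OF that(3,4)]
    have "g (block_start a + i) \<otimes> g (block_start b + j) = g (block_start b + j) \<otimes> g (block_start a + i)"
      using that bi(1,2) bj(1,2) ord by (intro g_comm) linarith+
    then show ?thesis
      using that cm[OF g_closed g_closed bj(5), of "block_start a + i"] cm[OF g_closed g_closed bi(5), of "block_start b + j"]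
      by (simp add: cg_def)
  qed
  show "cX a \<otimes> cg b j = cg b j \<otimes> cX a" if "1 \<le> cnt \<sigma> n a" "1 \<le> j" "j < cnt \<sigma> n b"
  proof -
    note bj = block[OF that(2,3)] and fa = block_first[OF that(1)]
    have "g (block_start b + j) \<otimes> J (block_start a) = J (block_start a) \<otimes> g (block_start b + j)"
      using that bj(1,2) fa(1) ord by (intro g_J) linarith+
    then show ?thesis
      using that cm[OF J_closed g_closed bj(5), of "block_start a"] cm[OF g_closed J_closed J_comm(1)[OF that(1)], of "block_start b + j"]
      by (simp add: cg_def cX_def)
  qed
  show "cX a \<otimes> cX b = cX b \<otimes> cX a" if "1 \<le> cnt \<sigma> n a" "1 \<le> cnt \<sigma> n b"
    unfolding cX_def cm[OF J_closed J_closed J_comm(1)[OF that(1)]] cm[OF J_closed J_closed J_comm(1)[OF that(2)]]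
    by (simp only: J_commute[OF block_first(1)[OF that(1)] block_first(1)[OF that(2)]])
qed

end

end


section \<open>The corner at a sorted colouring\<close>

lemma yh_rep_image:
  assumes "yh_rep A d n vs g t X Xi" and "kalgebra_hom A B h"
  shows "yh_rep B d n vs (\<lambda>i. h (g i)) (\<lambda>j. h (t j)) (h X) (h Xi)"
proof -
  interpret A: yh_rep A d n vs g t X Xi by fact
  interpret h: kalgebra_hom A B h by fact
  have pow: "h (x [^]\<^bsub>A\<^esub> (s::nat)) = h x [^]\<^bsub>B\<^esub> s" if "x \<in> carrier A" for x s
    using that by (induction s) (simp_all add: h.hom_mult h.hom_one)
  show ?thesis
  proof (intro yh_rep.intro root_algebra.intro yh_rep_axioms.intro root_algebra_axioms.intro
      h.B.kalgebra_axioms A.d_pos h.hom_closed A.g_closed A.t_closed A.X_closed A.Xi_closed)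
    show "h (g i) \<otimes>\<^bsub>B\<^esub> h (g j) = h (g j) \<otimes>\<^bsub>B\<^esub> h (g i)" if "1 \<le> i" "Suc i < j" "j < n" for i j
      using A.g_commute[OF that] by (simp flip: h.hom_mult)
    show "h (g i) \<otimes>\<^bsub>B\<^esub> (h (g (Suc i)) \<otimes>\<^bsub>B\<^esub> h (g i)) = h (g (Suc i)) \<otimes>\<^bsub>B\<^esub> (h (g i) \<otimes>\<^bsub>B\<^esub> h (g (Suc i)))"
      if "1 \<le> i" "Suc i < n" for i
      using A.g_braid[OF that] by (simp flip: h.hom_mult)
    show "h X \<otimes>\<^bsub>B\<^esub> h Xi = \<one>\<^bsub>B\<^esub>" "h Xi \<otimes>\<^bsub>B\<^esub> h X = \<one>\<^bsub>B\<^esub>"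
      by (simp_all add: A.X_Xi A.Xi_X h.hom_one flip: h.hom_mult)
    show "h X \<otimes>\<^bsub>B\<^esub> (h (g 1) \<otimes>\<^bsub>B\<^esub> (h X \<otimes>\<^bsub>B\<^esub> h (g 1))) = h (g 1) \<otimes>\<^bsub>B\<^esub> (h X \<otimes>\<^bsub>B\<^esub> (h (g 1) \<otimes>\<^bsub>B\<^esub> h X))" if "1 < n"
      using A.X_g_braid[OF that] by (simp flip: h.hom_mult)
    show "h X \<otimes>\<^bsub>B\<^esub> h (g i) = h (g i) \<otimes>\<^bsub>B\<^esub> h X" if "2 \<le> i" "i < n" for i
      using A.X_g[OF that] by (simp flip: h.hom_mult)
    show "h (t i) \<otimes>\<^bsub>B\<^esub> h (t j) = h (t j) \<otimes>\<^bsub>B\<^esub> h (t i)" if "i \<in> {1..n}" "j \<in> {1..n}" for i j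
      using A.t_commute[OF that] by (simp flip: h.hom_mult)
    show "h (g i) \<otimes>\<^bsub>B\<^esub> h (t j) = h (t (transpose i (Suc i) j)) \<otimes>\<^bsub>B\<^esub> h (g i)"
      if "1 \<le> i" "i < n" "j \<in> {1..n}" for i j
      using A.g_t[OF that] by (simp flip: h.hom_mult)
    show "h (t j) [^]\<^bsub>B\<^esub> d = \<one>\<^bsub>B\<^esub>" if "j \<in> {1..n}" for j
      using A.t_power[OF that] by (simp add: h.hom_one flip: pow)
    show "h X \<otimes>\<^bsub>B\<^esub> h (t j) = h (t j) \<otimes>\<^bsub>B\<^esub> h X" if "j \<in> {1..n}" for j
      using A.X_t[OF that] by (simp flip: h.hom_mult)
    show "h (g i) \<otimes>\<^bsub>B\<^esub> h (g i) = U \<odot>\<^bsub>B\<^esub> \<one>\<^bsub>B\<^esub> \<oplus>\<^bsub>B\<^esub> v_var \<odot>\<^bsub>B\<^esub> (const_ground (1 / of_nat d) \<odot>\<^bsub>B\<^esub>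
        (\<Oplus>\<^bsub>B\<^esub>s\<in>{1..d}. h (t i) [^]\<^bsub>B\<^esub> s \<otimes>\<^bsub>B\<^esub> h (t (Suc i)) [^]\<^bsub>B\<^esub> (d - s)) \<otimes>\<^bsub>B\<^esub> h (g i))"
      if i: "1 \<le> i" "i < n" for i
    proof -
      have sum: "h (\<Oplus>\<^bsub>A\<^esub>s\<in>{1..d}. t i [^]\<^bsub>A\<^esub> s \<otimes>\<^bsub>A\<^esub> t (Suc i) [^]\<^bsub>A\<^esub> (d - s))
        = (\<Oplus>\<^bsub>B\<^esub>s\<in>{1..d}. h (t i) [^]\<^bsub>B\<^esub> s \<otimes>\<^bsub>B\<^esub> h (t (Suc i)) [^]\<^bsub>B\<^esub> (d - s))"
        by (subst h.hom_finsum) (simp_all add: h.hom_mult pow)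
      have c: "(\<Oplus>\<^bsub>A\<^esub>s\<in>{1..d}. t i [^]\<^bsub>A\<^esub> s \<otimes>\<^bsub>A\<^esub> t (Suc i) [^]\<^bsub>A\<^esub> (d - s)) \<in> carrier A" by (simp add: Pi_def)
      have "h (g i) \<otimes>\<^bsub>B\<^esub> h (g i) = h (g i \<otimes>\<^bsub>A\<^esub> g i)" by (simp add: h.hom_mult)
      then show ?thesis
        using c by (simp only: A.g_square[OF i] h.hom_add h.hom_mult h.hom_smult h.hom_one sum A.g_closed
            A.smult_closed A.m_closed A.one_closed)
    qed
    show "foldr (\<lambda>c y. (h X \<ominus>\<^bsub>B\<^esub> c \<odot>\<^bsub>B\<^esub> \<one>\<^bsub>B\<^esub>) \<otimes>\<^bsub>B\<^esub> y) vs \<one>\<^bsub>B\<^esub> = \<zero>\<^bsub>B\<^esub>"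
    proof -
      have "A.poly_at vs X = \<zero>\<^bsub>A\<^esub>" using A.X_cyclotomic unfolding A.poly_at_def .
      then have "h.B.poly_at vs (h X) = \<zero>\<^bsub>B\<^esub>"
        using h.hom_poly_at[OF A.X_closed, of vs] by simp
      then show ?thesis unfolding h.B.poly_at_def .
    qed
  qed
qed

text \<open>Elements built from the generators by the same formulas correspond; the bounds on
  \<open>k\<close> keep to the indices where the generators are known to correspond.\<close>

lemma yh_rep_hom:
  assumes "yh_rep A d n vs g t X Xi" and "yh_rep B d n vs g' t' X' Xi'" and "kalgebra_hom A B h"
    and g: "\<And>i. \<lbrakk>1 \<le> i; i < n\<rbrakk> \<Longrightarrow> h (g i) = g' i" and t: "\<And>j. \<lbrakk>1 \<le> j; j \<le> n\<rbrakk> \<Longrightarrow> h (t j) = t' j" and X: "h X = X'"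
  shows "k \<le> n \<Longrightarrow> h (yh_rep.tE A d t k \<chi>) = yh_rep.tE B d t' k \<chi>"
    and "k < n \<Longrightarrow> h (yh_rep.J A g X k) = yh_rep.J B g' X' k"
proof -
  interpret A: yh_rep A d n vs g t X Xi by fact
  interpret B: yh_rep B d n vs g' t' X' Xi' by fact
  interpret h: kalgebra_hom A B h by fact
  have pow: "h (x [^]\<^bsub>A\<^esub> (s::nat)) = h x [^]\<^bsub>B\<^esub> s" if "x \<in> carrier A" for x s
    using that by (induction s) (simp_all add: h.hom_mult h.hom_one)
  have eps: "h (A.eps x a) = B.eps (h x) a" if "x \<in> carrier A" for x a
  proof -
    have c: "(\<Oplus>\<^bsub>A\<^esub>s\<in>{..<d}. const_ground ((1 / zeta d ^ a) ^ s) \<odot>\<^bsub>A\<^esub> x [^]\<^bsub>A\<^esub> s) \<in> carrier A"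
      using that by (simp add: Pi_def)
    show ?thesis
      unfolding A.eps_def B.eps_def h.hom_smult[OF c]
      by (subst h.hom_finsum) (simp_all add: that h.hom_smult pow)
  qed
  show "k \<le> n \<Longrightarrow> h (A.tE k \<chi>) = B.tE k \<chi>"
    by (induction k) (simp_all add: A.tE_Suc B.tE_Suc h.hom_one h.hom_mult eps t)
  show "k < n \<Longrightarrow> h (A.J k) = B.J k"
    by (induction k) (simp_all add: A.J_0 A.J_Suc B.J_0 B.J_Suc h.hom_mult h.hom_smult g X)
qed

section \<open>Idempotents and Jucys--Murphy elements acting on functions\<close>

context col_action
begin

interpretation R: yh_rep En d n vs aG aT "aM Xb" "aM Xib"
  by (rule yh_rep_En)

text \<open>Each \<open>t j\<close> multiplies the value at \<open>\<chi>\<close> by the eigenvalue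
  of the colour \<open>\<chi> j\<close>, so every factor of the idempotent fixes that value.\<close>

lemma E_apply:
  assumes \<chi>: "\<chi> \<in> Col" and f: "f \<in> carrier M" and k: "k \<le> n"
  shows "R.tE k \<chi> f \<chi> = f \<chi>"
  using k f
proof (induction k arbitrary: f)
  case 0
  then show ?case using En_apply(2)[OF 0(2) \<chi>] by (simp only: R.tE_0)
next
  case (Suc k)
  note f = \<open>f \<in> carrier M\<close>
  let ?a = "\<chi> (Suc k)"
  have a: "?a < d" using Col_val[OF \<chi>, of "Suc k"] Suc.prems(1) by simp
  have v: "f \<chi> \<in> carrier Z" by (rule M_val[OF f \<chi>])
  have cl: "const_ground ((1 / zeta d ^ ?a) ^ s) \<odot>\<^bsub>En\<^esub> aT (Suc k) [^]\<^bsub>En\<^esub> s \<in> carrier En" for s :: nat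
    by (intro R.smult_closed R.nat_pow_closed aT_closed)
  have "R.eps (aT (Suc k)) ?a f \<chi> = const_ground (1 / of_nat d) \<odot>\<^bsub>Z\<^esub>
      (\<Oplus>\<^bsub>Z\<^esub>s\<in>{..<d}. const_ground ((1 / zeta d ^ ?a) ^ s) \<odot>\<^bsub>Z\<^esub> (zp d ?a ^ s \<odot>\<^bsub>Z\<^esub> f \<chi>))"
    unfolding R.eps_def En_apply(4)[OF f \<chi>] En_finsum[OF cl f \<chi>] aT_pow[OF f \<chi>] ..
  also have "\<dots> = (const_ground (1 / of_nat d) * (\<Sum>s<d. const_ground ((1 / zeta d ^ ?a) ^ s) * zp d ?a ^ s)) \<odot>\<^bsub>Z\<^esub> f \<chi>"
    using v by (simp only: Z.smult_smult Z.finsum_scalar)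
  also have "\<dots> = f \<chi>" unfolding R.eps_scalar[OF a a] using v by (simp add: Z.one_smult)
  finally have eps: "R.eps (aT (Suc k)) ?a f \<chi> = f \<chi>" .
  have "R.eps (aT (Suc k)) ?a f \<in> carrier M" by (rule En_closed[OF R.eps_closed[OF aT_closed] f])
  then have "R.tE k \<chi> (R.eps (aT (Suc k)) ?a f) \<chi> = f \<chi>" using Suc.IH Suc.prems(1) eps by simp
  then show ?case by (simp only: R.tE_Suc En_apply(1)[OF f \<chi>])
qed

text \<open>The new colour is exchanged to the left until it stands at position 1, where X acts
  through its block. The two generators of each step contribute \<open>u_var\<close> twice, which
  \<open>U_inv\<close> cancels.\<close>

lemma J_apply:
  assumes "\<chi> \<in> Col" "f \<in> carrier M" "k < n" "cnt \<chi> k (\<chi> (Suc k)) = 0"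
  shows "R.J k f \<chi> = Xb (\<chi> (Suc k)) \<otimes>\<^bsub>Z\<^esub> f \<chi>"
  using assms
proof (induction k arbitrary: f \<chi>)
  case 0
  then show ?case by (simp add: R.J_0 aM_apply)
next
  case (Suc k)
  note \<chi> = Suc.prems(1) and f = Suc.prems(2)
  let ?i = "Suc k" and ?\<psi> = "sw (Suc k) \<chi>"
  have i: "1 \<le> ?i" "?i < n" using Suc.prems(3) by simp_all
  have ne: "\<chi> ?i \<noteq> \<chi> (Suc ?i)" and c0: "cnt \<chi> k (\<chi> (Suc ?i)) = 0"
    using Suc.prems(4) by (auto simp: cnt_Suc split: if_splits)
  have \<psi>: "?\<psi> \<in> Col" by (rule sw_Col[OF \<chi> i])
  have val: "?\<psi> ?i = \<chi> (Suc ?i)" "?\<psi> (Suc ?i) = \<chi> ?i" "sw ?i ?\<psi> = \<chi>" by (simp_all add: sw_def)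
  have "cnt ?\<psi> k (\<chi> (Suc ?i)) = cnt \<chi> k (\<chi> (Suc ?i))" using cnt_sw[of ?i k \<chi>] by simp
  then have c: "cnt ?\<psi> k (?\<psi> ?i) = 0" by (simp only: c0 val)
  have gf: "aG ?i f \<in> carrier M" by (rule aG_val[OF f])
  have Jf: "R.J k (aG ?i f) \<in> carrier M" by (rule En_closed[OF R.J_closed gf])
  have v: "f \<chi> \<in> carrier Z" by (rule M_val[OF f \<chi>])
  have "R.J ?i f \<chi> = U_inv \<odot>\<^bsub>Z\<^esub> (aG ?i (R.J k (aG ?i f)) \<chi>)"
    unfolding R.J_Suc En_apply(4)[OF f \<chi>] En_apply(1)[OF f \<chi>] ..
  also have "aG ?i (R.J k (aG ?i f)) \<chi> = u_var \<odot>\<^bsub>Z\<^esub> R.J k (aG ?i f) ?\<psi>"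
    using ne by (simp only: aG_apply[OF Jf \<chi> i] if_False)
  also have "R.J k (aG ?i f) ?\<psi> = Xb (\<chi> (Suc ?i)) \<otimes>\<^bsub>Z\<^esub> aG ?i f ?\<psi>"
    using Suc.IH[OF \<psi> gf _ c] i by (simp only: val)
  also have "aG ?i f ?\<psi> = u_var \<odot>\<^bsub>Z\<^esub> f \<chi>"
    using ne by (simp only: aG_apply[OF f \<psi> i] val) simp
  also have "U_inv \<odot>\<^bsub>Z\<^esub> (u_var \<odot>\<^bsub>Z\<^esub> (Xb (\<chi> (Suc ?i)) \<otimes>\<^bsub>Z\<^esub> (u_var \<odot>\<^bsub>Z\<^esub> f \<chi>)))
      = (U_inv * (u_var * u_var)) \<odot>\<^bsub>Z\<^esub> (Xb (\<chi> (Suc ?i)) \<otimes>\<^bsub>Z\<^esub> f \<chi>)"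
    using v by (simp add: Z.smult_mult_right Z.smult_smult)
  also have "U_inv * (u_var * u_var) = 1"
    using U_inv(2) unfolding U_def power2_eq_square .
  finally show ?case using v by (simp add: Z.one_smult)
qed

end


lemma (in tensor_factors) tensor_generates_gens:
  assumes "finite I" and G: "\<And>i. i \<in> I \<Longrightarrow> generates (A i) (G i)"
  shows "generates TA (\<Union>i\<in>I. inj i ` G i)"
  unfolding generates_def
proof (intro conjI allI impI)
  show "(\<Union>i\<in>I. inj i ` G i) \<subseteq> carrier TA"
  proof (intro UN_least image_subsetI)
    fix i x assume i: "i \<in> I" and x: "x \<in> G i"
    show "inj i x \<in> carrier TA"
      by (rule kalgebra_hom.hom_closed[OF kalgebra_hom_inj[OF i] subsetD[OF generatesD(1)[OF G[OF i]] x]])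
  qed
  fix P assume P: "subalgebra TA P" "(\<Union>i\<in>I. inj i ` G i) \<subseteq> P"
  show "carrier TA \<subseteq> P"
  proof (rule generatesD(2)[OF tensor_generates[OF assms(1)] P(1)], intro UN_least image_subsetI)
    fix i x assume i: "i \<in> I" and x: "x \<in> carrier (A i)"
    have "G i \<subseteq> {x \<in> carrier (A i). inj i x \<in> P}"
    proof (intro subsetI CollectI conjI)
      fix y assume y: "y \<in> G i"
      show "y \<in> carrier (A i)" by (rule subsetD[OF generatesD(1)[OF G[OF i]] y])
      show "inj i y \<in> P" by (rule subsetD[OF P(2)], rule UN_I[OF i], rule imageI, rule y)
    qed
    then have "carrier (A i) \<subseteq> {x \<in> carrier (A i). inj i x \<in> P}"
      by (rule generatesD(2)[OF G[OF i] subalgebra_vimage[OF kalgebra_hom_inj[OF i] P(1)]])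
    from subsetD[OF this x] show "inj i x \<in> P" by simp
  qed
qed

text \<open>For d = 1 all \<open>t j\<close> are equal to 1, so they form a single case.\<close>

lemma hecke_gens_cases [consumes 1, case_names g X Xinv one]:
  assumes "x \<in> hecke_gens k vs"
  obtains i where "1 \<le> i" "i < k" "x = ygen 1 k vs (gen_g i)"
    | "1 \<le> k" "x = ygen 1 k vs gen_X" | "1 \<le> k" "x = ygen 1 k vs gen_Xinv" | "x = \<one>\<^bsub>cyclotomic_hecke k vs\<^esub>"
proof -
  have k: "1 \<le> k" and x: "x \<in> ygen 1 k vs ` yh_gens k"
    using assms by (simp_all add: hecke_gens_def split: if_splits)
  from x obtain z where z: "x = ygen 1 k vs z" "z \<in> yh_gens k" by (rule imageE)
  show thesis
  proof (cases z)
    case (gen_g i)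
    then show ?thesis using z by (intro that(1)[of i]) (simp_all add: yh_gens_simps)
  next
    case gen_X
    then show ?thesis using z k by (intro that(2)) simp_all
  next
    case gen_Xinv
    then show ?thesis using z k by (intro that(3)) simp_all
  next
    case (gen_t j)
    then have "1 \<le> j" "j \<le> k" using z by (simp_all add: yh_gens_simps)
    then show ?thesis using z gen_t by (intro that(4)) (simp only: hecke_t cyclotomic_hecke_pos[OF k])
  qed
qed

locale sorted_colouring =
  fixes d n :: nat and vs :: "ground list" and \<sigma> :: "nat \<Rightarrow> nat"
  assumes d_pos: "d \<ge> 1" and n_pos: "n \<ge> 1"
    and \<sigma>: "\<sigma> \<in> colourings d n" and sorted: "\<nexists>i. desc n \<sigma> i"
begin

abbreviation YH where "YH \<equiv> cyclotomic_YH d n vs"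

sublocale Y: yh_rep YH d n vs "yh_g d n vs" "yh_t d n vs" "ygen d n vs gen_X" "ygen d n vs gen_Xinv"
  by (rule yh_rep_cyclotomic_YH[OF d_pos])

abbreviation C where "C \<equiv> corner YH (Y.E \<sigma>)"

definition \<mu> :: "nat list" where "\<mu> = col_type d n \<sigma>"

abbreviation HA where "HA \<equiv> \<lambda>a. cyclotomic_hecke (\<mu> ! a) vs"

lemma length_\<mu>: "length \<mu> = d" by (simp add: \<mu>_def col_type_def)

lemma cnt_\<sigma>: "a < d \<Longrightarrow> cnt \<sigma> n a = \<mu> ! a" by (simp add: \<mu>_def col_type_nth)

sublocale T: tensor_factors "{..<d}" HA
  by (rule tensor_factors.intro) (rule kalgebra_cyclotomic_hecke)

abbreviation H where "H \<equiv> cyclotomic_hecke_tensor \<mu> vs"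

lemma H_def: "H = tensor_algebra {..<d} HA"
  by (simp add: cyclotomic_hecke_tensor_def length_\<mu>)

sublocale C: kalgebra C
  by (rule Y.kalgebra_corner[OF Y.E_idem[OF \<sigma> sorted]])

text \<open>The map is specified by its values on the generators of the tensor factors; a colour
  that does not occur imposes no condition.\<close>

definition block_map :: "(((nat \<Rightarrow> free_elem set set) \<Rightarrow>\<^sub>0 ground) set \<Rightarrow> free_elem set set) \<Rightarrow> bool"
  where "block_map \<Psi> \<longleftrightarrow> kalgebra_hom H C \<Psi> \<and>
    (\<forall>a<d. (\<forall>k. 1 \<le> k \<and> k < \<mu> ! a \<longrightarrow> \<Psi> (T.inj a (ygen 1 (\<mu> ! a) vs (gen_g k))) = Y.cg \<sigma> a k) \<and>
      (1 \<le> \<mu> ! a \<longrightarrow> \<Psi> (T.inj a (ygen 1 (\<mu> ! a) vs gen_X)) = Y.cX \<sigma> a \<and>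
        \<Psi> (T.inj a (ygen 1 (\<mu> ! a) vs gen_Xinv)) = Y.cXi \<sigma> a))"

lemma hecke_closed:
  "\<lbrakk>1 \<le> i; i < k\<rbrakk> \<Longrightarrow> ygen 1 k vs (gen_g i) \<in> carrier (cyclotomic_hecke k vs)"
  "1 \<le> k \<Longrightarrow> ygen 1 k vs gen_X \<in> carrier (cyclotomic_hecke k vs)"
  "1 \<le> k \<Longrightarrow> ygen 1 k vs gen_Xinv \<in> carrier (cyclotomic_hecke k vs)"
  by (rule subsetD[OF generatesD(1)[OF cyclotomic_hecke_generates]];
      simp add: hecke_gens_def yh_gens_simps)+

text \<open>Each block gives a homomorphism from its own Hecke algebra. To combine them on the
  tensor product, commutation of different blocks is checked on generators.\<close>

lemma block_map_exists: "\<exists>\<Psi>. block_map \<Psi>"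
proof -
  have "\<forall>a\<in>{..<d}. \<exists>h. kalgebra_hom (HA a) C h \<and>
    (\<mu> ! a \<ge> 1 \<longrightarrow> (\<forall>i. 1 \<le> i \<and> i < \<mu> ! a \<longrightarrow> h (ygen 1 (\<mu> ! a) vs (gen_g i)) = Y.cg \<sigma> a i) \<and>
      h (ygen 1 (\<mu> ! a) vs gen_X) = Y.cX \<sigma> a \<and> h (ygen 1 (\<mu> ! a) vs gen_Xinv) = Y.cXi \<sigma> a)"
  proof
    fix a assume "a \<in> {..<d}"
    then have a: "cnt \<sigma> n a = \<mu> ! a" by (simp add: cnt_\<sigma>)
    show "\<exists>h. kalgebra_hom (HA a) C h \<and>
      (\<mu> ! a \<ge> 1 \<longrightarrow> (\<forall>i. 1 \<le> i \<and> i < \<mu> ! a \<longrightarrow> h (ygen 1 (\<mu> ! a) vs (gen_g i)) = Y.cg \<sigma> a i) \<and>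
        h (ygen 1 (\<mu> ! a) vs gen_X) = Y.cX \<sigma> a \<and> h (ygen 1 (\<mu> ! a) vs gen_Xinv) = Y.cXi \<sigma> a)"
      by (rule cyclotomic_hecke_lift[OF C.kalgebra_axioms])
        (rule Y.yh_rep_block[OF \<sigma> sorted, of a, unfolded a])
  qed
  from bchoice[OF this] obtain \<psi> where \<psi>0: "\<forall>a\<in>{..<d}. kalgebra_hom (HA a) C (\<psi> a) \<and>
    (\<mu> ! a \<ge> 1 \<longrightarrow> (\<forall>i. 1 \<le> i \<and> i < \<mu> ! a \<longrightarrow> \<psi> a (ygen 1 (\<mu> ! a) vs (gen_g i)) = Y.cg \<sigma> a i) \<and>
      \<psi> a (ygen 1 (\<mu> ! a) vs gen_X) = Y.cX \<sigma> a \<and> \<psi> a (ygen 1 (\<mu> ! a) vs gen_Xinv) = Y.cXi \<sigma> a)"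
    by (elim exE)
  have \<psi>: "kalgebra_hom (HA a) C (\<psi> a)" if "a < d" for a
    using bspec[OF \<psi>0, of a] that by simp
  have \<psi>_g: "\<psi> a (ygen 1 (\<mu> ! a) vs (gen_g i)) = Y.cg \<sigma> a i" if "a < d" "1 \<le> i" "i < \<mu> ! a" for a i
    using bspec[OF \<psi>0, of a] that by simp
  have \<psi>_X: "\<psi> a (ygen 1 (\<mu> ! a) vs gen_X) = Y.cX \<sigma> a" "\<psi> a (ygen 1 (\<mu> ! a) vs gen_Xinv) = Y.cXi \<sigma> a"
    if "a < d" "1 \<le> \<mu> ! a" for a
    using bspec[OF \<psi>0, of a] that by simp_all
  have cl: "Y.cX \<sigma> a \<in> carrier C" "Y.cXi \<sigma> a \<in> carrier C"
    and inv: "Y.cX \<sigma> a \<otimes>\<^bsub>C\<^esub> Y.cXi \<sigma> a = \<one>\<^bsub>C\<^esub>" "Y.cXi \<sigma> a \<otimes>\<^bsub>C\<^esub> Y.cX \<sigma> a = \<one>\<^bsub>C\<^esub>"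
    if "a < d" "1 \<le> \<mu> ! a" for a
    using Y.cX_closed[OF \<sigma> sorted, of a] Y.cX_inverse[OF \<sigma> sorted, of a] that by (simp_all add: cnt_\<sigma>)
  note clg = Y.cg_closed[OF \<sigma> sorted]
  \<comment> \<open>Commutation with the inverse generator follows from that with X, so only the g
    and X of block \<open>b\<close> have to be tested.\<close>
  have comm1: "z \<otimes>\<^bsub>C\<^esub> \<psi> b y = \<psi> b y \<otimes>\<^bsub>C\<^esub> z"
    if b: "b < d" and z: "z \<in> carrier C" and zg: "\<And>j. \<lbrakk>1 \<le> j; j < \<mu> ! b\<rbrakk> \<Longrightarrow> z \<otimes>\<^bsub>C\<^esub> Y.cg \<sigma> b j = Y.cg \<sigma> b j \<otimes>\<^bsub>C\<^esub> z"
      and zX: "1 \<le> \<mu> ! b \<Longrightarrow> z \<otimes>\<^bsub>C\<^esub> Y.cX \<sigma> b = Y.cX \<sigma> b \<otimes>\<^bsub>C\<^esub> z" and y: "y \<in> hecke_gens (\<mu> ! b) vs" for z b y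
    using y
  proof (cases rule: hecke_gens_cases)
    case (g j)
    show ?thesis unfolding g(3) \<psi>_g[OF b g(1,2)] by (rule zg[OF g(1,2)])
  next
    case X
    show ?thesis unfolding X(2) \<psi>_X(1)[OF b X(1)] by (rule zX[OF X(1)])
  next
    case Xinv
    show ?thesis unfolding Xinv(2) \<psi>_X(2)[OF b Xinv(1)]
      by (rule C.inverse_commute[symmetric, OF cl[OF b Xinv(1)] z inv[OF b Xinv(1)] zX[symmetric, OF Xinv(1)]])
  next
    case one
    show ?thesis unfolding one kalgebra_hom.hom_one[OF \<psi>[OF b]] by (simp only: C.l_one C.r_one z)
  qed
  have comm: "\<psi> a x \<otimes>\<^bsub>C\<^esub> \<psi> b y = \<psi> b y \<otimes>\<^bsub>C\<^esub> \<psi> a x"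
    if ab: "a < d" "b < d" "a \<noteq> b" and x: "x \<in> hecke_gens (\<mu> ! a) vs" and y: "y \<in> hecke_gens (\<mu> ! b) vs" for a b x y
  proof -
    note bc = Y.blocks_commute[OF \<sigma> sorted ab(3), unfolded cnt_\<sigma>[OF ab(1)] cnt_\<sigma>[OF ab(2)]]
    note bc' = Y.blocks_commute[OF \<sigma> sorted ab(3)[symmetric], unfolded cnt_\<sigma>[OF ab(1)] cnt_\<sigma>[OF ab(2)]]
    have yC: "\<psi> b y \<in> carrier C"
      by (rule kalgebra_hom.hom_closed[OF \<psi>[OF ab(2)] subsetD[OF generatesD(1)[OF cyclotomic_hecke_generates] y]])
    have X: "Y.cX \<sigma> a \<otimes>\<^bsub>C\<^esub> \<psi> b y = \<psi> b y \<otimes>\<^bsub>C\<^esub> Y.cX \<sigma> a" if "1 \<le> \<mu> ! a"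
      by (rule comm1[OF ab(2) cl(1)[OF ab(1) that] _ _ y]; unfold corner_simps(5))
        (rule bc(2)[OF that], assumption, assumption, rule bc(3)[OF that])
    from x show ?thesis
    proof (cases rule: hecke_gens_cases)
      case (g i)
      show ?thesis
        unfolding g(3) \<psi>_g[OF ab(1) g(1,2)]
        by (rule comm1[OF ab(2) clg _ _ y]; unfold corner_simps(5))
          (rule bc(1)[OF g(1,2)], assumption, assumption, rule bc'(2)[symmetric, OF _ g(1,2)])
    next
      case X
      show ?thesis unfolding X(2) \<psi>_X(1)[OF ab(1) X(1)] by (rule \<open>1 \<le> \<mu> ! a \<Longrightarrow> _\<close>[OF X(1)])
    next
      case Xinv
      show ?thesis unfolding Xinv(2) \<psi>_X(2)[OF ab(1) Xinv(1)]
        by (rule C.inverse_commute[OF cl[OF ab(1) Xinv(1)] yC inv[OF ab(1) Xinv(1)] \<open>1 \<le> \<mu> ! a \<Longrightarrow> _\<close>[OF Xinv(1)]])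
    next
      case one
      show ?thesis unfolding one kalgebra_hom.hom_one[OF \<psi>[OF ab(1)]] by (simp only: C.l_one C.r_one yC)
    qed
  qed
  have "\<exists>h. kalgebra_hom (tensor_algebra {..<d} HA) C h \<and> (\<forall>i<d. \<forall>x\<in>carrier (HA i). h (T.inj i x) = \<psi> i x)"
    by (rule tensor_algebra_lift[OF T.tensor_factors_axioms C.kalgebra_axioms \<psi>])
      (assumption, rule kalgebra_homs_commute[OF \<psi> \<psi> cyclotomic_hecke_generates cyclotomic_hecke_generates comm])
  then obtain \<Psi> where \<Psi>: "kalgebra_hom H C \<Psi>" "\<And>a x. \<lbrakk>a < d; x \<in> carrier (HA a)\<rbrakk> \<Longrightarrow> \<Psi> (T.inj a x) = \<psi> a x"
    unfolding H_def[symmetric] by (elim exE conjE) (simp only: Ball_def)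
  show ?thesis
    unfolding block_map_def
  proof (intro exI[of _ \<Psi>] conjI allI impI \<Psi>(1))
    fix a assume a: "a < d"
    show "\<Psi> (T.inj a (ygen 1 (\<mu> ! a) vs (gen_g k))) = Y.cg \<sigma> a k" if "1 \<le> k \<and> k < \<mu> ! a" for k
      using that by (simp only: \<Psi>(2)[OF a hecke_closed(1)] \<psi>_g[OF a])
    show "\<Psi> (T.inj a (ygen 1 (\<mu> ! a) vs gen_X)) = Y.cX \<sigma> a" "\<Psi> (T.inj a (ygen 1 (\<mu> ! a) vs gen_Xinv)) = Y.cXi \<sigma> a"
      if "1 \<le> \<mu> ! a"
      using that by (simp_all only: \<Psi>(2)[OF a hecke_closed(2)] \<Psi>(2)[OF a hecke_closed(3)] \<psi>_X[OF a])
  qed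
qed


text \<open>Colours that do not occur receive the unit, which keeps the family total.\<close>

definition gb :: "nat \<Rightarrow> nat \<Rightarrow> ((nat \<Rightarrow> free_elem set set) \<Rightarrow>\<^sub>0 ground) set"
  where "gb a k = (if a < d \<and> 1 \<le> \<mu> ! a then T.inj a (yh_g 1 (\<mu> ! a) vs k) else \<one>\<^bsub>H\<^esub>)"

definition Xb :: "nat \<Rightarrow> ((nat \<Rightarrow> free_elem set set) \<Rightarrow>\<^sub>0 ground) set"
  where "Xb a = (if a < d \<and> 1 \<le> \<mu> ! a then T.inj a (ygen 1 (\<mu> ! a) vs gen_X) else \<one>\<^bsub>H\<^esub>)"

definition Xib :: "nat \<Rightarrow> ((nat \<Rightarrow> free_elem set set) \<Rightarrow>\<^sub>0 ground) set"
  where "Xib a = (if a < d \<and> 1 \<le> \<mu> ! a then T.inj a (ygen 1 (\<mu> ! a) vs gen_Xinv) else \<one>\<^bsub>H\<^esub>)"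

sublocale H: kalgebra H
  unfolding H_def by (rule T.TA.kalgebra_axioms)

lemma inj_hom: "a < d \<Longrightarrow> kalgebra_hom (HA a) H (T.inj a)"
  unfolding H_def by (rule T.kalgebra_hom_inj) simp

lemma inj_comm:
  "\<lbrakk>a < d; b < d; a \<noteq> b; x \<in> carrier (HA a); y \<in> carrier (HA b)\<rbrakk> \<Longrightarrow>
    T.inj a x \<otimes>\<^bsub>H\<^esub> T.inj b y = T.inj b y \<otimes>\<^bsub>H\<^esub> T.inj a x"
  unfolding H_def by (rule T.inj_commute) simp_all

lemma hecke_rep:
  assumes a: "a < d" "1 \<le> \<mu> ! a"
  shows "yh_rep H 1 (\<mu> ! a) vs (gb a) (\<lambda>_. \<one>\<^bsub>H\<^esub>) (Xb a) (Xib a)"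
proof -
  note hom = inj_hom[OF a(1), unfolded cyclotomic_hecke_pos[OF a(2)]]
  have t: "yh_t 1 (\<mu> ! a) vs j = \<one>\<^bsub>cyclotomic_YH 1 (\<mu> ! a) vs\<^esub>" for j
    unfolding yh_t_def using hecke_t[of j "\<mu> ! a" vs] by simp
  have "yh_rep H 1 (\<mu> ! a) vs (\<lambda>i. T.inj a (yh_g 1 (\<mu> ! a) vs i)) (\<lambda>j. T.inj a (yh_t 1 (\<mu> ! a) vs j))
      (T.inj a (ygen 1 (\<mu> ! a) vs gen_X)) (T.inj a (ygen 1 (\<mu> ! a) vs gen_Xinv))"
    by (rule yh_rep_image[OF yh_rep_cyclotomic_YH[OF order_refl] hom])
  moreover have "gb a = (\<lambda>i. T.inj a (yh_g 1 (\<mu> ! a) vs i))" using a by (intro ext) (simp add: gb_def)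
  ultimately show ?thesis
    using a unfolding Xb_def Xib_def t kalgebra_hom.hom_one[OF hom] by (simp only: simp_thms if_True)
qed

sublocale A: col_action H d n \<mu> vs gb Xb Xib
proof (intro col_action.intro col_action_axioms.intro H.kalgebra_axioms d_pos n_pos hecke_rep)
  have g: "yh_g 1 (\<mu> ! a) vs i \<in> carrier (HA a)" if "1 \<le> \<mu> ! a" for a i
    unfolding cyclotomic_hecke_pos[OF that] by (rule yh_rep.g_closed[OF yh_rep_cyclotomic_YH[OF order_refl]])
  show "gb a i \<in> carrier H" for a i
    using kalgebra_hom.hom_closed[OF inj_hom g] by (simp add: gb_def)
  show "Xb a \<in> carrier H" "Xib a \<in> carrier H" for a
    using kalgebra_hom.hom_closed[OF inj_hom hecke_closed(2)] kalgebra_hom.hom_closed[OF inj_hom hecke_closed(3)]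
    by (simp_all add: Xb_def Xib_def)
  fix a b i j assume ab: "a < d" "b < d" "a \<noteq> b"
  show "gb a i \<otimes>\<^bsub>H\<^esub> gb b j = gb b j \<otimes>\<^bsub>H\<^esub> gb a i" if "1 \<le> i" "i < \<mu> ! a" "1 \<le> j" "j < \<mu> ! b"
    using ab that inj_comm[OF ab g g, of i j] by (simp add: gb_def)
  show "Xb a \<otimes>\<^bsub>H\<^esub> gb b j = gb b j \<otimes>\<^bsub>H\<^esub> Xb a" if "1 \<le> \<mu> ! a" "1 \<le> j" "j < \<mu> ! b"
    using ab that inj_comm[OF ab hecke_closed(2) g, of j] by (simp add: gb_def Xb_def)
  show "Xb a \<otimes>\<^bsub>H\<^esub> Xb b = Xb b \<otimes>\<^bsub>H\<^esub> Xb a" if "1 \<le> \<mu> ! a" "1 \<le> \<mu> ! b"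
    using ab that inj_comm[OF ab hecke_closed(2) hecke_closed(2)] by (simp add: Xb_def)
qed

text \<open>The property \<open>?Q\<close> passes to sums, products, scalar multiples and inverses,
  so it reduces to the generators g and X of the blocks, where \<open>aG_apply\<close> and
  \<open>J_apply\<close> compute the action.\<close>

lemma block_map_inj:
  assumes \<Psi>: "block_map \<Psi>"
  shows "inj_on \<Psi> (carrier H)"
proof -
  interpret R: yh_rep A.En d n vs A.aG A.aT "A.aM Xb" "A.aM Xib" by (rule A.yh_rep_En)
  interpret P: kalgebra_hom H C \<Psi> using \<Psi> by (simp only: block_map_def)
  obtain \<rho> where \<rho>: "kalgebra_hom YH A.En \<rho>"
    and \<rho>_g: "\<And>i. \<lbrakk>1 \<le> i; i < n\<rbrakk> \<Longrightarrow> \<rho> (yh_g d n vs i) = A.aG i"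
    and \<rho>_t: "\<And>j. \<lbrakk>1 \<le> j; j \<le> n\<rbrakk> \<Longrightarrow> \<rho> (yh_t d n vs j) = A.aT j"
    and \<rho>_X: "\<rho> (ygen d n vs gen_X) = A.aM Xb"
    using cyclotomic_YH_lift[OF A.yh_rep_En] by (elim exE conjE) (simp add: yh_g_def yh_t_def)
  interpret \<rho>: kalgebra_hom YH A.En \<rho> by (rule \<rho>)
  have \<rho>_E: "\<rho> (Y.E \<sigma>) = R.E \<sigma>"
    by (rule yh_rep_hom(1)[OF Y.yh_rep_axioms A.yh_rep_En \<rho> \<rho>_g \<rho>_t \<rho>_X order_refl])
  have \<rho>_J: "\<rho> (Y.J k) = R.J k" if "k < n" for k
    by (rule yh_rep_hom(2)[OF Y.yh_rep_axioms A.yh_rep_En \<rho> \<rho>_g \<rho>_t \<rho>_X that])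
  have \<sigma>_Col: "\<sigma> \<in> A.Col" unfolding A.Col_def using \<sigma> \<mu>_def by (simp only: mem_Collect_eq)
  have C_Y: "x \<in> carrier YH" if "x \<in> carrier C" for x using that by (simp add: corner_simps)
  have P_closed: "\<Psi> x \<in> carrier YH" if "x \<in> carrier H" for x by (rule C_Y[OF P.hom_closed[OF that]])
  have E_apply: "R.E \<sigma> f \<in> carrier A.M" "R.E \<sigma> f \<sigma> = f \<sigma>" if "f \<in> carrier A.M" for f
    by (rule A.En_closed[OF R.tE_closed that]) (rule A.E_apply[OF \<sigma>_Col that order_refl])
  let ?Q = "\<lambda>x. \<forall>f\<in>carrier A.M. \<rho> (\<Psi> x) f \<sigma> = x \<otimes>\<^bsub>H\<^esub> f \<sigma>"
  have Q_one: "?Q \<one>\<^bsub>H\<^esub>"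
  proof
    fix f assume f: "f \<in> carrier A.M"
    have "\<Psi> \<one>\<^bsub>H\<^esub> = Y.E \<sigma>" unfolding P.hom_one corner_simps ..
    then show "\<rho> (\<Psi> \<one>\<^bsub>H\<^esub>) f \<sigma> = \<one>\<^bsub>H\<^esub> \<otimes>\<^bsub>H\<^esub> f \<sigma>"
      by (simp only: \<rho>_E E_apply(2)[OF f] H.l_one[OF A.M_val[OF f \<sigma>_Col]])
  qed
  have PsiM: "\<rho> (\<Psi> x) f \<in> carrier A.M" if "x \<in> carrier H" "f \<in> carrier A.M" for x f
    by (rule A.En_closed[OF \<rho>.hom_closed[OF P_closed[OF that(1)]] that(2)])
  have PsiMult: "\<rho> (\<Psi> (x \<otimes>\<^bsub>H\<^esub> y)) f = \<rho> (\<Psi> x) (\<rho> (\<Psi> y) f)" if "x \<in> carrier H" "y \<in> carrier H" "f \<in> carrier A.M" for x y f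
    unfolding P.hom_mult[OF that(1,2)] corner_simps(5) \<rho>.hom_mult[OF P_closed[OF that(1)] P_closed[OF that(2)]]
    by (rule A.En_apply(1)[OF that(3) \<sigma>_Col])
  \<comment> \<open>The action of \<open>JI\<close> on functions is not computed: for mutually
    inverse elements, the property of one implies that of the other.\<close>
  have Q_inv: "?Q y" if x: "x \<in> carrier H" "?Q x" and y: "y \<in> carrier H" "x \<otimes>\<^bsub>H\<^esub> y = \<one>\<^bsub>H\<^esub>" "y \<otimes>\<^bsub>H\<^esub> x = \<one>\<^bsub>H\<^esub>" for x y
  proof
    fix f assume f: "f \<in> carrier A.M"
    let ?w = "\<rho> (\<Psi> y) f"
    have w: "?w \<in> carrier A.M" by (rule PsiM[OF y(1) f])
    have "x \<otimes>\<^bsub>H\<^esub> ?w \<sigma> = \<rho> (\<Psi> (x \<otimes>\<^bsub>H\<^esub> y)) f \<sigma>" unfolding PsiMult[OF x(1) y(1) f] by (rule bspec[OF x(2) w, symmetric])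
    also have "\<dots> = f \<sigma>" unfolding y(2) using bspec[OF Q_one f] by (simp only: H.l_one[OF A.M_val[OF f \<sigma>_Col]])
    finally have "y \<otimes>\<^bsub>H\<^esub> (x \<otimes>\<^bsub>H\<^esub> ?w \<sigma>) = y \<otimes>\<^bsub>H\<^esub> f \<sigma>" by (rule arg_cong)
    moreover have "y \<otimes>\<^bsub>H\<^esub> (x \<otimes>\<^bsub>H\<^esub> ?w \<sigma>) = ?w \<sigma>"
      using x(1) y(1) A.M_val[OF w \<sigma>_Col] y(3) by (simp add: H.m_assoc[symmetric])
    ultimately show "?w \<sigma> = y \<otimes>\<^bsub>H\<^esub> f \<sigma>" by simp
  qed
  have Q_g: "?Q (T.inj a (ygen 1 (\<mu> ! a) vs (gen_g k)))" if a: "a < d" and k: "1 \<le> k" "k < \<mu> ! a" for a k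
  proof
    fix f assume f: "f \<in> carrier A.M"
    have kc: "k < cnt \<sigma> n a" using k(2) by (simp only: cnt_\<sigma>[OF a])
    let ?i = "smaller n \<sigma> a + k"
    note b = Y.block[OF \<sigma> sorted k(1) kc]
    have i: "1 \<le> ?i" "?i < n" using b(1,2) by simp_all
    have cnt: "cnt \<sigma> ?i a = k" using sorted kc k(1) by (intro sorted_block(3)[of n]) simp_all
    have "\<Psi> (T.inj a (ygen 1 (\<mu> ! a) vs (gen_g k))) = yh_g d n vs ?i \<otimes>\<^bsub>YH\<^esub> Y.E \<sigma>"
      using \<Psi> a k kc by (simp add: block_map_def Y.cg_def[OF \<sigma> sorted])
    then have "\<rho> (\<Psi> (T.inj a (ygen 1 (\<mu> ! a) vs (gen_g k)))) f = A.aG ?i (R.E \<sigma> f)"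
      by (simp only: \<rho>.hom_mult Y.g_closed Y.tE_closed \<rho>_g[OF i] \<rho>_E A.En_apply(1)[OF f \<sigma>_Col])
    moreover have "A.aG ?i (R.E \<sigma> f) \<sigma> = gb a k \<otimes>\<^bsub>H\<^esub> f \<sigma>"
      using b(3,4) by (simp only: A.aG_apply[OF E_apply(1)[OF f] \<sigma>_Col i] E_apply(2)[OF f] cnt) simp
    moreover have "gb a k = T.inj a (ygen 1 (\<mu> ! a) vs (gen_g k))" using a k by (simp add: gb_def yh_g_def)
    ultimately show "\<rho> (\<Psi> (T.inj a (ygen 1 (\<mu> ! a) vs (gen_g k)))) f \<sigma> = T.inj a (ygen 1 (\<mu> ! a) vs (gen_g k)) \<otimes>\<^bsub>H\<^esub> f \<sigma>"
      by (simp only:)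
  qed
  have Q_X: "?Q (T.inj a (ygen 1 (\<mu> ! a) vs gen_X))" if a: "a < d" "1 \<le> \<mu> ! a" for a
  proof
    fix f assume f: "f \<in> carrier A.M"
    have c: "1 \<le> cnt \<sigma> n a" using a by (simp only: cnt_\<sigma>)
    let ?i = "smaller n \<sigma> a"
    note b = Y.block_first[OF \<sigma> sorted c]
    have "\<Psi> (T.inj a (ygen 1 (\<mu> ! a) vs gen_X)) = Y.J ?i \<otimes>\<^bsub>YH\<^esub> Y.E \<sigma>"
      using \<Psi> a by (simp add: block_map_def Y.cX_def[OF \<sigma> sorted])
    then have "\<rho> (\<Psi> (T.inj a (ygen 1 (\<mu> ! a) vs gen_X))) f = R.J ?i (R.E \<sigma> f)"
      by (simp only: \<rho>.hom_mult Y.J_closed Y.tE_closed \<rho>_J[OF b(1)] \<rho>_E A.En_apply(1)[OF f \<sigma>_Col])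
    moreover have "R.J ?i (R.E \<sigma> f) \<sigma> = Xb a \<otimes>\<^bsub>H\<^esub> f \<sigma>"
      using A.J_apply[OF \<sigma>_Col E_apply(1)[OF f] b(1)] b(2,3) by (simp only: E_apply(2)[OF f])
    moreover have "Xb a = T.inj a (ygen 1 (\<mu> ! a) vs gen_X)" using a by (simp add: Xb_def)
    ultimately show "\<rho> (\<Psi> (T.inj a (ygen 1 (\<mu> ! a) vs gen_X))) f \<sigma> = T.inj a (ygen 1 (\<mu> ! a) vs gen_X) \<otimes>\<^bsub>H\<^esub> f \<sigma>"
      by (simp only:)
  qed
  have Q_gen: "?Q (T.inj a x)" if a: "a < d" and x: "x \<in> hecke_gens (\<mu> ! a) vs" for a x
    using x
  proof (cases rule: hecke_gens_cases)
    case (g i)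
    show ?thesis unfolding g(3) by (rule Q_g[OF a g(1,2)])
  next
    case X
    show ?thesis unfolding X(2) by (rule Q_X[OF a X(1)])
  next
    case Xinv
    interpret h: kalgebra_hom "HA a" H "T.inj a" by (rule inj_hom[OF a])
    interpret B: yh_rep H 1 "\<mu> ! a" vs "gb a" "\<lambda>_. \<one>\<^bsub>H\<^esub>" "Xb a" "Xib a" by (rule hecke_rep[OF a Xinv(1)])
    have eq: "Xb a = T.inj a (ygen 1 (\<mu> ! a) vs gen_X)" "Xib a = T.inj a (ygen 1 (\<mu> ! a) vs gen_Xinv)"
      using a Xinv(1) by (simp_all add: Xb_def Xib_def)
    show ?thesis
      unfolding Xinv(2) eq(2)[symmetric]
      by (rule Q_inv[OF B.X_closed _ B.Xi_closed B.X_Xi B.Xi_X]) (unfold eq(1), rule Q_X[OF a Xinv(1)])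
  next
    case one
    show ?thesis unfolding one kalgebra_hom.hom_one[OF inj_hom[OF a]] by (rule Q_one)
  qed
  have "generates H (\<Union>a\<in>{..<d}. T.inj a ` hecke_gens (\<mu> ! a) vs)"
    unfolding H_def by (rule T.tensor_generates_gens[OF finite_lessThan cyclotomic_hecke_generates])
  then have Q: "?Q x" if "x \<in> carrier H" for x
    using that H.kalgebra_axioms
  proof (rule generates_induct)
    fix x assume "x \<in> (\<Union>a\<in>{..<d}. T.inj a ` hecke_gens (\<mu> ! a) vs)"
    then obtain a y where "a < d" "y \<in> hecke_gens (\<mu> ! a) vs" "x = T.inj a y" by (elim UN_E imageE) simp
    then show "?Q x" by (simp only:) (rule Q_gen)
  next
    show "?Q \<one>\<^bsub>H\<^esub>" by (rule Q_one)
  next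
    fix x y assume xy: "x \<in> carrier H" "y \<in> carrier H" "?Q x" "?Q y"
    show "?Q (x \<oplus>\<^bsub>H\<^esub> y)"
    proof
      fix f assume f: "f \<in> carrier A.M"
      have "\<rho> (\<Psi> (x \<oplus>\<^bsub>H\<^esub> y)) f \<sigma> = \<rho> (\<Psi> x) f \<sigma> \<oplus>\<^bsub>H\<^esub> \<rho> (\<Psi> y) f \<sigma>"
        unfolding P.hom_add[OF xy(1,2)] corner_simps(4) \<rho>.hom_add[OF P_closed[OF xy(1)] P_closed[OF xy(2)]]
        by (rule A.En_apply(3)[OF f \<sigma>_Col])
      also have "\<dots> = (x \<oplus>\<^bsub>H\<^esub> y) \<otimes>\<^bsub>H\<^esub> f \<sigma>"
        unfolding bspec[OF xy(3) f] bspec[OF xy(4) f] by (rule H.l_distr[symmetric, OF xy(1,2) A.M_val[OF f \<sigma>_Col]])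
      finally show "\<rho> (\<Psi> (x \<oplus>\<^bsub>H\<^esub> y)) f \<sigma> = (x \<oplus>\<^bsub>H\<^esub> y) \<otimes>\<^bsub>H\<^esub> f \<sigma>" .
    qed
    show "?Q (x \<otimes>\<^bsub>H\<^esub> y)"
    proof
      fix f assume f: "f \<in> carrier A.M"
      show "\<rho> (\<Psi> (x \<otimes>\<^bsub>H\<^esub> y)) f \<sigma> = (x \<otimes>\<^bsub>H\<^esub> y) \<otimes>\<^bsub>H\<^esub> f \<sigma>"
        unfolding PsiMult[OF xy(1,2) f] bspec[OF xy(3) PsiM[OF xy(2) f]] bspec[OF xy(4) f]
        by (rule H.m_assoc[symmetric, OF xy(1,2) A.M_val[OF f \<sigma>_Col]])
    qed
  next
    fix c x assume x: "x \<in> carrier H" "?Q x"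
    show "?Q (c \<odot>\<^bsub>H\<^esub> x)"
    proof
      fix f assume f: "f \<in> carrier A.M"
      have "\<rho> (\<Psi> (c \<odot>\<^bsub>H\<^esub> x)) f \<sigma> = c \<odot>\<^bsub>H\<^esub> \<rho> (\<Psi> x) f \<sigma>"
        unfolding P.hom_smult[OF x(1)] corner_simps(6) \<rho>.hom_smult[OF P_closed[OF x(1)]]
        by (rule A.En_apply(4)[OF f \<sigma>_Col])
      then show "\<rho> (\<Psi> (c \<odot>\<^bsub>H\<^esub> x)) f \<sigma> = (c \<odot>\<^bsub>H\<^esub> x) \<otimes>\<^bsub>H\<^esub> f \<sigma>"
        unfolding bspec[OF x(2) f] using x(1) A.M_val[OF f \<sigma>_Col] by (simp only: H.smult_mult_left)
    qed
  qed
  \<comment> \<open>The test function: its value at \<open>\<sigma>\<close> is 1, so left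
    multiplication by \<open>x\<close> returns \<open>x\<close> itself.\<close>
  define u where "u = (\<lambda>\<chi>\<in>A.Col. \<one>\<^bsub>H\<^esub>)"
  have u: "u \<in> carrier A.M" by (simp add: u_def A.M_carrier)
  have u\<sigma>: "u \<sigma> = \<one>\<^bsub>H\<^esub>" using \<sigma>_Col by (simp add: u_def)
  show ?thesis
  proof (rule inj_onI)
    fix x y assume xy: "x \<in> carrier H" "y \<in> carrier H" "\<Psi> x = \<Psi> y"
    have val: "\<rho> (\<Psi> x) u \<sigma> = x" if "x \<in> carrier H" for x
    proof -
      have "\<rho> (\<Psi> x) u \<sigma> = x \<otimes>\<^bsub>H\<^esub> u \<sigma>" by (rule bspec[OF Q[OF that] u])
      also have "\<dots> = x" unfolding u\<sigma> by (rule H.r_one[OF that])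
      finally show ?thesis .
    qed
    have "x = \<rho> (\<Psi> x) u \<sigma>" by (rule val[OF xy(1), symmetric])
    also have "\<dots> = y" unfolding xy(3) by (rule val[OF xy(2)])
    finally show "x = y" .
  qed
qed

text \<open>These are the closure properties and memberships that \<open>sandwich\<close> demands of
  the set attached to a sorted colouring.\<close>

lemma block_map_image:
  assumes \<Psi>: "block_map \<Psi>"
  shows "\<Psi> ` carrier H \<subseteq> carrier C"
    and "\<lbrakk>x \<in> \<Psi> ` carrier H; y \<in> \<Psi> ` carrier H\<rbrakk> \<Longrightarrow> x \<oplus>\<^bsub>YH\<^esub> y \<in> \<Psi> ` carrier H"
    and "\<lbrakk>x \<in> \<Psi> ` carrier H; y \<in> \<Psi> ` carrier H\<rbrakk> \<Longrightarrow> x \<otimes>\<^bsub>YH\<^esub> y \<in> \<Psi> ` carrier H"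
    and "x \<in> \<Psi> ` carrier H \<Longrightarrow> c \<odot>\<^bsub>YH\<^esub> x \<in> \<Psi> ` carrier H"
    and "Y.E \<sigma> \<in> \<Psi> ` carrier H"
    and "\<lbrakk>a < d; 1 \<le> k; k < cnt \<sigma> n a\<rbrakk> \<Longrightarrow> yh_g d n vs (smaller n \<sigma> a + k) \<otimes>\<^bsub>YH\<^esub> Y.E \<sigma> \<in> \<Psi> ` carrier H"
    and "\<lbrakk>a < d; 1 \<le> cnt \<sigma> n a\<rbrakk> \<Longrightarrow> Y.J (smaller n \<sigma> a) \<otimes>\<^bsub>YH\<^esub> Y.E \<sigma> \<in> \<Psi> ` carrier H \<and>
      Y.JI (smaller n \<sigma> a) \<otimes>\<^bsub>YH\<^esub> Y.E \<sigma> \<in> \<Psi> ` carrier H"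
proof -
  interpret P: kalgebra_hom H C \<Psi> using \<Psi> by (simp only: block_map_def)
  show "\<Psi> ` carrier H \<subseteq> carrier C" by (intro image_subsetI P.hom_closed)
  show "x \<oplus>\<^bsub>YH\<^esub> y \<in> \<Psi> ` carrier H" "x \<otimes>\<^bsub>YH\<^esub> y \<in> \<Psi> ` carrier H"
    if xy: "x \<in> \<Psi> ` carrier H" "y \<in> \<Psi> ` carrier H"
  proof -
    from xy obtain x' y' where eq: "x = \<Psi> x'" "y = \<Psi> y'" and c: "x' \<in> carrier H" "y' \<in> carrier H" by (elim imageE)
    have "x \<oplus>\<^bsub>YH\<^esub> y = \<Psi> (x' \<oplus>\<^bsub>H\<^esub> y')" "x \<otimes>\<^bsub>YH\<^esub> y = \<Psi> (x' \<otimes>\<^bsub>H\<^esub> y')"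
      unfolding P.hom_add[OF c] P.hom_mult[OF c] corner_simps eq by (rule refl)+
    then show "x \<oplus>\<^bsub>YH\<^esub> y \<in> \<Psi> ` carrier H" "x \<otimes>\<^bsub>YH\<^esub> y \<in> \<Psi> ` carrier H"
      by (simp_all only: imageI H.a_closed[OF c] H.m_closed[OF c])
  qed
  show "c \<odot>\<^bsub>YH\<^esub> x \<in> \<Psi> ` carrier H" if x: "x \<in> \<Psi> ` carrier H"
  proof -
    from x obtain x' where eq: "x = \<Psi> x'" and c: "x' \<in> carrier H" by (rule imageE)
    have "c \<odot>\<^bsub>YH\<^esub> x = \<Psi> (c \<odot>\<^bsub>H\<^esub> x')" unfolding P.hom_smult[OF c] corner_simps eq ..
    then show ?thesis by (simp only: imageI H.smult_closed[OF c])
  qed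
  have "Y.E \<sigma> = \<Psi> \<one>\<^bsub>H\<^esub>" unfolding P.hom_one corner_simps ..
  then show "Y.E \<sigma> \<in> \<Psi> ` carrier H" by (simp only: imageI H.one_closed)
  show "yh_g d n vs (smaller n \<sigma> a + k) \<otimes>\<^bsub>YH\<^esub> Y.E \<sigma> \<in> \<Psi> ` carrier H" if a: "a < d" "1 \<le> k" "k < cnt \<sigma> n a" for a k
  proof -
    have k: "k < \<mu> ! a" using a by (simp only: cnt_\<sigma>)
    have "yh_g d n vs (smaller n \<sigma> a + k) \<otimes>\<^bsub>YH\<^esub> Y.E \<sigma> = \<Psi> (T.inj a (ygen 1 (\<mu> ! a) vs (gen_g k)))"
      using \<Psi> a k by (simp add: block_map_def Y.cg_def[OF \<sigma> sorted])
    then show ?thesis by (simp only: imageI kalgebra_hom.hom_closed[OF inj_hom[OF a(1)] hecke_closed(1)[OF a(2) k]])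
  qed
  show "Y.J (smaller n \<sigma> a) \<otimes>\<^bsub>YH\<^esub> Y.E \<sigma> \<in> \<Psi> ` carrier H \<and> Y.JI (smaller n \<sigma> a) \<otimes>\<^bsub>YH\<^esub> Y.E \<sigma> \<in> \<Psi> ` carrier H"
    if a: "a < d" "1 \<le> cnt \<sigma> n a" for a
  proof -
    have k: "1 \<le> \<mu> ! a" using a by (simp only: cnt_\<sigma>)
    have "Y.J (smaller n \<sigma> a) \<otimes>\<^bsub>YH\<^esub> Y.E \<sigma> = \<Psi> (T.inj a (ygen 1 (\<mu> ! a) vs gen_X))"
      "Y.JI (smaller n \<sigma> a) \<otimes>\<^bsub>YH\<^esub> Y.E \<sigma> = \<Psi> (T.inj a (ygen 1 (\<mu> ! a) vs gen_Xinv))"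
      using \<Psi> a k by (simp_all add: block_map_def Y.cX_def[OF \<sigma> sorted] Y.cXi_def[OF \<sigma> sorted])
    then show ?thesis
      by (simp only: imageI simp_thms kalgebra_hom.hom_closed[OF inj_hom[OF a(1)] hecke_closed(2)[OF k]]
          kalgebra_hom.hom_closed[OF inj_hom[OF a(1)] hecke_closed(3)[OF k]])
  qed
qed

end


section \<open>The decomposition\<close>

lemma kalgebra_hom_inverse:
  assumes "kalgebra_hom A B h" and bij: "bij_betw h (carrier A) (carrier B)"
  shows "kalgebra_hom B A (inv_into (carrier A) h)"
proof -
  interpret kalgebra_hom A B h by fact
  let ?k = "inv_into (carrier A) h"
  have k: "?k x \<in> carrier A" "h (?k x) = x" if "x \<in> carrier B" for x
    using that bij by (simp_all add: bij_betw_def inv_into_into f_inv_into_f)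
  have eq: "?k y = x" if "x \<in> carrier A" "h x = y" for x y
    using that bij by (auto simp: bij_betw_def)
  show ?thesis
    by (intro kalgebra_hom.intro kalgebra_hom_axioms.intro A.kalgebra_axioms B.kalgebra_axioms eq)
      (simp_all add: k hom_add hom_mult hom_one hom_smult)
qed

context
  fixes d n :: nat and vs :: "ground list"
  assumes d_pos: "d \<ge> 1" and n_pos: "n \<ge> 1"
begin

interpretation Y: yh_rep "cyclotomic_YH d n vs" d n vs "yh_g d n vs" "yh_t d n vs" "ygen d n vs gen_X" "ygen d n vs gen_Xinv"
  by (rule yh_rep_cyclotomic_YH[OF d_pos])

abbreviation (input) YH where "YH \<equiv> cyclotomic_YH d n vs"

lemma YH_generates: "generates YH (yh_g d n vs ` {1..<n} \<union> yh_t d n vs ` {1..n} \<union> {ygen d n vs gen_X, ygen d n vs gen_Xinv})"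
proof -
  have "yh_g d n vs ` {1..<n} = (\<lambda>i. ygen d n vs (gen_g i)) ` {1..<n}" "yh_t d n vs ` {1..n} = (\<lambda>j. ygen d n vs (gen_t j)) ` {1..n}"
    by (intro image_cong refl; simp add: yh_g_def yh_t_def)+
  then have "yh_g d n vs ` {1..<n} \<union> yh_t d n vs ` {1..n} \<union> {ygen d n vs gen_X, ygen d n vs gen_Xinv} = ygen d n vs ` yh_gens n"
    by (simp only: yh_gens_def image_Un image_image image_insert image_empty) (simp only: Un_ac)
  then show ?thesis using cyclotomic_YH_generates[of d n vs] by (simp only:)
qed

text \<open>A choice of one block map for each sorted colouring; bijectivity onto the corner is
  established in \<open>corner_matrix_isomorphic\<close>.\<close>

definition block_iso :: "(nat \<Rightarrow> nat) \<Rightarrow> ((nat \<Rightarrow> free_elem set set) \<Rightarrow>\<^sub>0 ground) set \<Rightarrow> free_elem set set"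
  where "block_iso \<sigma> = (SOME \<Psi>. sorted_colouring.block_map d n vs \<sigma> \<Psi>)"

lemma block_iso:
  assumes "\<sigma> \<in> colourings d n" "\<nexists>i. desc n \<sigma> i"
  shows "sorted_colouring d n \<sigma>" and "sorted_colouring.block_map d n vs \<sigma> (block_iso \<sigma>)"
proof -
  show sc: "sorted_colouring d n \<sigma>" by (rule sorted_colouring.intro[OF d_pos n_pos assms])
  show "sorted_colouring.block_map d n vs \<sigma> (block_iso \<sigma>)"
    unfolding block_iso_def by (rule someI_ex[OF sorted_colouring.block_map_exists[OF sc]])
qed

text \<open>The case \<open>\<sigma> = \<tau>\<close> gives surjectivity of \<open>block_iso\<close>
  onto the corner, the other case the hypothesis \<open>off\<close> of the Peirce
  decomposition.\<close>

lemma sorted_sandwich: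
  assumes \<sigma>: "\<sigma> \<in> colourings d n" "\<nexists>i. desc n \<sigma> i" and \<tau>: "\<tau> \<in> colourings d n" "\<nexists>i. desc n \<tau> i"
    and y: "y \<in> carrier YH"
  shows "Y.E \<sigma> \<otimes>\<^bsub>YH\<^esub> y \<otimes>\<^bsub>YH\<^esub> Y.E \<tau> \<in>
    (if \<sigma> = \<tau> then block_iso \<sigma> ` carrier (cyclotomic_hecke_tensor (col_type d n \<sigma>) vs) else {\<zero>\<^bsub>YH\<^esub>})"
proof -
  \<comment> \<open>\<open>sandwich\<close> asks for closure at every colouring, so one that is not
    sorted gets the whole algebra.\<close>
  define D where "D \<sigma> = (if \<sigma> \<in> colourings d n \<and> (\<nexists>i. desc n \<sigma> i)
    then block_iso \<sigma> ` carrier (cyclotomic_hecke_tensor (col_type d n \<sigma>) vs) else carrier YH)" for \<sigma>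
  have D1: "D \<sigma> = block_iso \<sigma> ` carrier (cyclotomic_hecke_tensor (col_type d n \<sigma>) vs)"
    if "\<sigma> \<in> colourings d n" "\<nexists>i. desc n \<sigma> i" for \<sigma>
    unfolding D_def if_P[OF conjI[OF that]] ..
  have D2: "D \<sigma> = carrier YH" if "\<not> (\<sigma> \<in> colourings d n \<and> (\<nexists>i. desc n \<sigma> i))" for \<sigma>
    unfolding D_def if_not_P[OF that] ..
  have "\<forall>\<chi>\<in>colourings d n. \<forall>\<psi>\<in>colourings d n. Y.S \<chi> \<otimes>\<^bsub>YH\<^esub> y \<otimes>\<^bsub>YH\<^esub> Y.T \<psi> \<in>
    (if sort_col n \<chi> = sort_col n \<psi> then D (sort_col n \<chi>) else {\<zero>\<^bsub>YH\<^esub>})"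
  proof (rule Y.sandwich[OF YH_generates _ _ _ _ _ _ _ n_pos y])
    fix \<sigma>
    have "D \<sigma> \<subseteq> carrier YH \<and> (\<forall>x\<in>D \<sigma>. \<forall>y\<in>D \<sigma>. x \<oplus>\<^bsub>YH\<^esub> y \<in> D \<sigma> \<and> x \<otimes>\<^bsub>YH\<^esub> y \<in> D \<sigma>) \<and> (\<forall>c. \<forall>x\<in>D \<sigma>. c \<odot>\<^bsub>YH\<^esub> x \<in> D \<sigma>)"
    proof (cases "\<sigma> \<in> colourings d n \<and> (\<nexists>i. desc n \<sigma> i)")
      case False
      show ?thesis unfolding D2[OF False] by simp
    next
      case True
      then have \<sigma>: "\<sigma> \<in> colourings d n" "\<nexists>i. desc n \<sigma> i" by (rule conjunct1, rule conjunct2)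
      note im = sorted_colouring.block_map_image[OF block_iso[OF \<sigma>], unfolded sorted_colouring.\<mu>_def[OF block_iso(1)[OF \<sigma>]]]
      have "carrier (corner YH (Y.E \<sigma>)) \<subseteq> carrier YH" by (intro subsetI) (simp add: corner_simps)
      then have "block_iso \<sigma> ` carrier (cyclotomic_hecke_tensor (col_type d n \<sigma>) vs) \<subseteq> carrier YH"
        by (rule subset_trans[OF im(1)])
      then show ?thesis
        unfolding D1[OF \<sigma>] by (intro conjI ballI allI im(2-4))
    qed
    then show "D \<sigma> \<subseteq> carrier YH" "\<And>x y. \<lbrakk>x \<in> D \<sigma>; y \<in> D \<sigma>\<rbrakk> \<Longrightarrow> x \<oplus>\<^bsub>YH\<^esub> y \<in> D \<sigma>"
      "\<And>x y. \<lbrakk>x \<in> D \<sigma>; y \<in> D \<sigma>\<rbrakk> \<Longrightarrow> x \<otimes>\<^bsub>YH\<^esub> y \<in> D \<sigma>" "\<And>x c. x \<in> D \<sigma> \<Longrightarrow> c \<odot>\<^bsub>YH\<^esub> x \<in> D \<sigma>"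
      by simp_all
    assume \<sigma>: "\<sigma> \<in> colourings d n" "\<nexists>i. desc n \<sigma> i"
    note im = sorted_colouring.block_map_image[OF block_iso[OF \<sigma>], unfolded sorted_colouring.\<mu>_def[OF block_iso(1)[OF \<sigma>]]]
    show "Y.E \<sigma> \<in> D \<sigma>" unfolding D1[OF \<sigma>] by (rule im(5))
    show "yh_g d n vs (smaller n \<sigma> a + k) \<otimes>\<^bsub>YH\<^esub> Y.E \<sigma> \<in> D \<sigma>" if "a < d" "1 \<le> k" "k < cnt \<sigma> n a" for a k
      unfolding D1[OF \<sigma>] by (rule im(6)[OF that])
    show "Y.J (smaller n \<sigma> a) \<otimes>\<^bsub>YH\<^esub> Y.E \<sigma> \<in> D \<sigma> \<and> Y.JI (smaller n \<sigma> a) \<otimes>\<^bsub>YH\<^esub> Y.E \<sigma> \<in> D \<sigma>"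
      if "a < d" "1 \<le> cnt \<sigma> n a" for a
      unfolding D1[OF \<sigma>] by (rule im(7)[OF that])
  qed
  from bspec[OF bspec[OF this \<sigma>(1)] \<tau>(1)] show ?thesis
    unfolding sort_col_sorted[OF \<sigma>(2)] sort_col_sorted[OF \<tau>(2)] Y.S_sorted[OF \<sigma>(2)] Y.T_sorted[OF \<tau>(2)] D1[OF \<sigma>] .
qed

lemma corners_orthogonal:
  assumes "\<sigma> \<in> colourings d n" "\<nexists>i. desc n \<sigma> i" "\<tau> \<in> colourings d n" "\<nexists>i. desc n \<tau> i" "\<sigma> \<noteq> \<tau>" "y \<in> carrier YH"
  shows "Y.E \<sigma> \<otimes>\<^bsub>YH\<^esub> y \<otimes>\<^bsub>YH\<^esub> Y.E \<tau> = \<zero>\<^bsub>YH\<^esub>"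
  using sorted_sandwich[OF assms(1-4,6)] unfolding if_not_P[OF assms(5)] by (simp only: singleton_iff)

lemma corner_matrix_isomorphic:
  assumes \<sigma>: "\<sigma> \<in> colourings d n" "\<nexists>i. desc n \<sigma> i"
  shows "alg_isomorphic (matrix_algebra N (corner YH (Y.E \<sigma>))) (matrix_algebra N (cyclotomic_hecke_tensor (col_type d n \<sigma>) vs))"
proof -
  let ?H = "cyclotomic_hecke_tensor (col_type d n \<sigma>) vs" and ?C = "corner YH (Y.E \<sigma>)"
  note sc = block_iso(1)[OF \<sigma>]
  note \<mu> = sorted_colouring.\<mu>_def[OF sc]
  have hom: "kalgebra_hom ?H ?C (block_iso \<sigma>)"
    using block_iso(2)[OF \<sigma>] unfolding sorted_colouring.block_map_def[OF sc] \<mu> by (rule conjunct1)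
  have "carrier ?C \<subseteq> block_iso \<sigma> ` carrier ?H"
  proof
    fix y assume "y \<in> carrier ?C"
    then have y: "y \<in> carrier YH" "Y.E \<sigma> \<otimes>\<^bsub>YH\<^esub> y = y" "y \<otimes>\<^bsub>YH\<^esub> Y.E \<sigma> = y" by (simp_all add: corner_simps)
    show "y \<in> block_iso \<sigma> ` carrier ?H"
      using sorted_sandwich[OF \<sigma> \<sigma> y(1)] unfolding y(2,3) if_P[OF refl] .
  qed
  then have "block_iso \<sigma> ` carrier ?H = carrier ?C"
    using sorted_colouring.block_map_image(1)[OF sc block_iso(2)[OF \<sigma>], unfolded \<mu>] by (intro subset_antisym)
  moreover have "inj_on (block_iso \<sigma>) (carrier ?H)"
    using sorted_colouring.block_map_inj[OF sc block_iso(2)[OF \<sigma>], unfolded \<mu>] .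
  ultimately have bij: "bij_betw (block_iso \<sigma>) (carrier ?H) (carrier ?C)" by (intro bij_betw_imageI)
  show ?thesis
    by (rule alg_isomorphic_matrix_algebra[OF kalgebra_hom_inverse[OF hom bij] bij_betw_inv_into[OF bij]])
qed

text \<open>The Peirce decomposition with \<open>T\<close> and \<open>S\<close> as matrix units:
  rows and columns of the block of \<open>\<mu>\<close> are the colourings of type
  \<open>\<mu>\<close>, numbered by \<open>en\<close>.\<close>

lemma cyclotomic_YH_decomposition:
  "alg_isomorphic YH (direct_sum_algebra (compositions d n)
    (\<lambda>\<mu>. matrix_algebra (multinomial \<mu>) (cyclotomic_hecke_tensor \<mu> vs)))"
proof -
  let ?I = "compositions d n"
  define Col where "Col \<mu> = {\<chi> \<in> colourings d n. col_type d n \<chi> = \<mu>}" for \<mu>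
  \<comment> \<open>The choice is harmless: all colourings of type \<open>\<mu>\<close> have the
    same sorted colouring.\<close>
  define \<sigma> where "\<sigma> \<mu> = sort_col n (SOME \<chi>. \<chi> \<in> Col \<mu>)" for \<mu>
  have Col_D: "\<chi> \<in> colourings d n" "col_type d n \<chi> = \<mu>" if "\<chi> \<in> Col \<mu>" for \<chi> \<mu>
    using that by (simp_all add: Col_def)
  have some: "(SOME \<chi>. \<chi> \<in> Col \<mu>) \<in> Col \<mu>" if "\<mu> \<in> ?I" for \<mu>
    using card_colourings_of_type(2)[OF that] by (intro someI_ex[of "\<lambda>\<chi>. \<chi> \<in> Col \<mu>"]) (simp only: Col_def mem_Collect_eq)
  have \<sigma>: "\<sigma> \<mu> \<in> colourings d n" "\<nexists>i. desc n (\<sigma> \<mu>) i" "col_type d n (\<sigma> \<mu>) = \<mu>" if "\<mu> \<in> ?I" for \<mu>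
  proof -
    note c = Col_D[OF some[OF that]]
    note s = sort_col[OF c(1), folded \<sigma>_def]
    show 1: "\<sigma> \<mu> \<in> colourings d n" using s by (rule conjunct1)
    show "\<nexists>i. desc n (\<sigma> \<mu>) i" using s by simp
    have "col_type d n (\<sigma> \<mu>) = col_type d n (SOME \<chi>. \<chi> \<in> Col \<mu>)"
      unfolding col_type_eq_iff[OF 1 c(1)] using s by simp
    then show "col_type d n (\<sigma> \<mu>) = \<mu>" by (simp only: c(2))
  qed
  have sort: "sort_col n \<chi> = \<sigma> \<mu>" if "\<mu> \<in> ?I" "\<chi> \<in> Col \<mu>" for \<chi> \<mu>
  proof -
    note c = Col_D[OF some[OF that(1)]] and c' = Col_D[OF that(2)]
    show ?thesis
      unfolding \<sigma>_def sort_col_eq_iff[OF c'(1) c(1)] col_type_eq_iff[OF c'(1) c(1), symmetric] by (simp only: c c')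
  qed
  have "\<exists>f. bij_betw f {..<multinomial \<mu>} (Col \<mu>)" if "\<mu> \<in> ?I" for \<mu>
  proof -
    have "finite (Col \<mu>)" unfolding Col_def by (rule finite_subset[OF _ finite_colourings[of d n]]) simp
    then obtain f where "bij_betw f {0..<card (Col \<mu>)} (Col \<mu>)" using ex_bij_betw_nat_finite by metis
    then show ?thesis unfolding Col_def card_colourings_of_type(1)[OF that] atLeast0LessThan by (intro exI)
  qed
  then have "\<forall>\<mu>\<in>?I. \<exists>f. bij_betw f {..<multinomial \<mu>} (Col \<mu>)" by (rule ballI)
  from bchoice[OF this] obtain en where "\<forall>\<mu>\<in>?I. bij_betw (en \<mu>) {..<multinomial \<mu>} (Col \<mu>)" by (elim exE)
  then have en: "bij_betw (en \<mu>) {..<multinomial \<mu>} (Col \<mu>)" if "\<mu> \<in> ?I" for \<mu> using that by (rule bspec)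
  have en_Col: "en \<mu> i \<in> Col \<mu>" if "\<mu> \<in> ?I" "i < multinomial \<mu>" for \<mu> i
    using bij_betwE[OF en[OF that(1)]] that(2) by simp
  have en_eq: "en \<mu> i = en \<nu> j \<longleftrightarrow> \<mu> = \<nu> \<and> i = j"
    if "\<mu> \<in> ?I" "\<nu> \<in> ?I" "i < multinomial \<mu>" "j < multinomial \<nu>" for \<mu> \<nu> i j
  proof
    assume eq: "en \<mu> i = en \<nu> j"
    have "\<mu> = \<nu>" using Col_D(2)[OF en_Col[OF that(1,3)]] Col_D(2)[OF en_Col[OF that(2,4)]] by (simp only: eq)
    then show "\<mu> = \<nu> \<and> i = j"
      using inj_onD[OF bij_betw_imp_inj_on[OF en[OF that(1)]], of i j] eq that by simp
  qed simp
  note en_c = Col_D(1)[OF en_Col]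
  let ?K = "Sigma ?I (\<lambda>\<mu>. {..<multinomial \<mu>})"
  \<comment> \<open>Together with \<open>inj\<close>: the index pairs run through all colourings
    exactly once, which turns the sum required by the Peirce decomposition into the sum of all
    idempotents.\<close>
  have image: "(\<lambda>k. en (fst k) (snd k)) ` ?K = colourings d n"
  proof (intro subset_antisym subsetI)
    fix \<chi> assume "\<chi> \<in> (\<lambda>k. en (fst k) (snd k)) ` ?K"
    then show "\<chi> \<in> colourings d n" by (elim imageE SigmaE) (simp only: fst_conv snd_conv en_c lessThan_iff)
  next
    fix \<chi> assume \<chi>: "\<chi> \<in> colourings d n"
    let ?\<mu> = "col_type d n \<chi>"
    have \<mu>: "?\<mu> \<in> ?I" by (rule col_type_compositions[OF \<chi>])
    have "\<chi> \<in> en ?\<mu> ` {..<multinomial ?\<mu>}"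
      unfolding bij_betw_imp_surj_on[OF en[OF \<mu>]] using \<chi> by (simp only: Col_def mem_Collect_eq simp_thms)
    then obtain i where "\<chi> = en ?\<mu> i" "i \<in> {..<multinomial ?\<mu>}" by (rule imageE)
    then show "\<chi> \<in> (\<lambda>k. en (fst k) (snd k)) ` ?K" using \<mu> by (intro image_eqI[of _ _ "(?\<mu>, i)"]) simp_all
  qed
  have inj: "inj_on (\<lambda>k. en (fst k) (snd k)) ?K"
  proof (rule inj_onI)
    fix k l assume "k \<in> ?K" "l \<in> ?K" "en (fst k) (snd k) = en (fst l) (snd l)"
    then show "k = l" using en_eq[of "fst k" "fst l" "snd k" "snd l"] by (simp add: mem_Times_iff prod_eq_iff mem_Sigma_iff split: prod.splits) auto
  qed
  have "alg_isomorphic YH (direct_sum_algebra ?I (\<lambda>\<mu>. matrix_algebra (multinomial \<mu>) (corner YH (Y.E (\<sigma> \<mu>)))))"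
  proof (rule Y.peirce_decomposition[where P = "\<lambda>\<mu> i. Y.T (en \<mu> i)" and Q = "\<lambda>\<mu> i. Y.S (en \<mu> i)"])
    show "finite ?I" by (rule finite_compositions)
    show "Y.E (\<sigma> \<mu>) \<in> carrier YH" for \<mu> by (rule Y.tE_closed)
    show "Y.T (en \<mu> i) \<in> carrier YH" "Y.S (en \<mu> i) \<in> carrier YH" for \<mu> i by (rule Y.T_closed Y.S_closed)+
    show "Y.E (\<sigma> \<mu>) \<otimes>\<^bsub>YH\<^esub> Y.E (\<sigma> \<mu>) = Y.E (\<sigma> \<mu>)" if "\<mu> \<in> ?I" for \<mu>
      by (rule Y.E_idem(2)[OF \<sigma>(1,2)[OF that]])
    show "Y.S (en \<mu> i) \<otimes>\<^bsub>YH\<^esub> Y.T (en \<nu> j) = (if \<mu> = \<nu> \<and> i = j then Y.E (\<sigma> \<mu>) else \<zero>\<^bsub>YH\<^esub>)"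
      if "\<mu> \<in> ?I" "\<nu> \<in> ?I" "i < multinomial \<mu>" "j < multinomial \<nu>" for \<mu> \<nu> i j
    proof (cases "\<mu> = \<nu> \<and> i = j")
      case True
      then show ?thesis
        using Y.S_T_same[OF en_c[OF that(1,3)]] sort[OF that(1) en_Col[OF that(1,3)]] by simp
    next
      case False
      then have "en \<mu> i \<noteq> en \<nu> j" unfolding en_eq[OF that] .
      then show ?thesis
        unfolding if_not_P[OF False] by (rule Y.S_T_diff[OF en_c[OF that(1,3)] en_c[OF that(2,4)]])
    qed
    show "Y.T (en \<mu> i) \<otimes>\<^bsub>YH\<^esub> Y.E (\<sigma> \<mu>) = Y.T (en \<mu> i)" "Y.E (\<sigma> \<mu>) \<otimes>\<^bsub>YH\<^esub> Y.S (en \<mu> i) = Y.S (en \<mu> i)"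
      if "\<mu> \<in> ?I" "i < multinomial \<mu>" for \<mu> i
      using Y.T_sort[OF en_c[OF that]] Y.sort_S[OF en_c[OF that]] by (simp_all only: sort[OF that(1) en_Col[OF that]])
    have "(\<Oplus>\<^bsub>YH\<^esub>k\<in>?K. Y.T (en (fst k) (snd k)) \<otimes>\<^bsub>YH\<^esub> Y.S (en (fst k) (snd k))) = (\<Oplus>\<^bsub>YH\<^esub>k\<in>?K. Y.E (en (fst k) (snd k)))"
    proof (rule Y.add.finprod_cong'[OF refl])
      fix k assume "k \<in> ?K"
      then have "fst k \<in> ?I" "snd k < multinomial (fst k)" by (auto simp: mem_Sigma_iff)
      then show "Y.T (en (fst k) (snd k)) \<otimes>\<^bsub>YH\<^esub> Y.S (en (fst k) (snd k)) = Y.E (en (fst k) (snd k))"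
        by (intro Y.T_S en_c)
    qed simp
    also have "\<dots> = (\<Oplus>\<^bsub>YH\<^esub>\<chi>\<in>colourings d n. Y.E \<chi>)"
      unfolding image[symmetric] by (rule Y.finsum_reindex[OF _ inj, symmetric]) simp
    also have "\<dots> = \<one>\<^bsub>YH\<^esub>" by (rule Y.sum_E)
    finally show "(\<Oplus>\<^bsub>YH\<^esub>k\<in>?K. Y.T (en (fst k) (snd k)) \<otimes>\<^bsub>YH\<^esub> Y.S (en (fst k) (snd k))) = \<one>\<^bsub>YH\<^esub>" .
    show "Y.E (\<sigma> \<mu>) \<otimes>\<^bsub>YH\<^esub> y \<otimes>\<^bsub>YH\<^esub> Y.E (\<sigma> \<nu>) = \<zero>\<^bsub>YH\<^esub>"
      if "\<mu> \<in> ?I" "\<nu> \<in> ?I" "\<mu> \<noteq> \<nu>" "y \<in> carrier YH" for \<mu> \<nu> y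
    proof (rule corners_orthogonal[OF \<sigma>(1,2)[OF that(1)] \<sigma>(1,2)[OF that(2)] _ that(4)])
      show "\<sigma> \<mu> \<noteq> \<sigma> \<nu>"
        using that(3) \<sigma>(3)[OF that(1)] \<sigma>(3)[OF that(2)] by metis
    qed
  qed
  moreover have "alg_isomorphic (direct_sum_algebra ?I (\<lambda>\<mu>. matrix_algebra (multinomial \<mu>) (corner YH (Y.E (\<sigma> \<mu>)))))
    (direct_sum_algebra ?I (\<lambda>\<mu>. matrix_algebra (multinomial \<mu>) (cyclotomic_hecke_tensor \<mu> vs)))"
    using corner_matrix_isomorphic[OF \<sigma>(1,2)] by (intro alg_isomorphic_direct_sum) (simp only: \<sigma>(3))
  ultimately show ?thesis by (rule alg_isomorphic_trans)
qed

end

theorem corollary3p2: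
  fixes d n m :: nat and vs :: "ground list"
  assumes "d \<ge> 1" and "n \<ge> 1" and "m \<ge> 1"
    and "length vs = m" and "\<forall>c \<in> set vs. c \<noteq> 0"
  shows "alg_isomorphic (cyclotomic_YH d n vs)
    (direct_sum_algebra (compositions d n)
      (\<lambda>\<mu>. matrix_algebra (multinomial \<mu>) (cyclotomic_hecke_tensor \<mu> vs)))"
  using assms(1,2) by (rule cyclotomic_YH_decomposition)

end
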